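(* Let $d=2$, $T>0$ and let $M\ge1$ be an integer. As $N\uparrow\infty$, the law of $\{\mathfrak X^{N,M}_t:0\le t\le T\}$ (started from a fixed $j\in\{1,\dots,M\}$, i.e. $\mathfrak X^N_0=x^N_j$) converges in distribution to the random walk on $\{1,\dots,M\}$ (started from $j$) with generator $$(\mathfrak L^\star_Mf)(i)=\frac\pi2\,\frac1{M\hat w_i}\sum_{j=1}^M[f(j)-f(i)] .$$ Moreover, if $\mathfrak T^{\Delta_{N,M}}_N(T)$ denotes the time spent by the process $\mathfrak X^N_t$ in the set $\Delta_{N,M}=\mathbb T^2_N\setminus A^N_M$ on the time interval $[0,T]$, then $$\lim_{M\to\infty}\limsup_{N\to\infty}\max_{1\le j\le M}\mathbf E^N_{x^N_j}\big[\mathfrak T^{\Delta_{N,M}}_N(T)\big]=0 .$$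
   Context: $\mathbb T^2$ is the two-dimensional torus, $\mathbb T^2_N=(\mathbb Z/N\mathbb Z)^2$, and $x\sim y$ means that $x,y\in\mathbb T^2_N$ are nearest neighbors. $W=\sum_{i\ge1}w_i\delta_{x_i}$ is a finite atomic measure on $\mathbb T^2$, with $w_i>0$, $\sum_iw_i<\infty$, and $\{x_i:i\ge1\}$ (distinct points) dense in $\mathbb T^2$. The weights arranged in decreasing order are $\hat w_1\ge\hat w_2\ge\cdots$ (ties broken by a pre-established order). For $x\in\mathbb T^2_N$, $W^N_x=W\{[x/N,(x+\mathbf 1)/N)\}$ is the $W$-measure of the half-open square $\prod_{i}[x_i/N,(x_i+1)/N)$. Let $(\mathcal L_Nf)(x)=\frac14\,\frac1{W^N_x}\sum_{y\sim x}[f(y)-f(x)]$. $\{\mathfrak X^N_t:t\ge0\}$ is the continuous-time random walk on $\mathbb T^2_N$ with generator $(\log N)\mathcal L_N$, $\mathbf P^N_x$ its law started from $x$, and $\mathbf E^N_x$ the expectation. $\mathbb T^2_N=\{x^N_1,\dots,x^N_{N^2}\}$ is enumerated so that $W^N_{x^N_1}\ge W^N_{x^N_2}\ge\cdots\ge W^N_{x^N_{N^2}}$ (ties broken by a pre-established order), and $A^N_M=\{x^N_1,\dots,x^N_M\}$, $1\le M\le N^2$. The trace $\hat{\mathfrak X}^{N,M}_t$ of $\mathfrak X^N$ on $A^N_M$ is $\hat{\mathfrak X}^{N,M}_t=\mathfrak X^N(\mathcal S(t))$, where $\mathcal S(t)=\sup\{s\ge0:\int_0^s\mathbf 1\{\mathfrak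 X^N_r\in A^N_M\}\,dr\le t\}$. With $\Psi_N(x^N_j)=j$, $\mathfrak X^{N,M}_t=\Psi_N(\hat{\mathfrak X}^{N,M}_t)$, a Markov process on $\{1,\dots,M\}$. Convergence in distribution is on $D([0,T],\{1,\dots,M\})$ with the Skorohod topology. *)

theory Defs
  imports "HOL-Probability.Probability"
begin

section \<open>The torus and the atomic measure\<close>

text \<open>
  The torus \<open>\<real>\<^sup>2 / \<int>\<^sup>2\<close> is represented by its fundamental domain \<open>[0,1)\<^sup>2\<close>, carrying the quotient
  topology of the projection that takes fractional parts.
\<close>

definition torus :: "(real \<times> real) set" where
  "torus = {0..<1} \<times> {0..<1}"

definition torus_proj :: "real \<times> real \<Rightarrow> real \<times> real" where
  "torus_proj z = (frac (fst z), frac (snd z))"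

definition torus_topology :: "(real \<times> real) topology" where
  "torus_topology = topology (\<lambda>U. U \<subseteq> torus \<and> open (torus_proj -` U))"

lemma openin_torus_topology:
  "openin torus_topology U \<longleftrightarrow> U \<subseteq> torus \<and> open (torus_proj -` U)"
proof -
  have "istopology (\<lambda>U. U \<subseteq> torus \<and> open (torus_proj -` U))"
    unfolding istopology_def by (auto simp: vimage_Union intro!: open_Int)
  then show ?thesis
    by (simp add: torus_topology_def)
qed

lemma topspace_torus_topology [simp]: "topspace torus_topology = torus"
proof -
  have "torus_proj -` torus = UNIV"
    by (auto simp: torus_def torus_proj_def frac_lt_1)
  then have "openin torus_topology torus"
    by (simp add: openin_torus_topology)
  then show ?thesis
    by (meson openin_subset openin_torus_topology openin_topspace subset_antisym)
qed

text \<open>The measure \<open>\<Sum>\<^sub>i\<^sub>\<ge>\<^sub>1 w\<^sub>i \<delta>\<^bsub>x\<^sub>i\<^esub>\<close>, obtained as the image under \<open>x\<close> of the measure with masses \<open>w\<^sub>i\<close> on \<open>{1,2,\<dots>}\<close>.\<close>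

definition atomic_measure :: "(nat \<Rightarrow> real) \<Rightarrow> (nat \<Rightarrow> real \<times> real) \<Rightarrow> (real \<times> real) measure" where
  "atomic_measure w x = distr (density (count_space {1..}) (\<lambda>i. ennreal (w i))) borel x"

definition decreasing_rearrangement :: "(nat \<Rightarrow> real) \<Rightarrow> (nat \<Rightarrow> real) \<Rightarrow> bool" where
  "decreasing_rearrangement w v \<longleftrightarrow>
     (\<exists>\<sigma>. bij_betw \<sigma> {1..} {1..} \<and> (\<forall>k\<ge>1. v k = w (\<sigma> k))) \<and>
     (\<forall>k\<ge>1. \<forall>l\<ge>k. v l \<le> v k)"


section \<open>The discrete torus and the generator of the walk\<close>

definition grid :: "nat \<Rightarrow> (int \<times> int) set" where
  "grid N = {0..<int N} \<times> {0..<int N}"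

definition neighbours :: "nat \<Rightarrow> int \<times> int \<Rightarrow> (int \<times> int) set" where
  "neighbours N z = (\<lambda>e. ((fst z + fst e) mod int N, (snd z + snd e) mod int N)) `
     {(1, 0), (-1, 0), (0, 1), (0, -1)}"

definition cell_mass :: "(real \<times> real) measure \<Rightarrow> nat \<Rightarrow> int \<times> int \<Rightarrow> real" where
  "cell_mass W N z = measure W
     ({real_of_int (fst z) / real N ..< (real_of_int (fst z) + 1) / real N} \<times>
      {real_of_int (snd z) / real N ..< (real_of_int (snd z) + 1) / real N})"

definition walk_generator ::
    "(real \<times> real) measure \<Rightarrow> nat \<Rightarrow> (int \<times> int \<Rightarrow> real) \<Rightarrow> int \<times> int \<Rightarrow> real" where
  "walk_generator W N f z = 1/4 * (1 / cell_mass W N z) * (\<Sum>y\<in>neighbours N z. f y - f z)"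

definition limit_generator :: "(nat \<Rightarrow> real) \<Rightarrow> nat \<Rightarrow> (nat \<Rightarrow> real) \<Rightarrow> nat \<Rightarrow> real" where
  "limit_generator v M f i = pi / 2 * (1 / (real M * v i)) * (\<Sum>j=1..M. f j - f i)"

definition decreasing_enumeration ::
    "(real \<times> real) measure \<Rightarrow> nat \<Rightarrow> (nat \<Rightarrow> int \<times> int) \<Rightarrow> bool" where
  "decreasing_enumeration W N e \<longleftrightarrow> bij_betw e {1..N^2} (grid N) \<and>
     (\<forall>i\<in>{1..N^2}. \<forall>j\<in>{i..N^2}. cell_mass W N (e j) \<le> cell_mass W N (e i))"


section \<open>Continuous-time Markov chains\<close>

definition cadlag_on :: "real set \<Rightarrow> (real \<Rightarrow> 'a::topological_space) \<Rightarrow> bool" where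
  "cadlag_on I f \<longleftrightarrow> (\<forall>t\<in>I. (f \<longlongrightarrow> f t) (at t within I \<inter> {t<..}) \<and>
                            (\<exists>l. (f \<longlongrightarrow> l) (at t within I \<inter> {..<t})))"

text \<open>The semigroup \<open>e\<^bsup>tL\<^esup>\<close> of a generator \<open>L\<close> on a finite state space, as an exponential series.\<close>

definition generator_semigroup ::
    "(('a \<Rightarrow> real) \<Rightarrow> 'a \<Rightarrow> real) \<Rightarrow> real \<Rightarrow> ('a \<Rightarrow> real) \<Rightarrow> 'a \<Rightarrow> real" where
  "generator_semigroup L t f x = (\<Sum>k. t ^ k / fact k * (L ^^ k) f x)"

text \<open>
  Under \<open>P\<close> the process \<open>X\<close> is the continuous-time Markov chain on the finite set \<open>E\<close> with generator
  \<open>L\<close> started from \<open>x\<close>: its paths are right-continuous with left limits, and its finite-dimensional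
  distributions are those given by the initial state \<open>x\<close> and the transition probabilities
  \<open>p\<^sub>t(y,z) = (e\<^bsup>tL\<^esup> 1\<^bsub>{z}\<^esub>)(y)\<close>.
\<close>

definition markov_chain ::
    "'a set \<Rightarrow> (('a \<Rightarrow> real) \<Rightarrow> 'a \<Rightarrow> real) \<Rightarrow> 'w measure \<Rightarrow> (real \<Rightarrow> 'w \<Rightarrow> 'a::topological_space)
      \<Rightarrow> 'a \<Rightarrow> bool" where
  "markov_chain E L P X x \<longleftrightarrow>
     prob_space P \<and>
     (\<forall>t\<ge>0. X t \<in> P \<rightarrow>\<^sub>M count_space E) \<and>
     (\<forall>\<omega>\<in>space P. cadlag_on {0..} (\<lambda>t. X t \<omega>)) \<and>
     (\<forall>n (t::nat \<Rightarrow> real) y. t 0 = 0 \<longrightarrow> mono t \<longrightarrow> range y \<subseteq> E \<longrightarrow>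
        measure P {\<omega> \<in> space P. \<forall>i\<le>n. X (t i) \<omega> = y i} =
          (if y 0 = x then 1 else 0) *
          (\<Prod>i<n. generator_semigroup L (t (Suc i) - t i) (indicator {y (Suc i)}) (y i)))"


section \<open>Occupation times and traces\<close>

definition occupation_time :: "'a set \<Rightarrow> (real \<Rightarrow> 'a) \<Rightarrow> real \<Rightarrow> real" where
  "occupation_time A p s = (LINT r:{0..s}|lborel. indicator A (p r))"

definition time_change :: "'a set \<Rightarrow> (real \<Rightarrow> 'a) \<Rightarrow> real \<Rightarrow> real" where
  "time_change A p t = Sup {s. 0 \<le> s \<and> occupation_time A p s \<le> t}"

definition trace_path :: "'a set \<Rightarrow> (real \<Rightarrow> 'a) \<Rightarrow> real \<Rightarrow> 'a" where
  "trace_path A p t = p (time_change A p t)"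

text \<open>
  The trace on \<open>{e 1, \<dots>, e M}\<close> of a path in \<open>{e 1, \<dots>, e K}\<close>, read through the inverse of the
  labelling \<open>e\<close>. If the path spends only a finite total time in the set, the supremum defining the time
  change is eventually taken over an unbounded set and the trace is not defined for all times; for an
  irreducible chain this is a null event, and there we use the constant path \<open>1\<close>.
\<close>

definition labelled_trace ::
    "nat \<Rightarrow> (nat \<Rightarrow> 'a) \<Rightarrow> nat \<Rightarrow> (real \<Rightarrow> 'a) \<Rightarrow> real \<Rightarrow> nat" where
  "labelled_trace K e M p t =
     (if \<forall>u. \<exists>s\<ge>0. occupation_time (e ` {1..M}) p s > u
      then inv_into {1..K} e (trace_path (e ` {1..M}) p t)
      else 1)"


section \<open>Skorohod space and convergence in distribution\<close>

text \<open>\<open>D([0,T],E)\<close>; as functions on all of \<open>\<real>\<close>, its elements are undefined outside \<open>[0,T]\<close>.\<close>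

definition skorohod_space :: "real \<Rightarrow> 'a::topological_space set \<Rightarrow> (real \<Rightarrow> 'a) set" where
  "skorohod_space T E = {f \<in> {0..T} \<rightarrow>\<^sub>E E. cadlag_on {0..T} f}"

text \<open>
  The Skorohod distance for a discrete state space, with the \<open>0\<close>-\<open>1\<close> metric on the states.
  The increasing bijections of \<open>[0,T]\<close> are automatically homeomorphisms. The distance is given the
  value \<open>0\<close> outside the space only because \<^locale>\<open>Metric_space\<close> asks for nonnegativity everywhere.
\<close>

definition time_deformations :: "real \<Rightarrow> (real \<Rightarrow> real) set" where
  "time_deformations T = {l. strict_mono_on {0..T} l \<and> l ` {0..T} = {0..T}}"

definition skorohod_dist ::
    "real \<Rightarrow> 'a::discrete_topology set \<Rightarrow> (real \<Rightarrow> 'a) \<Rightarrow> (real \<Rightarrow> 'a) \<Rightarrow> real" where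
  "skorohod_dist T E f g =
     (if f \<in> skorohod_space T E \<and> g \<in> skorohod_space T E
      then Inf {r. \<exists>l\<in>time_deformations T. \<forall>t\<in>{0..T}. \<bar>l t - t\<bar> \<le> r \<and> of_bool (f t \<noteq> g (l t)) \<le> r}
      else 0)"

definition skorohod_topology :: "real \<Rightarrow> 'a::discrete_topology set \<Rightarrow> (real \<Rightarrow> 'a) topology" where
  "skorohod_topology T E = Metric_space.mtopology (skorohod_space T E) (skorohod_dist T E)"

definition borel_sets_of :: "'a topology \<Rightarrow> 'a measure" where
  "borel_sets_of X = sigma (topspace X) {U. openin X U}"

definition weakly_converges :: "'a topology \<Rightarrow> (nat \<Rightarrow> 'a measure) \<Rightarrow> 'a measure \<Rightarrow> bool" where
  "weakly_converges X \<mu> \<nu> \<longleftrightarrow>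
     (\<forall>F. continuous_map X euclideanreal F \<and> bounded (F ` topspace X) \<longrightarrow>
        (\<lambda>n. \<integral>p. F p \<partial>\<mu> n) \<longlonglongrightarrow> (\<integral>p. F p \<partial>\<nu>))"

definition skorohod_law ::
    "real \<Rightarrow> 'a::discrete_topology set \<Rightarrow> 'w measure \<Rightarrow> ('w \<Rightarrow> real \<Rightarrow> 'a) \<Rightarrow> (real \<Rightarrow> 'a) measure" where
  "skorohod_law T E P Y =
     distr P (borel_sets_of (skorohod_topology T E)) (\<lambda>\<omega>. restrict (Y \<omega>) {0..T})"

lemma time_deformations_endpoint:
  assumes "l \<in> time_deformations T" "0 \<le> T"
  shows "l T = T"
proof -
  have l: "strict_mono_on {0..T} l" "l ` {0..T} = {0..T}"
    using assms by (auto simp: time_deformations_def)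
  then obtain s where s: "s \<in> {0..T}" "l s = T"
    using \<open>0 \<le> T\<close> by (metis atLeastAtMost_iff imageE order_refl)
  have "l T \<le> T"
    using l(2) \<open>0 \<le> T\<close> by auto
  then have "\<not> s < T"
    using strict_mono_onD[OF l(1), of s T] s \<open>0 \<le> T\<close> by auto
  then show ?thesis
    using s by auto
qed

lemma time_deformations_inv:
  assumes "l \<in> time_deformations T"
  shows "inv_into {0..T} l \<in> time_deformations T"
    and "\<And>t. t \<in> {0..T} \<Longrightarrow> inv_into {0..T} l t \<in> {0..T} \<and> l (inv_into {0..T} l t) = t"
proof -
  have l: "strict_mono_on {0..T} l" "l ` {0..T} = {0..T}"
    using assms by (auto simp: time_deformations_def)
  have inj: "inj_on l {0..T}"
    using l(1) strict_mono_on_imp_inj_on by blast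
  show *: "inv_into {0..T} l t \<in> {0..T} \<and> l (inv_into {0..T} l t) = t" if "t \<in> {0..T}" for t
    using that l(2) inv_into_into[of t l "{0..T}"] f_inv_into_f[of t l "{0..T}"] by auto
  have "strict_mono_on {0..T} (inv_into {0..T} l)"
  proof (rule strict_mono_onI)
    fix r s assume rs: "r \<in> {0..T}" "s \<in> {0..T}" "r < s"
    show "inv_into {0..T} l r < inv_into {0..T} l s"
      using *[OF rs(1)] *[OF rs(2)] rs(3) strict_mono_on_leD[OF l(1)]
      by (metis linorder_not_less)
  qed
  moreover have "inv_into {0..T} l ` {0..T} = {0..T}"
    using inj l(2) by (metis inj_on_imp_bij_betw bij_betw_inv_into bij_betw_imp_surj_on)
  ultimately show "inv_into {0..T} l \<in> time_deformations T"
    by (simp add: time_deformations_def)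
qed

lemma time_deformations_comp:
  assumes "l \<in> time_deformations T" "m \<in> time_deformations T"
  shows "m \<circ> l \<in> time_deformations T"
proof -
  have l: "strict_mono_on {0..T} l" "l ` {0..T} = {0..T}"
    and m: "strict_mono_on {0..T} m" "m ` {0..T} = {0..T}"
    using assms by (auto simp: time_deformations_def)
  have "strict_mono_on {0..T} (m \<circ> l)"
  proof (rule strict_mono_onI)
    fix r s assume rs: "r \<in> {0..T}" "s \<in> {0..T}" "r < s"
    then have "l r \<in> {0..T}" "l s \<in> {0..T}"
      using l(2) by blast+
    then show "(m \<circ> l) r < (m \<circ> l) s"
      using strict_mono_onD[OF l(1) rs] strict_mono_onD[OF m(1)] by simp
  qed
  moreover have "(m \<circ> l) ` {0..T} = {0..T}"
    using l(2) m(2) by (simp only: image_comp[symmetric])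
  ultimately show ?thesis
    by (simp add: time_deformations_def)
qed

lemma Metric_space_skorohod:
  fixes E :: "'a::discrete_topology set"
  assumes "0 < T"
  shows "Metric_space (skorohod_space T E) (skorohod_dist T E)"
proof -
  define dd :: "'a \<Rightarrow> 'a \<Rightarrow> real" where "dd = (\<lambda>a b. of_bool (a \<noteq> b))"
  have dd_self [simp]: "dd a a = 0" for a
    by (simp add: dd_def)
  have dd_commute: "dd a b = dd b a" for a b
    by (auto simp: dd_def)
  have dd_triangle: "dd a c \<le> dd a b + dd b c" for a b c
    by (auto simp: dd_def)
  define R where "R = (\<lambda>f g :: real \<Rightarrow> 'a. {r. \<exists>l\<in>time_deformations T.
    \<forall>t\<in>{0..T}. \<bar>l t - t\<bar> \<le> r \<and> dd (f t) (g (l t)) \<le> r})"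
  define D where "D = skorohod_space T E"
  have dist_eq: "skorohod_dist T E f g = (if f \<in> D \<and> g \<in> D then Inf (R f g) else 0)" for f g
    unfolding skorohod_dist_def R_def D_def dd_def by (rule refl)
  have R_nonneg: "0 \<le> r" if r: "r \<in> R f g" for r f g
  proof -
    obtain l where "\<forall>t\<in>{0..T}. \<bar>l t - t\<bar> \<le> r"
      using r unfolding R_def by blast
    moreover have "0 \<in> {0..T}"
      using \<open>0 < T\<close> by simp
    ultimately have "\<bar>l 0 - 0\<bar> \<le> r"
      by blast
    then show ?thesis by linarith
  qed
  have R_bdd: "bdd_below (R f g)" for f g
    using R_nonneg by (meson bdd_belowI)
  have R_ne: "R f g \<noteq> {}" if fg: "f \<in> D" "g \<in> D" for f g
  proof -
    have "1 + T \<in> R f g"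
      using \<open>0 < T\<close> unfolding R_def
      by (auto intro!: bexI[of _ "\<lambda>t. t"] simp: time_deformations_def strict_mono_on_def dd_def)
    then show ?thesis by blast
  qed
  have R_sub: "R f g \<subseteq> R g f" for f g
  proof
    fix r assume "r \<in> R f g"
    then obtain l where l: "l \<in> time_deformations T"
      "\<And>t. t \<in> {0..T} \<Longrightarrow> \<bar>l t - t\<bar> \<le> r \<and> dd (f t) (g (l t)) \<le> r"
      unfolding R_def by blast
    let ?m = "inv_into {0..T} l"
    have "\<bar>?m t - t\<bar> \<le> r \<and> dd (g t) (f (?m t)) \<le> r" if "t \<in> {0..T}" for t
      using l(2)[of "?m t"] time_deformations_inv(2)[OF l(1) that]
      by (auto simp: dd_commute abs_minus_commute)
    then show "r \<in> R g f"
      using time_deformations_inv(1)[OF l(1)] unfolding R_def by blast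
  qed
  then have R_commute: "R f g = R g f" for f g
    by (simp add: subset_antisym)
  have R_small: "\<exists>r\<in>R f g. r < e" if "f \<in> D" "g \<in> D" "Inf (R f g) < e" for f g e
    using that R_ne cInf_lessD by blast
  have R_add: "r + s \<in> R f h" if r: "r \<in> R f g" and s: "s \<in> R g h" for r s f g h
  proof -
    obtain l where l: "l \<in> time_deformations T"
      "\<And>t. t \<in> {0..T} \<Longrightarrow> \<bar>l t - t\<bar> \<le> r \<and> dd (f t) (g (l t)) \<le> r"
      using r unfolding R_def by blast
    obtain m where m: "m \<in> time_deformations T"
      "\<And>t. t \<in> {0..T} \<Longrightarrow> \<bar>m t - t\<bar> \<le> s \<and> dd (g t) (h (m t)) \<le> s"
      using s unfolding R_def by blast
    have "\<bar>(m \<circ> l) t - t\<bar> \<le> r + s \<and> dd (f t) (h ((m \<circ> l) t)) \<le> r + s" if t: "t \<in> {0..T}" for t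
    proof -
      have "l t \<in> {0..T}"
        using l(1) t by (auto simp: time_deformations_def)
      then show ?thesis
        using l(2)[OF t] m(2)[of "l t"] dd_triangle[of "f t" "h (m (l t))" "g (l t)"] by auto
    qed
    then show ?thesis
      using time_deformations_comp[OF l(1) m(1)] unfolding R_def by blast
  qed
  have eq: "f = g" if fg: "f \<in> D" "g \<in> D" and 0: "Inf (R f g) = 0" for f g
  proof (rule PiE_ext)
    show "f \<in> {0..T} \<rightarrow>\<^sub>E E" "g \<in> {0..T} \<rightarrow>\<^sub>E E"
      using fg by (auto simp: D_def skorohod_space_def)
    fix t assume t: "t \<in> {0..T}"
    have "dd (f t) (g t) \<le> 3 * e" if e: "0 < e" for e
    proof (cases "t = T")
      case True
      obtain r where "r \<in> R f g" "r < e"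
        using R_small[OF fg] 0 e by metis
      then obtain l where l: "l \<in> time_deformations T" "dd (f T) (g (l T)) \<le> r"
        unfolding R_def using \<open>0 < T\<close> by force
      then show ?thesis
        using time_deformations_endpoint[OF l(1)] \<open>0 < T\<close> True \<open>r < e\<close> e by auto
    next
      case False
      have rc: "\<exists>d>0. \<forall>s\<in>{0..T}. t < s \<and> s < t + d \<longrightarrow> dd (k s) (k t) < e" if k: "k \<in> D" for k
      proof -
        have "(k \<longlongrightarrow> k t) (at t within {0..T} \<inter> {t<..})"
          using k t by (auto simp: D_def skorohod_space_def cadlag_on_def)
        then have "\<forall>\<^sub>F s in at t within {0..T} \<inter> {t<..}. dd (k s) (k t) < e"
          by (auto simp: tendsto_discrete e elim: eventually_mono)
        then obtain d where "d > 0"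
          "\<forall>s\<in>{0..T} \<inter> {t<..}. s \<noteq> t \<and> dist s t < d \<longrightarrow> dd (k s) (k t) < e"
          unfolding eventually_at by blast
        then show ?thesis
          by (intro exI[of _ d]) (auto simp: dist_real_def)
      qed
      obtain d1 where d1: "d1 > 0"
        "\<And>s. s \<in> {0..T} \<Longrightarrow> t < s \<Longrightarrow> s < t + d1 \<Longrightarrow> dd (f s) (f t) < e"
        using rc[OF fg(1)] by blast
      obtain d2 where d2: "d2 > 0"
        "\<And>s. s \<in> {0..T} \<Longrightarrow> t < s \<Longrightarrow> s < t + d2 \<Longrightarrow> dd (g s) (g t) < e"
        using rc[OF fg(2)] by blast
      define d where "d = min (min d1 d2) (T - t)"
      have d: "d > 0" "d \<le> d1" "d \<le> d2" "t + d \<le> T"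
        using d1(1) d2(1) t False by (auto simp: d_def)
      define s where "s = t + d / 2"
      have s: "s \<in> {0..T}" "t < s" "s < t + d"
        using d t by (auto simp: s_def)
      obtain r where r: "r \<in> R f g" "r < min e (d / 2)"
        using R_small[OF fg, of "min e (d / 2)"] 0 e d by auto
      then obtain l where l: "l \<in> time_deformations T" "\<bar>l s - s\<bar> \<le> r" "dd (f s) (g (l s)) \<le> r"
        using s unfolding R_def by blast
      have ls: "l s \<in> {0..T}" "t < l s" "l s < t + d"
        using l(1) s(1) l(2) r(2) by (auto simp: time_deformations_def s_def)
      have "dd (f s) (f t) < e" "dd (g (l s)) (g t) < e"
        using d1(2)[OF s(1)] d2(2)[OF ls(1)] s ls d by auto
      then show ?thesis
        using l(3) r(2) dd_triangle[of "f t" "g t" "f s"] dd_triangle[of "f s" "g t" "g (l s)"]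
        by (simp add: dd_commute)
    qed
    then have "dd (f t) (g t) \<le> 0 + e" if "0 < e" for e
      using that by (metis add_0 mult.commute nonzero_mult_div_cancel_left times_divide_eq_right
        zero_less_divide_iff zero_less_numeral zero_neq_numeral)
    then have "dd (f t) (g t) \<le> 0"
      by (rule field_le_epsilon)
    then show "f t = g t" by (cases "f t = g t") (simp_all add: dd_def)
  qed
  show ?thesis
    unfolding D_def[symmetric]
  proof
    show "0 \<le> skorohod_dist T E f g" for f g
      using R_ne R_nonneg by (auto simp: dist_eq intro: cInf_greatest)
    show "skorohod_dist T E f g = skorohod_dist T E g f" for f g
      by (auto simp: dist_eq R_commute)
  next
    fix f g assume fg: "f \<in> D" "g \<in> D"
    have "Inf (R f f) = 0"
    proof -
      have "0 \<in> R f f"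
        unfolding R_def
        by (auto intro!: bexI[of _ "\<lambda>t. t"] simp: time_deformations_def strict_mono_on_def)
      then have "Inf (R f f) \<le> 0"
        using R_bdd by (rule cInf_lower)
      moreover have "0 \<le> Inf (R f f)"
        using R_ne[OF fg(1) fg(1)] R_nonneg by (rule cInf_greatest)
      ultimately show ?thesis by simp
    qed
    then show "skorohod_dist T E f g = 0 \<longleftrightarrow> f = g"
      using fg eq[OF fg] by (auto simp: dist_eq)
  next
    fix f g h assume fgh: "f \<in> D" "g \<in> D" "h \<in> D"
    have "Inf (R f h) \<le> Inf (R f g) + Inf (R g h) + e" if e: "0 < e" for e
    proof -
      obtain r where r: "r \<in> R f g" "r < Inf (R f g) + e / 2"
        using R_small[OF fgh(1,2), of "Inf (R f g) + e / 2"] e by auto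
      obtain s where s: "s \<in> R g h" "s < Inf (R g h) + e / 2"
        using R_small[OF fgh(2,3), of "Inf (R g h) + e / 2"] e by auto
      have "Inf (R f h) \<le> r + s"
        using R_add[OF r(1) s(1)] R_bdd by (rule cInf_lower)
      then show ?thesis
        using r(2) s(2) by auto
    qed
    then show "skorohod_dist T E f h \<le> skorohod_dist T E f g + skorohod_dist T E g h"
      using fgh by (simp add: dist_eq field_le_epsilon)
  qed
qed

end

theory Submission
  imports Defs
begin

text \<open>
  Three facts carry the proof: the trace of a finite chain is again a Markov chain, whose generator is
  read off from harmonic extensions; the Green function of the discrete torus is of order \<open>log N\<close> on
  the diagonal and bounded at macroscopic distance; and convergence of the generators of finite
  chains implies weak convergence of their laws on Skorohod space.

  The trace. Let \<open>A = {e 1, \<dots>, e M}\<close>, and for a function \<open>f\<close> on \<open>{1, \<dots>, M}\<close> let \<open>h\<close> be its extension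
  from \<open>A\<close> that is harmonic for the generator \<open>L\<close> off \<open>A\<close>. Along the chain, \<open>h\<close> changes in mean only
  while the chain is in \<open>A\<close>, and there at the rate \<open>L h\<close>. Hence, in the clock that runs only in \<open>A\<close>,
  the chain has the generator sending \<open>f\<close> to the restriction of \<open>L h\<close> to \<open>A\<close>. This is made rigorous by observing
  the chain at the times \<open>k/n\<close>: a backward recursion in the number of visits to \<open>A\<close> yields a function
  of the past whose expectation is constant up to \<open>O(n\<^sup>-\<^sup>2)\<close> per step (\<open>payoff_drift\<close>), and as \<open>n \<rightarrow> \<infinity>\<close> its
  initial and final values become the two sides of the formula for the finite-dimensional
  distributions (\<open>trace_markov_chain\<close>). That the clock is almost surely unbounded follows from
  a Foster function, one with drift at most \<open>-1\<close> off \<open>A\<close>.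

  The rates. Let \<open>G(p,z)\<close> be the solution, unique up to constants, of \<open>\<Delta> G(p,\<cdot>) = 4/N\<^sup>2 - 4 \<delta>\<^sub>p\<close> on the torus. A Fourier
  transform in one coordinate gives it as an explicit sum of hyperbolic cosines, from which
  \<open>G(p,p) \<sim> (2/\<pi>) log N\<close> (\<open>green_0_asymptotics\<close>), while \<open>G(p,z)\<close> stays bounded if \<open>p\<close> and \<open>z\<close> are at
  distance of order \<open>N\<close> (\<open>kernel_far\<close>). For large \<open>N\<close> the \<open>M\<close> heaviest cells contain the \<open>M\<close> heaviest atoms up to
  ties, hence are at such distances from each other, and their masses converge to
  \<open>w_hat 1, \<dots>, w_hat M\<close>. The combination \<open>1/M + \<Sum>\<^sub>i (\<delta>\<^sub>i\<^sub>j - 1/M) G(e i,\<cdot>) / G(0,0)\<close> is then harmonic off \<open>A\<close> and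
  almost the indicator of \<open>e j\<close> on \<open>A\<close>. Its Laplacian at \<open>e i\<close> is \<open>-4 (\<delta>\<^sub>i\<^sub>j - 1/M) / G(0,0)\<close>, which after
  multiplication by \<open>log N / (4 W\<^sub>i)\<close> tends to \<open>\<pi> / (2 w_hat i) (1/M - \<delta>\<^sub>i\<^sub>j)\<close>, the limiting rates
  (\<open>trace_rates_tendsto\<close>).

  Weak convergence. The jump rates of the chains are uniformly bounded, so that with high probability
  a path of any of them has at most one jump in each cell of a fine partition of \<open>[0,T]\<close>. It is then
  close in the Skorohod distance to the step function through finitely many of its values, whose law
  depends continuously on the generator (\<open>chain_weak_convergence\<close>).

  The time off \<open>A\<close>. The potential of the charge \<open>W\<close> off \<open>A\<close>, compensated on \<open>A\<close>, is a function \<open>u\<close> with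
  \<open>L u = -1\<close> off \<open>A\<close> and \<open>L u = W(A\<^sup>c)/W(A)\<close> on \<open>A\<close>, and \<open>\<bar>u\<bar>\<close> is at most \<open>2 W(A\<^sup>c) (G(0,0) + 1) / log N\<close>
  (\<open>foster_function\<close>). By Dynkin's formula the expected time off \<open>A\<close> is bounded by a multiple of
  \<open>W(A\<^sup>c)\<close>, which is at most the mass of all atoms but the \<open>M\<close> heaviest. The same \<open>u\<close> serves as the
  Foster function above.
\<close>

section \<open>The semigroup of a finite generator\<close>

locale finite_operator =
  fixes E :: "'a set" and q :: "'a \<Rightarrow> 'a \<Rightarrow> real" and L :: "('a \<Rightarrow> real) \<Rightarrow> 'a \<Rightarrow> real"
  assumes finite_states: "finite E"
    and matrix_form: "\<And>f x. x \<in> E \<Longrightarrow> L f x = (\<Sum>y\<in>E. q x y * f y)"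
begin

definition bound :: real where
  "bound = (\<Sum>x\<in>E. \<Sum>y\<in>E. \<bar>q x y\<bar>)"

lemma bound_nonneg: "0 \<le> bound"
  by (simp add: bound_def sum_nonneg)

lemma apply_bound:
  assumes "x \<in> E" "\<And>y. y \<in> E \<Longrightarrow> \<bar>f y\<bar> \<le> B"
  shows "\<bar>L f x\<bar> \<le> bound * B"
proof -
  have B: "0 \<le> B" using assms by force
  have "\<bar>L f x\<bar> \<le> (\<Sum>y\<in>E. \<bar>q x y * f y\<bar>)"
    by (simp add: matrix_form[OF assms(1)] sum_abs)
  also have "\<dots> \<le> (\<Sum>y\<in>E. \<bar>q x y\<bar> * B)"
    using assms(2) by (intro sum_mono) (simp add: abs_mult mult_left_mono)
  also have "\<dots> = (\<Sum>y\<in>E. \<bar>q x y\<bar>) * B"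
    by (simp add: sum_distrib_right)
  also have "\<dots> \<le> bound * B"
    unfolding bound_def using assms(1) finite_states B
    by (intro mult_right_mono member_le_sum[of x E "\<lambda>x. \<Sum>y\<in>E. \<bar>q x y\<bar>"]) (auto intro: sum_nonneg)
  finally show ?thesis .
qed

lemma apply_cong: "x \<in> E \<Longrightarrow> (\<And>y. y \<in> E \<Longrightarrow> f y = g y) \<Longrightarrow> L f x = L g x"
  by (simp add: matrix_form)

lemma iterate_bound:
  assumes "x \<in> E" "\<And>y. y \<in> E \<Longrightarrow> \<bar>f y\<bar> \<le> B"
  shows "\<bar>(L ^^ k) f x\<bar> \<le> bound ^ k * B"
  using assms(1)
proof (induction k arbitrary: x)
  case (Suc k)
  have "\<bar>L ((L ^^ k) f) x\<bar> \<le> bound * (bound ^ k * B)"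
    using Suc by (intro apply_bound) auto
  then show ?case by (simp add: mult.assoc)
qed (use assms in auto)

lemma iterate_cong:
  assumes "x \<in> E" "\<And>y. y \<in> E \<Longrightarrow> f y = g y"
  shows "(L ^^ k) f x = (L ^^ k) g x"
  using assms(1)
proof (induction k arbitrary: x)
  case (Suc k)
  then show ?case by (simp add: apply_cong[of x "(L ^^ k) f" "(L ^^ k) g"])
qed (use assms in auto)

lemma iterate_sum:
  assumes "x \<in> E" "finite I"
  shows "(L ^^ k) (\<lambda>y. \<Sum>i\<in>I. c i * f i y) x = (\<Sum>i\<in>I. c i * (L ^^ k) (f i) x)"
  using assms(1)
proof (induction k arbitrary: x)
  case (Suc k)
  have "L ((L ^^ k) (\<lambda>y. \<Sum>i\<in>I. c i * f i y)) x = L (\<lambda>y. \<Sum>i\<in>I. c i * (L ^^ k) (f i) y) x"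
    using Suc by (intro apply_cong) auto
  also have "\<dots> = (\<Sum>i\<in>I. c i * L ((L ^^ k) (f i)) x)"
    using Suc.prems by (simp add: matrix_form sum_distrib_left sum.swap[of _ I E] mult.left_commute)
  finally show ?case by simp
qed auto

lemma sum_indicator: "y \<in> E \<Longrightarrow> (\<Sum>z\<in>E. f z * indicator {z} y) = (f y :: real)"
proof -
  assume "y \<in> E"
  have "(\<Sum>z\<in>E. f z * indicator {z} y) = (\<Sum>z\<in>E. if y = z then f z else 0)"
    by (intro sum.cong refl) (auto simp: indicator_def)
  then show ?thesis using \<open>y \<in> E\<close> finite_states by simp
qed

lemma obtain_sup_bound:
  obtains B where "0 \<le> B" "\<And>y. y \<in> E \<Longrightarrow> \<bar>f y :: real\<bar> \<le> B"
proof
  show "0 \<le> (\<Sum>y\<in>E. \<bar>f y\<bar>)" by (simp add: sum_nonneg)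
  show "\<bar>f y\<bar> \<le> (\<Sum>y\<in>E. \<bar>f y\<bar>)" if "y \<in> E" for y
    using that finite_states by (intro member_le_sum[of y E "\<lambda>y. \<bar>f y\<bar>"]) auto
qed

lemma term_bound:
  assumes "x \<in> E" "\<And>y. y \<in> E \<Longrightarrow> \<bar>f y\<bar> \<le> B"
  shows "\<bar>t ^ k / fact k * (L ^^ k) f x\<bar> \<le> (\<bar>t\<bar> * bound) ^ k /\<^sub>R fact k * B"
proof -
  have "\<bar>t ^ k / fact k * (L ^^ k) f x\<bar> = \<bar>t\<bar> ^ k / fact k * \<bar>(L ^^ k) f x\<bar>"
    by (simp add: abs_mult power_abs)
  also have "\<dots> \<le> \<bar>t\<bar> ^ k / fact k * (bound ^ k * B)"
    by (intro mult_left_mono iterate_bound assms) auto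
  finally show ?thesis by (simp add: power_mult_distrib field_simps)
qed

lemma semigroup_summable_abs:
  assumes "x \<in> E"
  shows "summable (\<lambda>k. \<bar>t ^ k / fact k * (L ^^ k) f x\<bar>)"
proof -
  obtain B where B: "\<And>y. y \<in> E \<Longrightarrow> \<bar>f y\<bar> \<le> B" using obtain_sup_bound by blast
  show ?thesis
  proof (rule summable_comparison_test')
    show "summable (\<lambda>k. (\<bar>t\<bar> * bound) ^ k /\<^sub>R fact k * B)"
      by (intro summable_mult2 summable_exp_generic)
    show "norm \<bar>t ^ k / fact k * (L ^^ k) f x\<bar> \<le> (\<bar>t\<bar> * bound) ^ k /\<^sub>R fact k * B" if "0 \<le> k" for k
      using term_bound[OF assms B, where t = t and k = k] by auto
  qed
qed

lemma semigroup_summable: "x \<in> E \<Longrightarrow> summable (\<lambda>k. t ^ k / fact k * (L ^^ k) f x)"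
  by (rule summable_rabs_cancel[OF semigroup_summable_abs])

lemma semigroup_cong:
  assumes "x \<in> E" "\<And>y. y \<in> E \<Longrightarrow> f y = g y"
  shows "generator_semigroup L t f x = generator_semigroup L t g x"
  unfolding generator_semigroup_def using iterate_cong[OF assms] by simp

lemma semigroup_sum:
  assumes "x \<in> E" "finite I"
  shows "generator_semigroup L t (\<lambda>y. \<Sum>i\<in>I. c i * f i y) x
     = (\<Sum>i\<in>I. c i * generator_semigroup L t (f i) x)"
proof -
  have "generator_semigroup L t (\<lambda>y. \<Sum>i\<in>I. c i * f i y) x
      = (\<Sum>k. \<Sum>i\<in>I. c i * (t ^ k / fact k * (L ^^ k) (f i) x))"
    unfolding generator_semigroup_def
    by (simp add: iterate_sum[OF assms] sum_distrib_left mult.left_commute)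
  also have "\<dots> = (\<Sum>i\<in>I. \<Sum>k. c i * (t ^ k / fact k * (L ^^ k) (f i) x))"
    by (intro suminf_sum summable_mult semigroup_summable assms)
  also have "\<dots> = (\<Sum>i\<in>I. c i * generator_semigroup L t (f i) x)"
    unfolding generator_semigroup_def
    by (intro sum.cong refl suminf_mult semigroup_summable assms)
  finally show ?thesis .
qed

lemma semigroup_scale:
  "x \<in> E \<Longrightarrow> generator_semigroup L t (\<lambda>y. c * f y) x = c * generator_semigroup L t f x"
  using semigroup_sum[of x "{()}" t "\<lambda>_. c" "\<lambda>_. f"] by simp

lemma semigroup_expand:
  assumes "x \<in> E"
  shows "generator_semigroup L t f x = (\<Sum>z\<in>E. f z * generator_semigroup L t (indicator {z}) x)"
proof -
  have "generator_semigroup L t f x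
      = generator_semigroup L t (\<lambda>y. \<Sum>z\<in>E. f z * indicator {z} y) x"
    by (rule semigroup_cong[OF assms]) (simp add: sum_indicator)
  then show ?thesis
    by (simp add: semigroup_sum[OF assms finite_states])
qed

lemma semigroup_bound:
  assumes "x \<in> E" "\<And>y. y \<in> E \<Longrightarrow> \<bar>f y\<bar> \<le> B"
  shows "\<bar>generator_semigroup L t f x\<bar> \<le> exp (\<bar>t\<bar> * bound) * B"
proof -
  have "\<bar>generator_semigroup L t f x\<bar> \<le> (\<Sum>k. \<bar>t ^ k / fact k * (L ^^ k) f x\<bar>)"
    unfolding generator_semigroup_def
    by (rule summable_rabs[OF semigroup_summable_abs[OF assms(1)]])
  also have "\<dots> \<le> (\<Sum>k. (\<bar>t\<bar> * bound) ^ k /\<^sub>R fact k * B)"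
    by (intro suminf_le term_bound assms semigroup_summable_abs summable_mult2 summable_exp_generic)
  also have "\<dots> = exp (\<bar>t\<bar> * bound) * B"
    unfolding exp_def by (rule suminf_mult2[OF summable_exp_generic, symmetric])
  finally show ?thesis .
qed

lemma semigroup_0 [simp]: "generator_semigroup L 0 f x = f x"
proof -
  have "(\<lambda>k. 0 ^ k / fact k * (L ^^ k) f x) = (\<lambda>k. if k = 0 then f x else 0)"
    by (auto simp: fun_eq_iff)
  moreover have "(\<lambda>k. if k = 0 then f x else 0) sums f x"
    using sums_single[of 0 "\<lambda>_. f x"] by simp
  ultimately show ?thesis by (simp add: generator_semigroup_def sums_iff)
qed

text \<open>
  The tail of the exponential series is compared termwise, after an index shift by \<open>n\<close>, with \<open>h\<^sup>n\<close> times
  the full series at time one.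
\<close>

lemma semigroup_remainder:
  assumes "x \<in> E" "\<And>y. y \<in> E \<Longrightarrow> \<bar>f y\<bar> \<le> B" "0 \<le> h" "h \<le> 1"
  shows "\<bar>generator_semigroup L h f x - (\<Sum>k<n. h ^ k / fact k * (L ^^ k) f x)\<bar>
      \<le> h ^ n * (exp bound * B * bound ^ n)"
proof -
  have B: "0 \<le> B" using assms by force
  have "generator_semigroup L h f x - (\<Sum>k<n. h ^ k / fact k * (L ^^ k) f x)
      = (\<Sum>k. h ^ (k + n) / fact (k + n) * (L ^^ (k + n)) f x)"
    unfolding generator_semigroup_def
    using suminf_minus_initial_segment[OF semigroup_summable[OF assms(1)], where k = n] by simp
  also have "\<bar>\<dots>\<bar> \<le> (\<Sum>k. h ^ n * (bound ^ n * B) * (bound ^ k /\<^sub>R fact k))"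
  proof (rule order_trans[OF summable_rabs suminf_le])
    show "summable (\<lambda>k. h ^ n * (bound ^ n * B) * (bound ^ k /\<^sub>R fact k))"
      by (intro summable_mult summable_exp_generic)
    show "summable (\<lambda>k. \<bar>h ^ (k + n) / fact (k + n) * (L ^^ (k + n)) f x\<bar>)"
      using semigroup_summable_abs[OF assms(1), where t = h and f = f]
      by (subst summable_iff_shift)
    then show "summable (\<lambda>k. \<bar>h ^ (k + n) / fact (k + n) * (L ^^ (k + n)) f x\<bar>)" .
    show "\<bar>h ^ (k + n) / fact (k + n) * (L ^^ (k + n)) f x\<bar>
        \<le> h ^ n * (bound ^ n * B) * (bound ^ k /\<^sub>R fact k)" for k
    proof -
      have "\<bar>h ^ (k + n) / fact (k + n) * (L ^^ (k + n)) f x\<bar>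
          = h ^ (k + n) / fact (k + n) * \<bar>(L ^^ (k + n)) f x\<bar>"
        using assms(3) by (simp add: abs_mult)
      also have "\<dots> \<le> h ^ n / fact k * (bound ^ (k + n) * B)"
      proof (rule mult_mono)
        show "h ^ (k + n) / fact (k + n) \<le> h ^ n / fact k"
          using assms(3,4) by (intro frac_le power_decreasing) (auto intro: fact_mono)
        show "\<bar>(L ^^ (k + n)) f x\<bar> \<le> bound ^ (k + n) * B"
          by (rule iterate_bound[OF assms(1,2)])
      qed (use assms in auto)
      finally show ?thesis by (simp add: power_add field_simps)
    qed
  qed
  also have "\<dots> = h ^ n * (bound ^ n * B) * exp bound"
    unfolding exp_def by (rule suminf_mult[OF summable_exp_generic])
  finally show ?thesis by (simp add: mult_ac)
qed

lemma semigroup_first_order: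
  assumes "x \<in> E" "\<And>y. y \<in> E \<Longrightarrow> \<bar>f y\<bar> \<le> B" "0 \<le> h" "h \<le> 1"
  shows "\<bar>generator_semigroup L h f x - f x\<bar> \<le> h * (exp bound * B * bound)"
  using semigroup_remainder[OF assms, where n = 1] by simp

lemma semigroup_second_order:
  assumes "x \<in> E" "\<And>y. y \<in> E \<Longrightarrow> \<bar>f y\<bar> \<le> B" "0 \<le> h" "h \<le> 1"
  shows "\<bar>generator_semigroup L h f x - (f x + h * L f x)\<bar> \<le> h\<^sup>2 * (exp bound * B * bound\<^sup>2)"
  using semigroup_remainder[OF assms, where n = 2] by (simp add: numeral_2_eq_2 lessThan_Suc add.commute)

lemma semigroup_swap: "x \<in> E \<Longrightarrow> generator_semigroup L t (L f) x = L (generator_semigroup L t f) x"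
proof -
  assume x: "x \<in> E"
  have "generator_semigroup L t (L f) x = (\<Sum>k. \<Sum>y\<in>E. q x y * (t ^ k / fact k * (L ^^ k) f y))"
    unfolding generator_semigroup_def
    by (simp add: funpow_swap1[symmetric] matrix_form[OF x] sum_distrib_left mult.left_commute)
  also have "\<dots> = (\<Sum>y\<in>E. q x y * generator_semigroup L t f y)"
    unfolding generator_semigroup_def
    by (subst suminf_sum, intro summable_mult semigroup_summable, assumption)
      (intro sum.cong refl suminf_mult semigroup_summable, assumption)
  finally show ?thesis by (simp add: matrix_form[OF x])
qed

lemma semigroup_derivative:
  assumes "x \<in> E"
  shows "((\<lambda>t. generator_semigroup L t f x) has_real_derivative generator_semigroup L t (L f) x) (at t)"
proof -
  define c where "c k = (L ^^ k) f x / fact k" for k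
  have gs: "generator_semigroup L t f x = (\<Sum>k. c k * t ^ k)" for t
    by (simp add: generator_semigroup_def c_def mult.commute)
  have "diffs c = (\<lambda>k. (L ^^ k) (L f) x / fact k)"
    by (auto simp: diffs_def c_def fun_eq_iff funpow_swap1 fact_Suc simp del: of_nat_Suc)
  then have "generator_semigroup L t (L f) x = (\<Sum>k. diffs c k * t ^ k)"
    by (simp add: generator_semigroup_def mult.commute)
  moreover have "summable (\<lambda>k. c k * t ^ k)" for t
    using semigroup_summable[OF assms, where t = t and f = f] by (simp add: c_def mult.commute)
  ultimately show ?thesis
    unfolding gs using termdiffs_strong_converges_everywhere[of c t] by simp
qed

lemma semigroup_continuous: "x \<in> E \<Longrightarrow> isCont (\<lambda>t. generator_semigroup L t f x) t"
  using semigroup_derivative DERIV_isCont by blast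

text \<open>Both sides agree because \<open>r \<mapsto> e\<^bsup>rL\<^esup> e\<^bsup>(t-r)L\<^esup> f\<close> has derivative zero.\<close>

lemma semigroup_add:
  assumes x: "x \<in> E"
  shows "generator_semigroup L s (generator_semigroup L t f) x = generator_semigroup L (s + t) f x"
proof -
  let ?g = "generator_semigroup L"
  define \<phi> where "\<phi> r = (\<Sum>z\<in>E. ?g (s + t - r) f z * ?g r (indicator {z}) x)" for r
  have \<phi>: "\<phi> r = ?g r (?g (s + t - r) f) x" for r
    unfolding \<phi>_def by (rule semigroup_expand[OF x, symmetric])
  have "(\<phi> has_real_derivative 0) (at r)" for r
  proof -
    let ?v = "?g (s + t - r) f"
    have d1: "((\<lambda>r. ?g (s + t - r) f z) has_real_derivative - L ?v z) (at r)" if "z \<in> E" for z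
    proof -
      have "((\<lambda>r. s + t - r) has_real_derivative -1) (at r)"
        by (auto intro!: derivative_eq_intros)
      from DERIV_chain2[OF semigroup_derivative[OF that, of f "s + t - r"] this]
      show ?thesis using semigroup_swap[OF that] by simp
    qed
    have "((\<lambda>r. \<Sum>z\<in>E. ?g (s + t - r) f z * ?g r (indicator {z}) x) has_real_derivative
        (\<Sum>z\<in>E. - L ?v z * ?g r (indicator {z}) x + ?g r (L (indicator {z})) x * ?v z)) (at r)"
      by (intro DERIV_sum DERIV_mult d1 semigroup_derivative x)
    then have "(\<phi> has_real_derivative
        (\<Sum>z\<in>E. - L ?v z * ?g r (indicator {z}) x + ?g r (L (indicator {z})) x * ?v z)) (at r)"
      by (simp add: \<phi>_def [abs_def])
    moreover have "(\<Sum>z\<in>E. L ?v z * ?g r (indicator {z}) x) = ?g r (L ?v) x"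
      by (rule semigroup_expand[OF x, symmetric])
    moreover have "(\<Sum>z\<in>E. ?v z * ?g r (L (indicator {z})) x) = ?g r (L ?v) x"
    proof -
      have "?g r (L ?v) x = ?g r (\<lambda>y. \<Sum>z\<in>E. ?v z * L (indicator {z}) y) x"
      proof (rule semigroup_cong[OF x])
        fix y assume "y \<in> E"
        have "L ?v y = L (\<lambda>u. \<Sum>z\<in>E. ?v z * indicator {z} u) y"
          by (rule apply_cong[OF \<open>y \<in> E\<close>]) (simp add: sum_indicator)
        then show "L ?v y = (\<Sum>z\<in>E. ?v z * L (indicator {z}) y)"
          using iterate_sum[OF \<open>y \<in> E\<close> finite_states, of 1 ?v "\<lambda>z. indicator {z}"] by simp
      qed
      then show ?thesis by (simp add: semigroup_sum[OF x finite_states])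
    qed
    ultimately show ?thesis by (simp add: sum_subtractf mult.commute)
  qed
  then have "\<phi> s = \<phi> (s + t)"
    using DERIV_isconst_all by blast
  moreover have "generator_semigroup L 0 f = f"
    by (rule ext) simp
  ultimately show ?thesis
    by (simp add: \<phi>)
qed

end

text \<open>
  Termwise convergence of the exponential series, dominated because convergent matrices are
  uniformly bounded.
\<close>

lemma generator_semigroup_tendsto:
  fixes q :: "nat \<Rightarrow> 'a \<Rightarrow> 'a \<Rightarrow> real"
  assumes ops: "\<And>n. finite_operator E (q n) (L n)" "finite_operator E q' L'"
    and conv: "\<And>x y. x \<in> E \<Longrightarrow> y \<in> E \<Longrightarrow> (\<lambda>n. q n x y) \<longlonglongrightarrow> q' x y"
    and x: "x \<in> E"
  shows "(\<lambda>n. generator_semigroup (L n) t f x) \<longlonglongrightarrow> generator_semigroup L' t f x"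
proof -
  interpret op: finite_operator E "q n" "L n" for n by (rule ops)
  interpret lim: finite_operator E q' L' by (rule ops)
  obtain B where B: "\<And>y. y \<in> E \<Longrightarrow> \<bar>f y\<bar> \<le> B" using lim.obtain_sup_bound by blast
  have "(\<lambda>n. op.bound n) \<longlonglongrightarrow> lim.bound"
    unfolding op.bound_def lim.bound_def by (intro tendsto_intros conv)
  then obtain C where C: "\<And>n. op.bound n \<le> C"
    by (metis Bseq_def convergentI convergent_imp_Bseq abs_le_D1 real_norm_def)
  have C0: "0 \<le> C" using C[of 0] op.bound_nonneg[of 0] by linarith
  have it: "(\<lambda>n. (L n ^^ k) f x) \<longlonglongrightarrow> (L' ^^ k) f x" if "x \<in> E" for k x
    using that
  proof (induction k arbitrary: x)
    case (Suc k)
    then have "(\<lambda>n. \<Sum>y\<in>E. q n x y * (L n ^^ k) f y) \<longlonglongrightarrow> (\<Sum>y\<in>E. q' x y * (L' ^^ k) f y)"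
      by (intro tendsto_intros conv) auto
    then show ?case using Suc.prems by (simp add: op.matrix_form lim.matrix_form)
  qed auto
  have "norm (t ^ k / fact k * (L n ^^ k) f x) \<le> (\<bar>t\<bar> * C) ^ k /\<^sub>R fact k * B" for n k
  proof -
    have "\<bar>t ^ k / fact k * (L n ^^ k) f x\<bar> \<le> (\<bar>t\<bar> * op.bound n) ^ k /\<^sub>R fact k * B"
      by (rule op.term_bound[OF x B])
    also have "\<dots> \<le> (\<bar>t\<bar> * C) ^ k /\<^sub>R fact k * B"
      using C B[OF x] op.bound_nonneg
      by (intro mult_right_mono scaleR_left_mono power_mono mult_left_mono) auto
    finally show ?thesis by simp
  qed
  then show ?thesis
    unfolding generator_semigroup_def
    by (intro tannerys_theorem[where M = "\<lambda>k. (\<bar>t\<bar> * C) ^ k /\<^sub>R fact k * B", THEN conjunct2, THEN conjunct2]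
        tendsto_mult tendsto_const it x summable_mult2 summable_exp_generic
        always_eventually) auto
qed

section \<open>Histories of a finite Markov chain\<close>

text \<open>
  A function of a sequence that reads only the entries up to time \<open>n\<close>, as do the functionals of the
  past in the Markov property.
\<close>

definition adapted :: "nat \<Rightarrow> ((nat \<Rightarrow> 'a) \<Rightarrow> 'b) \<Rightarrow> bool" where
  "adapted n u \<longleftrightarrow> (\<forall>z z'. (\<forall>i\<le>n. z i = z' i) \<longrightarrow> u z = u z')"

lemma adaptedI: "(\<And>z z'. (\<And>i. i \<le> n \<Longrightarrow> z i = z' i) \<Longrightarrow> u z = u z') \<Longrightarrow> adapted n u"
  unfolding adapted_def by blast

lemma adaptedD: "adapted n u \<Longrightarrow> (\<And>i. i \<le> n \<Longrightarrow> z i = z' i) \<Longrightarrow> u z = u z'"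
  unfolding adapted_def by blast

locale finite_chain = finite_operator E q L
  for E :: "'a::topological_space set" and q and L +
  fixes P :: "'w measure" and X :: "real \<Rightarrow> 'w \<Rightarrow> 'a" and x :: 'a
  assumes chain: "markov_chain E L P X x"
    and start: "x \<in> E"
begin

lemma prob: "prob_space P"
  using chain by (simp add: markov_chain_def)

sublocale prob_space P
  by (rule prob)

lemma state_measurable: "0 \<le> t \<Longrightarrow> X t \<in> P \<rightarrow>\<^sub>M count_space E"
  using chain by (simp add: markov_chain_def)

lemma state_in: "0 \<le> t \<Longrightarrow> \<omega> \<in> space P \<Longrightarrow> X t \<omega> \<in> E"
  using measurable_space[OF state_measurable] by simp

lemma paths: "\<omega> \<in> space P \<Longrightarrow> cadlag_on {0..} (\<lambda>t. X t \<omega>)"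
  using chain by (simp add: markov_chain_def)

lemma state_event: "0 \<le> t \<Longrightarrow> {\<omega> \<in> space P. X t \<omega> = y} \<in> sets P"
proof -
  assume t: "0 \<le> t"
  have "{\<omega> \<in> space P. X t \<omega> = y} = X t -` ({y} \<inter> E) \<inter> space P"
    using state_in[OF t] by auto
  then show ?thesis
    using measurable_sets[OF state_measurable[OF t], of "{y} \<inter> E"] by simp
qed

lemma history_event:
  fixes n :: nat
  assumes "\<And>i. 0 \<le> t i"
  shows "{\<omega> \<in> space P. \<forall>i\<le>n. X (t i) \<omega> = y i} \<in> sets P"
proof -
  have "{\<omega> \<in> space P. \<forall>i\<in>{..n}. X (t i) \<omega> = y i} \<in> sets P"
    by (rule sets.sets_Collect_finite_All, rule state_event, rule assms, simp)
  then show ?thesis unfolding Ball_def atMost_iff .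
qed

lemma event_integrable:
  "A \<in> sets P \<Longrightarrow> integrable P (\<lambda>\<omega>. c * indicator A \<omega> :: real)"
  by (intro integrable_mult_right integrable_real_indicator) (simp_all add: emeasure_eq_measure)

lemma event_expectation:
  assumes "A \<in> sets P"
  shows "expectation (\<lambda>\<omega>. c * indicator A \<omega>) = c * prob A"
  using sets.sets_into_space[OF assms] by (simp add: Int_absorb2)

lemma history_prob:
  assumes "t 0 = 0" "mono t" "\<And>i. i \<le> n \<Longrightarrow> y i \<in> E"
  shows "prob {\<omega> \<in> space P. \<forall>i\<le>n. X (t i) \<omega> = y i} =
     (if y 0 = x then 1 else 0) *
     (\<Prod>i<n. generator_semigroup L (t (Suc i) - t i) (indicator {y (Suc i)}) (y i))"
proof -
  define z where "z = (\<lambda>i. if i \<le> n then y i else x)"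
  have "range z \<subseteq> E" using assms(3) start by (auto simp: z_def)
  then have "prob {\<omega> \<in> space P. \<forall>i\<le>n. X (t i) \<omega> = z i} =
     (if z 0 = x then 1 else 0) *
     (\<Prod>i<n. generator_semigroup L (t (Suc i) - t i) (indicator {z (Suc i)}) (z i))"
    using chain assms by (simp add: markov_chain_def)
  moreover have "(\<Prod>i<n. generator_semigroup L (t (Suc i) - t i) (indicator {z (Suc i)}) (z i))
    = (\<Prod>i<n. generator_semigroup L (t (Suc i) - t i) (indicator {y (Suc i)}) (y i))"
    by (intro prod.cong) (auto simp: z_def)
  ultimately show ?thesis by (simp add: z_def cong: conj_cong)
qed

text \<open>
  A function of the states at finitely many times takes finitely many values and is a combination of
  indicators of histories. Its integrability and its expectation therefore need only the
  finite-dimensional distributions.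
\<close>

lemma history_decomposition:
  fixes u :: "(nat \<Rightarrow> 'a) \<Rightarrow> real"
  assumes t: "\<And>i. 0 \<le> t i" and u: "adapted n u" and \<omega>: "\<omega> \<in> space P"
  shows "u (\<lambda>i. X (t i) \<omega>) = (\<Sum>z\<in>PiE {..n} (\<lambda>_. E).
      u z * indicator {\<omega> \<in> space P. \<forall>i\<le>n. X (t i) \<omega> = z i} \<omega>)"
proof -
  define z0 where "z0 = restrict (\<lambda>i. X (t i) \<omega>) {..n}"
  have z0: "z0 \<in> PiE {..n} (\<lambda>_. E)"
    using state_in t \<omega> by (auto simp: z0_def)
  have uniq: "z = z0" if "z \<in> PiE {..n} (\<lambda>_. E)" "\<forall>i\<le>n. X (t i) \<omega> = z i" for z
    by (rule PiE_ext[OF that(1) z0]) (use that(2) in \<open>auto simp: z0_def\<close>)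
  have "(\<Sum>z\<in>PiE {..n} (\<lambda>_. E). u z * indicator {\<omega> \<in> space P. \<forall>i\<le>n. X (t i) \<omega> = z i} \<omega>)
      = (\<Sum>z\<in>PiE {..n} (\<lambda>_. E). if z0 = z then u z0 else 0)"
  proof (rule sum.cong[OF refl])
    fix z assume z: "z \<in> PiE {..n} (\<lambda>_. E)"
    have "(\<forall>i\<le>n. X (t i) \<omega> = z i) \<longleftrightarrow> z0 = z"
      using uniq[OF z] by (auto simp: z0_def)
    then show "u z * indicator {\<omega> \<in> space P. \<forall>i\<le>n. X (t i) \<omega> = z i} \<omega> = (if z0 = z then u z0 else 0)"
      using \<omega> by (simp add: indicator_def)
  qed
  also have "\<dots> = u z0"
    using z0 by (simp add: finite_PiE finite_states)
  also have "u z0 = u (\<lambda>i. X (t i) \<omega>)"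
    by (rule adaptedD[OF u]) (simp add: z0_def)
  finally show ?thesis by simp
qed

lemma history_integrable:
  fixes u :: "(nat \<Rightarrow> 'a) \<Rightarrow> real"
  assumes t: "\<And>i. 0 \<le> t i" and u: "adapted n u"
  shows "integrable P (\<lambda>\<omega>. u (\<lambda>i. X (t i) \<omega>))"
proof -
  have "integrable P (\<lambda>\<omega>. (\<Sum>z\<in>PiE {..n} (\<lambda>_. E).
      u z * indicator {\<omega> \<in> space P. \<forall>i\<le>n. X (t i) \<omega> = z i} \<omega>))"
    by (rule Bochner_Integration.integrable_sum) (rule event_integrable[OF history_event[OF t]])
  then show ?thesis
    by (rule iffD2[OF Bochner_Integration.integrable_cong, rotated 2])
      (rule refl, erule history_decomposition[OF t u])
qed

lemma history_measurable:
  fixes u :: "(nat \<Rightarrow> 'a) \<Rightarrow> real"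
  assumes "\<And>i. 0 \<le> t i" "adapted n u"
  shows "(\<lambda>\<omega>. u (\<lambda>i. X (t i) \<omega>)) \<in> borel_measurable P"
  using history_integrable[OF assms] by simp

lemma history_pred:
  assumes "\<And>i. 0 \<le> t i" "adapted n Q"
  shows "{\<omega> \<in> space P. Q (\<lambda>i. X (t i) \<omega>)} \<in> sets P"
proof -
  have "(\<lambda>\<omega>. of_bool (Q (\<lambda>i. X (t i) \<omega>)) :: real) \<in> borel_measurable P"
  proof (rule history_measurable[where n = n, OF assms(1)])
    show "adapted n (\<lambda>z. of_bool (Q z) :: real)"
      by (rule adaptedI) (rule arg_cong[where f = of_bool], rule adaptedD[OF assms(2)])
  qed
  from measurable_sets[OF this, of "{1}"]
  have "(\<lambda>\<omega>. of_bool (Q (\<lambda>i. X (t i) \<omega>)) :: real) -` {1} \<inter> space P \<in> sets P"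
    by simp
  moreover have "{\<omega> \<in> space P. Q (\<lambda>i. X (t i) \<omega>)}
      = (\<lambda>\<omega>. of_bool (Q (\<lambda>i. X (t i) \<omega>)) :: real) -` {1} \<inter> space P"
    by auto
  ultimately show ?thesis by metis
qed

lemma history_expectation:
  fixes u :: "(nat \<Rightarrow> 'a) \<Rightarrow> real"
  assumes t: "\<And>i. 0 \<le> t i" and u: "adapted n u"
  shows "expectation (\<lambda>\<omega>. u (\<lambda>i. X (t i) \<omega>)) = (\<Sum>z\<in>PiE {..n} (\<lambda>_. E).
      u z * prob {\<omega> \<in> space P. \<forall>i\<le>n. X (t i) \<omega> = z i})"
proof -
  have "expectation (\<lambda>\<omega>. u (\<lambda>i. X (t i) \<omega>)) = expectation (\<lambda>\<omega>. (\<Sum>z\<in>PiE {..n} (\<lambda>_. E).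
      u z * indicator {\<omega> \<in> space P. \<forall>i\<le>n. X (t i) \<omega> = z i} \<omega>))"
    by (rule Bochner_Integration.integral_cong) (rule refl, erule history_decomposition[OF t u])
  also have "\<dots> = (\<Sum>z\<in>PiE {..n} (\<lambda>_. E).
      expectation (\<lambda>\<omega>. u z * indicator {\<omega> \<in> space P. \<forall>i\<le>n. X (t i) \<omega> = z i} \<omega>))"
    by (rule Bochner_Integration.integral_sum) (rule event_integrable[OF history_event[OF t]])
  also have "\<dots> = (\<Sum>z\<in>PiE {..n} (\<lambda>_. E).
      u z * prob {\<omega> \<in> space P. \<forall>i\<le>n. X (t i) \<omega> = z i})"
    by (intro sum.cong refl event_expectation history_event t)
  finally show ?thesis .
qed

text \<open>
  Summation over all histories: appending one state multiplies the probability of a history by one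
  transition probability. The function applied to the new state may itself depend on the past, which
  is what a martingale argument with random coefficients needs.
\<close>

lemma markov_property:
  assumes t: "t 0 = 0" "mono t" and u: "adapted n u"
  shows "expectation (\<lambda>\<omega>. u (\<lambda>i. X (t i) \<omega>) (X (t (Suc n)) \<omega>))
    = expectation (\<lambda>\<omega>. generator_semigroup L (t (Suc n) - t n) (u (\<lambda>i. X (t i) \<omega>)) (X (t n) \<omega>))"
proof -
  have t0: "0 \<le> t i" for i using monoD[OF t(2), of 0 i] t(1) by simp
  let ?p = "\<lambda>n z. prob {\<omega> \<in> space P. \<forall>i\<le>n. X (t i) \<omega> = z i}"
  let ?g = "generator_semigroup L (t (Suc n) - t n)"
  have step: "?p (Suc n) (z(Suc n := y)) = ?p n z * ?g (indicator {y}) (z n)"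
    if z: "z \<in> PiE {..n} (\<lambda>_. E)" and y: "y \<in> E" for z y
  proof -
    have "?p (Suc n) (z(Suc n := y)) = (if z 0 = x then 1 else 0) *
       (\<Prod>i<Suc n. generator_semigroup L (t (Suc i) - t i) (indicator {(z(Suc n := y)) (Suc i)}) ((z(Suc n := y)) i))"
      using z y by (subst history_prob[OF t]) (auto simp: PiE_iff)
    also have "(\<Prod>i<Suc n. generator_semigroup L (t (Suc i) - t i) (indicator {(z(Suc n := y)) (Suc i)}) ((z(Suc n := y)) i))
      = (\<Prod>i<n. generator_semigroup L (t (Suc i) - t i) (indicator {z (Suc i)}) (z i)) * ?g (indicator {y}) (z n)"
      by (simp add: lessThan_Suc mult.commute)
    finally show ?thesis
      using z by (subst history_prob[OF t]) (auto simp: PiE_iff)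
  qed
  have "expectation (\<lambda>\<omega>. u (\<lambda>i. X (t i) \<omega>) (X (t (Suc n)) \<omega>))
      = (\<Sum>z\<in>PiE {..Suc n} (\<lambda>_. E). u z (z (Suc n)) * ?p (Suc n) z)"
  proof (rule history_expectation[OF t0], rule adaptedI)
    fix z z' :: "nat \<Rightarrow> 'a" assume zz: "\<And>i. i \<le> Suc n \<Longrightarrow> z i = z' i"
    have "u z = u z'"
      by (rule adaptedD[OF u]) (simp add: zz)
    then show "u z (z (Suc n)) = u z' (z' (Suc n))"
      by (simp add: zz)
  qed
  also have "PiE {..Suc n} (\<lambda>_. E) = (\<lambda>(y, z). z(Suc n := y)) ` (E \<times> PiE {..n} (\<lambda>_. E))"
    by (simp add: atMost_Suc PiE_insert_eq)
  also have "(\<Sum>z\<in>(\<lambda>(y, z). z(Suc n := y)) ` (E \<times> PiE {..n} (\<lambda>_. E)). u z (z (Suc n)) * ?p (Suc n) z)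
      = (\<Sum>(y, z)\<in>E \<times> PiE {..n} (\<lambda>_. E). u (z(Suc n := y)) y * ?p (Suc n) (z(Suc n := y)))"
    by (subst sum.reindex[OF inj_combinator]) (auto simp: case_prod_unfold)
  also have "\<dots> = (\<Sum>(y, z)\<in>E \<times> PiE {..n} (\<lambda>_. E). u z y * (?p n z * ?g (indicator {y}) (z n)))"
  proof (intro sum.cong refl, clarify)
    fix y z assume "y \<in> E" "z \<in> PiE {..n} (\<lambda>_. E)"
    moreover have "u (z(Suc n := y)) = u z"
      by (rule adaptedD[OF u]) auto
    ultimately show "u (z(Suc n := y)) y * ?p (Suc n) (z(Suc n := y)) = u z y * (?p n z * ?g (indicator {y}) (z n))"
      by (simp only: step)
  qed
  also have "\<dots> = (\<Sum>z\<in>PiE {..n} (\<lambda>_. E). \<Sum>y\<in>E. u z y * (?p n z * ?g (indicator {y}) (z n)))"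
    by (subst sum.swap) (simp add: sum.cartesian_product)
  also have "\<dots> = (\<Sum>z\<in>PiE {..n} (\<lambda>_. E). ?g (u z) (z n) * ?p n z)"
  proof (rule sum.cong[OF refl])
    fix z assume "z \<in> PiE {..n} (\<lambda>_. E)"
    then have "z n \<in> E" by auto
    then show "(\<Sum>y\<in>E. u z y * (?p n z * ?g (indicator {y}) (z n))) = ?g (u z) (z n) * ?p n z"
      by (simp add: semigroup_expand[of "z n" _ "u z"] sum_distrib_left sum_distrib_right mult_ac)
  qed
  also have "\<dots> = expectation (\<lambda>\<omega>. ?g (u (\<lambda>i. X (t i) \<omega>)) (X (t n) \<omega>))"
  proof (rule history_expectation[symmetric])
    show "adapted n (\<lambda>z. ?g (u z) (z n))"
    proof (rule adaptedI)
      fix z z' :: "nat \<Rightarrow> 'a" assume "\<And>i. i \<le> n \<Longrightarrow> z i = z' i"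
      moreover have "u z = u z'"
        by (rule adaptedD[OF u]) (rule calculation)
      ultimately show "?g (u z) (z n) = ?g (u z') (z' n)"
        by simp
    qed
  qed (rule t0)
  finally show ?thesis .
qed

text \<open>
  A bound for the probability of a change of state per unit of time, valid for time steps of length
  at most one.
\<close>

definition jump_rate :: real where
  "jump_rate = exp bound * bound"

lemma jump_rate_nonneg: "0 \<le> jump_rate"
  by (simp add: jump_rate_def bound_nonneg)

text \<open>
  Conditionally on the past the probability of leaving the current state \<open>a\<close> during a step \<open>h\<close> is one
  minus \<open>(e\<^bsup>hL\<^esup> 1\<^bsub>{a}\<^esub>)(a)\<close>, and so at most \<open>h\<close> times the jump rate. The nonnegative factor \<open>D\<close> carries
  information about the past.
\<close>

lemma expected_jump:
  assumes t: "t 0 = 0" "mono t" and D: "adapted n D" "\<And>z. 0 \<le> D z"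
    and small: "t (Suc n) - t n \<le> 1"
  shows "expectation (\<lambda>\<omega>. D (\<lambda>i. X (t i) \<omega>) * of_bool (X (t (Suc n)) \<omega> \<noteq> X (t n) \<omega>))
      \<le> jump_rate * (t (Suc n) - t n) * expectation (\<lambda>\<omega>. D (\<lambda>i. X (t i) \<omega>))"
proof -
  have t0: "0 \<le> t i" for i using monoD[OF t(2), of 0 i] t(1) by simp
  define u where "u = (\<lambda>z y. D z * of_bool (y \<noteq> z n) :: real)"
  have u: "adapted n u"
  proof (rule adaptedI)
    fix z z' :: "nat \<Rightarrow> 'a" assume zz: "\<And>i. i \<le> n \<Longrightarrow> z i = z' i"
    have "D z = D z'"
      by (rule adaptedD[OF D(1)]) (rule zz)
    then show "u z = u z'"
      by (simp add: u_def zz)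
  qed
  let ?g = "generator_semigroup L (t (Suc n) - t n)"
  have "expectation (\<lambda>\<omega>. u (\<lambda>i. X (t i) \<omega>) (X (t (Suc n)) \<omega>))
      = expectation (\<lambda>\<omega>. ?g (u (\<lambda>i. X (t i) \<omega>)) (X (t n) \<omega>))"
    by (rule markov_property[OF t u])
  also have "\<dots> \<le> expectation (\<lambda>\<omega>. jump_rate * (t (Suc n) - t n) * D (\<lambda>i. X (t i) \<omega>))"
  proof (rule integral_mono)
    show "integrable P (\<lambda>\<omega>. jump_rate * (t (Suc n) - t n) * D (\<lambda>i. X (t i) \<omega>))"
      by (intro integrable_mult_right history_integrable[where n = n] t0 D)
    have "adapted n (\<lambda>z. ?g (u z) (z n))"
    proof (rule adaptedI)
      fix z z' :: "nat \<Rightarrow> 'a" assume zz: "\<And>i. i \<le> n \<Longrightarrow> z i = z' i"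
      have "u z = u z'"
        by (rule adaptedD[OF u]) (rule zz)
      then show "?g (u z) (z n) = ?g (u z') (z' n)"
        by (simp add: zz)
    qed
    from history_integrable[OF t0 this]
    show "integrable P (\<lambda>\<omega>. ?g (u (\<lambda>i. X (t i) \<omega>)) (X (t n) \<omega>))" .
    show "?g (u (\<lambda>i. X (t i) \<omega>)) (X (t n) \<omega>) \<le> jump_rate * (t (Suc n) - t n) * D (\<lambda>i. X (t i) \<omega>)"
      if "\<omega> \<in> space P" for \<omega>
    proof -
      let ?z = "\<lambda>i. X (t i) \<omega>"
      have "\<bar>?g (u ?z) (?z n) - u ?z (?z n)\<bar> \<le> (t (Suc n) - t n) * (exp bound * D ?z * bound)"
        using state_in[OF t0 that] D(2) monoD[OF t(2), of n "Suc n"] small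
        by (intro semigroup_first_order) (auto simp: u_def)
      then show ?thesis by (simp add: u_def jump_rate_def mult_ac)
    qed
  qed
  finally show ?thesis by (simp add: u_def)
qed

lemma one_jump:
  assumes "0 \<le> a" "a \<le> b" "b - a \<le> 1"
  shows "prob {\<omega> \<in> space P. X a \<omega> \<noteq> X b \<omega>} \<le> jump_rate * (b - a)"
proof -
  define t where "t = (\<lambda>i::nat. if i = 0 then 0 else if i = 1 then a else b)"
  have t: "t 0 = 0" "mono t" using assms by (auto simp: t_def mono_def)
  have t0: "0 \<le> t i" for i using assms by (simp add: t_def)
  have "{\<omega> \<in> space P. X a \<omega> \<noteq> X b \<omega>} \<in> sets P"
    using history_pred[where n = 2 and t = t and Q = "\<lambda>z. z 1 \<noteq> z 2"] t0 by (simp add: adapted_def t_def)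
  then have "prob {\<omega> \<in> space P. X a \<omega> \<noteq> X b \<omega>}
      = expectation (\<lambda>\<omega>. indicator {\<omega> \<in> space P. X a \<omega> \<noteq> X b \<omega>} \<omega>)"
    by (simp add: Int_absorb1)
  also have "\<dots> = expectation (\<lambda>\<omega>. 1 * of_bool (X (t (Suc 1)) \<omega> \<noteq> X (t 1) \<omega>))"
    by (intro Bochner_Integration.integral_cong) (auto simp: t_def indicator_def)
  also have "\<dots> \<le> jump_rate * (t (Suc 1) - t 1) * expectation (\<lambda>\<omega>. 1)"
    using assms by (intro expected_jump[where D = "\<lambda>_. 1"] t) (auto simp: adapted_def t_def)
  finally show ?thesis by (simp add: t_def prob_space)
qed

text \<open>
  The estimate for one change of state is applied twice, the second time with the indicator of the
  first change as the factor depending on the past.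
\<close>

lemma two_jumps:
  assumes "0 \<le> a" "a \<le> b" "b \<le> c" "c \<le> d" "b - a \<le> 1" "d - c \<le> 1"
  shows "prob {\<omega> \<in> space P. X a \<omega> \<noteq> X b \<omega> \<and> X c \<omega> \<noteq> X d \<omega>} \<le> jump_rate\<^sup>2 * (b - a) * (d - c)"
proof -
  define t where "t = (\<lambda>i::nat. if i = 0 then 0 else if i = 1 then a else if i = 2 then b
    else if i = 3 then c else d)"
  have t: "t 0 = 0" "mono t" using assms by (auto simp: t_def mono_def)
  have t0: "0 \<le> t i" for i using assms by (simp add: t_def)
  have ev: "{\<omega> \<in> space P. X a \<omega> \<noteq> X b \<omega>} \<in> sets P"
    using history_pred[where n = 2 and t = t and Q = "\<lambda>z. z 1 \<noteq> z 2"] t0 by (simp add: adapted_def t_def)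
  have "{\<omega> \<in> space P. X a \<omega> \<noteq> X b \<omega> \<and> X c \<omega> \<noteq> X d \<omega>} \<in> sets P"
    using history_pred[where n = 4 and t = t and Q = "\<lambda>z. z 1 \<noteq> z 2 \<and> z 3 \<noteq> z 4"] t0 by (simp add: adapted_def t_def)
  then have "prob {\<omega> \<in> space P. X a \<omega> \<noteq> X b \<omega> \<and> X c \<omega> \<noteq> X d \<omega>}
      = expectation (\<lambda>\<omega>. indicator {\<omega> \<in> space P. X a \<omega> \<noteq> X b \<omega> \<and> X c \<omega> \<noteq> X d \<omega>} \<omega>)"
    by (simp add: Int_absorb1)
  also have "\<dots> = expectation (\<lambda>\<omega>. of_bool (X (t 1) \<omega> \<noteq> X (t 2) \<omega>)
      * of_bool (X (t (Suc 3)) \<omega> \<noteq> X (t 3) \<omega>))"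
    by (intro Bochner_Integration.integral_cong) (auto simp: t_def indicator_def)
  also have "\<dots> \<le> jump_rate * (t (Suc 3) - t 3) * expectation (\<lambda>\<omega>. of_bool (X (t 1) \<omega> \<noteq> X (t 2) \<omega>))"
    using assms by (intro expected_jump[where D = "\<lambda>z. of_bool (z 1 \<noteq> z 2)"] t) (auto simp: adapted_def t_def)
  also have "expectation (\<lambda>\<omega>. of_bool (X (t 1) \<omega> \<noteq> X (t 2) \<omega>))
      = expectation (\<lambda>\<omega>. indicator {\<omega> \<in> space P. X a \<omega> \<noteq> X b \<omega>} \<omega>)"
    by (intro Bochner_Integration.integral_cong) (auto simp: t_def indicator_def)
  also have "\<dots> = prob {\<omega> \<in> space P. X a \<omega> \<noteq> X b \<omega>}"
    using ev by (simp add: Int_absorb1)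
  also have "jump_rate * (t (Suc 3) - t 3) * prob {\<omega> \<in> space P. X a \<omega> \<noteq> X b \<omega>}
      \<le> jump_rate * (t (Suc 3) - t 3) * (jump_rate * (b - a))"
    using assms jump_rate_nonneg by (intro mult_left_mono one_jump) (auto simp: t_def)
  finally show ?thesis by (simp add: t_def power2_eq_square mult_ac)
qed

end

section \<open>Step paths, occupation times and time changes\<close>

text \<open>
  Points of the discrete torus are pairs of integers, and Skorohod space is defined for states in a
  discrete topology.
\<close>

instance prod :: (discrete_topology, discrete_topology) discrete_topology
proof
  fix S :: "('a::discrete_topology \<times> 'b::discrete_topology) set"
  have "open (\<Union>z\<in>S. {fst z} \<times> {snd z})"
    by (intro open_UN ballI open_Times) (rule discrete_topology_class.open_discrete)+
  then show "open S" by simp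
qed

text \<open>What right-continuity with left limits means for values in a discrete topology.\<close>

definition step_path :: "real set \<Rightarrow> (real \<Rightarrow> 'a) \<Rightarrow> bool" where
  "step_path I p \<longleftrightarrow> (\<forall>t\<in>I. (\<exists>d>0. \<forall>s\<in>I. t < s \<and> s < t + d \<longrightarrow> p s = p t) \<and>
                        (\<exists>a. \<exists>d>0. \<forall>s\<in>I. t - d < s \<and> s < t \<longrightarrow> p s = a))"

lemma cadlag_on_iff_step_path:
  fixes p :: "real \<Rightarrow> 'a::discrete_topology"
  shows "cadlag_on I p \<longleftrightarrow> step_path I p"
proof -
  have right: "(p \<longlongrightarrow> p t) (at t within I \<inter> {t<..}) \<longleftrightarrow> (\<exists>d>0. \<forall>s\<in>I. t < s \<and> s < t + d \<longrightarrow> p s = p t)" for t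
    unfolding tendsto_discrete eventually_at
    by (intro ex_cong1 conj_cong refl) (auto simp: dist_real_def)
  have left: "(p \<longlongrightarrow> l) (at t within I \<inter> {..<t}) \<longleftrightarrow> (\<exists>d>0. \<forall>s\<in>I. t - d < s \<and> s < t \<longrightarrow> p s = l)" for t l
    unfolding tendsto_discrete eventually_at
    by (intro ex_cong1 conj_cong refl) (auto simp: dist_real_def)
  show ?thesis
    unfolding cadlag_on_def step_path_def right left by (rule refl)
qed

lemma step_path_right:
  assumes "step_path I p" "t \<in> I"
  obtains d where "d > 0" "\<And>s. s \<in> I \<Longrightarrow> t \<le> s \<Longrightarrow> s < t + d \<Longrightarrow> p s = p t"
proof -
  obtain d where "d > 0" "\<forall>s\<in>I. t < s \<and> s < t + d \<longrightarrow> p s = p t"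
    using assms unfolding step_path_def by blast
  then show ?thesis using that[of d] by (metis le_less)
qed

lemma step_path_left:
  assumes "step_path I p" "t \<in> I"
  obtains a d where "d > 0" "\<And>s. s \<in> I \<Longrightarrow> t - d < s \<Longrightarrow> s < t \<Longrightarrow> p s = a"
proof -
  obtain a d where "d > 0" "\<forall>s\<in>I. t - d < s \<and> s < t \<longrightarrow> p s = a"
    using assms unfolding step_path_def by blast
  then show ?thesis using that[of d a] by blast
qed

lemma step_path_subset: "step_path I p \<Longrightarrow> J \<subseteq> I \<Longrightarrow> step_path J p"
proof -
  assume p: "step_path I p" and J: "J \<subseteq> I"
  show "step_path J p"
    unfolding step_path_def
  proof (intro ballI conjI)
    fix t assume "t \<in> J"
    then have t: "t \<in> I" using J by blast
    obtain d where "d > 0" "\<And>s. s \<in> I \<Longrightarrow> t \<le> s \<Longrightarrow> s < t + d \<Longrightarrow> p s = p t"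
      by (rule step_path_right[OF p t]) blast
    then show "\<exists>d>0. \<forall>s\<in>J. t < s \<and> s < t + d \<longrightarrow> p s = p t"
      using J by (intro exI[of _ d]) (simp add: subset_iff)
    obtain a d where "d > 0" "\<And>s. s \<in> I \<Longrightarrow> t - d < s \<Longrightarrow> s < t \<Longrightarrow> p s = a"
      by (rule step_path_left[OF p t]) blast
    then show "\<exists>a. \<exists>d>0. \<forall>s\<in>J. t - d < s \<and> s < t \<longrightarrow> p s = a"
      using J by (intro exI[of _ a] exI[of _ d]) (simp add: subset_iff)
  qed
qed

definition jumps_within :: "real set \<Rightarrow> real \<Rightarrow> real \<Rightarrow> (real \<Rightarrow> 'a) \<Rightarrow> bool" where
  "jumps_within S a b p \<longleftrightarrow> finite S \<and>
     (\<forall>r s. a \<le> r \<longrightarrow> r \<le> s \<longrightarrow> s \<le> b \<longrightarrow> {r<..s} \<inter> S = {} \<longrightarrow> p s = p r)"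

lemma jumps_withinD:
  "jumps_within S a b p \<Longrightarrow> a \<le> r \<Longrightarrow> r \<le> s \<Longrightarrow> s \<le> b \<Longrightarrow> {r<..s} \<inter> S = {} \<Longrightarrow> p s = p r"
  unfolding jumps_within_def by blast

text \<open>
  Bolzano's bisection principle: a neighbourhood of every time contains at most one jump, and sets
  of jumps of adjacent intervals can be joined.
\<close>

lemma finitely_many_jumps:
  assumes p: "step_path {a..b} p" and "a \<le> b"
  shows "\<exists>S. jumps_within S a b p"
proof -
  define Q where "Q = (\<lambda>u v. a \<le> u \<longrightarrow> v \<le> b \<longrightarrow> (\<exists>S. jumps_within S u v p))"
  have "Q a b"
  proof (rule Bolzano[OF \<open>a \<le> b\<close>])
    fix u v w assume Q: "Q u v" "Q v w" and le: "u \<le> v" "v \<le> w"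
    show "Q u w"
      unfolding Q_def
    proof (intro impI)
      assume "a \<le> u" "w \<le> b"
      then obtain S S' where S: "jumps_within S u v p" "jumps_within S' v w p"
        using Q le unfolding Q_def by (meson order_trans)
      have "p s = p r" if rs: "u \<le> r" "r \<le> s" "s \<le> w" "{r<..s} \<inter> (S \<union> S') = {}" for r s
      proof -
        consider "s \<le> v" | "v \<le> r" | "r \<le> v" "v \<le> s" by linarith
        then show ?thesis
        proof cases
          case 1 then show ?thesis using jumps_withinD[OF S(1), of r s] rs by blast
        next
          case 2 then show ?thesis using jumps_withinD[OF S(2), of r s] rs by blast
        next
          case 3
          have "{r<..v} \<subseteq> {r<..s}" "{v<..s} \<subseteq> {r<..s}" using 3 by auto
          then have "{r<..v} \<inter> S = {}" "{v<..s} \<inter> S' = {}" using rs(4) by blast+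
          then have "p v = p r" "p s = p v"
            using jumps_withinD[OF S(1), of r v] jumps_withinD[OF S(2), of v s] rs 3 by auto
          then show ?thesis by simp
        qed
      qed
      then have "jumps_within (S \<union> S') u w p"
        using S unfolding jumps_within_def by (intro conjI allI impI finite_UnI) blast+
      then show "\<exists>S. jumps_within S u w p" by blast
    qed
  next
    fix x assume x: "a \<le> x" "x \<le> b"
    obtain d where d: "d > 0" "\<And>s. s \<in> {a..b} \<Longrightarrow> x \<le> s \<Longrightarrow> s < x + d \<Longrightarrow> p s = p x"
      using step_path_right[OF p, of x] x by auto
    obtain c d' where d': "d' > 0" "\<And>s. s \<in> {a..b} \<Longrightarrow> x - d' < s \<Longrightarrow> s < x \<Longrightarrow> p s = c"
      by (rule step_path_left[OF p, of x]) (use x in auto)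
    show "\<exists>d>0. \<forall>u v. u \<le> x \<and> x \<le> v \<and> v - u < d \<longrightarrow> Q u v"
    proof (intro exI[of _ "min d d'"] conjI allI impI)
      fix u v assume uv: "u \<le> x \<and> x \<le> v \<and> v - u < min d d'"
      show "Q u v"
        unfolding Q_def
      proof (intro impI exI[of _ "{x}"])
        assume "a \<le> u" "v \<le> b"
        have "p s = p r" if rs: "u \<le> r" "r \<le> s" "s \<le> v" "{r<..s} \<inter> {x} = {}" for r s
        proof (cases "x \<le> r")
          case True
          have "p r = p x" by (rule d(2)) (use True rs uv \<open>a \<le> u\<close> \<open>v \<le> b\<close> in simp_all)
          moreover have "p s = p x" by (rule d(2)) (use True rs uv \<open>a \<le> u\<close> \<open>v \<le> b\<close> in simp_all)
          ultimately show ?thesis by simp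
        next
          case False
          then have "s < x" using rs by auto
          have "p r = c" by (rule d'(2)) (use False \<open>s < x\<close> rs uv \<open>a \<le> u\<close> \<open>v \<le> b\<close> in simp_all)
          moreover have "p s = c" by (rule d'(2)) (use False \<open>s < x\<close> rs uv \<open>a \<le> u\<close> \<open>v \<le> b\<close> in simp_all)
          ultimately show ?thesis by simp
        qed
        then show "jumps_within {x} u v p"
          unfolding jumps_within_def by (intro conjI allI impI) (simp, blast)
      qed
    qed (use d d' in auto)
  qed
  then show ?thesis by (simp add: Q_def)
qed

primrec visits :: "'a set \<Rightarrow> (nat \<Rightarrow> 'a) \<Rightarrow> nat \<Rightarrow> nat" where
  "visits A z 0 = 0"
| "visits A z (Suc l) = visits A z l + of_bool (z l \<in> A)"

lemma visits_cong: "(\<And>i. i < l \<Longrightarrow> z i = z' i) \<Longrightarrow> visits A z l = visits A z' l"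
  by (induction l) auto

lemma visits_attained: "m < visits A z k \<Longrightarrow> \<exists>l<k. z l \<in> A \<and> visits A z l = m"
proof (induction k)
  case (Suc k)
  show ?case
  proof (cases "m < visits A z k")
    case True
    then show ?thesis using Suc.IH less_SucI by blast
  next
    case False
    then show ?thesis using Suc.prems by (intro exI[of _ k]) (auto simp: of_bool_def split: if_splits)
  qed
qed auto

definition mesh :: "nat \<Rightarrow> real" where
  "mesh n = 1 / real (Suc n)"

lemma mesh_pos: "0 < mesh n" and mesh_le_1: "mesh n \<le> 1"
  by (auto simp: mesh_def)

lemma mesh_tendsto: "mesh \<longlonglongrightarrow> 0"
  unfolding mesh_def using LIMSEQ_inverse_real_of_nat by (simp add: inverse_eq_divide)

lemma mesh_steps: "real (R * Suc n) * mesh n = real R"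
  unfolding mesh_def of_nat_mult by (simp del: of_nat_Suc)

text \<open>
  The number of visits that a trace at local time \<open>t\<close> corresponds to at mesh \<open>1/(n+1)\<close>. The excess
  \<open>sqrt (mesh n)\<close> tends to zero but exceeds the error of the Riemann sums, which is of the order of
  the mesh, so that the visit with this number happens after local time \<open>t\<close>. The shift by \<open>i\<close> keeps the
  marks of \<open>t\<^sub>0 \<le> t\<^sub>1 \<le> \<dots>\<close> distinct when some of these times coincide.
\<close>

definition mark :: "real \<Rightarrow> nat \<Rightarrow> nat \<Rightarrow> nat" where
  "mark t n i = nat \<lceil>(t + sqrt (mesh n)) / mesh n\<rceil> + i"

lemma mark_bounds:
  assumes "0 \<le> t"
  shows "t + sqrt (mesh n) \<le> real (mark t n i) * mesh n"
    and "real (mark t n i) * mesh n \<le> t + sqrt (mesh n) + (real i + 1) * mesh n"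
proof -
  let ?x = "(t + sqrt (mesh n)) / mesh n"
  have "0 \<le> ?x" using assms mesh_pos[of n] by simp
  then have m: "?x + real i \<le> real (mark t n i)" "real (mark t n i) \<le> ?x + 1 + real i"
    unfolding mark_def by linarith+
  have x: "?x * mesh n = t + sqrt (mesh n)" using mesh_pos[of n] by simp
  have "(?x + real i) * mesh n \<le> real (mark t n i) * mesh n"
    by (rule mult_right_mono[OF m(1)]) (use mesh_pos[of n] in simp)
  moreover have "0 \<le> real i * mesh n" using mesh_pos[of n] by simp
  ultimately show "t + sqrt (mesh n) \<le> real (mark t n i) * mesh n"
    using x by (simp add: distrib_right)
  have "real (mark t n i) * mesh n \<le> (?x + 1 + real i) * mesh n"
    by (rule mult_right_mono[OF m(2)]) (use mesh_pos[of n] in simp)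
  then show "real (mark t n i) * mesh n \<le> t + sqrt (mesh n) + (real i + 1) * mesh n"
    using x by (simp add: distrib_right)
qed

locale infinite_path =
  fixes p :: "real \<Rightarrow> 'a" and A :: "'a set"
  assumes step: "step_path {0..} p"
begin

abbreviation occ :: "real \<Rightarrow> real" where
  "occ \<equiv> occupation_time A p"

lemma obtain_jumps:
  obtains S where "jumps_within S 0 R p"
proof (cases "0 \<le> R")
  case True
  then show ?thesis
    using finitely_many_jumps[of 0 R p] step_path_subset[OF step, of "{0..R}"] that by auto
next
  case False
  then have "jumps_within {} 0 R p" by (auto simp: jumps_within_def)
  then show ?thesis by (rule that)
qed

lemma Icc_fmeasurable: "{a..b::real} \<in> fmeasurable lborel"
  by (rule fmeasurableI) (auto simp: emeasure_lborel_Icc_eq)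

lemma in_set_measurable: "{0..R} \<inter> {r. p r \<in> A} \<in> sets borel"
proof -
  obtain S where S: "jumps_within S 0 R p" by (rule obtain_jumps)
  have fin: "finite (S \<union> {0, R})" using S by (auto simp: jumps_within_def)
  define V where "V = ({0<..<R} - S) \<inter> {r. p r \<in> A}"
  have "open V"
    unfolding open_dist
  proof
    fix r assume r: "r \<in> V"
    have "open ({0<..<R} - S)"
      using S by (intro open_Diff finite_imp_closed) (auto simp: jumps_within_def)
    then obtain e where e: "e > 0" "ball r e \<subseteq> {0<..<R} - S"
      using r unfolding V_def by (meson IntD1 openE)
    have "s \<in> V" if "dist s r < e" for s
    proof -
      have int: "{min r s..max r s} \<subseteq> ball r e"
        using that by (auto simp: dist_real_def)
      have "p (max r s) = p (min r s)"
      proof (rule jumps_withinD[OF S])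
        have "min r s \<in> ball r e" "max r s \<in> ball r e"
          using that e(1) by (auto simp: min_def max_def dist_commute)
        then show "0 \<le> min r s" "max r s \<le> R" using e(2) by force+
        have "{min r s<..max r s} \<subseteq> ball r e" using int by fastforce
        then show "{min r s<..max r s} \<inter> S = {}" using e(2) by blast
      qed simp
      then have "p s = p r" by (auto simp: max_def min_def split: if_splits)
      moreover have "s \<in> ball r e" using that by (simp add: dist_commute)
      ultimately show ?thesis using r e(2) by (auto simp: V_def)
    qed
    then show "\<exists>e>0. \<forall>s. dist s r < e \<longrightarrow> s \<in> V" using e(1) by blast
  qed
  have "{0..R} \<inter> {r. p r \<in> A} = V \<union> ((S \<union> {0, R}) \<inter> ({0..R} \<inter> {r. p r \<in> A}))"
    by (auto simp: V_def)
  moreover have "\<dots> \<in> sets borel"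
    using \<open>open V\<close> finite_subset[OF _ fin] by (intro sets.Un) (auto intro!: borel_closed finite_imp_closed)
  ultimately show ?thesis by simp
qed

lemma in_set_measurable_Ioc: "0 \<le> a \<Longrightarrow> {a<..b} \<inter> {r. p r \<in> A} \<in> sets borel"
proof -
  assume "0 \<le> a"
  then have "{a<..b} \<inter> {r. p r \<in> A} = {a<..b} \<inter> ({0..b} \<inter> {r. p r \<in> A})" by auto
  also have "\<dots> \<in> sets borel" by (rule sets.Int[OF _ in_set_measurable]) simp
  finally show ?thesis .
qed

lemma occ_measure: "occ s = measure lborel ({0..s} \<inter> {r. p r \<in> A})"
proof -
  have "occ s = (\<integral>r. indicator ({0..s} \<inter> {r. p r \<in> A}) r \<partial>lborel)"
    unfolding occupation_time_def set_lebesgue_integral_def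
    by (intro Bochner_Integration.integral_cong) (auto simp: indicator_def)
  then show ?thesis by simp
qed

lemma occ_diff:
  assumes "0 \<le> a" "a \<le> b"
  shows "occ b - occ a = measure lborel ({a<..b} \<inter> {r. p r \<in> A})"
proof -
  have "{0..b} \<inter> {r. p r \<in> A} = ({0..a} \<inter> {r. p r \<in> A}) \<union> ({a<..b} \<inter> {r. p r \<in> A})"
    using assms by auto
  moreover have "measure lborel \<dots> = measure lborel ({0..a} \<inter> {r. p r \<in> A}) + measure lborel ({a<..b} \<inter> {r. p r \<in> A})"
  proof (rule measure_Union)
    have "{0..a} \<inter> {r. p r \<in> A} \<in> fmeasurable lborel"
      by (rule fmeasurableI2[OF Icc_fmeasurable[of 0 a]]) (auto simp: in_set_measurable)
    then show "emeasure lborel ({0..a} \<inter> {r. p r \<in> A}) \<noteq> \<infinity>"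
      by (auto simp: fmeasurable_def)
    have "{a<..b} \<inter> {r. p r \<in> A} \<in> fmeasurable lborel"
      by (rule fmeasurableI2[OF Icc_fmeasurable[of a b]]) (auto simp: in_set_measurable_Ioc assms)
    then show "emeasure lborel ({a<..b} \<inter> {r. p r \<in> A}) \<noteq> \<infinity>"
      by (auto simp: fmeasurable_def)
  qed (auto simp: in_set_measurable in_set_measurable_Ioc assms)
  ultimately show ?thesis by (simp add: occ_measure)
qed

lemma occ_0 [simp]: "occ 0 = 0"
proof -
  have "measure lborel ({0..0} \<inter> {r. p r \<in> A}) \<le> measure lborel {0..0::real}"
    by (rule measure_mono_fmeasurable[OF _ _ Icc_fmeasurable]) (use in_set_measurable[of 0] in auto)
  then show ?thesis by (simp add: occ_measure measure_le_0_iff)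
qed

lemma occ_mono: "0 \<le> a \<Longrightarrow> a \<le> b \<Longrightarrow> occ a \<le> occ b"
  using occ_diff[of a b] measure_nonneg[of lborel "{a<..b} \<inter> {r. p r \<in> A}"] by linarith

lemma occ_lipschitz:
  assumes "0 \<le> a" "a \<le> b"
  shows "occ b \<le> occ a + (b - a)"
proof -
  have "measure lborel ({a<..b} \<inter> {r. p r \<in> A}) \<le> measure lborel {a<..b}"
    by (rule measure_mono_fmeasurable) (auto simp: in_set_measurable_Ioc assms fmeasurable_def)
  then show ?thesis using occ_diff[OF assms] assms by simp
qed

lemma occ_constant:
  assumes "0 \<le> a" "a \<le> b" and const: "\<And>r. a \<le> r \<Longrightarrow> r < b \<Longrightarrow> p r = p a"
  shows "occ b = occ a + (if p a \<in> A then b - a else 0)"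
proof (cases "p a \<in> A")
  case True
  have sub: "{a<..<b} \<subseteq> {a<..b} \<inter> {r. p r \<in> A}"
  proof
    fix r assume "r \<in> {a<..<b}"
    then show "r \<in> {a<..b} \<inter> {r. p r \<in> A}" using const[of r] True by simp
  qed
  have "{a<..b} \<inter> {r. p r \<in> A} \<in> fmeasurable lborel"
    by (rule fmeasurableI2[OF Icc_fmeasurable[of a b]]) (auto simp: in_set_measurable_Ioc assms(1))
  then have "measure lborel {a<..<b} \<le> measure lborel ({a<..b} \<inter> {r. p r \<in> A})"
    by (intro measure_mono_fmeasurable sub) simp_all
  then show ?thesis
    using True occ_diff[OF assms(1,2)] occ_lipschitz[OF assms(1,2)] assms(2) by simp
next
  case False
  have "r = b" if "r \<in> {a<..b}" "p r \<in> A" for r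
  proof (rule ccontr)
    assume "r \<noteq> b"
    then have "p r = p a" using that by (intro const) simp_all
    then show False using that False by simp
  qed
  then have "{a<..b} \<inter> {r. p r \<in> A} \<subseteq> {b..b}" by auto
  then have "measure lborel ({a<..b} \<inter> {r. p r \<in> A}) \<le> measure lborel {b..b}"
    using in_set_measurable_Ioc[OF assms(1)] Icc_fmeasurable[of b b]
    by (intro measure_mono_fmeasurable) (simp_all only: sets_lborel)
  then show ?thesis
    using False occ_diff[OF assms(1,2)] by (simp add: measure_le_0_iff)
qed

lemma occ_strict:
  assumes "0 \<le> s" "p s \<in> A" "s < r"
  shows "occ s < occ r"
proof -
  have "s \<in> {0..}" using assms(1) by simp
  then obtain d where d: "d > 0" "\<And>u. u \<in> {0..} \<Longrightarrow> s \<le> u \<Longrightarrow> u < s + d \<Longrightarrow> p u = p s"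
    by (rule step_path_right[OF step]) blast
  define u where "u = min r (s + d)"
  have "s < u" "u \<le> r" using d(1) assms(3) by (simp_all add: u_def)
  have "occ u = occ s + (if p s \<in> A then u - s else 0)"
  proof (rule occ_constant[OF assms(1)])
    show "p v = p s" if "s \<le> v" "v < u" for v
      using that assms(1) by (intro d(2)) (simp_all add: u_def)
  qed (use \<open>s < u\<close> in simp)
  then have "occ u = occ s + (u - s)" using assms(2) by simp
  then show ?thesis using occ_mono[of u r] \<open>s < u\<close> \<open>u \<le> r\<close> assms(1) by linarith
qed

text \<open>Only the cells that contain a jump contribute to the error, each at most its length.\<close>

lemma riemann_sum_error:
  assumes S: "jumps_within S 0 R p" and h: "0 \<le> h" and k: "real k * h \<le> R"
  shows "\<bar>h * real (visits A (\<lambda>l. p (real l * h)) k) - occ (real k * h)\<bar> \<le> h * real (card S)"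
proof -
  let ?v = "visits A (\<lambda>l. p (real l * h))"
  have fin: "finite S" using S by (simp add: jumps_within_def)
  have "\<bar>h * real (?v k) - occ (real k * h)\<bar> \<le> h * real (card (S \<inter> {0<..real k * h}))"
    using k
  proof (induction k)
    case (Suc k)
    let ?a = "real k * h" and ?b = "real (Suc k) * h"
    have ab: "0 \<le> ?a" "?a \<le> ?b" "?b - ?a = h" using h by (auto simp: algebra_simps)
    have IH: "\<bar>h * real (?v k) - occ ?a\<bar> \<le> h * real (card (S \<inter> {0<..?a}))"
      using Suc ab by simp
    have inc: "0 \<le> occ ?b - occ ?a" "occ ?b - occ ?a \<le> h"
      using occ_mono[OF ab(1,2)] occ_lipschitz[OF ab(1,2)] ab(3) by linarith+
    have sub: "S \<inter> {0<..?a} \<subseteq> S \<inter> {0<..?b}" using ab by auto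
    have step: "h * real (?v (Suc k)) = h * real (?v k) + (if p ?a \<in> A then h else 0)"
      by (simp add: algebra_simps)
    show ?case
    proof (cases "S \<inter> {?a<..?b} = {}")
      case True
      have "occ ?b = occ ?a + (if p ?a \<in> A then ?b - ?a else 0)"
      proof (rule occ_constant[OF ab(1,2)])
        show "p r = p ?a" if "?a \<le> r" "r < ?b" for r
          by (rule jumps_withinD[OF S]) (use that True ab Suc.prems in auto)
      qed
      moreover have "card (S \<inter> {0<..?a}) \<le> card (S \<inter> {0<..?b})"
        using sub fin by (intro card_mono) auto
      then have "h * real (card (S \<inter> {0<..?a})) \<le> h * real (card (S \<inter> {0<..?b}))"
        using h by (intro mult_left_mono) auto
      ultimately show ?thesis using IH step ab(3) by (simp split: if_splits)
    next
      case False
      then obtain s where s: "s \<in> S" "?a < s" "s \<le> ?b" by auto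
      then have "s \<in> S \<inter> {0<..?b}" "s \<notin> S \<inter> {0<..?a}" using ab(1) by auto
      then have "S \<inter> {0<..?a} \<subset> S \<inter> {0<..?b}" using sub by blast
      then have "card (S \<inter> {0<..?a}) < card (S \<inter> {0<..?b})"
        using fin by (intro psubset_card_mono) auto
      then have "real (card (S \<inter> {0<..?a})) + 1 \<le> real (card (S \<inter> {0<..?b}))" by linarith
      then have "h * (real (card (S \<inter> {0<..?a})) + 1) \<le> h * real (card (S \<inter> {0<..?b}))"
        using h by (intro mult_left_mono) auto
      then show ?thesis using IH step inc h by (simp add: algebra_simps split: if_splits)
    qed
  qed auto
  also have "\<dots> \<le> h * real (card S)"
    using h fin by (intro mult_left_mono of_nat_mono card_mono) auto
  finally show ?thesis .
qed

end

locale recurrent_path = infinite_path +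
  assumes unbounded: "\<And>u. \<exists>s\<ge>0. u < occ s"
begin

abbreviation clock :: "real \<Rightarrow> real" where
  "clock \<equiv> time_change A p"

lemma clock_bdd: "bdd_above {s. 0 \<le> s \<and> occ s \<le> t}"
proof -
  obtain r where "0 \<le> r" "t < occ r" using unbounded by blast
  then have "s \<le> r" if "0 \<le> s" "occ s \<le> t" for s
    using occ_mono[of r s] that by linarith
  then show ?thesis by (auto intro!: bdd_aboveI[of _ r])
qed

lemma clock_upper: "0 \<le> s \<Longrightarrow> occ s \<le> t \<Longrightarrow> s \<le> clock t"
  unfolding time_change_def using clock_bdd by (intro cSup_upper) auto

lemma clock_nonneg: "0 \<le> t \<Longrightarrow> 0 \<le> clock t"
  by (rule clock_upper) auto

text \<open>The occupation time is continuous, so that the supremum which defines the clock is attained.\<close>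

lemma occ_clock:
  assumes "0 \<le> t"
  shows "occ (clock t) = t"
proof (rule antisym)
  show "occ (clock t) \<le> t"
  proof (rule field_le_epsilon)
    fix e :: real assume "0 < e"
    have "{s. 0 \<le> s \<and> occ s \<le> t} \<noteq> {}" using assms by (auto intro!: exI[of _ 0])
    then obtain s where s: "0 \<le> s" "occ s \<le> t" "clock t - e < s"
      using less_cSup_iff[OF _ clock_bdd, of t "clock t - e"] \<open>0 < e\<close>
      unfolding time_change_def by auto
    then have "occ (clock t) \<le> occ s + (clock t - s)"
      using clock_upper by (intro occ_lipschitz) auto
    then show "occ (clock t) \<le> t + e" using s by linarith
  qed
  show "t \<le> occ (clock t)"
  proof (rule ccontr)
    assume less: "\<not> t \<le> occ (clock t)"
    define r where "r = clock t + (t - occ (clock t))"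
    have "occ r \<le> t"
      using occ_lipschitz[of "clock t" r] less clock_nonneg[OF assms] by (simp add: r_def)
    then have "r \<le> clock t"
      using less clock_nonneg[OF assms] by (intro clock_upper) (auto simp: r_def)
    then show False using less by (simp add: r_def)
  qed
qed

lemma clock_less: "0 \<le> t \<Longrightarrow> 0 \<le> s \<Longrightarrow> t < occ s \<Longrightarrow> clock t < s"
  using occ_mono[of s "clock t"] occ_clock[of t] clock_nonneg by force

lemma clock_strict_mono: "0 \<le> t \<Longrightarrow> t < t' \<Longrightarrow> clock t < clock t'"
  using clock_less[of t "clock t'"] occ_clock[of t'] clock_nonneg[of t'] by simp

text \<open>
  If the path were outside \<open>A\<close> at the time \<open>clock t\<close>, it would stay outside for a while by
  right-continuity, the occupation time would not grow, and the supremum could be enlarged.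
\<close>

lemma clock_state:
  assumes "0 \<le> t"
  shows "p (clock t) \<in> A"
proof (rule ccontr)
  assume out: "p (clock t) \<notin> A"
  have "clock t \<in> {0..}" using clock_nonneg[OF assms] by simp
  then obtain d where d: "d > 0" "\<And>u. u \<in> {0..} \<Longrightarrow> clock t \<le> u \<Longrightarrow> u < clock t + d \<Longrightarrow> p u = p (clock t)"
    by (rule step_path_right[OF step]) blast
  have "occ (clock t + d) = occ (clock t) + (if p (clock t) \<in> A then clock t + d - clock t else 0)"
  proof (rule occ_constant[OF clock_nonneg[OF assms]])
    show "p r = p (clock t)" if "clock t \<le> r" "r < clock t + d" for r
      using that clock_nonneg[OF assms] by (intro d(2)) simp_all
  qed (use d(1) in simp)
  then have "occ (clock t + d) = occ (clock t)" using out by simp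
  then have "clock t + d \<le> clock t"
    using occ_clock[OF assms] clock_nonneg[OF assms] d(1) by (intro clock_upper) auto
  then show False using d(1) by simp
qed

lemma clock_occ:
  assumes "0 \<le> s" "p s \<in> A"
  shows "clock (occ s) = s"
proof (rule antisym)
  have "0 \<le> occ s" using occ_mono[of 0 s] assms(1) by simp
  then have "\<not> s < clock (occ s)"
    using occ_strict[OF assms, of "clock (occ s)"] occ_clock[of "occ s"] by auto
  then show "clock (occ s) \<le> s" by simp
qed (use assms clock_upper in auto)

lemma trace_at_visit: "0 \<le> s \<Longrightarrow> p s \<in> A \<Longrightarrow> trace_path A p (occ s) = p s"
  by (simp add: trace_path_def clock_occ)

text \<open>
  Inside \<open>A\<close> the clock moves at unit speed and the trace copies the path. At the jumps of the clock,
  which skip an excursion, right-continuity is inherited at the right end of the excursion and the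
  left limit at its left end.
\<close>

lemma trace_step_path: "step_path {0..} (trace_path A p)"
  unfolding step_path_def
proof (intro ballI conjI)
  fix t :: real assume "t \<in> {0..}"
  then have t: "0 \<le> t" by simp
  have "clock t \<in> {0..}" using clock_nonneg[OF t] by simp
  then obtain d where d: "d > 0" "\<And>u. u \<in> {0..} \<Longrightarrow> clock t \<le> u \<Longrightarrow> u < clock t + d \<Longrightarrow> p u = p (clock t)"
    by (rule step_path_right[OF step]) blast
  have gap: "t < occ (clock t + d)"
    using occ_strict[OF clock_nonneg[OF t] clock_state[OF t], of "clock t + d"] occ_clock[OF t] d(1) by simp
  show "\<exists>d>0. \<forall>s\<in>{0..}. t < s \<and> s < t + d \<longrightarrow> trace_path A p s = trace_path A p t"
  proof (intro exI[of _ "occ (clock t + d) - t"] conjI ballI impI)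
    fix s assume s: "s \<in> {0..}" "t < s \<and> s < t + (occ (clock t + d) - t)"
    have "clock s < clock t + d"
      using s clock_nonneg[OF t] d(1) by (intro clock_less) auto
    moreover have "clock t < clock s" using s t by (intro clock_strict_mono) auto
    ultimately show "trace_path A p s = trace_path A p t"
      unfolding trace_path_def using clock_nonneg[OF t] by (intro d(2)) auto
  qed (use gap in simp)
  show "\<exists>a. \<exists>d>0. \<forall>s\<in>{0..}. t - d < s \<and> s < t \<longrightarrow> trace_path A p s = a"
  proof (cases "t = 0")
    case True
    then show ?thesis by (intro exI[of _ undefined] exI[of _ 1]) auto
  next
    case False
    define C where "C = clock ` {0..<t}"
    have ne: "C \<noteq> {}" using t False by (auto simp: C_def)
    have bdd: "bdd_above C"
      by (intro bdd_aboveI[of _ "clock t"]) (auto simp: C_def intro!: less_imp_le[OF clock_strict_mono])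
    have "0 \<le> Sup C"
      using ne bdd clock_nonneg by (intro cSup_upper2[of "clock 0"]) (auto simp: C_def t False less_le)
    then have "Sup C \<in> {0..}" by simp
    then obtain a e where e: "e > 0" "\<And>s. s \<in> {0..} \<Longrightarrow> Sup C - e < s \<Longrightarrow> s < Sup C \<Longrightarrow> p s = a"
      by (rule step_path_left[OF step]) blast
    obtain c where "c \<in> C" "Sup C - e < c"
      using less_cSupE[OF _ ne, of "Sup C - e"] e(1) by auto
    then obtain r where r: "0 \<le> r" "r < t" "Sup C - e < clock r" by (auto simp: C_def)
    have "trace_path A p s = a" if "s \<in> {0..}" "t - (t - r) < s" "s < t" for s
    proof -
      have "clock r < clock s" using that r by (intro clock_strict_mono) auto
      moreover have "clock s < clock ((s + t) / 2)"
        using that by (intro clock_strict_mono) auto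
      moreover have "clock ((s + t) / 2) \<le> Sup C"
        using that by (intro cSup_upper bdd) (auto simp: C_def)
      ultimately show ?thesis
        unfolding trace_path_def using r that clock_nonneg by (intro e(2)) auto
    qed
    then show ?thesis using r by (intro exI[of _ a] exI[of _ "t - r"]) auto
  qed
qed

text \<open>
  The visit with number \<open>mark t n i\<close> to \<open>A\<close> on the grid takes place at a local time slightly larger than
  \<open>t\<close>, because the error of the Riemann sum is smaller than the excess of the mark. By
  right-continuity the trace has there the same value as at \<open>t\<close>.
\<close>

lemma eventually_trace_at_mark:
  assumes t: "0 \<le> t" "t < occ (real R)"
  shows "\<forall>\<^sub>F n in sequentially. mark t n i < visits A (\<lambda>l. p (real l * mesh n)) (R * Suc n) \<and>
     (\<forall>l<R * Suc n. p (real l * mesh n) \<in> A \<longrightarrow> visits A (\<lambda>l. p (real l * mesh n)) l = mark t n i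
        \<longrightarrow> p (real l * mesh n) = trace_path A p t)"
proof -
  obtain S where S: "jumps_within S 0 (real R) p" by (rule obtain_jumps)
  define J where "J = real (card S)"
  have "t \<in> {0..}" using t by simp
  then obtain d where d: "d > 0" "\<And>s. s \<in> {0..} \<Longrightarrow> t \<le> s \<Longrightarrow> s < t + d \<Longrightarrow> trace_path A p s = trace_path A p t"
    by (rule step_path_right[OF trace_step_path]) blast
  define e where "e = min d (occ (real R) - t)"
  have e: "e > 0" "e \<le> d" "e \<le> occ (real R) - t" using d t by (auto simp: e_def)
  have sq: "(\<lambda>n. sqrt (mesh n)) \<longlonglongrightarrow> 0"
    using tendsto_real_sqrt[OF mesh_tendsto] by simp
  have "(\<lambda>n. sqrt (mesh n) + (real i + 1 + J) * mesh n) \<longlonglongrightarrow> 0 + (real i + 1 + J) * 0"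
    by (intro tendsto_intros sq mesh_tendsto)
  then have ev1: "\<forall>\<^sub>F n in sequentially. sqrt (mesh n) + (real i + 1 + J) * mesh n < e"
    using e(1) by (intro order_tendstoD(2)) simp_all
  have "(\<lambda>n. J * sqrt (mesh n)) \<longlonglongrightarrow> J * 0"
    by (intro tendsto_intros sq)
  from order_tendstoD(2)[OF this, of 1]
  have ev2: "\<forall>\<^sub>F n in sequentially. J * sqrt (mesh n) < 1"
    by simp
  show ?thesis
    using ev1 ev2
  proof eventually_elim
    fix n assume n: "sqrt (mesh n) + (real i + 1 + J) * mesh n < e" "J * sqrt (mesh n) < 1"
    let ?h = "mesh n" and ?v = "visits A (\<lambda>l. p (real l * mesh n))"
    have h: "0 < ?h" by (rule mesh_pos)
    have "J * sqrt ?h * sqrt ?h < 1 * sqrt ?h"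
      by (rule mult_strict_right_mono[OF n(2)]) (use h in simp)
    then have slack: "J * ?h < sqrt ?h" using h by (simp add: mult.assoc)
    note m = mark_bounds[OF t(1), of n i]
    have err: "\<bar>?h * real (?v l) - occ (real l * ?h)\<bar> \<le> ?h * J" if "l \<le> R * Suc n" for l
    proof -
      have "real l * ?h \<le> real (R * Suc n) * ?h"
        using that h by (intro mult_right_mono) (simp_all only: of_nat_le_iff less_imp_le)
      then have "real l * ?h \<le> real R" by (simp only: mesh_steps)
      then show ?thesis unfolding J_def by (intro riemann_sum_error[OF S]) (use h in simp)
    qed
    have "?h * real (mark t n i) < ?h * real (?v (R * Suc n))"
    proof -
      have "\<bar>?h * real (?v (R * Suc n)) - occ (real R)\<bar> \<le> ?h * J"
        using err[of "R * Suc n"] by (simp only: mesh_steps order_refl)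
      then have "occ (real R) - ?h * J \<le> ?h * real (?v (R * Suc n))" by linarith
      moreover have "t + sqrt ?h + (real i + 1) * ?h < occ (real R) - ?h * J"
        using n(1) e(3) by (simp add: algebra_simps)
      ultimately show ?thesis using m(2) by (simp add: mult.commute)
    qed
    then have "mark t n i < ?v (R * Suc n)" using h by simp
    moreover have "p (real l * ?h) = trace_path A p t"
      if l: "l < R * Suc n" "p (real l * ?h) \<in> A" "?v l = mark t n i" for l
    proof -
      have l0: "0 \<le> real l * ?h" using h by simp
      have er: "\<bar>?h * real (mark t n i) - occ (real l * ?h)\<bar> \<le> ?h * J"
        using err[of l] l by (simp only: less_imp_le)
      have "t \<le> occ (real l * ?h)" using er m(1) slack by (simp add: mult.commute)
      moreover have "occ (real l * ?h) < t + d"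
        using er m(2) n(1) e(2) by (simp add: algebra_simps)
      ultimately have "trace_path A p (occ (real l * ?h)) = trace_path A p t"
        using t(1) by (intro d(2)) simp_all
      then show ?thesis using trace_at_visit[OF l0 l(2)] by simp
    qed
    ultimately show "mark t n i < ?v (R * Suc n) \<and>
     (\<forall>l<R * Suc n. p (real l * ?h) \<in> A \<longrightarrow> ?v l = mark t n i \<longrightarrow> p (real l * ?h) = trace_path A p t)"
      by blast
  qed
qed

end

section \<open>Harmonic extension and recurrence\<close>

text \<open>
  The function \<open>H l\<close> stands for the harmonic extension of the indicator of \<open>e l\<close>, so that the sum is \<open>L\<close>
  applied to the harmonic extension of \<open>f\<close>, evaluated at \<open>e i\<close>.
\<close>

definition trace_generator ::
    "(('a \<Rightarrow> real) \<Rightarrow> 'a \<Rightarrow> real) \<Rightarrow> (nat \<Rightarrow> 'a \<Rightarrow> real) \<Rightarrow> (nat \<Rightarrow> 'a) \<Rightarrow> nat \<Rightarrow> (nat \<Rightarrow> real) \<Rightarrow> nat \<Rightarrow> real" where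
  "trace_generator L H e M f i = (\<Sum>l\<in>{1..M}. L (H l) (e i) * f l)"

text \<open>
  The chain is observed on the first \<open>M\<close> of its \<open>K\<close> labelled states. The function \<open>u\<close> is a Foster
  function: its drift off the observed set forces the chain to return.
\<close>

locale trace_setting = finite_chain "e ` {1..K}" q L P X "e j"
  for e :: "nat \<Rightarrow> 'a::discrete_topology" and K q L P X j +
  fixes M :: nat and H :: "nat \<Rightarrow> 'a \<Rightarrow> real" and u :: "'a \<Rightarrow> real"
  assumes labels_inj: "inj_on e {1..K}"
    and j: "j \<in> {1..M}" and MK: "M \<le> K"
    and conservative: "\<And>z. z \<in> e ` {1..K} \<Longrightarrow> L (\<lambda>_. 1) z = 0"
    and boundary: "\<And>i l. i \<in> {1..M} \<Longrightarrow> l \<in> {1..M} \<Longrightarrow> H i (e l) = of_bool (i = l)"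
    and harmonic: "\<And>i z. i \<in> {1..M} \<Longrightarrow> z \<in> e ` {1..K} - e ` {1..M} \<Longrightarrow> L (H i) z = 0"
    and foster: "\<And>z. z \<in> e ` {1..K} - e ` {1..M} \<Longrightarrow> L u z \<le> - 1"
begin

abbreviation E where "E \<equiv> e ` {1..K}"
abbreviation A where "A \<equiv> e ` {1..M}"
abbreviation G where "G \<equiv> trace_generator L H e M"
abbreviation lab where "lab \<equiv> inv_into {1..K} e"
abbreviation Z :: "nat \<Rightarrow> 'b \<Rightarrow> nat \<Rightarrow> 'a" where
  "Z N \<omega> \<equiv> (\<lambda>l. X (real l * mesh N) \<omega>)"

lemma A_subset: "A \<subseteq> E"
  using MK by (intro image_mono) auto

lemma lab: assumes "z \<in> A" shows "lab z \<in> {1..M}" "e (lab z) = z"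
proof -
  obtain i where i: "i \<in> {1..M}" "z = e i" using assms by auto
  then have "lab z = i" using inv_into_f_f[OF labels_inj, of i] MK by auto
  then show "lab z \<in> {1..M}" "e (lab z) = z" using i by auto
qed

sublocale tr: finite_operator "{1..M}" "\<lambda>i l. L (H l) (e i)" G
  by unfold_locales (auto simp: trace_generator_def)

text \<open>The harmonic extension of a function of the labels.\<close>

definition ext :: "(nat \<Rightarrow> real) \<Rightarrow> 'a \<Rightarrow> real" where
  "ext f z = (\<Sum>l\<in>{1..M}. f l * H l z)"

lemma ext_boundary: "z \<in> A \<Longrightarrow> ext f z = f (lab z)"
proof -
  assume z: "z \<in> A"
  have "ext f z = (\<Sum>l\<in>{1..M}. f l * H l (e (lab z)))"
    using lab(2)[OF z] by (simp add: ext_def)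
  also have "\<dots> = (\<Sum>l\<in>{1..M}. if l = lab z then f l else 0)"
    using lab(1)[OF z] by (intro sum.cong refl) (simp add: boundary)
  also have "\<dots> = f (lab z)" using lab(1)[OF z] by simp
  finally show ?thesis .
qed

lemma apply_ext: "z \<in> E \<Longrightarrow> L (ext f) z = (\<Sum>l\<in>{1..M}. f l * L (H l) z)"
  using iterate_sum[where k = 1 and x = z and I = "{1..M}" and c = f and f = H] unfolding ext_def[abs_def] by simp

lemma apply_ext_outside: "z \<in> E - A \<Longrightarrow> L (ext f) z = 0"
  by (simp add: apply_ext harmonic)

lemma apply_ext_inside: "z \<in> A \<Longrightarrow> L (ext f) z = G f (lab z)"
  using A_subset lab(2) by (simp add: apply_ext subset_iff trace_generator_def mult.commute)

definition ext_bound :: real where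
  "ext_bound = (\<Sum>l\<in>{1..M}. \<Sum>z\<in>E. \<bar>H l z\<bar>)"

lemma ext_bound_nonneg: "0 \<le> ext_bound"
  by (simp add: ext_bound_def sum_nonneg)

lemma ext_bounded:
  assumes "z \<in> E" "\<And>l. l \<in> {1..M} \<Longrightarrow> \<bar>f l\<bar> \<le> B"
  shows "\<bar>ext f z\<bar> \<le> ext_bound * B"
proof -
  have "\<bar>ext f z\<bar> \<le> (\<Sum>l\<in>{1..M}. \<bar>f l * H l z\<bar>)" unfolding ext_def by (rule sum_abs)
  also have "\<dots> \<le> (\<Sum>l\<in>{1..M}. (\<Sum>z\<in>E. \<bar>H l z\<bar>) * B)"
  proof (rule sum_mono)
    fix l assume l: "l \<in> {1..M}"
    have "\<bar>H l z\<bar> \<le> (\<Sum>z\<in>E. \<bar>H l z\<bar>)"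
      using assms(1) by (intro member_le_sum[where f = "\<lambda>z. \<bar>H l z\<bar>"]) auto
    then show "\<bar>f l * H l z\<bar> \<le> (\<Sum>z\<in>E. \<bar>H l z\<bar>) * B"
      using assms(2)[OF l] by (simp add: abs_mult mult.commute mult_mono)
  qed
  finally show ?thesis by (simp add: ext_bound_def sum_distrib_right)
qed

definition step_error :: real where
  "step_error = exp bound * ext_bound * bound\<^sup>2 + exp tr.bound * tr.bound\<^sup>2"

lemma step_error_nonneg: "0 \<le> step_error"
  by (simp add: step_error_def ext_bound_nonneg)

lemma ext_step_outside:
  assumes "z \<in> E - A" "\<And>l. l \<in> {1..M} \<Longrightarrow> \<bar>f l\<bar> \<le> B" "0 \<le> h" "h \<le> 1"
  shows "\<bar>generator_semigroup L h (ext f) z - ext f z\<bar> \<le> h\<^sup>2 * (step_error * B)"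
proof -
  have z: "z \<in> E" using assms(1) by simp
  have B: "0 \<le> B" using assms(2)[OF j] by linarith
  have "\<bar>generator_semigroup L h (ext f) z - (ext f z + h * L (ext f) z)\<bar>
      \<le> h\<^sup>2 * (exp bound * (ext_bound * B) * bound\<^sup>2)"
    by (rule semigroup_second_order[OF z ext_bounded assms(3,4)]) (auto intro: assms(2))
  also have "\<dots> \<le> h\<^sup>2 * (step_error * B)"
    using B by (intro mult_left_mono) (auto simp: step_error_def algebra_simps)
  finally show ?thesis using apply_ext_outside[OF assms(1)] by simp
qed

text \<open>
  To first order in \<open>h\<close> both semigroups act as their generators, and \<open>L\<close> applied to the harmonic
  extension of \<open>f\<close> coincides on \<open>A\<close> with the trace generator applied to \<open>f\<close>.
\<close>

lemma ext_step_inside: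
  assumes "z \<in> A" "\<And>l. l \<in> {1..M} \<Longrightarrow> \<bar>f l\<bar> \<le> B" "0 \<le> h" "h \<le> 1"
  shows "\<bar>generator_semigroup L h (ext f) z - generator_semigroup G h f (lab z)\<bar> \<le> h\<^sup>2 * (step_error * B)"
proof -
  have z: "z \<in> E" using assms(1) A_subset by blast
  have "\<bar>generator_semigroup L h (ext f) z - (ext f z + h * L (ext f) z)\<bar>
      \<le> h\<^sup>2 * (exp bound * (ext_bound * B) * bound\<^sup>2)"
    by (rule semigroup_second_order[OF z ext_bounded assms(3,4)]) (auto intro: assms(2))
  moreover have "\<bar>generator_semigroup G h f (lab z) - (f (lab z) + h * G f (lab z))\<bar>
      \<le> h\<^sup>2 * (exp tr.bound * B * tr.bound\<^sup>2)"
    by (rule tr.semigroup_second_order[OF lab(1)[OF assms(1)] assms(2) assms(3,4)])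
  moreover have "ext f z + h * L (ext f) z = f (lab z) + h * G f (lab z)"
    by (simp add: ext_boundary[OF assms(1)] apply_ext_inside[OF assms(1)])
  ultimately show ?thesis by (simp add: step_error_def algebra_simps)
qed

lemma semigroup_const: "z \<in> E \<Longrightarrow> generator_semigroup L h (\<lambda>_. c) z = c"
proof -
  assume z: "z \<in> E"
  have it: "(L ^^ k) (\<lambda>_. 1) y = (if k = 0 then 1 else 0)" if "y \<in> E" for k y
    using that
  proof (induction k arbitrary: y)
    case (Suc k)
    have "L ((L ^^ k) (\<lambda>_. 1)) y = L (\<lambda>_. if k = 0 then 1 else 0) y"
      using Suc by (intro apply_cong) auto
    also have "\<dots> = 0"
      using Suc.prems conservative by (cases k) (auto simp: matrix_form)
    finally show ?case by simp
  qed auto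
  have "(\<lambda>k. h ^ k / fact k * (L ^^ k) (\<lambda>_. 1) z) = (\<lambda>k. if k = 0 then 1 else 0)"
    using it[OF z] by (auto simp: fun_eq_iff)
  moreover have "(\<lambda>k. if k = 0 then 1 else 0 :: real) sums 1"
    using sums_single[of 0 "\<lambda>_. 1"] by simp
  ultimately have "generator_semigroup L h (\<lambda>_. 1) z = 1"
    by (simp add: generator_semigroup_def sums_iff)
  then show ?thesis using semigroup_scale[OF z, of h c "\<lambda>_. 1"] by simp
qed

lemma skeleton_times: "0 \<le> real l * mesh N" "real 0 * mesh N = 0" "mono (\<lambda>l. real l * mesh N)"
  using mesh_pos[of N] by (auto simp: mono_def)

lemma skeleton_step: "real (Suc l) * mesh N - real l * mesh N = mesh N"
  by (simp add: algebra_simps)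

lemma Z_in: "\<omega> \<in> space P \<Longrightarrow> Z N \<omega> l \<in> E"
  using state_in skeleton_times(1) by blast

lemma skeleton_markov:
  assumes "adapted k v"
  shows "expectation (\<lambda>\<omega>. v (Z N \<omega>) (Z N \<omega> (Suc k)))
     = expectation (\<lambda>\<omega>. generator_semigroup L (mesh N) (v (Z N \<omega>)) (Z N \<omega> k))"
  using markov_property[where t = "\<lambda>l. real l * mesh N", OF skeleton_times(2,3) assms]
  by (simp only: skeleton_step)

lemma skeleton_integrable: "adapted k v \<Longrightarrow> integrable P (\<lambda>\<omega>. v (Z N \<omega>) :: real)"
  by (rule history_integrable[where t = "\<lambda>l. real l * mesh N", OF skeleton_times(1)])

lemma skeleton_pred: "adapted k Q \<Longrightarrow> {\<omega> \<in> space P. Q (Z N \<omega>)} \<in> sets P"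
  by (rule history_pred[where t = "\<lambda>l. real l * mesh N", OF skeleton_times(1)])

lemma adapted_semigroup:
  assumes "adapted k v"
  shows "adapted k (\<lambda>z. generator_semigroup L h (v z) (z k))"
proof (rule adaptedI)
  fix z z' :: "nat \<Rightarrow> 'a" assume zz: "\<And>i. i \<le> k \<Longrightarrow> z i = z' i"
  have "v z = v z'" by (rule adaptedD[OF assms]) (rule zz)
  then show "generator_semigroup L h (v z) (z k) = generator_semigroup L h (v z') (z' k)"
    by (simp add: zz)
qed

lemma paths_infinite: "\<omega> \<in> space P \<Longrightarrow> infinite_path (\<lambda>t. X t \<omega>)"
  by unfold_locales (use paths cadlag_on_iff_step_path in blast)

lemma visits_adapted: "l \<le> Suc n \<Longrightarrow> adapted n (\<lambda>z. f (visits A z l))"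
proof (rule adaptedI)
  fix z z' :: "nat \<Rightarrow> 'a" assume l: "l \<le> Suc n" and zz: "\<And>i. i \<le> n \<Longrightarrow> z i = z' i"
  have "visits A z l = visits A z' l"
    by (rule visits_cong) (use l zz in simp)
  then show "f (visits A z l) = f (visits A z' l)" by simp
qed

text \<open>
  A multiple of \<open>u\<close> added to a constant gives a function \<open>\<kappa> \<ge> 1\<close> for which the discounted process, \<open>exp\<close>
  of minus the time spent in \<open>A\<close> times \<open>\<kappa>\<close> of the state, loses at least a fixed multiple of the discount
  per unit of time: off \<open>A\<close> because of the drift of \<open>u\<close>, in \<open>A\<close> because of the discount. Since the process
  is nonnegative, the total loss is bounded, and the expected discount at time \<open>R\<close> is \<open>O(1/R)\<close>, up to
  the error of the discretisation.
\<close>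

lemma discount_bound:
  obtains C where "\<And>R. 0 < R \<Longrightarrow>
    \<forall>N. expectation (\<lambda>\<omega>. exp (- (mesh N * real (visits A (Z N \<omega>) (R * Suc N))))) \<le> C / real R + C * mesh N"
proof -
  obtain Bu where Bu: "0 \<le> Bu" "\<And>z. z \<in> E \<Longrightarrow> \<bar>u z\<bar> \<le> Bu" using obtain_sup_bound by blast
  \<comment> \<open>In \<open>A\<close> the function \<open>\<kappa>\<close> below then grows at a rate of at most \<open>1/4\<close>, which the discount outweighs.\<close>
  define \<eta> where "\<eta> = 1 / (4 * (1 + bound * Bu))"
  have bB: "0 \<le> bound * Bu" using bound_nonneg Bu(1) by simp
  then have \<eta>: "0 < \<eta>" "\<eta> \<le> 1/4" "\<eta> * (bound * Bu) \<le> 1/4"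
    by (auto simp: \<eta>_def field_simps)
  define \<kappa> where "\<kappa> z = 1 + \<eta> * (u z + Bu)" for z
  have \<kappa>: "1 \<le> \<kappa> z" "\<bar>\<kappa> z\<bar> \<le> 1 + Bu" if "z \<in> E" for z
  proof -
    have "0 \<le> u z + Bu" "u z + Bu \<le> 2 * Bu" using Bu(2)[OF that] by auto
    then have "0 \<le> \<eta> * (u z + Bu)" "\<eta> * (u z + Bu) \<le> 1/4 * (2 * Bu)"
      using mult_mono[OF \<eta>(2), of "u z + Bu" "2 * Bu"] \<eta>(1) by simp_all
    then show "1 \<le> \<kappa> z" "\<bar>\<kappa> z\<bar> \<le> 1 + Bu" using Bu(1) by (auto simp: \<kappa>_def)
  qed
  have L\<kappa>: "L \<kappa> z = \<eta> * L u z" if "z \<in> E" for z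
  proof -
    have "L \<kappa> z = (1 + \<eta> * Bu) * L (\<lambda>_. 1) z + \<eta> * L u z"
      using that unfolding \<kappa>_def[abs_def]
      by (simp add: matrix_form sum_distrib_left sum.distrib[symmetric] algebra_simps)
    then show ?thesis using conservative[OF that] by simp
  qed
  define C0 where "C0 = exp bound * (1 + Bu) * bound\<^sup>2"
  have C0: "0 \<le> C0" using Bu(1) by (simp add: C0_def)
  have pointwise: "exp (- (h * of_bool (z \<in> A))) * generator_semigroup L h \<kappa> z \<le> \<kappa> z - \<eta> * h + C0 * h\<^sup>2"
    if z: "z \<in> E" and h: "0 \<le> h" "h \<le> 1" for z h
  proof -
    have so: "\<bar>generator_semigroup L h \<kappa> z - (\<kappa> z + h * L \<kappa> z)\<bar> \<le> h\<^sup>2 * C0"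
      unfolding C0_def by (rule semigroup_second_order[OF z \<kappa>(2) h])
    show ?thesis
    proof (cases "z \<in> A")
      case True
      have "\<bar>L u z\<bar> \<le> bound * Bu"
        by (rule apply_bound[OF z]) (rule Bu(2))
      then have "\<eta> * L u z \<le> \<eta> * (bound * Bu)"
        using \<eta>(1) by (intro mult_left_mono) auto
      then have "h * L \<kappa> z \<le> h * (1/4)"
        using L\<kappa>[OF z] \<eta>(3) h by (intro mult_left_mono) auto
      then have g: "generator_semigroup L h \<kappa> z \<le> \<kappa> z + h / 4 + h\<^sup>2 * C0" using so by linarith
      have ex: "exp (- h) \<le> 1 - h / 2"
      proof -
        have "1 \<le> (1 + h) * (1 - h / 2)"
          using h mult_left_mono[OF h(2) h(1)] by (simp add: field_simps)
        also have "\<dots> \<le> exp h * (1 - h / 2)"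
          using h exp_ge_add_one_self[of h] by (intro mult_right_mono) auto
        finally show ?thesis by (simp add: exp_minus field_simps)
      qed
      have nonneg: "0 \<le> \<kappa> z + h / 4 + h\<^sup>2 * C0" using \<kappa>(1)[OF z] h C0 by simp
      have "exp (- h) * generator_semigroup L h \<kappa> z \<le> exp (- h) * (\<kappa> z + h / 4 + h\<^sup>2 * C0)"
        using g by (intro mult_left_mono) auto
      also have "\<dots> = exp (- h) * \<kappa> z + exp (- h) * (h / 4 + h\<^sup>2 * C0)"
        by (simp add: algebra_simps)
      also have "\<dots> \<le> (1 - h / 2) * \<kappa> z + 1 * (h / 4 + h\<^sup>2 * C0)"
        using ex \<kappa>(1)[OF z] h C0 by (intro add_mono mult_right_mono) auto
      also have "\<dots> \<le> \<kappa> z - h / 4 + h\<^sup>2 * C0"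
        using mult_left_mono[OF \<kappa>(1)[OF z], of "h/2"] h by (simp add: algebra_simps)
      also have "\<dots> \<le> \<kappa> z - \<eta> * h + C0 * h\<^sup>2"
        using mult_right_mono[OF \<eta>(2) h(1)] by (simp add: mult.commute)
      finally show ?thesis using True by simp
    next
      case False
      then have "\<eta> * L u z \<le> \<eta> * (- 1)"
        using foster[of z] z \<eta>(1) by (intro mult_left_mono) auto
      then have "h * L \<kappa> z \<le> h * (- \<eta>)"
        using L\<kappa>[OF z] h by (intro mult_left_mono) auto
      then show ?thesis using False so by (simp add: algebra_simps)
    qed
  qed
  define D where "D N z k = exp (- (mesh N * real (visits A z k)))" for N :: nat and z k
  have D: "0 \<le> D N z k" "D N z k \<le> 1" for N z k
    using mesh_pos[of N] by (auto simp: D_def)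
  have D_Suc: "D N z (Suc k) = D N z k * exp (- (mesh N * of_bool (z k \<in> A)))" for N z k
    by (simp add: D_def exp_add[symmetric] algebra_simps)
  have D_ad: "adapted n (\<lambda>z. D N z k)" if "k \<le> Suc n" for N k n
    unfolding D_def by (rule visits_adapted[OF that])
  have D_mono: "D N z n \<le> D N z k" if "k \<le> n" for N z k n
    using that
  proof (induction n rule: dec_induct)
    case (step n)
    have "D N z (Suc n) \<le> D N z n"
      unfolding D_Suc using D(1)[of N z n] mesh_pos[of N] by (intro mult_left_le) auto
    then show ?case using step by simp
  qed simp
  define \<Phi> where "\<Phi> N k = expectation (\<lambda>\<omega>. D N (Z N \<omega>) k * \<kappa> (Z N \<omega> k))" for N k
  have stepE: "\<Phi> N (Suc k) \<le> \<Phi> N k - \<eta> * mesh N * expectation (\<lambda>\<omega>. D N (Z N \<omega>) k) + C0 * (mesh N)\<^sup>2" for N k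
  proof -
    define v where "v = (\<lambda>z y. D N z (Suc k) * \<kappa> y)"
    have v: "adapted k v"
    proof (rule adaptedI)
      fix z z' :: "nat \<Rightarrow> 'a" assume "\<And>i. i \<le> k \<Longrightarrow> z i = z' i"
      then have "D N z (Suc k) = D N z' (Suc k)" by (rule adaptedD[OF D_ad[of "Suc k" k], OF order_refl])
      then show "v z = v z'" by (simp add: v_def)
    qed
    have "\<Phi> N (Suc k) = expectation (\<lambda>\<omega>. v (Z N \<omega>) (Z N \<omega> (Suc k)))"
      by (simp add: \<Phi>_def v_def)
    also have "\<dots> = expectation (\<lambda>\<omega>. generator_semigroup L (mesh N) (v (Z N \<omega>)) (Z N \<omega> k))"
      by (rule skeleton_markov[OF v])
    also have "\<dots> \<le> expectation (\<lambda>\<omega>. D N (Z N \<omega>) k * \<kappa> (Z N \<omega> k) - \<eta> * mesh N * D N (Z N \<omega>) k + C0 * (mesh N)\<^sup>2)"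
    proof (rule integral_mono)
      show "integrable P (\<lambda>\<omega>. generator_semigroup L (mesh N) (v (Z N \<omega>)) (Z N \<omega> k))"
        by (rule skeleton_integrable[OF adapted_semigroup[OF v]])
      have "adapted k (\<lambda>z. D N z k * \<kappa> (z k))"
      proof (rule adaptedI)
        fix z z' :: "nat \<Rightarrow> 'a" assume zz: "\<And>i. i \<le> k \<Longrightarrow> z i = z' i"
        have "D N z k = D N z' k"
          by (rule adaptedD[OF D_ad[of k k]]) (use zz in simp_all)
        then show "D N z k * \<kappa> (z k) = D N z' k * \<kappa> (z' k)" by (simp add: zz)
      qed
      then show "integrable P (\<lambda>\<omega>. D N (Z N \<omega>) k * \<kappa> (Z N \<omega> k) - \<eta> * mesh N * D N (Z N \<omega>) k + C0 * (mesh N)\<^sup>2)"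
        by (intro Bochner_Integration.integrable_add Bochner_Integration.integrable_diff
            integrable_mult_right integrable_const
            skeleton_integrable[where k = k] D_ad) auto
      fix \<omega> assume \<omega>: "\<omega> \<in> space P"
      let ?z = "Z N \<omega>"
      have zk: "?z k \<in> E" by (rule Z_in[OF \<omega>])
      have "generator_semigroup L (mesh N) (v ?z) (?z k)
          = D N ?z k * (exp (- (mesh N * of_bool (?z k \<in> A))) * generator_semigroup L (mesh N) \<kappa> (?z k))"
        unfolding v_def by (subst semigroup_scale[OF zk]) (simp only: D_Suc mult.assoc)
      also have "\<dots> \<le> D N ?z k * (\<kappa> (?z k) - \<eta> * mesh N + C0 * (mesh N)\<^sup>2)"
        by (intro mult_left_mono pointwise[OF zk] D mesh_le_1 less_imp_le[OF mesh_pos])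
      also have "\<dots> = D N ?z k * \<kappa> (?z k) - \<eta> * mesh N * D N ?z k + D N ?z k * (C0 * (mesh N)\<^sup>2)"
        by (simp add: algebra_simps)
      also have "\<dots> \<le> D N ?z k * \<kappa> (?z k) - \<eta> * mesh N * D N ?z k + 1 * (C0 * (mesh N)\<^sup>2)"
        using C0 D by (intro add_mono mult_right_mono) auto
      finally show "generator_semigroup L (mesh N) (v ?z) (?z k)
          \<le> D N ?z k * \<kappa> (?z k) - \<eta> * mesh N * D N ?z k + C0 * (mesh N)\<^sup>2" by simp
    qed
    also have "\<dots> = \<Phi> N k - \<eta> * mesh N * expectation (\<lambda>\<omega>. D N (Z N \<omega>) k) + C0 * (mesh N)\<^sup>2"
    proof -
      have "adapted k (\<lambda>z. D N z k * \<kappa> (z k))"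
      proof (rule adaptedI)
        fix z z' :: "nat \<Rightarrow> 'a" assume zz: "\<And>i. i \<le> k \<Longrightarrow> z i = z' i"
        have "D N z k = D N z' k"
          by (rule adaptedD[OF D_ad[of k k]]) (use zz in simp_all)
        then show "D N z k * \<kappa> (z k) = D N z' k * \<kappa> (z' k)" by (simp add: zz)
      qed
      from skeleton_integrable[OF this, of N] skeleton_integrable[OF D_ad[of k k], of N]
      show ?thesis by (simp add: \<Phi>_def prob_space)
    qed
    finally show ?thesis .
  qed
  have lower: "0 \<le> \<Phi> N k" for N k
    unfolding \<Phi>_def using D \<kappa>(1) Z_in by (intro integral_nonneg_AE AE_I2 mult_nonneg_nonneg) (auto intro: order_trans[of 0 1])
  have tele: "\<Phi> N n + real n * (\<eta> * mesh N * expectation (\<lambda>\<omega>. D N (Z N \<omega>) n)) \<le> \<Phi> N 0 + real n * (C0 * (mesh N)\<^sup>2)" for N n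
  proof -
    have "\<Phi> N k + real k * (\<eta> * mesh N * expectation (\<lambda>\<omega>. D N (Z N \<omega>) n)) \<le> \<Phi> N 0 + real k * (C0 * (mesh N)\<^sup>2)" if "k \<le> n" for k
      using that
    proof (induction k)
      case (Suc k)
      have "expectation (\<lambda>\<omega>. D N (Z N \<omega>) n) \<le> expectation (\<lambda>\<omega>. D N (Z N \<omega>) k)"
        using Suc.prems by (intro integral_mono skeleton_integrable[where k = n] D_ad D_mono) auto
      then have "\<eta> * mesh N * expectation (\<lambda>\<omega>. D N (Z N \<omega>) n) \<le> \<eta> * mesh N * expectation (\<lambda>\<omega>. D N (Z N \<omega>) k)"
        using \<eta>(1) mesh_pos[of N] by (intro mult_left_mono) auto
      then show ?case using stepE[of N k] Suc by (simp add: algebra_simps)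
    qed simp
    then show ?thesis by simp
  qed
  have \<Phi>0: "\<Phi> N 0 \<le> 1 + Bu" for N
  proof -
    have "\<Phi> N 0 \<le> expectation (\<lambda>\<omega>. 1 + Bu)"
      unfolding \<Phi>_def
    proof (rule integral_mono)
      show "integrable P (\<lambda>\<omega>. D N (Z N \<omega>) 0 * \<kappa> (Z N \<omega> 0))"
        by (rule skeleton_integrable[where k = 0]) (auto intro!: adaptedI simp: D_def)
    next
      fix \<omega> assume "\<omega> \<in> space P"
      from \<kappa>(2)[OF Z_in[OF this, where N = N and l = 0]]
      show "D N (Z N \<omega>) 0 * \<kappa> (Z N \<omega> 0) \<le> 1 + Bu" by (simp add: D_def)
    qed auto
    then show ?thesis by (simp add: prob_space)
  qed
  define C where "C = (1 + Bu + C0) / \<eta>"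
  have "expectation (\<lambda>\<omega>. D N (Z N \<omega>) (R * Suc N)) \<le> C / real R + C * mesh N" if R: "0 < R" for R N
  proof -
    let ?ED = "expectation (\<lambda>\<omega>. D N (Z N \<omega>) (R * Suc N))"
    have Rh: "real (R * Suc N) * mesh N = real R" by (rule mesh_steps)
    have "real (R * Suc N) * (\<eta> * mesh N * ?ED) \<le> 1 + Bu + real (R * Suc N) * (C0 * (mesh N)\<^sup>2)"
      using tele[of N "R * Suc N"] lower[of N "R * Suc N"] \<Phi>0[of N] by linarith
    moreover have "real (R * Suc N) * (\<eta> * mesh N * ?ED) = (real (R * Suc N) * mesh N) * \<eta> * ?ED"
      by (simp only: mult_ac)
    moreover have "real (R * Suc N) * (C0 * (mesh N)\<^sup>2) = (real (R * Suc N) * mesh N) * C0 * mesh N"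
      by (simp only: mult_ac power2_eq_square)
    ultimately have "real R * \<eta> * ?ED \<le> 1 + Bu + real R * C0 * mesh N" by (simp only: Rh)
    then have "?ED \<le> (1 + Bu + real R * C0 * mesh N) / (real R * \<eta>)"
      using R \<eta>(1) by (simp add: field_simps)
    also have "\<dots> = (1 + Bu) / \<eta> / real R + C0 / \<eta> * mesh N"
      using R \<eta>(1) by (simp add: field_simps)
    also have "\<dots> \<le> C / real R + C * mesh N"
    proof -
      have "(1 + Bu) / \<eta> \<le> C" "C0 / \<eta> \<le> C"
        unfolding C_def using \<eta>(1) C0 Bu(1) by (intro divide_right_mono; simp)+
      then show ?thesis
        using mesh_pos[of N] by (intro add_mono divide_right_mono mult_right_mono) simp_all
    qed
    finally show ?thesis .
  qed
  then show ?thesis using that[of C] by (simp add: D_def)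
qed

lemma visits_error:
  assumes "\<omega> \<in> space P"
  obtains J where "\<And>N. \<bar>mesh N * real (visits A (Z N \<omega>) (R * Suc N)) - occupation_time A (\<lambda>t. X t \<omega>) (real R)\<bar> \<le> mesh N * J"
proof -
  interpret infinite_path "\<lambda>t. X t \<omega>" A by (rule paths_infinite[OF assms])
  obtain S where S: "jumps_within S 0 (real R) (\<lambda>t. X t \<omega>)" by (rule obtain_jumps)
  have "\<bar>mesh N * real (visits A (Z N \<omega>) (R * Suc N)) - occ (real R)\<bar> \<le> mesh N * real (card S)" for N
  proof -
    have "\<bar>mesh N * real (visits A (Z N \<omega>) (R * Suc N)) - occ (real (R * Suc N) * mesh N)\<bar> \<le> mesh N * real (card S)"
      by (rule riemann_sum_error[OF S]) (use mesh_pos[of N] in \<open>auto simp only: mesh_steps less_imp_le\<close>)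
    then show ?thesis by (simp only: mesh_steps)
  qed
  then show ?thesis by (rule that)
qed

lemma visits_tendsto_occupation:
  assumes "\<omega> \<in> space P"
  shows "(\<lambda>N. mesh N * real (visits A (Z N \<omega>) (R * Suc N)))
    \<longlonglongrightarrow> occupation_time A (\<lambda>t. X t \<omega>) (real R)"
proof -
  obtain J where J: "\<And>N. \<bar>mesh N * real (visits A (Z N \<omega>) (R * Suc N)) - occupation_time A (\<lambda>t. X t \<omega>) (real R)\<bar> \<le> mesh N * J"
    by (rule visits_error[OF assms, of R]) blast
  have "(\<lambda>N. mesh N * J) \<longlonglongrightarrow> 0"
    using tendsto_mult_right[OF mesh_tendsto, of J] by simp
  then have "(\<lambda>N. mesh N * real (visits A (Z N \<omega>) (R * Suc N)) - occupation_time A (\<lambda>t. X t \<omega>) (real R)) \<longlonglongrightarrow> 0"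
    by (rule Lim_null_comparison[rotated]) (simp only: real_norm_def J eventually_True)
  then show ?thesis by (rule LIM_zero_cancel)
qed

lemma occupation_measurable: "(\<lambda>\<omega>. occupation_time A (\<lambda>t. X t \<omega>) (real R)) \<in> borel_measurable P"
proof (rule borel_measurable_LIMSEQ_real[OF visits_tendsto_occupation])
  show "(\<lambda>\<omega>. mesh N * real (visits A (Z N \<omega>) (R * Suc N))) \<in> borel_measurable P" for N
    by (rule borel_measurable_integrable[OF skeleton_integrable[where k = "R * Suc N"]])
       (rule visits_adapted, simp)
qed

text \<open>
  Markov's inequality for \<open>exp\<close> of minus the occupation time, whose expectation is the limit of the
  discounts along the skeleton.
\<close>

lemma occupation_small_prob:
  "(\<lambda>R. prob {\<omega> \<in> space P. occupation_time A (\<lambda>t. X t \<omega>) (real R) \<le> a}) \<longlonglongrightarrow> 0"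
proof -
  obtain C where C: "\<And>R. 0 < R \<Longrightarrow>
    \<forall>N. expectation (\<lambda>\<omega>. exp (- (mesh N * real (visits A (Z N \<omega>) (R * Suc N))))) \<le> C / real R + C * mesh N"
    using discount_bound by blast
  have occ0: "0 \<le> occupation_time A (\<lambda>t. X t \<omega>) (real R)" if "\<omega> \<in> space P" for \<omega> R
  proof -
    interpret infinite_path "\<lambda>t. X t \<omega>" A by (rule paths_infinite[OF that])
    have "occ 0 \<le> occ (real R)" by (rule occ_mono) simp_all
    then show ?thesis by (simp only: occ_0)
  qed
  have bound: "prob {\<omega> \<in> space P. occupation_time A (\<lambda>t. X t \<omega>) (real R) \<le> a} \<le> exp a * (C / real R)" if "0 < R" for R
  proof -
    let ?o = "\<lambda>\<omega>. occupation_time A (\<lambda>t. X t \<omega>) (real R)"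
    have int: "integrable P (\<lambda>\<omega>. exp (- ?o \<omega>))"
      by (rule integrable_const_bound[where B = 1])
         (use occ0 occupation_measurable[of R] in \<open>auto intro!: AE_I2\<close>)
    have "(\<lambda>N. expectation (\<lambda>\<omega>. exp (- (mesh N * real (visits A (Z N \<omega>) (R * Suc N))))))
        \<longlonglongrightarrow> expectation (\<lambda>\<omega>. exp (- ?o \<omega>))"
    proof (rule integral_dominated_convergence[where w = "\<lambda>_. 1"])
      show "AE \<omega> in P. (\<lambda>N. exp (- (mesh N * real (visits A (Z N \<omega>) (R * Suc N))))) \<longlonglongrightarrow> exp (- ?o \<omega>)"
        by (intro AE_I2 tendsto_exp tendsto_minus visits_tendsto_occupation)
      show "(\<lambda>\<omega>. exp (- (mesh N * real (visits A (Z N \<omega>) (R * Suc N))))) \<in> borel_measurable P" for N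
        by (rule borel_measurable_integrable[OF skeleton_integrable[where k = "R * Suc N"]])
           (rule visits_adapted, simp)
      have "0 \<le> mesh N * real (visits A (Z N \<omega>) (R * Suc N))" for N \<omega>
        using mesh_pos[of N] by simp
      then show "AE \<omega> in P. norm (exp (- (mesh N * real (visits A (Z N \<omega>) (R * Suc N))))) \<le> 1" for N
        by (intro AE_I2) simp
    qed (use int in simp_all)
    moreover have "(\<lambda>N. C / real R + C * mesh N) \<longlonglongrightarrow> C / real R + C * 0"
      by (intro tendsto_intros mesh_tendsto)
    ultimately have le: "expectation (\<lambda>\<omega>. exp (- ?o \<omega>)) \<le> C / real R + C * 0"
      by (rule LIMSEQ_le) (use C[OF that] in blast)
    have ev: "{\<omega> \<in> space P. ?o \<omega> \<le> a} \<in> sets P"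
      using occupation_measurable[of R] by measurable
    have "prob {\<omega> \<in> space P. ?o \<omega> \<le> a} = expectation (indicator {\<omega> \<in> space P. ?o \<omega> \<le> a})"
      using event_expectation[OF ev, of 1] by simp
    also have "\<dots> \<le> expectation (\<lambda>\<omega>. exp a * exp (- ?o \<omega>))"
    proof (rule integral_mono)
      show "integrable P (indicator {\<omega> \<in> space P. ?o \<omega> \<le> a} :: _ \<Rightarrow> real)"
        using event_integrable[OF ev, of 1] by simp
      show "integrable P (\<lambda>\<omega>. exp a * exp (- ?o \<omega>))" using int by simp
      show "indicator {\<omega> \<in> space P. ?o \<omega> \<le> a} \<omega> \<le> exp a * exp (- ?o \<omega>)" for \<omega>
        by (auto simp: indicator_def exp_add[symmetric])
    qed
    also have "\<dots> = exp a * expectation (\<lambda>\<omega>. exp (- ?o \<omega>))" by simp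
    also have "\<dots> \<le> exp a * (C / real R)" using le by (intro mult_left_mono) auto
    finally show ?thesis .
  qed
  have "(\<lambda>R. exp a * (C / real R)) \<longlonglongrightarrow> exp a * 0"
    by (intro tendsto_intros lim_const_over_n)
  then have "(\<lambda>R. exp a * (C / real R)) \<longlonglongrightarrow> 0" by simp
  moreover have "\<forall>\<^sub>F R in sequentially.
      norm (prob {\<omega> \<in> space P. occupation_time A (\<lambda>t. X t \<omega>) (real R) \<le> a}) \<le> exp a * (C / real R)"
    by (rule eventually_sequentiallyI[of 1]) (unfold real_norm_def abs_of_nonneg[OF measure_nonneg], rule bound, simp)
  ultimately show ?thesis by (rule Lim_null_comparison[rotated])
qed

definition recurrent :: "'b set" where
  "recurrent = {\<omega> \<in> space P. \<forall>a. \<exists>s\<ge>0. a < occupation_time A (\<lambda>t. X t \<omega>) s}"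

lemma recurrent_iff:
  assumes "\<omega> \<in> space P"
  shows "\<omega> \<in> recurrent \<longleftrightarrow> (\<forall>a::nat. \<exists>R::nat. real a < occupation_time A (\<lambda>t. X t \<omega>) (real R))"
proof -
  interpret infinite_path "\<lambda>t. X t \<omega>" A by (rule paths_infinite[OF assms])
  show ?thesis
  proof
    assume r: "\<omega> \<in> recurrent"
    show "\<forall>a::nat. \<exists>R::nat. real a < occ (real R)"
    proof
      fix a :: nat
      obtain s where "0 \<le> s" "real a < occ s" using r unfolding recurrent_def by blast
      moreover have "s \<le> real (nat \<lceil>s\<rceil>)" by linarith
      ultimately show "\<exists>R::nat. real a < occ (real R)"
        using occ_mono[of s "real (nat \<lceil>s\<rceil>)"] by (intro exI[of _ "nat \<lceil>s\<rceil>"]) linarith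
    qed
  next
    assume r: "\<forall>a::nat. \<exists>R::nat. real a < occ (real R)"
    show "\<omega> \<in> recurrent"
      unfolding recurrent_def
    proof (intro CollectI conjI assms allI)
      fix a :: real
      obtain R :: nat where "real (nat \<lceil>a\<rceil>) < occ (real R)" using r by blast
      moreover have "a \<le> real (nat \<lceil>a\<rceil>)" by linarith
      ultimately show "\<exists>s\<ge>0. a < occ s" by (intro exI[of _ "real R"]) auto
    qed
  qed
qed

lemma recurrent_event: "recurrent \<in> sets P"
proof -
  have "recurrent = {\<omega> \<in> space P. \<forall>a::nat. \<exists>R::nat. real a < occupation_time A (\<lambda>t. X t \<omega>) (real R)}"
    using recurrent_iff by (auto simp: recurrent_def)
  moreover have "{\<omega> \<in> space P. \<forall>a::nat. \<exists>R::nat. real a < occupation_time A (\<lambda>t. X t \<omega>) (real R)} \<in> sets P"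
    using occupation_measurable by measurable
  ultimately show ?thesis by simp
qed

text \<open>
  If the occupation time never exceeds some integer, the path lies in the events of the previous
  estimate for all \<open>R\<close>, whose probabilities tend to zero.
\<close>

lemma recurrent_almost_surely: "AE \<omega> in P. \<omega> \<in> recurrent"
proof -
  have "AE \<omega> in P. \<exists>R::nat. real a < occupation_time A (\<lambda>t. X t \<omega>) (real R)" for a :: nat
  proof -
    define B where "B = {\<omega> \<in> space P. \<forall>R::nat. occupation_time A (\<lambda>t. X t \<omega>) (real R) \<le> real a}"
    have ev: "B \<in> sets P" unfolding B_def using occupation_measurable by measurable
    have evR: "{\<omega> \<in> space P. occupation_time A (\<lambda>t. X t \<omega>) (real R) \<le> real a} \<in> sets P" for R
      using occupation_measurable[of R] by measurable
    have "prob B \<le> prob {\<omega> \<in> space P. occupation_time A (\<lambda>t. X t \<omega>) (real R) \<le> real a}" for R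
      by (rule finite_measure_mono[OF _ evR]) (auto simp: B_def)
    then have "prob B \<le> 0"
      by (intro LIMSEQ_le_const[OF occupation_small_prob[of "real a"]]) blast
    then have "prob B = 0" by (simp add: measure_le_0_iff)
    then have "B \<in> null_sets P" using ev by (simp add: null_sets_def emeasure_eq_measure)
    then show ?thesis by (rule AE_I') (auto simp: B_def not_less)
  qed
  then have "AE \<omega> in P. \<forall>a::nat. \<exists>R::nat. real a < occupation_time A (\<lambda>t. X t \<omega>) (real R)"
    by (simp add: AE_all_countable)
  then show ?thesis
    by (rule AE_mp) (use recurrent_iff in \<open>auto intro!: AE_I2\<close>)
qed

end

section \<open>Payoffs along the skeleton\<close>

context trace_setting
begin

text \<open>
  The indicator that every visit to \<open>A\<close> before step \<open>k\<close>, when it is the visit with number \<open>c\<close>, finds a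
  label allowed by the condition \<open>Q c\<close>.
\<close>

definition weight :: "(nat \<Rightarrow> nat \<Rightarrow> bool) \<Rightarrow> (nat \<Rightarrow> 'a) \<Rightarrow> nat \<Rightarrow> real" where
  "weight Q z k = of_bool (\<forall>l<k. z l \<in> A \<longrightarrow> Q (visits A z l) (lab (z l)))"

lemma weight_Suc:
  "weight Q z (Suc k) = weight Q z k * (if z k \<in> A then of_bool (Q (visits A z k) (lab (z k))) else 1)"
  by (auto simp: weight_def less_Suc_eq)

lemma weight_bounds: "0 \<le> weight Q z k" "weight Q z k \<le> 1"
  by (auto simp: weight_def)

lemma weight_cong: "(\<And>i. i < k \<Longrightarrow> z i = z' i) \<Longrightarrow> weight Q z k = weight Q z' k"
proof (induction k)
  case (Suc k)
  have "visits A z k = visits A z' k" by (rule visits_cong) (use Suc.prems in simp)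
  then show ?case using Suc by (simp add: weight_Suc)
qed (simp add: weight_def)

text \<open>
  The conditional expectation, up to discretisation, of the indicator that all visits up to number \<open>m\<close>
  satisfy their conditions, given the first \<open>k\<close> steps and the current state \<open>y\<close>. Between two visits it
  is the harmonic extension of a function \<open>\<psi>\<close> of the label, indexed by the number of visits made so
  far.
\<close>

definition payoff :: "(nat \<Rightarrow> nat \<Rightarrow> bool) \<Rightarrow> (nat \<Rightarrow> nat \<Rightarrow> real) \<Rightarrow> nat \<Rightarrow> (nat \<Rightarrow> 'a) \<Rightarrow> nat \<Rightarrow> 'a \<Rightarrow> real" where
  "payoff Q \<psi> m z k y = weight Q z k * (if m < visits A z k then 1 else ext (\<psi> (visits A z k)) y)"

lemma payoff_cong: "(\<And>i. i < k \<Longrightarrow> z i = z' i) \<Longrightarrow> payoff Q \<psi> m z k = payoff Q \<psi> m z' k"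
proof -
  assume zz: "\<And>i. i < k \<Longrightarrow> z i = z' i"
  have "visits A z k = visits A z' k" "weight Q z k = weight Q z' k"
    by (rule visits_cong, rule zz, assumption) (rule weight_cong, rule zz, assumption)
  then show ?thesis by (simp add: payoff_def fun_eq_iff)
qed

lemma payoff_bound:
  assumes "y \<in> E" and \<psi>: "\<And>c i. c \<le> m \<Longrightarrow> i \<in> {1..M} \<Longrightarrow> \<bar>\<psi> c i\<bar> \<le> B"
  shows "\<bar>payoff Q \<psi> m z k y\<bar> \<le> 1 + ext_bound * B"
proof -
  have B: "0 \<le> ext_bound * B" using \<psi>[of 0, OF _ j] ext_bound_nonneg by force
  have "\<bar>if m < visits A z k then 1 else ext (\<psi> (visits A z k)) y\<bar> \<le> 1 + ext_bound * B"
  proof (cases "m < visits A z k")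
    case False
    have "\<bar>ext (\<psi> (visits A z k)) y\<bar> \<le> ext_bound * B"
      by (rule ext_bounded[OF assms(1)], rule \<psi>) (use False in simp_all)
    then show ?thesis using False by simp
  qed (use B in simp)
  then have "weight Q z k * \<bar>if m < visits A z k then 1 else ext (\<psi> (visits A z k)) y\<bar> \<le> 1 * (1 + ext_bound * B)"
    using weight_bounds[of Q z k] by (intro mult_mono) auto
  then show ?thesis by (simp add: payoff_def abs_mult weight_bounds)
qed

lemma payoff_adapted: "adapted k (\<lambda>z. payoff Q \<psi> m z k (z k))"
proof (rule adaptedI)
  fix z z' :: "nat \<Rightarrow> 'a" assume zz: "\<And>i. i \<le> k \<Longrightarrow> z i = z' i"
  have "payoff Q \<psi> m z k = payoff Q \<psi> m z' k" by (rule payoff_cong) (simp add: zz)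
  then show "payoff Q \<psi> m z k (z k) = payoff Q \<psi> m z' k (z' k)" by (simp add: zz)
qed

text \<open>
  Off \<open>A\<close> the number of visits does not change and the harmonic extension has no drift. In \<open>A\<close> the
  number of visits grows by one, and the backward recursion for \<open>\<psi>\<close> makes the value before the step
  equal to the value after it, averaged with the semigroup of the trace generator in place of the
  semigroup of the chain. Both replacements cost \<open>O(h\<^sup>2)\<close>.
\<close>

lemma payoff_drift:
  assumes \<psi>: "\<And>c i. c \<le> m \<Longrightarrow> i \<in> {1..M} \<Longrightarrow> \<bar>\<psi> c i\<bar> \<le> B"
    and late: "\<And>c i. m < c \<Longrightarrow> Q c i"
    and final: "\<And>i. i \<in> {1..M} \<Longrightarrow> \<psi> m i = of_bool (Q m i)"
    and backward: "\<And>c i. c < m \<Longrightarrow> i \<in> {1..M} \<Longrightarrow>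
       \<psi> c i = of_bool (Q c i) * generator_semigroup G (mesh N) (\<psi> (Suc c)) i"
  shows "\<bar>expectation (\<lambda>\<omega>. payoff Q \<psi> m (Z N \<omega>) (Suc k) (Z N \<omega> (Suc k)))
      - expectation (\<lambda>\<omega>. payoff Q \<psi> m (Z N \<omega>) k (Z N \<omega> k))\<bar> \<le> (mesh N)\<^sup>2 * (step_error * B)"
proof -
  let ?h = "mesh N"
  have h: "0 \<le> ?h" "?h \<le> 1" using mesh_pos[of N] mesh_le_1 by auto
  have B: "0 \<le> B" using \<psi>[of 0, OF _ j] by force
  define v where "v = (\<lambda>z. payoff Q \<psi> m z (Suc k))"
  have v: "adapted k v"
    unfolding v_def by (rule adaptedI, rule payoff_cong) simp
  have pointwise: "\<bar>generator_semigroup L ?h (v z) (z k) - payoff Q \<psi> m z k (z k)\<bar> \<le> ?h\<^sup>2 * (step_error * B)"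
    if zk: "z k \<in> E" for z
  proof -
    define c where "c = visits A z k"
    define W where "W = weight Q z k"
    have W: "\<bar>W\<bar> \<le> 1" using weight_bounds[of Q z k] by (simp add: W_def)
    have err: "0 \<le> ?h\<^sup>2 * (step_error * B)" using B step_error_nonneg by simp
    have scaled: "\<bar>W * a\<bar> \<le> ?h\<^sup>2 * (step_error * B)" if "\<bar>a\<bar> \<le> ?h\<^sup>2 * (step_error * B)" for a
    proof -
      have "\<bar>W * a\<bar> \<le> 1 * \<bar>a\<bar>" unfolding abs_mult using W by (intro mult_right_mono) auto
      then show ?thesis using that by simp
    qed
    have pk: "payoff Q \<psi> m z k (z k) = W * (if m < c then 1 else ext (\<psi> c) (z k))"
      by (simp add: payoff_def W_def c_def)
    show ?thesis
    proof (cases "z k \<in> A")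
      case False
      have vz: "v z = (\<lambda>y. W * (if m < c then 1 else ext (\<psi> c) y))"
        using False by (simp add: v_def payoff_def weight_Suc W_def c_def fun_eq_iff)
      show ?thesis
      proof (cases "m < c")
        case True
        then show ?thesis using err by (simp add: vz pk semigroup_const[OF zk])
      next
        case F2: False
        have eq: "generator_semigroup L ?h (v z) (z k) - payoff Q \<psi> m z k (z k)
            = W * (generator_semigroup L ?h (ext (\<psi> c)) (z k) - ext (\<psi> c) (z k))"
          using F2 by (simp add: vz pk semigroup_scale[OF zk] right_diff_distrib)
        show ?thesis
          unfolding eq using False F2 zk by (intro scaled ext_step_outside h \<psi>) auto
      qed
    next
      case True
      have labk: "lab (z k) \<in> {1..M}" by (rule lab(1)[OF True])
      define b :: real where "b = of_bool (Q c (lab (z k)))"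
      have vz: "v z = (\<lambda>y. W * b * (if m < Suc c then 1 else ext (\<psi> (Suc c)) y))"
        using True by (simp add: v_def payoff_def weight_Suc W_def c_def b_def fun_eq_iff)
      consider "m < c" | "c = m" | "c < m" by linarith
      then show ?thesis
      proof cases
        case 1
        then have "b = 1" using late by (simp add: b_def)
        then show ?thesis using 1 err by (simp add: vz pk semigroup_const[OF zk])
      next
        case 2
        then have "ext (\<psi> c) (z k) = b"
          using final[OF labk] by (simp add: ext_boundary[OF True] b_def)
        then show ?thesis using 2 err by (simp add: vz pk semigroup_const[OF zk])
      next
        case 3
        have "ext (\<psi> c) (z k) = b * generator_semigroup G ?h (\<psi> (Suc c)) (lab (z k))"
          using backward[OF 3 labk] by (simp add: ext_boundary[OF True] b_def)
        then have eq: "generator_semigroup L ?h (v z) (z k) - payoff Q \<psi> m z k (z k)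
            = W * (b * (generator_semigroup L ?h (ext (\<psi> (Suc c))) (z k)
                 - generator_semigroup G ?h (\<psi> (Suc c)) (lab (z k))))"
          using 3 by (simp add: vz pk semigroup_scale[OF zk] right_diff_distrib mult.assoc)
        show ?thesis
          unfolding eq
        proof (rule scaled)
          have "\<bar>generator_semigroup L ?h (ext (\<psi> (Suc c))) (z k)
                 - generator_semigroup G ?h (\<psi> (Suc c)) (lab (z k))\<bar> \<le> ?h\<^sup>2 * (step_error * B)"
            using 3 by (intro ext_step_inside True h \<psi>) auto
          then show "\<bar>b * (generator_semigroup L ?h (ext (\<psi> (Suc c))) (z k)
                 - generator_semigroup G ?h (\<psi> (Suc c)) (lab (z k)))\<bar> \<le> ?h\<^sup>2 * (step_error * B)"
            using err by (simp add: b_def)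
        qed
      qed
    qed
  qed
  have int1: "integrable P (\<lambda>\<omega>. generator_semigroup L ?h (v (Z N \<omega>)) (Z N \<omega> k))"
    by (rule skeleton_integrable[OF adapted_semigroup[OF v]])
  have int2: "integrable P (\<lambda>\<omega>. payoff Q \<psi> m (Z N \<omega>) k (Z N \<omega> k))"
    by (rule skeleton_integrable[OF payoff_adapted])
  have "expectation (\<lambda>\<omega>. payoff Q \<psi> m (Z N \<omega>) (Suc k) (Z N \<omega> (Suc k)))
      = expectation (\<lambda>\<omega>. generator_semigroup L ?h (v (Z N \<omega>)) (Z N \<omega> k))"
    using skeleton_markov[OF v, of N] by (simp add: v_def)
  then have eq: "expectation (\<lambda>\<omega>. payoff Q \<psi> m (Z N \<omega>) (Suc k) (Z N \<omega> (Suc k)))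
      - expectation (\<lambda>\<omega>. payoff Q \<psi> m (Z N \<omega>) k (Z N \<omega> k))
      = expectation (\<lambda>\<omega>. generator_semigroup L ?h (v (Z N \<omega>)) (Z N \<omega> k) - payoff Q \<psi> m (Z N \<omega>) k (Z N \<omega> k))"
    using int1 int2 by simp
  have "\<bar>expectation (\<lambda>\<omega>. generator_semigroup L ?h (v (Z N \<omega>)) (Z N \<omega> k) - payoff Q \<psi> m (Z N \<omega>) k (Z N \<omega> k))\<bar>
     \<le> expectation (\<lambda>\<omega>. \<bar>generator_semigroup L ?h (v (Z N \<omega>)) (Z N \<omega> k) - payoff Q \<psi> m (Z N \<omega>) k (Z N \<omega> k)\<bar>)"
    by (rule integral_abs_bound)
  also have "\<dots> \<le> expectation (\<lambda>\<omega>. ?h\<^sup>2 * (step_error * B))"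
  proof (rule integral_mono)
    show "integrable P (\<lambda>\<omega>. \<bar>generator_semigroup L ?h (v (Z N \<omega>)) (Z N \<omega> k) - payoff Q \<psi> m (Z N \<omega>) k (Z N \<omega> k)\<bar>)"
      by (intro integrable_abs Bochner_Integration.integrable_diff int1 int2)
    show "\<bar>generator_semigroup L ?h (v (Z N \<omega>)) (Z N \<omega> k) - payoff Q \<psi> m (Z N \<omega>) k (Z N \<omega> k)\<bar> \<le> ?h\<^sup>2 * (step_error * B)"
      if "\<omega> \<in> space P" for \<omega>
      by (rule pointwise[OF Z_in[OF that]])
  qed simp
  finally show ?thesis unfolding eq by (simp add: prob_space)
qed

lemma start_state: "AE \<omega> in P. X 0 \<omega> = e j"
proof -
  have "prob {\<omega> \<in> space P. \<forall>i\<le>0. X (real i * mesh 0) \<omega> = e j} = 1"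
    by (subst history_prob[where t = "\<lambda>l. real l * mesh 0", OF skeleton_times(2,3)]) (use start in simp_all)
  then have "prob {\<omega> \<in> space P. X 0 \<omega> = e j} = 1" by simp
  from AE_prob_1[OF this] show ?thesis by (rule AE_mp) (auto intro!: AE_I2)
qed

lemma expected_payoff:
  assumes \<psi>: "\<And>c i. c \<le> m \<Longrightarrow> i \<in> {1..M} \<Longrightarrow> \<bar>\<psi> c i\<bar> \<le> B"
    and late: "\<And>c i. m < c \<Longrightarrow> Q c i"
    and final: "\<And>i. i \<in> {1..M} \<Longrightarrow> \<psi> m i = of_bool (Q m i)"
    and backward: "\<And>c i. c < m \<Longrightarrow> i \<in> {1..M} \<Longrightarrow>
       \<psi> c i = of_bool (Q c i) * generator_semigroup G (mesh N) (\<psi> (Suc c)) i"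
  shows "\<bar>expectation (\<lambda>\<omega>. payoff Q \<psi> m (Z N \<omega>) k (Z N \<omega> k)) - \<psi> 0 j\<bar>
     \<le> real k * ((mesh N)\<^sup>2 * (step_error * B))"
proof (induction k)
  case 0
  have "e j \<in> A" using j by simp
  have labj: "lab (e j) = j" using inv_into_f_f[OF labels_inj, of j] j MK by auto
  have "expectation (\<lambda>\<omega>. payoff Q \<psi> m (Z N \<omega>) 0 (Z N \<omega> 0)) = expectation (\<lambda>\<omega>. \<psi> 0 j)"
  proof (rule integral_cong_AE)
    show "(\<lambda>\<omega>. payoff Q \<psi> m (Z N \<omega>) 0 (Z N \<omega> 0)) \<in> borel_measurable P"
      by (rule borel_measurable_integrable[OF skeleton_integrable[OF payoff_adapted]])
    show "AE \<omega> in P. payoff Q \<psi> m (Z N \<omega>) 0 (Z N \<omega> 0) = \<psi> 0 j"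
      using start_state
    proof (rule AE_mp, intro AE_I2 impI)
      fix \<omega> assume "X 0 \<omega> = e j"
      then show "payoff Q \<psi> m (Z N \<omega>) 0 (Z N \<omega> 0) = \<psi> 0 j"
        using ext_boundary[OF \<open>e j \<in> A\<close>, of "\<psi> 0"] labj by (simp add: payoff_def weight_def)
    qed
  qed simp
  then show ?case by (simp add: prob_space)
next
  case (Suc k)
  then show ?case using payoff_drift[OF \<psi> late final backward, of k] by (simp add: algebra_simps)
qed

end

section \<open>The law of the trace\<close>

lemma mark_strict_mono: "mono t \<Longrightarrow> strict_mono (\<lambda>i. mark (t i) N i)"
proof (rule strict_mono_Suc_iff[THEN iffD2], rule allI)
  fix i assume "mono t"
  then have "t i \<le> t (Suc i)" by (simp add: mono_def)
  then have "(t i + sqrt (mesh N)) / mesh N \<le> (t (Suc i) + sqrt (mesh N)) / mesh N"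
    using mesh_pos[of N] by (intro divide_right_mono) auto
  then have "nat \<lceil>(t i + sqrt (mesh N)) / mesh N\<rceil> \<le> nat \<lceil>(t (Suc i) + sqrt (mesh N)) / mesh N\<rceil>"
    by (intro nat_mono ceiling_mono)
  then show "mark (t i) N i < mark (t (Suc i)) N (Suc i)" unfolding mark_def by linarith
qed

lemma mark_tendsto:
  assumes "0 \<le> t"
  shows "(\<lambda>N. mesh N * real (mark t N i)) \<longlonglongrightarrow> t"
proof (rule tendsto_sandwich)
  have sq: "(\<lambda>n. sqrt (mesh n)) \<longlonglongrightarrow> 0"
    using tendsto_real_sqrt[OF mesh_tendsto] by simp
  have "(\<lambda>N. t + sqrt (mesh N)) \<longlonglongrightarrow> t + 0" by (intro tendsto_intros sq)
  then show "(\<lambda>N. t + sqrt (mesh N)) \<longlonglongrightarrow> t" by simp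
  have "(\<lambda>N. t + sqrt (mesh N) + (real i + 1) * mesh N) \<longlonglongrightarrow> t + 0 + (real i + 1) * 0"
    by (intro tendsto_intros sq mesh_tendsto)
  then show "(\<lambda>N. t + sqrt (mesh N) + (real i + 1) * mesh N) \<longlonglongrightarrow> t" by simp
qed (use mark_bounds[OF assms] in \<open>simp_all add: mult.commute\<close>)

context finite_operator
begin

definition next_mark :: "(nat \<Rightarrow> nat) \<Rightarrow> nat \<Rightarrow> nat" where
  "next_mark \<mu> c = (LEAST i. c \<le> \<mu> i)"

text \<open>
  The explicit solution of the backward recursion when the conditions are to be in the state \<open>y i\<close> at
  the visit with number \<open>\<mu> i\<close>: the probability that a chain with one step of length \<open>h\<close> per visit, now
  in the state \<open>a\<close> at visit \<open>c\<close>, meets all the remaining conditions.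
\<close>

definition marked_value :: "(nat \<Rightarrow> nat) \<Rightarrow> (nat \<Rightarrow> 'a) \<Rightarrow> nat \<Rightarrow> real \<Rightarrow> nat \<Rightarrow> 'a \<Rightarrow> real" where
  "marked_value \<mu> y n h c a =
     generator_semigroup L (h * real (\<mu> (next_mark \<mu> c) - c)) (indicator {y (next_mark \<mu> c)}) a *
     (\<Prod>l\<in>{next_mark \<mu> c..<n}. generator_semigroup L (h * real (\<mu> (Suc l) - \<mu> l)) (indicator {y (Suc l)}) (y l))"

lemma next_mark_eq:
  assumes "strict_mono \<mu>" "c \<le> \<mu> i" "\<And>l. l < i \<Longrightarrow> \<mu> l < c"
  shows "next_mark \<mu> c = i"
  unfolding next_mark_def
  by (rule Least_equality) (use assms in \<open>auto simp: not_le intro: leI dest: leD\<close>)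

lemma next_mark_props:
  assumes "c \<le> \<mu> i"
  shows "c \<le> \<mu> (next_mark \<mu> c)" "l < next_mark \<mu> c \<Longrightarrow> \<mu> l < c" "next_mark \<mu> c \<le> i"
  unfolding next_mark_def
  using LeastI[of "\<lambda>i. c \<le> \<mu> i", OF assms] not_less_Least[of l "\<lambda>i. c \<le> \<mu> i"]
    Least_le[of "\<lambda>i. c \<le> \<mu> i", OF assms] by auto

lemma marked_value_final:
  assumes "strict_mono \<mu>"
  shows "marked_value \<mu> y n h (\<mu> n) a = of_bool (\<forall>i\<le>n. \<mu> i = \<mu> n \<longrightarrow> a = y i)"
proof -
  have "next_mark \<mu> (\<mu> n) = n"
    by (rule next_mark_eq) (use assms in \<open>auto simp: strict_mono_less\<close>)
  moreover have "(\<forall>i\<le>n. \<mu> i = \<mu> n \<longrightarrow> a = y i) \<longleftrightarrow> a = y n"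
    using strict_mono_eq[OF assms] by auto
  ultimately show ?thesis by (simp add: marked_value_def indicator_def)
qed

text \<open>
  If \<open>c\<close> is not a mark, this is the semigroup property. If it is one, the condition at this mark is
  checked and the next factor of the product is opened.
\<close>

lemma marked_value_step:
  assumes \<mu>: "strict_mono \<mu>" and c: "c < \<mu> n" and a: "a \<in> E" and h: "0 \<le> h"
  shows "marked_value \<mu> y n h c a
    = of_bool (\<forall>i\<le>n. \<mu> i = c \<longrightarrow> a = y i) * generator_semigroup L h (marked_value \<mu> y n h (Suc c)) a"
proof -
  define I where "I = next_mark \<mu> c"
  note I = next_mark_props[where \<mu> = \<mu> and i = n, OF less_imp_le[OF c], folded I_def]
  show ?thesis
  proof (cases "c = \<mu> I")
    case False
    then have cI: "Suc c \<le> \<mu> I" using I(1) by simp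
    have I': "next_mark \<mu> (Suc c) = I"
      by (rule next_mark_eq[OF \<mu> cI]) (use I(2) in force)
    have none: "\<mu> i \<noteq> c" for i
    proof (cases "i < I")
      case True then show ?thesis using I(2)[OF True] by simp
    next
      case F: False
      then have "\<mu> I \<le> \<mu> i" using \<mu> by (simp add: strict_mono_less_eq)
      then show ?thesis using cI by simp
    qed
    define p where "p = (\<Prod>l\<in>{I..<n}. generator_semigroup L (h * real (\<mu> (Suc l) - \<mu> l)) (indicator {y (Suc l)}) (y l))"
    have "marked_value \<mu> y n h (Suc c) = (\<lambda>b. p * generator_semigroup L (h * real (\<mu> I - Suc c)) (indicator {y I}) b)"
      by (simp add: marked_value_def I' p_def mult.commute fun_eq_iff)
    then have "generator_semigroup L h (marked_value \<mu> y n h (Suc c)) a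
        = p * generator_semigroup L h (generator_semigroup L (h * real (\<mu> I - Suc c)) (indicator {y I})) a"
      by (simp add: semigroup_scale[OF a])
    also have "\<dots> = p * generator_semigroup L (h + h * real (\<mu> I - Suc c)) (indicator {y I}) a"
      by (simp add: semigroup_add[OF a])
    also have "h + h * real (\<mu> I - Suc c) = h * real (\<mu> I - c)"
      using cI by (simp add: of_nat_diff algebra_simps)
    finally have eq: "generator_semigroup L h (marked_value \<mu> y n h (Suc c)) a
        = p * generator_semigroup L (h * real (\<mu> I - c)) (indicator {y I}) a" .
    show ?thesis
      unfolding eq using none by (simp add: marked_value_def I_def[symmetric] p_def mult.commute)
  next
    case True
    have "I < n"
    proof (rule ccontr)
      assume "\<not> I < n"
      then have "I = n" using I(3) by simp
      then show False using True c by simp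
    qed
    have uniq: "(\<forall>i\<le>n. \<mu> i = c \<longrightarrow> a = y i) \<longleftrightarrow> a = y I"
      using True strict_mono_eq[OF \<mu>] \<open>I < n\<close> by auto
    have I': "next_mark \<mu> (Suc c) = Suc I"
      by (rule next_mark_eq[OF \<mu>])
        (use True strict_mono_less[OF \<mu>, of I "Suc I"] strict_mono_less_eq[OF \<mu>] in \<open>auto simp: less_Suc_eq_le\<close>)
    define p where "p = (\<Prod>l\<in>{Suc I..<n}. generator_semigroup L (h * real (\<mu> (Suc l) - \<mu> l)) (indicator {y (Suc l)}) (y l))"
    have p: "(\<Prod>l\<in>{I..<n}. generator_semigroup L (h * real (\<mu> (Suc l) - \<mu> l)) (indicator {y (Suc l)}) (y l))
        = generator_semigroup L (h * real (\<mu> (Suc I) - \<mu> I)) (indicator {y (Suc I)}) (y I) * p"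
      unfolding p_def using \<open>I < n\<close> by (rule prod.atLeast_Suc_lessThan)
    have gt: "Suc c \<le> \<mu> (Suc I)" using True strict_mono_less[OF \<mu>, of I "Suc I"] by simp
    have "marked_value \<mu> y n h (Suc c) = (\<lambda>b. p * generator_semigroup L (h * real (\<mu> (Suc I) - Suc c)) (indicator {y (Suc I)}) b)"
      by (simp add: marked_value_def I' p_def mult.commute fun_eq_iff)
    then have "generator_semigroup L h (marked_value \<mu> y n h (Suc c)) a
        = p * generator_semigroup L h (generator_semigroup L (h * real (\<mu> (Suc I) - Suc c)) (indicator {y (Suc I)})) a"
      by (simp add: semigroup_scale[OF a])
    also have "\<dots> = p * generator_semigroup L (h + h * real (\<mu> (Suc I) - Suc c)) (indicator {y (Suc I)}) a"
      by (simp add: semigroup_add[OF a])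
    also have "h + h * real (\<mu> (Suc I) - Suc c) = h * real (\<mu> (Suc I) - \<mu> I)"
      using gt True by (simp add: of_nat_diff algebra_simps)
    finally have eq: "generator_semigroup L h (marked_value \<mu> y n h (Suc c)) a
        = p * generator_semigroup L (h * real (\<mu> (Suc I) - \<mu> I)) (indicator {y (Suc I)}) a" .
    show ?thesis
      unfolding eq uniq marked_value_def I_def[symmetric] p
      using True by (cases "a = y I") simp_all
  qed
qed

lemma marked_value_0:
  "marked_value \<mu> y n h 0 a = generator_semigroup L (h * real (\<mu> 0)) (indicator {y 0}) a *
     (\<Prod>l<n. generator_semigroup L (h * real (\<mu> (Suc l) - \<mu> l)) (indicator {y (Suc l)}) (y l))"
proof -
  have "next_mark \<mu> 0 = 0" unfolding next_mark_def by (rule Least_eq_0) simp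
  then show ?thesis by (simp add: marked_value_def atLeast0LessThan)
qed

lemma marked_value_bound:
  assumes \<mu>: "strict_mono \<mu>" and c: "c \<le> \<mu> n" and a: "a \<in> E" "range y \<subseteq> E" and h: "0 \<le> h" "h * real (\<mu> n) \<le> \<tau>"
  shows "\<bar>marked_value \<mu> y n h c a\<bar> \<le> exp (\<tau> * bound) ^ Suc n"
proof -
  define I where "I = next_mark \<mu> c"
  note I = next_mark_props[where \<mu> = \<mu> and i = n, OF c, folded I_def]
  have ge1: "1 \<le> exp (\<tau> * bound)"
    using order_trans[OF _ h(2), of 0] h bound_nonneg by simp
  have factor: "\<bar>generator_semigroup L (h * real k) (indicator {x}) b\<bar> \<le> exp (\<tau> * bound)" if "k \<le> \<mu> n" "b \<in> E" for k x b
  proof -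
    have "\<bar>generator_semigroup L (h * real k) (indicator {x}) b\<bar> \<le> exp (\<bar>h * real k\<bar> * bound) * 1"
      by (rule semigroup_bound[OF that(2)]) (simp add: indicator_def)
    also have "\<bar>h * real k\<bar> \<le> \<tau>"
      using mult_left_mono[of "real k" "real (\<mu> n)" h] that h by simp
    then have "exp (\<bar>h * real k\<bar> * bound) * 1 \<le> exp (\<tau> * bound)"
      using bound_nonneg by (simp add: mult_right_mono)
    finally show ?thesis .
  qed
  have y: "y l \<in> E" for l using a(2) by blast
  have "\<mu> (Suc l) - \<mu> l \<le> \<mu> n" if "l < n" for l
    using strict_mono_less_eq[OF \<mu>, of "Suc l" n] that by simp
  then have "(\<Prod>l\<in>{I..<n}. \<bar>generator_semigroup L (h * real (\<mu> (Suc l) - \<mu> l)) (indicator {y (Suc l)}) (y l)\<bar>)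
      \<le> (\<Prod>l\<in>{I..<n}. exp (\<tau> * bound))"
    by (intro prod_mono conjI abs_ge_zero factor y) auto
  also have "\<dots> \<le> exp (\<tau> * bound) ^ n"
    using ge1 by (simp add: power_increasing)
  finally have 1: "(\<Prod>l\<in>{I..<n}. \<bar>generator_semigroup L (h * real (\<mu> (Suc l) - \<mu> l)) (indicator {y (Suc l)}) (y l)\<bar>)
      \<le> exp (\<tau> * bound) ^ n" .
  have "\<mu> I - c \<le> \<mu> n" using strict_mono_less_eq[OF \<mu>, of I n] I(3) by simp
  then have 2: "\<bar>generator_semigroup L (h * real (\<mu> I - c)) (indicator {y I}) a\<bar> \<le> exp (\<tau> * bound)"
    by (rule factor[OF _ a(1)])
  have "\<bar>marked_value \<mu> y n h c a\<bar> \<le> exp (\<tau> * bound) * exp (\<tau> * bound) ^ n"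
    unfolding marked_value_def I_def[symmetric] abs_mult abs_prod
    by (rule mult_mono[OF 2 1]) (auto intro: prod_nonneg)
  then show ?thesis by simp
qed

end

context trace_setting
begin

abbreviation Y :: "real \<Rightarrow> 'b \<Rightarrow> nat" where
  "Y t \<omega> \<equiv> labelled_trace K e M (\<lambda>s. X s \<omega>) t"

lemma recurrent_path: "\<omega> \<in> recurrent \<Longrightarrow> recurrent_path (\<lambda>t. X t \<omega>) A"
proof -
  assume r: "\<omega> \<in> recurrent"
  interpret infinite_path "\<lambda>t. X t \<omega>" A
    by (rule paths_infinite) (use r in \<open>simp add: recurrent_def\<close>)
  show ?thesis by unfold_locales (use r in \<open>simp add: recurrent_def\<close>)
qed

lemma Y_recurrent:
  assumes "\<omega> \<in> recurrent" "0 \<le> t"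
  shows "Y t \<omega> = lab (trace_path A (\<lambda>s. X s \<omega>) t)" and "trace_path A (\<lambda>s. X s \<omega>) t \<in> A"
proof -
  interpret recurrent_path "\<lambda>t. X t \<omega>" A by (rule recurrent_path[OF assms(1)])
  show "trace_path A (\<lambda>s. X s \<omega>) t \<in> A"
    unfolding trace_path_def by (rule clock_state[OF assms(2)])
  show "Y t \<omega> = lab (trace_path A (\<lambda>s. X s \<omega>) t)"
    using assms(1) by (simp add: labelled_trace_def recurrent_def)
qed

lemma Y_not_recurrent: "\<omega> \<in> space P \<Longrightarrow> \<omega> \<notin> recurrent \<Longrightarrow> Y t \<omega> = 1"
  unfolding labelled_trace_def recurrent_def by (rule if_not_P) blast

lemma Y_in: "\<omega> \<in> space P \<Longrightarrow> 0 \<le> t \<Longrightarrow> Y t \<omega> \<in> {1..M}"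
proof (cases "\<omega> \<in> recurrent")
  case True
  assume "0 \<le> t"
  then show ?thesis using Y_recurrent[OF True] lab(1) by simp
next
  case False
  assume "\<omega> \<in> space P"
  then show ?thesis using Y_not_recurrent[OF _ False] j by simp
qed

lemma Y_step_path: "\<omega> \<in> space P \<Longrightarrow> step_path {0..} (\<lambda>t. Y t \<omega>)"
proof (cases "\<omega> \<in> recurrent")
  case True
  interpret recurrent_path "\<lambda>t. X t \<omega>" A by (rule recurrent_path[OF True])
  let ?tr = "trace_path A (\<lambda>s. X s \<omega>)"
  show ?thesis
    unfolding step_path_def
  proof (intro ballI conjI)
    fix t :: real assume t: "t \<in> {0..}"
    obtain d where d: "d > 0" "\<And>s. s \<in> {0..} \<Longrightarrow> t \<le> s \<Longrightarrow> s < t + d \<Longrightarrow> ?tr s = ?tr t"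
      by (rule step_path_right[OF trace_step_path t]) blast
    show "\<exists>d>0. \<forall>s\<in>{0..}. t < s \<and> s < t + d \<longrightarrow> Y s \<omega> = Y t \<omega>"
    proof (intro exI[of _ d] conjI d(1) ballI impI)
      fix s assume s: "s \<in> {0..}" "t < s \<and> s < t + d"
      have "?tr s = ?tr t" by (rule d(2)) (use s in simp_all)
      then show "Y s \<omega> = Y t \<omega>" using Y_recurrent(1)[OF True] s t by simp
    qed
    obtain a d where d: "d > 0" "\<And>s. s \<in> {0..} \<Longrightarrow> t - d < s \<Longrightarrow> s < t \<Longrightarrow> ?tr s = a"
      by (rule step_path_left[OF trace_step_path t]) blast
    show "\<exists>a. \<exists>d>0. \<forall>s\<in>{0..}. t - d < s \<and> s < t \<longrightarrow> Y s \<omega> = a"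
    proof (intro exI[of _ "lab a"] exI[of _ d] conjI d(1) ballI impI)
      fix s assume s: "s \<in> {0..}" "t - d < s \<and> s < t"
      have "?tr s = a" by (rule d(2)) (use s in simp_all)
      then show "Y s \<omega> = lab a" using Y_recurrent(1)[OF True] s by simp
    qed
  qed
next
  case False
  assume "\<omega> \<in> space P"
  then have "(\<lambda>t. Y t \<omega>) = (\<lambda>t. 1)" using Y_not_recurrent[OF _ False] by auto
  then show ?thesis by (auto simp: step_path_def intro!: exI[of _ 1])
qed

text \<open>
  An event seen on the skeleton up to time \<open>R\<close>, which for fine meshes decides whether the trace at
  time \<open>t\<close> is \<open>a\<close>.
\<close>

definition observed :: "real \<Rightarrow> nat \<Rightarrow> nat \<Rightarrow> nat \<Rightarrow> (nat \<Rightarrow> 'a) \<Rightarrow> bool" where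
  "observed t a R N z \<longleftrightarrow> (\<exists>l<R * Suc N. z l \<in> A \<and> visits A z l = mark t N 0 \<and> lab (z l) = a)"

lemma observed_adapted: "adapted (R * Suc N) (observed t a R N)"
proof (rule adaptedI)
  fix z z' :: "nat \<Rightarrow> 'a" assume zz: "\<And>i. i \<le> R * Suc N \<Longrightarrow> z i = z' i"
  have "visits A z l = visits A z' l" if "l < R * Suc N" for l
    by (rule visits_cong) (use that zz in simp)
  then show "observed t a R N z = observed t a R N z'"
    unfolding observed_def using zz by (metis less_imp_le)
qed

text \<open>
  On the event of recurrence, the value of the trace is eventually the label of the visit whose
  number is the mark of \<open>t\<close>, an event that depends on finitely many states only.
\<close>

lemma Y_measurable:
  assumes t: "0 \<le> t"
  shows "Y t \<in> P \<rightarrow>\<^sub>M count_space {1..M}"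
proof -
  have ev: "{\<omega> \<in> space P. observed t a R N (Z N \<omega>)} \<in> sets P" for a R N
    by (rule skeleton_pred[OF observed_adapted])
  have char: "Y t \<omega> = a \<longleftrightarrow> (\<exists>R::nat. t < occupation_time A (\<lambda>s. X s \<omega>) (real R) \<and>
      (\<exists>N0. \<forall>N\<ge>N0. observed t a R N (Z N \<omega>)))" if \<omega>: "\<omega> \<in> recurrent" for \<omega> a
  proof -
    interpret recurrent_path "\<lambda>t. X t \<omega>" A by (rule recurrent_path[OF \<omega>])
    have space: "\<omega> \<in> space P" using \<omega> by (simp add: recurrent_def)
    have *: "\<forall>\<^sub>F N in sequentially. observed t a R N (Z N \<omega>) \<longleftrightarrow> Y t \<omega> = a"
      if "t < occ (real R)" for R
      using eventually_trace_at_mark[OF t that, of 0]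
    proof eventually_elim
      case (elim N)
      obtain l where l: "l < R * Suc N" "Z N \<omega> l \<in> A" "visits A (Z N \<omega>) l = mark t N 0"
        using visits_attained[OF elim[THEN conjunct1]] by blast
      show ?case
        unfolding observed_def Y_recurrent(1)[OF \<omega> t] using elim l by metis
    qed
    show ?thesis
    proof
      assume Y: "Y t \<omega> = a"
      obtain R :: nat where "real (nat \<lceil>t\<rceil>) < occ (real R)"
        using recurrent_iff[OF space] \<omega> by blast
      then have R: "t < occ (real R)" by linarith
      have "\<forall>\<^sub>F N in sequentially. observed t a R N (Z N \<omega>)"
        using *[OF R] Y by simp
      then show "\<exists>R::nat. t < occ (real R) \<and> (\<exists>N0. \<forall>N\<ge>N0. observed t a R N (Z N \<omega>))"
        using R unfolding eventually_sequentially by blast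
    next
      assume "\<exists>R::nat. t < occ (real R) \<and> (\<exists>N0. \<forall>N\<ge>N0. observed t a R N (Z N \<omega>))"
      then obtain R :: nat where R: "t < occ (real R)" "\<forall>\<^sub>F N in sequentially. observed t a R N (Z N \<omega>)"
        unfolding eventually_sequentially by blast
      from eventually_conj[OF R(2) *[OF R(1)]] have "\<exists>N. observed t a R N (Z N \<omega>) \<and> (observed t a R N (Z N \<omega>) \<longleftrightarrow> Y t \<omega> = a)"
        by (rule eventually_happens'[OF sequentially_bot])
      then show "Y t \<omega> = a" by blast
    qed
  qed
  have "Y t -` {a} \<inter> space P \<in> sets P" for a
  proof -
    define C where "C = {\<omega> \<in> space P. \<exists>R::nat. t < occupation_time A (\<lambda>s. X s \<omega>) (real R) \<and>
      (\<exists>N0. \<forall>N\<ge>N0. observed t a R N (Z N \<omega>))}"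
    have "C \<in> sets P"
      unfolding C_def using occupation_measurable ev by measurable
    then have "recurrent \<inter> C \<union> (if a = 1 then space P - recurrent else {}) \<in> sets P"
      using recurrent_event by auto
    also have "recurrent \<inter> C \<union> (if a = 1 then space P - recurrent else {}) = Y t -` {a} \<inter> space P"
    proof (rule set_eqI)
      fix \<omega>
      show "\<omega> \<in> recurrent \<inter> C \<union> (if a = 1 then space P - recurrent else {}) \<longleftrightarrow> \<omega> \<in> Y t -` {a} \<inter> space P"
      proof (cases "\<omega> \<in> recurrent")
        case True
        then have sp: "\<omega> \<in> space P" by (simp add: recurrent_def)
        have "\<omega> \<in> C \<longleftrightarrow> Y t \<omega> = a"
          unfolding C_def char[OF True] using sp by blast
        then show ?thesis using True sp by (simp split: if_splits)
      next
        case False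
        then show ?thesis
          using Y_not_recurrent[OF _ False, of t] by (cases "\<omega> \<in> space P") (auto simp del: One_nat_def)
      qed
    qed
    finally show ?thesis .
  qed
  then show ?thesis
    using Y_in[OF _ t] by (subst measurable_count_space_eq2) auto
qed

text \<open>
  Once all the marks have been passed, only the weight is left, and the visits with these numbers
  show the trace at the times \<open>t i\<close>.
\<close>

lemma payoff_tendsto:
  fixes y :: "nat \<Rightarrow> nat"
  assumes \<omega>: "\<omega> \<in> recurrent" and t: "\<And>i. 0 \<le> t i" "mono t" and R: "t n < occupation_time A (\<lambda>s. X s \<omega>) (real R)"
  defines "Q N c a \<equiv> \<forall>i\<le>n. mark (t i) N i = c \<longrightarrow> a = y i"
  shows "\<forall>\<^sub>F N in sequentially. payoff (Q N) (\<psi> N) (mark (t n) N n) (Z N \<omega>) (R * Suc N) (Z N \<omega> (R * Suc N))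
     = of_bool (\<forall>i\<le>n. Y (t i) \<omega> = y i)"
proof -
  interpret recurrent_path "\<lambda>t. X t \<omega>" A by (rule recurrent_path[OF \<omega>])
  let ?tr = "trace_path A (\<lambda>s. X s \<omega>)"
  have "\<forall>\<^sub>F N in sequentially. \<forall>i\<in>{..n}. mark (t i) N i < visits A (Z N \<omega>) (R * Suc N) \<and>
     (\<forall>l<R * Suc N. Z N \<omega> l \<in> A \<longrightarrow> visits A (Z N \<omega>) l = mark (t i) N i \<longrightarrow> Z N \<omega> l = ?tr (t i))"
  proof (intro eventually_ball_finite ballI eventually_trace_at_mark t(1))
    fix i assume "i \<in> {..n}"
    then have "t i \<le> t n" using t(2) by (simp add: mono_def)
    then show "t i < occ (real R)" using R by simp
  qed simp
  then show ?thesis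
  proof eventually_elim
    case (elim N)
    let ?z = "Z N \<omega>"
    have "weight (Q N) ?z (R * Suc N) = of_bool (\<forall>i\<le>n. Y (t i) \<omega> = y i)"
      unfolding weight_def
    proof (intro arg_cong[where f = of_bool] iffI allI impI)
      fix i assume *: "\<forall>l<R * Suc N. ?z l \<in> A \<longrightarrow> Q N (visits A ?z l) (lab (?z l))" and i: "i \<le> n"
      obtain l where l: "l < R * Suc N" "?z l \<in> A" "visits A ?z l = mark (t i) N i"
        using visits_attained[of "mark (t i) N i" A ?z "R * Suc N"] elim i by auto
      have "Q N (mark (t i) N i) (lab (?z l))" using * l by metis
      then have "lab (?z l) = y i" using i by (simp add: Q_def)
      moreover have "?z l = ?tr (t i)" using elim i l by blast
      ultimately show "Y (t i) \<omega> = y i" using Y_recurrent(1)[OF \<omega> t(1)] by simp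
    next
      fix l assume *: "\<forall>i\<le>n. Y (t i) \<omega> = y i" and l: "l < R * Suc N" "?z l \<in> A"
      show "Q N (visits A ?z l) (lab (?z l))"
        unfolding Q_def
      proof (intro allI impI)
        fix i assume i: "i \<le> n" "mark (t i) N i = visits A ?z l"
        then have "?z l = ?tr (t i)" using elim l by (metis atMost_iff)
        then show "lab (?z l) = y i" using * i Y_recurrent(1)[OF \<omega> t(1)] by simp
      qed
    qed
    moreover have "mark (t n) N n < visits A ?z (R * Suc N)" using elim by blast
    ultimately show ?case by (simp add: payoff_def)
  qed
qed

text \<open>
  The expectation of the payoff is almost constant in the number of steps. At the start it is \<open>\<psi> 0 j\<close>,
  which tends to the product of transition probabilities because a mark times the mesh tends to its
  time; after the time \<open>R\<close> it tends to the probability on the left, up to the probability that the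
  occupation time at \<open>R\<close> is still too small. First the mesh tends to zero, then \<open>R\<close> to infinity.
\<close>

lemma finite_dimensional:
  assumes t: "t 0 = 0" "mono t" and y: "range y \<subseteq> {1..M}"
  shows "prob {\<omega> \<in> space P. \<forall>i\<le>n. Y (t i) \<omega> = y i} =
          (if y 0 = j then 1 else 0) *
          (\<Prod>i<n. generator_semigroup G (t (Suc i) - t i) (indicator {y (Suc i)}) (y i))"
proof -
  have t0: "0 \<le> t i" for i using monoD[OF t(2), of 0 i] t(1) by simp
  define \<mu> where "\<mu> N i = mark (t i) N i" for N i
  have \<mu>: "strict_mono (\<mu> N)" for N
    unfolding \<mu>_def using mark_strict_mono[OF t(2)] .
  define Q where "Q N c a \<longleftrightarrow> (\<forall>i\<le>n. \<mu> N i = c \<longrightarrow> a = y i)" for N c a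
  define \<psi> where "\<psi> N = tr.marked_value (\<mu> N) y n (mesh N)" for N
  \<comment> \<open>A bound for the times that correspond to the marks, at every mesh.\<close>
  define \<tau> where "\<tau> = t n + 1 + (real n + 1)"
  define B where "B = exp (\<tau> * tr.bound) ^ Suc n"
  define V where "V R N \<omega> = payoff (Q N) (\<psi> N) (\<mu> N n) (Z N \<omega>) (R * Suc N) (Z N \<omega> (R * Suc N))" for R N \<omega>
  define F where "F \<omega> = (of_bool (\<forall>i\<le>n. Y (t i) \<omega> = y i) :: real)" for \<omega>
  have h: "0 \<le> mesh N" "mesh N \<le> 1" for N using mesh_pos[of N] mesh_le_1 by auto
  have \<tau>: "mesh N * real (\<mu> N n) \<le> \<tau>" for N
  proof -
    have "sqrt (mesh N) \<le> 1" using h by simp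
    moreover have "(real n + 1) * mesh N \<le> (real n + 1) * 1" using h by (intro mult_left_mono) auto
    ultimately have "t n + sqrt (mesh N) + (real n + 1) * mesh N \<le> t n + 1 + (real n + 1) * 1"
      by (intro add_mono order_refl)
    then have "real (\<mu> N n) * mesh N \<le> \<tau>"
      unfolding \<mu>_def \<tau>_def mult_1_right by (rule order_trans[OF mark_bounds(2)[OF t0]])
    then show ?thesis by (simp only: mult.commute)
  qed
  have \<psi>: "\<bar>\<psi> N c i\<bar> \<le> B" if "c \<le> \<mu> N n" "i \<in> {1..M}" for N c i
    unfolding \<psi>_def B_def by (rule tr.marked_value_bound[OF \<mu> that y h(1) \<tau>])
  have B: "0 \<le> B" by (simp add: B_def)
  have E_V: "\<bar>expectation (V R N) - \<psi> N 0 j\<bar> \<le> real R * (mesh N * (step_error * B))" for R N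
  proof -
    have "\<bar>expectation (V R N) - \<psi> N 0 j\<bar> \<le> real (R * Suc N) * ((mesh N)\<^sup>2 * (step_error * B))"
      unfolding V_def
    proof (rule expected_payoff)
      show "\<bar>\<psi> N c i\<bar> \<le> B" if "c \<le> \<mu> N n" "i \<in> {1..M}" for c i using \<psi>[OF that] .
      show "Q N c i" if "\<mu> N n < c" for c i
        unfolding Q_def
      proof (intro allI impI)
        fix l assume "l \<le> n" "\<mu> N l = c"
        then show "i = y l" using that strict_mono_less_eq[OF \<mu>[of N], of l n] by simp
      qed
      show "\<psi> N (\<mu> N n) i = of_bool (Q N (\<mu> N n) i)" for i
        unfolding \<psi>_def Q_def by (rule tr.marked_value_final[OF \<mu>])
      show "\<psi> N c i = of_bool (Q N c i) * generator_semigroup G (mesh N) (\<psi> N (Suc c)) i"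
        if "c < \<mu> N n" "i \<in> {1..M}" for c i
        unfolding \<psi>_def Q_def by (rule tr.marked_value_step[OF \<mu> that h(1)])
    qed
    also have "\<dots> = (real (R * Suc N) * mesh N) * (mesh N * (step_error * B))"
      by (simp only: power2_eq_square mult_ac)
    finally show ?thesis by (simp only: mesh_steps)
  qed
  have \<psi>_lim: "(\<lambda>N. \<psi> N 0 j) \<longlonglongrightarrow> (if y 0 = j then 1 else 0) *
          (\<Prod>i<n. generator_semigroup G (t (Suc i) - t i) (indicator {y (Suc i)}) (y i))" (is "_ \<longlonglongrightarrow> ?lim")
  proof -
    have yi: "y i \<in> {1..M}" for i using y by blast
    have \<mu>_lim: "(\<lambda>N. mesh N * real (\<mu> N i)) \<longlonglongrightarrow> t i" for i
      unfolding \<mu>_def by (rule mark_tendsto[OF t0])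
    have "(\<lambda>N. mesh N * real (\<mu> N (Suc i)) - mesh N * real (\<mu> N i)) \<longlonglongrightarrow> t (Suc i) - t i" for i
      by (intro tendsto_diff \<mu>_lim)
    moreover have "mesh N * real (\<mu> N (Suc i)) - mesh N * real (\<mu> N i) = mesh N * real (\<mu> N (Suc i) - \<mu> N i)" for N i
      using strict_mono_less[OF \<mu>[of N], of i "Suc i"] by (simp add: of_nat_diff right_diff_distrib)
    ultimately have d: "(\<lambda>N. mesh N * real (\<mu> N (Suc i) - \<mu> N i)) \<longlonglongrightarrow> t (Suc i) - t i" for i
      by simp
    have "(\<lambda>N. \<psi> N 0 j) \<longlonglongrightarrow> generator_semigroup G (t 0) (indicator {y 0}) j *
          (\<Prod>i<n. generator_semigroup G (t (Suc i) - t i) (indicator {y (Suc i)}) (y i))"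
      unfolding \<psi>_def tr.marked_value_0
      by (intro tendsto_mult tendsto_prod isCont_tendsto_compose[OF tr.semigroup_continuous] j yi \<mu>_lim d)
    then show ?thesis using t(1) by (auto simp: indicator_def)
  qed
  have ev: "{\<omega> \<in> space P. \<forall>i\<le>n. Y (t i) \<omega> = y i} \<in> sets P"
  proof -
    have "{\<omega> \<in> space P. Y (t i) \<omega> = y i} \<in> sets P" for i
    proof -
      have "y i \<in> {1..M}" using y by blast
      then have "Y (t i) -` {y i} \<inter> space P \<in> sets P"
        by (intro measurable_sets[OF Y_measurable[OF t0]]) simp
      moreover have "{\<omega> \<in> space P. Y (t i) \<omega> = y i} = Y (t i) -` {y i} \<inter> space P" by auto
      ultimately show ?thesis by simp
    qed
    then have "{\<omega> \<in> space P. \<forall>i\<in>{..n}. Y (t i) \<omega> = y i} \<in> sets P"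
      by (intro sets.sets_Collect_finite_All) auto
    then show ?thesis unfolding Ball_def atMost_iff .
  qed
  let ?p = "prob {\<omega> \<in> space P. \<forall>i\<le>n. Y (t i) \<omega> = y i}"
  have F_ind: "F \<omega> = indicator {\<omega> \<in> space P. \<forall>i\<le>n. Y (t i) \<omega> = y i} \<omega>" if "\<omega> \<in> space P" for \<omega>
    using that by (auto simp: F_def indicator_def)
  have F_int: "integrable P F"
  proof -
    have "integrable P F \<longleftrightarrow> integrable P (\<lambda>\<omega>. 1 * indicator {\<omega> \<in> space P. \<forall>i\<le>n. Y (t i) \<omega> = y i} \<omega> :: real)"
      by (rule Bochner_Integration.integrable_cong[OF refl]) (simp only: F_ind mult_1)
    then show ?thesis using event_integrable[OF ev, of 1] by blast
  qed
  have F_exp: "expectation F = ?p"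
  proof -
    have "expectation F = expectation (\<lambda>\<omega>. 1 * indicator {\<omega> \<in> space P. \<forall>i\<le>n. Y (t i) \<omega> = y i} \<omega>)"
      by (rule Bochner_Integration.integral_cong[OF refl]) (simp only: F_ind mult_1)
    also have "\<dots> = ?p" unfolding event_expectation[OF ev] by (rule mult_1)
    finally show ?thesis .
  qed
  have V_int: "integrable P (V R N)" for R N
    unfolding V_def by (rule skeleton_integrable[OF payoff_adapted])
  have V_bound: "\<bar>V R N \<omega>\<bar> \<le> 1 + ext_bound * B" if "\<omega> \<in> space P" for R N \<omega>
    unfolding V_def by (rule payoff_bound[OF Z_in[OF that] \<psi>])
  define C where "C = 2 + ext_bound * B"
  have C: "0 \<le> C" "\<bar>F \<omega> - V R N \<omega>\<bar> \<le> C" if "\<omega> \<in> space P" for R N \<omega>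
  proof -
    have "\<bar>F \<omega>\<bar> \<le> 1" by (simp add: F_def)
    then show "\<bar>F \<omega> - V R N \<omega>\<bar> \<le> C" using V_bound[OF that, of R N] by (simp add: C_def)
  qed (use ext_bound_nonneg B in \<open>simp add: C_def\<close>)
  define bad where "bad R = {\<omega> \<in> space P. occupation_time A (\<lambda>s. X s \<omega>) (real R) \<le> t n}" for R
  have bad_ev: "bad R \<in> sets P" for R
    unfolding bad_def using occupation_measurable[of R] by measurable
  have main: "\<bar>?p - ?lim\<bar> \<le> C * prob (bad R)" for R
  proof -
    define g where "g N \<omega> = \<bar>F \<omega> - V R N \<omega>\<bar> * indicator (space P - bad R) \<omega>" for N \<omega>
    have g_lim: "(\<lambda>N. expectation (g N)) \<longlonglongrightarrow> expectation (\<lambda>_. 0)"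
    proof (rule integral_dominated_convergence[where w = "\<lambda>_. C"])
      show "AE \<omega> in P. (\<lambda>N. g N \<omega>) \<longlonglongrightarrow> 0"
        using recurrent_almost_surely
      proof (rule AE_mp, intro AE_I2 impI)
        fix \<omega> assume \<omega>: "\<omega> \<in> space P" "\<omega> \<in> recurrent"
        show "(\<lambda>N. g N \<omega>) \<longlonglongrightarrow> 0"
        proof (cases "\<omega> \<in> bad R")
          case False
          then have "t n < occupation_time A (\<lambda>s. X s \<omega>) (real R)" using \<omega> by (simp add: bad_def)
          from payoff_tendsto[OF \<omega>(2) t0 t(2) this, of y \<psi>]
          have "\<forall>\<^sub>F N in sequentially. V R N \<omega> = F \<omega>"
            unfolding V_def F_def \<mu>_def Q_def[abs_def] .
          then have "\<forall>\<^sub>F N in sequentially. g N \<omega> = 0"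
            by eventually_elim (simp add: g_def)
          then show ?thesis by (rule tendsto_eventually)
        qed (simp add: g_def)
      qed
      show "g N \<in> borel_measurable P" for N
        unfolding g_def[abs_def] using F_int V_int[of R N] bad_ev[of R] by measurable
      show "AE \<omega> in P. norm (g N \<omega>) \<le> C" for N
        by (intro AE_I2) (use C in \<open>auto simp: g_def indicator_def\<close>)
    qed auto
    have bnd: "\<bar>?p - \<psi> N 0 j\<bar> \<le> expectation (g N) + C * prob (bad R) + real R * (mesh N * (step_error * B))" for N
    proof -
      have g_int: "integrable P (g N)"
        unfolding g_def[abs_def] using bad_ev
        by (intro integrable_real_mult_indicator integrable_abs Bochner_Integration.integrable_diff
            F_int V_int sets.Diff sets.top) simp
      have "\<bar>?p - expectation (V R N)\<bar> = \<bar>expectation (\<lambda>\<omega>. F \<omega> - V R N \<omega>)\<bar>"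
        using F_int V_int[of R N] by (simp add: F_exp)
      moreover have "\<bar>expectation (\<lambda>\<omega>. F \<omega> - V R N \<omega>)\<bar> \<le> expectation (\<lambda>\<omega>. \<bar>F \<omega> - V R N \<omega>\<bar>)"
        by (rule integral_abs_bound)
      moreover have "expectation (\<lambda>\<omega>. \<bar>F \<omega> - V R N \<omega>\<bar>) \<le> expectation (\<lambda>\<omega>. g N \<omega> + C * indicator (bad R) \<omega>)"
      proof (rule integral_mono)
        show "integrable P (\<lambda>\<omega>. \<bar>F \<omega> - V R N \<omega>\<bar>)"
          by (intro integrable_abs Bochner_Integration.integrable_diff F_int V_int)
        show "integrable P (\<lambda>\<omega>. g N \<omega> + C * indicator (bad R) \<omega>)"
          by (intro Bochner_Integration.integrable_add g_int event_integrable bad_ev)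
        show "\<bar>F \<omega> - V R N \<omega>\<bar> \<le> g N \<omega> + C * indicator (bad R) \<omega>" if "\<omega> \<in> space P" for \<omega>
          using C(2)[OF that, of R N] that by (auto simp: g_def indicator_def)
      qed
      moreover have "expectation (\<lambda>\<omega>. g N \<omega> + C * indicator (bad R) \<omega>) = expectation (g N) + C * prob (bad R)"
        by (subst Bochner_Integration.integral_add[OF g_int event_integrable[OF bad_ev]])
           (simp only: event_expectation[OF bad_ev])
      ultimately show ?thesis using E_V[of R N] by linarith
    qed
    have "(\<lambda>N. expectation (g N) + C * prob (bad R) + real R * (mesh N * (step_error * B)))
        \<longlonglongrightarrow> expectation (\<lambda>_. 0) + C * prob (bad R) + real R * (0 * (step_error * B))"
      by (intro tendsto_intros g_lim mesh_tendsto)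
    then have lim1: "(\<lambda>N. expectation (g N) + C * prob (bad R) + real R * (mesh N * (step_error * B)))
        \<longlonglongrightarrow> C * prob (bad R)" by simp
    have lim2: "(\<lambda>N. \<bar>?p - \<psi> N 0 j\<bar>) \<longlonglongrightarrow> \<bar>?p - ?lim\<bar>"
      by (intro tendsto_intros \<psi>_lim)
    show ?thesis
      by (rule LIMSEQ_le[OF lim2 lim1]) (use bnd in blast)
  qed
  have "(\<lambda>R. C * prob (bad R)) \<longlonglongrightarrow> C * 0"
    unfolding bad_def by (intro tendsto_intros occupation_small_prob)
  then have "\<bar>?p - ?lim\<bar> \<le> C * 0"
    by (rule LIMSEQ_le_const) (use main in blast)
  then show ?thesis by simp
qed

text \<open>
  The paths of the trace are step paths, also on the null event of no recurrence, where they are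
  constant.
\<close>

theorem trace_markov_chain: "markov_chain {1..M} G P Y j"
  unfolding markov_chain_def
proof (intro conjI allI impI ballI)
  show "prob_space P" by (rule prob)
  show "Y t \<in> P \<rightarrow>\<^sub>M count_space {1..M}" if "0 \<le> t" for t by (rule Y_measurable[OF that])
  show "cadlag_on {0..} (\<lambda>t. Y t \<omega>)" if "\<omega> \<in> space P" for \<omega>
    using Y_step_path[OF that] by (simp only: cadlag_on_iff_step_path)
  show "prob {\<omega> \<in> space P. \<forall>i\<le>n. Y (t i) \<omega> = y i} =
          (if y 0 = j then 1 else 0) *
          (\<Prod>i<n. generator_semigroup G (t (Suc i) - t i) (indicator {y (Suc i)}) (y i))"
    if "t 0 = 0" "mono t" "range y \<subseteq> {1..M}" for n t y
    by (rule finite_dimensional[OF that])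
qed

end

section \<open>Time deformations and discretised paths\<close>

lemma increasing_mono:
  fixes a :: "nat \<Rightarrow> real"
  assumes a: "\<And>i. i < n \<Longrightarrow> a i < a (Suc i)" and "i \<le> k" "k \<le> n"
  shows "a i \<le> a k"
  using assms(2,3)
proof (induction k rule: dec_induct)
  case (step k)
  then show ?case using a[of k] by simp
qed simp

lemma real_Suc_mult: "real (Suc i) * c = real i * c + c"
  by (simp add: distrib_right)

lemma find_interval:
  fixes a :: "nat \<Rightarrow> real"
  assumes "a 0 \<le> t" "t < a n"
  obtains k where "k < n" "a k \<le> t" "t < a (Suc k)"
proof -
  have "\<exists>k<n. a k \<le> t \<and> t < a (Suc k)"
    using assms(2)
  proof (induction n)
    case (Suc n)
    show ?case
    proof (cases "t < a n")
      case True then show ?thesis using Suc.IH less_SucI by blast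
    next
      case False then show ?thesis using Suc.prems by (intro exI[of _ n]) auto
    qed
  qed (use assms in auto)
  then show ?thesis using that by blast
qed

text \<open>The piecewise linear function with value \<open>b i\<close> at \<open>a i\<close>, as a sum of truncated linear ramps.\<close>

definition interpolation :: "(nat \<Rightarrow> real) \<Rightarrow> (nat \<Rightarrow> real) \<Rightarrow> nat \<Rightarrow> real \<Rightarrow> real" where
  "interpolation a b n t = b 0 + (\<Sum>i<n. (b (Suc i) - b i) * max 0 (min 1 ((t - a i) / (a (Suc i) - a i))))"

lemma interpolation_eq:
  assumes a: "\<And>i. i < n \<Longrightarrow> a i < a (Suc i)" and k: "k < n" "a k \<le> t" "t \<le> a (Suc k)"
  shows "interpolation a b n t = b k + (b (Suc k) - b k) * ((t - a k) / (a (Suc k) - a k))"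
proof -
  have mono: "a i \<le> a l" if "i \<le> l" "l \<le> n" for i l
    by (rule increasing_mono[where a = a and n = n, OF a that])
  let ?c = "\<lambda>i. (b (Suc i) - b i) * max 0 (min 1 ((t - a i) / (a (Suc i) - a i)))"
  have lo: "?c i = b (Suc i) - b i" if "i < k" for i
  proof -
    have "a (Suc i) \<le> t" using mono[of "Suc i" k] that k by simp
    then have "1 \<le> (t - a i) / (a (Suc i) - a i)" using a[of i] that k by (simp add: field_simps)
    then show ?thesis by (simp add: min_def max_def)
  qed
  have hi: "?c i = 0" if "k < i" "i < n" for i
  proof -
    have "t \<le> a i" using mono[of "Suc k" i] that k by simp
    then have "(t - a i) / (a (Suc i) - a i) \<le> 0" using a[of i] that by (simp add: divide_nonpos_pos)
    then show ?thesis by (simp add: min_def max_def)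
  qed
  have mid: "?c k = (b (Suc k) - b k) * ((t - a k) / (a (Suc k) - a k))"
  proof -
    have "0 \<le> (t - a k) / (a (Suc k) - a k)" "(t - a k) / (a (Suc k) - a k) \<le> 1"
      using a[of k] k by (auto simp: field_simps)
    then show ?thesis by (simp add: min_def max_def)
  qed
  have split: "sum f {..<n} = sum f {..<k} + f k + sum f {k<..<n}" for f :: "nat \<Rightarrow> real"
  proof -
    have "{..<n} = {..<Suc k} \<union> {k<..<n}" "{..<Suc k} \<inter> {k<..<n} = {}" using k by auto
    then have "sum f {..<n} = sum f {..<Suc k} + sum f {k<..<n}"
      by (metis finite_greaterThanLessThan finite_lessThan sum.union_disjoint)
    then show ?thesis by simp
  qed
  have "(\<Sum>i<n. ?c i) = (\<Sum>i<k. ?c i) + ?c k + (\<Sum>i\<in>{k<..<n}. ?c i)"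
    by (rule split)
  also have "(\<Sum>i<k. ?c i) = (\<Sum>i<k. b (Suc i) - b i)" by (intro sum.cong refl lo) simp
  also have "\<dots> = b k - b 0" by (rule sum_lessThan_telescope)
  also have "(\<Sum>i\<in>{k<..<n}. ?c i) = 0" by (intro sum.neutral ballI hi) auto
  finally show ?thesis by (simp add: interpolation_def mid)
qed

lemma deformation_exists:
  assumes a: "\<And>i. i < n \<Longrightarrow> a i < a (Suc i)" and b: "\<And>i. i < n \<Longrightarrow> b i < b (Suc i)"
    and ends: "a 0 = 0" "b 0 = 0" "a n = T" "b n = T" and T: "0 < T"
    and close: "\<And>i. i \<le> n \<Longrightarrow> \<bar>b i - a i\<bar> \<le> r"
  obtains l where "l \<in> time_deformations T" "\<And>t. t \<in> {0..T} \<Longrightarrow> \<bar>l t - t\<bar> \<le> r"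
    "\<And>i t. i < n \<Longrightarrow> a i \<le> t \<Longrightarrow> t < a (Suc i) \<Longrightarrow> b i \<le> l t \<and> l t < b (Suc i)"
proof -
  define l where "l = interpolation a b n"
  have n: "0 < n" using ends T by (cases n) auto
  have bmono: "b i \<le> b k" if "i \<le> k" "k \<le> n" for i k
    by (rule increasing_mono[where a = b and n = n, OF b that])
  have amono: "a i \<le> a k" if "i \<le> k" "k \<le> n" for i k
    by (rule increasing_mono[where a = a and n = n, OF a that])
  have form: "l t = b k + (b (Suc k) - b k) * ((t - a k) / (a (Suc k) - a k))"
    if "k < n" "a k \<le> t" "t \<le> a (Suc k)" for k t
    unfolding l_def by (rule interpolation_eq[OF a that])
  have loc: "b k \<le> l t \<and> l t < b (Suc k)" if k: "k < n" "a k \<le> t" "t < a (Suc k)" for k t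
  proof -
    define x where "x = (t - a k) / (a (Suc k) - a k)"
    have x: "0 \<le> x" "x < 1" using k a[OF k(1)] by (auto simp: x_def field_simps)
    have "l t = b k + (b (Suc k) - b k) * x" using form[of k t] k by (simp add: x_def)
    moreover have "0 \<le> (b (Suc k) - b k) * x" using x b[OF k(1)] by simp
    moreover have "(b (Suc k) - b k) * x < (b (Suc k) - b k) * 1"
      by (rule mult_strict_left_mono[OF x(2)]) (use b[OF k(1)] in simp)
    ultimately show ?thesis by auto
  qed
  have lT: "l T = T"
  proof -
    obtain m where m: "n = Suc m" using n by (cases n) auto
    have "l T = b m + (b (Suc m) - b m) * ((T - a m) / (a (Suc m) - a m))"
      using a[of m] ends m by (intro form) auto
    then show ?thesis using a[of m] ends m by simp
  qed
  have cover: "\<exists>k<n. a k \<le> t \<and> t < a (Suc k)" if "0 \<le> t" "t < T" for t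
    using find_interval[of a t n] that ends by metis
  have smono: "strict_mono_on {0..T} l"
  proof (rule strict_mono_onI)
    fix s t assume st: "s \<in> {0..T}" "t \<in> {0..T}" "s < t"
    obtain k where k: "k < n" "a k \<le> s" "s < a (Suc k)" using cover[of s] st by auto
    have ls: "l s < b (Suc k)" using loc[OF k] by simp
    show "l s < l t"
    proof (cases "t = T")
      case True
      then show ?thesis using ls bmono[of "Suc k" n] k ends lT by simp
    next
      case False
      then obtain k' where k': "k' < n" "a k' \<le> t" "t < a (Suc k')" using cover[of t] st by auto
      show ?thesis
      proof (cases "k' = k")
        case True
        have "(s - a k) / (a (Suc k) - a k) < (t - a k) / (a (Suc k) - a k)"
          using st a[OF k(1)] by (intro divide_strict_right_mono) auto
        then have "(b (Suc k) - b k) * ((s - a k) / (a (Suc k) - a k)) < (b (Suc k) - b k) * ((t - a k) / (a (Suc k) - a k))"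
          using b[OF k(1)] by (intro mult_strict_left_mono) auto
        then show ?thesis using form[of k s] form[of k t] k k' True by simp
      next
        case False
        have "\<not> k' < k" using amono[of "Suc k'" k] k k' st by auto
        then have "Suc k \<le> k'" using False by simp
        then have "b (Suc k) \<le> b k'" using bmono k'(1) by simp
        then show ?thesis using ls loc[OF k'] by simp
      qed
    qed
  qed
  have into: "l t \<in> {0..T}" if t: "t \<in> {0..T}" for t
  proof (cases "t = T")
    case False
    then obtain k where k: "k < n" "a k \<le> t" "t < a (Suc k)" using cover[of t] t by auto
    then show ?thesis using loc[OF k] bmono[of 0 k] bmono[of "Suc k" n] ends by auto
  qed (use lT T in simp)
  have onto: "y \<in> l ` {0..T}" if y: "y \<in> {0..T}" for y
  proof (cases "y = T")
    case True
    then show ?thesis using lT T by (intro image_eqI[of _ _ T]) auto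
  next
    case False
    then obtain k where k: "k < n" "b k \<le> y" "y < b (Suc k)"
      using find_interval[of b y n] y ends by auto
    define x where "x = (y - b k) / (b (Suc k) - b k)"
    have x: "0 \<le> x" "x \<le> 1" using k b[OF k(1)] by (auto simp: x_def field_simps)
    define t where "t = a k + x * (a (Suc k) - a k)"
    have "x * (a (Suc k) - a k) \<le> 1 * (a (Suc k) - a k)"
      using x a[OF k(1)] by (intro mult_right_mono) auto
    then have "t \<le> a (Suc k)" unfolding t_def mult_1 by linarith
    moreover have "a k \<le> t" using x a[OF k(1)] by (simp add: t_def)
    ultimately have t: "a k \<le> t" "t \<le> a (Suc k)" by simp_all
    have "(t - a k) / (a (Suc k) - a k) = x" using a[OF k(1)] by (simp add: t_def)
    then have "l t = y" using form[OF k(1) t] b[OF k(1)] by (simp add: x_def)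
    moreover have "t \<in> {0..T}" using t amono[of 0 k] amono[of "Suc k" n] k ends by auto
    ultimately show ?thesis by blast
  qed
  have "l \<in> time_deformations T"
    unfolding time_deformations_def using smono into onto by blast
  moreover have "\<bar>l t - t\<bar> \<le> r" if t: "t \<in> {0..T}" for t
  proof (cases "t = T")
    case False
    then obtain k where k: "k < n" "a k \<le> t" "t < a (Suc k)" using cover[of t] t by auto
    define x where "x = (t - a k) / (a (Suc k) - a k)"
    have x: "0 \<le> x" "x \<le> 1" using k a[OF k(1)] by (auto simp: x_def field_simps)
    have tx: "t = a k + x * (a (Suc k) - a k)" using a[OF k(1)] by (simp add: x_def)
    have "l t = b k + (b (Suc k) - b k) * x" using form[of k t] k by (simp add: x_def)
    then have "l t - t = b k + (b (Suc k) - b k) * x - (a k + x * (a (Suc k) - a k))"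
      using tx by linarith
    then have "l t - t = (1 - x) * (b k - a k) + x * (b (Suc k) - a (Suc k))"
      by (simp add: algebra_simps)
    then have "\<bar>l t - t\<bar> \<le> (1 - x) * \<bar>b k - a k\<bar> + x * \<bar>b (Suc k) - a (Suc k)\<bar>"
      using x abs_triangle_ineq[of "(1 - x) * (b k - a k)" "x * (b (Suc k) - a (Suc k))"] by (simp add: abs_mult)
    also have "\<dots> \<le> (1 - x) * r + x * r"
      using x close[of k] close[of "Suc k"] k by (intro add_mono mult_left_mono) auto
    finally show ?thesis by (simp add: algebra_simps)
  qed (use lT close[of 0] ends in simp)
  ultimately show ?thesis using loc that by blast
qed

definition step_function :: "real \<Rightarrow> nat \<Rightarrow> (nat \<Rightarrow> 'a) \<Rightarrow> real \<Rightarrow> 'a" where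
  "step_function T n z = restrict (\<lambda>t. z (nat \<lfloor>t * real n / T\<rfloor>)) {0..T}"

definition discretize :: "real \<Rightarrow> nat \<Rightarrow> (real \<Rightarrow> 'a) \<Rightarrow> real \<Rightarrow> 'a" where
  "discretize T n p = step_function T n (\<lambda>i. p (real i * (T / real n)))"

lemma grid_index:
  assumes "0 < T" "0 < n" "real i * (T / real n) \<le> t" "t < real (Suc i) * (T / real n)"
  shows "nat \<lfloor>t * real n / T\<rfloor> = i"
proof -
  have "real i \<le> t * real n / T" "t * real n / T < real i + 1"
    using assms by (auto simp: field_simps)
  then have "\<lfloor>t * real n / T\<rfloor> = int i" by (simp add: floor_eq_iff)
  then show ?thesis by simp
qed

lemma step_function_interval:
  assumes "0 < T" "0 < n" "i < n" "real i * (T / real n) \<le> t" "t < real (Suc i) * (T / real n)"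
  shows "step_function T n z t = z i"
proof -
  have "real (Suc i) * (T / real n) \<le> real n * (T / real n)"
    using assms by (intro mult_right_mono) auto
  then have "t \<le> T" using assms by simp
  moreover have "0 \<le> real i * (T / real n)" using assms by simp
  then have "0 \<le> t" using assms(4) by linarith
  ultimately show ?thesis
    unfolding step_function_def using grid_index[OF assms(1,2,4,5)] by simp
qed

lemma step_function_end: "0 < T \<Longrightarrow> 0 < n \<Longrightarrow> step_function T n z T = z n"
  by (simp add: step_function_def)

lemma step_function_in_space:
  fixes z :: "nat \<Rightarrow> 'a::discrete_topology"
  assumes T: "0 < T" "0 < n" and z: "\<And>i. i \<le> n \<Longrightarrow> z i \<in> S"
  shows "step_function T n z \<in> skorohod_space T S"
proof -
  let ?g = "\<lambda>i. real i * (T / real n)"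
  have gn: "?g n = T" using T by simp
  have gm: "?g i < ?g (Suc i)" for i using T by (simp add: field_simps)
  have cover: "\<exists>i<n. ?g i \<le> t \<and> t < ?g (Suc i)" if "0 \<le> t" "t < T" for t
    using find_interval[of ?g t n] that gn by (metis mult_zero_left of_nat_0)
  have "step_path {0..T} (step_function T n z)"
    unfolding step_path_def
  proof (intro ballI conjI)
    fix t assume t: "t \<in> {0..T}"
    show "\<exists>d>0. \<forall>s\<in>{0..T}. t < s \<and> s < t + d \<longrightarrow> step_function T n z s = step_function T n z t"
    proof (cases "t = T")
      case True then show ?thesis by (intro exI[of _ 1]) auto
    next
      case False
      then obtain i where i: "i < n" "?g i \<le> t" "t < ?g (Suc i)" using cover[of t] t by auto
      show ?thesis
      proof (intro exI[of _ "?g (Suc i) - t"] conjI ballI impI)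
        fix s assume s: "s \<in> {0..T}" "t < s \<and> s < t + (?g (Suc i) - t)"
        have "step_function T n z s = z i" by (rule step_function_interval[OF T i(1)]) (use s i in auto)
        moreover have "step_function T n z t = z i" by (rule step_function_interval[OF T i])
        ultimately show "step_function T n z s = step_function T n z t" by simp
      qed (use i in simp)
    qed
    show "\<exists>c. \<exists>d>0. \<forall>s\<in>{0..T}. t - d < s \<and> s < t \<longrightarrow> step_function T n z s = c"
    proof (cases "t = 0")
      case True then show ?thesis by (intro exI[of _ undefined] exI[of _ 1]) auto
    next
      case False
      have "\<exists>i<n. ?g i < t \<and> t \<le> ?g (Suc i)"
      proof -
        have "\<exists>i<n. - ?g (n - i) \<le> - t \<and> - t < - ?g (n - Suc i)"
          using find_interval[of "\<lambda>i. - ?g (n - i)" "- t" n] t False gn by (metis atLeastAtMost_iff diff_self_eq_0 diff_zero le_imp_neg_le less_le mult_zero_left neg_less_iff_less of_nat_0)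
        then obtain i where i: "i < n" "- ?g (n - i) \<le> - t" "- t < - ?g (n - Suc i)" by blast
        have "Suc (n - Suc i) = n - i" using i by simp
        then show ?thesis using i by (intro exI[of _ "n - Suc i"]) auto
      qed
      then obtain i where i: "i < n" "?g i < t" "t \<le> ?g (Suc i)" by blast
      show ?thesis
      proof (intro exI[of _ "z i"] exI[of _ "t - ?g i"] conjI ballI impI)
        fix s assume "s \<in> {0..T}" "t - (t - ?g i) < s \<and> s < t"
        then show "step_function T n z s = z i"
          by (intro step_function_interval[OF T i(1)]) (use i in auto)
      qed (use i in simp)
    qed
  qed
  then have "cadlag_on {0..T} (step_function T n z)"
    by (simp only: cadlag_on_iff_step_path)
  moreover have "step_function T n z \<in> {0..T} \<rightarrow>\<^sub>E S"
  proof (rule PiE_I)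
    fix t assume t: "t \<in> {0..T}"
    show "step_function T n z t \<in> S"
    proof (cases "t = T")
      case True then show ?thesis using step_function_end[OF T, of z] z[of n] by simp
    next
      case False
      then obtain i where i: "i < n" "?g i \<le> t" "t < ?g (Suc i)" using cover[of t] t by auto
      then show ?thesis using step_function_interval[OF T i, of z] z[of i] by simp
    qed
  qed (simp only: step_function_def restrict_def if_False)
  ultimately show ?thesis by (simp add: skorohod_space_def)
qed

text \<open>At most one jump; a path without a jump satisfies this with \<open>s = v\<close>.\<close>

definition single_jump :: "(real \<Rightarrow> 'a) \<Rightarrow> real \<Rightarrow> real \<Rightarrow> bool" where
  "single_jump p u v \<longleftrightarrow> (\<exists>s. u < s \<and> s \<le> v \<and> (\<forall>r. u \<le> r \<longrightarrow> r < s \<longrightarrow> p r = p u) \<and>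
     (\<forall>r. s \<le> r \<longrightarrow> r \<le> v \<longrightarrow> p r = p v))"

text \<open>
  The last cell is treated separately because its right end \<open>T\<close> is fixed by every time deformation, so
  that a jump in its interior could not be moved to a grid point.
\<close>

definition resolved :: "real \<Rightarrow> nat \<Rightarrow> (real \<Rightarrow> 'a) \<Rightarrow> bool" where
  "resolved T n p \<longleftrightarrow>
     (\<forall>i<n. single_jump p (real i * (T / real (Suc n))) (real (Suc i) * (T / real (Suc n)))) \<and>
     (\<forall>r. real n * (T / real (Suc n)) \<le> r \<longrightarrow> r < T \<longrightarrow> p r = p (real n * (T / real (Suc n))))"

text \<open>
  The jump in each cell is moved by a piecewise linear time deformation to the right end of the
  cell, where the discretised path jumps.
\<close>

lemma resolved_dist:
  fixes p :: "real \<Rightarrow> 'a::discrete_topology"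
  assumes T: "0 < T" and p: "p \<in> skorohod_space T S" and res: "resolved T n p"
  shows "skorohod_dist T S p (discretize T (Suc n) p) \<le> T / real (Suc n)"
proof -
  let ?g = "\<lambda>i. real i * (T / real (Suc n))"
  have gn: "?g (Suc n) = T" by simp
  have gd: "?g (Suc i) = ?g i + T / real (Suc n)" for i by (rule real_Suc_mult)
  have pos: "0 < T / real (Suc n)" using T by simp
  obtain s where s: "\<And>i. i < n \<Longrightarrow> ?g i < s i \<and> s i \<le> ?g (Suc i) \<and>
      (\<forall>r. ?g i \<le> r \<longrightarrow> r < s i \<longrightarrow> p r = p (?g i)) \<and> (\<forall>r. s i \<le> r \<longrightarrow> r \<le> ?g (Suc i) \<longrightarrow> p r = p (?g (Suc i)))"
    using res unfolding resolved_def single_jump_def by metis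
  define a where "a = (\<lambda>i. if i = 0 then 0 else if i = Suc n then T else s (i - 1))"
  have a_lt: "a i < a (Suc i)" if i: "i < Suc n" for i
  proof -
    have lo: "a i \<le> ?g i"
    proof (cases i)
      case (Suc k)
      then show ?thesis using s[of k] i by (simp add: a_def)
    qed (simp add: a_def)
    have "?g i < a (Suc i)"
    proof (cases "i = n")
      case True
      then have "a (Suc i) = T" by (simp add: a_def)
      moreover have "?g n < T" using gd[of n] gn pos by linarith
      ultimately show ?thesis using True by (simp only:)
    next
      case False
      then have "a (Suc i) = s i" by (simp add: a_def)
      then show ?thesis using s[of i] i False by simp
    qed
    then show ?thesis using lo by linarith
  qed
  have close: "\<bar>?g i - a i\<bar> \<le> T / real (Suc n)" if "i \<le> Suc n" for i
  proof (cases i)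
    case 0 then show ?thesis using pos by (simp add: a_def)
  next
    case (Suc k)
    show ?thesis
    proof (cases "k = n")
      case True then show ?thesis using pos Suc gn by (simp add: a_def del: of_nat_Suc)
    next
      case False
      then have "k < n" using that Suc by simp
      then have "?g k < s k" "s k \<le> ?g (Suc k)" using s by blast+
      then show ?thesis using gd[of k] Suc False unfolding a_def by (simp del: of_nat_Suc)
    qed
  qed
  have g_lt: "?g i < ?g (Suc i)" for i using gd[of i] pos by linarith
  obtain l where l: "l \<in> time_deformations T" "\<And>t. t \<in> {0..T} \<Longrightarrow> \<bar>l t - t\<bar> \<le> T / real (Suc n)"
    "\<And>i t. i < Suc n \<Longrightarrow> a i \<le> t \<Longrightarrow> t < a (Suc i) \<Longrightarrow> ?g i \<le> l t \<and> l t < ?g (Suc i)"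
  proof (rule deformation_exists[of "Suc n" a ?g T "T / real (Suc n)"])
    show "a 0 = 0" "a (Suc n) = T" by (simp_all add: a_def)
  qed (use a_lt g_lt close T gn in \<open>simp_all del: of_nat_Suc\<close>)
  have const: "p t = p (?g i)" if i: "i < Suc n" "a i \<le> t" "t < a (Suc i)" for i t
  proof (cases "t \<le> ?g i")
    case True
    show ?thesis
    proof (cases i)
      case 0
      then show ?thesis using i True by (simp add: a_def)
    next
      case (Suc k)
      then have k: "a i = s k" "k < n" using i by (auto simp: a_def)
      have D: "\<forall>r. s k \<le> r \<longrightarrow> r \<le> ?g (Suc k) \<longrightarrow> p r = p (?g (Suc k))"
        using s[OF k(2)] by (elim conjE)
      have "s k \<le> t" using i(2) k(1) by simp
      moreover have "t \<le> ?g (Suc k)" using True unfolding Suc .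
      ultimately show ?thesis using D unfolding Suc by blast
    qed
  next
    case False
    show ?thesis
    proof (cases "i = n")
      case True
      then have "t < T" using i(3) by (simp add: a_def)
      moreover have "?g n \<le> t" using False unfolding True by (rule less_imp_le[OF not_le_imp_less])
      ultimately show ?thesis using res unfolding resolved_def True by blast
    next
      case F2: False
      then have k: "a (Suc i) = s i" "i < n" using i by (auto simp: a_def)
      have D: "\<forall>r. ?g i \<le> r \<longrightarrow> r < s i \<longrightarrow> p r = p (?g i)"
        using s[OF k(2)] by (elim conjE)
      have "t < s i" using i(3) k(1) by simp
      moreover have "?g i \<le> t" using False by simp
      ultimately show ?thesis using D by blast
    qed
  qed
  have disc: "p t = discretize T (Suc n) p (l t)" if t: "t \<in> {0..T}" for t
  proof (cases "t = T")
    case True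
    then have "l t = T" using time_deformations_endpoint[OF l(1)] T by simp
    then show ?thesis
      using True step_function_end[OF T, of "Suc n" "\<lambda>i. p (?g i)"] gn unfolding discretize_def by simp
  next
    case False
    then obtain i where i: "i < Suc n" "a i \<le> t" "t < a (Suc i)"
      using find_interval[of a t "Suc n"] t by (auto simp: a_def)
    have "discretize T (Suc n) p (l t) = p (?g i)"
      unfolding discretize_def using l(3)[OF i] T i(1) by (intro step_function_interval) auto
    then show ?thesis using const[OF i] by simp
  qed
  have disc_in: "discretize T (Suc n) p \<in> skorohod_space T S"
    unfolding discretize_def
  proof (rule step_function_in_space[OF T])
    fix i assume "i \<le> Suc n"
    then have "?g i \<le> ?g (Suc n)" using T by (intro mult_right_mono) auto
    then have "?g i \<in> {0..T}" using gn T by simp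
    then show "p (?g i) \<in> S" using p by (auto simp: skorohod_space_def)
  qed simp
  let ?R = "{r. \<exists>l\<in>time_deformations T. \<forall>t\<in>{0..T}. \<bar>l t - t\<bar> \<le> r \<and> of_bool (p t \<noteq> discretize T (Suc n) p (l t)) \<le> r}"
  have "T / real (Suc n) \<in> ?R"
    using l(1,2) disc pos by (auto intro!: bexI[of _ l])
  moreover have "bdd_below ?R"
  proof (rule bdd_belowI[of _ 0])
    fix r assume "r \<in> ?R"
    then obtain l where "\<bar>l 0 - 0\<bar> \<le> r" using T by force
    then show "0 \<le> r" by linarith
  qed
  ultimately have "Inf ?R \<le> T / real (Suc n)" by (intro cInf_lower)
  then show ?thesis using p disc_in by (simp only: skorohod_dist_def simp_thms if_True)
qed

lemma finite_separated:
  assumes "finite F"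
  obtains \<delta> :: real where "\<delta> > 0" "\<And>x y. x \<in> F \<Longrightarrow> y \<in> F \<Longrightarrow> x < y \<Longrightarrow> \<delta> \<le> y - x"
proof -
  let ?D = "insert 1 ((\<lambda>(x, y). y - x) ` {(x, y) \<in> F \<times> F. x < y})"
  have fin: "finite ?D" using assms by (auto intro: finite_subset[of _ "F \<times> F"])
  show ?thesis
  proof (rule that[of "Min ?D"])
    show "0 < Min ?D" using fin by (subst Min_gr_iff) auto
    show "Min ?D \<le> y - x" if "x \<in> F" "y \<in> F" "x < y" for x y
      using fin that by (intro Min_le) (auto intro!: image_eqI[of _ _ "(x, y)"])
  qed
qed

text \<open>
  When the mesh is smaller than all the gaps between the finitely many jump times and \<open>T\<close>, no two of
  these points share a cell.
\<close>

lemma eventually_resolved: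
  assumes T: "0 < T" and p: "step_path {0..T} p"
  shows "\<forall>\<^sub>F n in sequentially. resolved T n p"
proof -
  obtain J where J: "jumps_within J 0 T p" using finitely_many_jumps[OF p] T by auto
  then have "finite (insert T J)" by (simp add: jumps_within_def)
  then obtain \<delta> where \<delta>: "\<delta> > 0" "\<And>x y. x \<in> insert T J \<Longrightarrow> y \<in> insert T J \<Longrightarrow> x < y \<Longrightarrow> \<delta> \<le> y - x"
    by (rule finite_separated) blast
  have "(\<lambda>n. T / real (Suc n)) \<longlonglongrightarrow> 0"
    using LIMSEQ_Suc[OF lim_const_over_n[of T]] by simp
  then have "\<forall>\<^sub>F n in sequentially. T / real (Suc n) < \<delta>"
    using \<delta>(1) by (rule order_tendstoD(2))
  then show ?thesis
  proof eventually_elim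
    case (elim n)
    let ?g = "\<lambda>i. real i * (T / real (Suc n))"
    have gd: "?g (Suc i) = ?g i + T / real (Suc n)" for i by (rule real_Suc_mult)
    have gn: "?g (Suc n) = T" by simp
    have g0: "0 \<le> ?g i" for i using T by simp
    have pos: "0 < T / real (Suc n)" using T by simp
    show ?case
      unfolding resolved_def
    proof (intro conjI allI impI)
      fix i assume i: "i < n"
      have "?g (Suc i) \<le> ?g (Suc n)" using i T by (intro mult_right_mono) auto
      then have gT: "?g (Suc i) \<le> T" using gn by linarith
      show "single_jump p (?g i) (?g (Suc i))"
      proof (cases "{?g i<..?g (Suc i)} \<inter> J = {}")
        case True
        have const: "p r = p (?g i)" if r: "?g i \<le> r" "r \<le> ?g (Suc i)" for r
        proof (rule jumps_withinD[OF J g0 r(1)])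
          show "r \<le> T" using r(2) gT by linarith
          have "{?g i<..r} \<subseteq> {?g i<..?g (Suc i)}" using r(2) by auto
          then show "{?g i<..r} \<inter> J = {}" using True by blast
        qed
        show ?thesis
          unfolding single_jump_def
        proof (intro exI[of _ "?g (Suc i)"] conjI allI impI)
          show "?g i < ?g (Suc i)" using gd[of i] pos by linarith
          show "p r = p (?g i)" if "?g i \<le> r" "r < ?g (Suc i)" for r
            by (rule const[OF that(1) less_imp_le[OF that(2)]])
          show "p r = p (?g (Suc i))" if "?g (Suc i) \<le> r" "r \<le> ?g (Suc i)" for r
            by (rule arg_cong[where f = p], rule order_antisym[OF that(2,1)])
        qed (rule order_refl)
      next
        case False
        then obtain c where c: "c \<in> J" "?g i < c" "c \<le> ?g (Suc i)" by auto
        have only: "x = c" if x: "x \<in> J" "?g i < x" "x \<le> ?g (Suc i)" for x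
        proof (rule ccontr)
          assume "x \<noteq> c"
          then have "\<delta> \<le> \<bar>x - c\<bar>" using \<delta>(2)[of x c] \<delta>(2)[of c x] x c by (cases "x < c") auto
          then show False using x c gd[of i] elim by linarith
        qed
        show ?thesis
          unfolding single_jump_def
        proof (intro exI[of _ c] conjI allI impI)
          show "p r = p (?g i)" if "?g i \<le> r" "r < c" for r
          proof (rule jumps_withinD[OF J g0 that(1)])
            show "r \<le> T" using that c gT by linarith
            have "x \<notin> J" if "?g i < x" "x \<le> r" for x using only[of x] that \<open>r < c\<close> c by auto
            then show "{?g i<..r} \<inter> J = {}" by auto
          qed
          show "p r = p (?g (Suc i))" if "c \<le> r" "r \<le> ?g (Suc i)" for r
          proof (rule jumps_withinD[OF J _ that(2) gT, symmetric])
            show "0 \<le> r" using that c g0[of i] by linarith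
            have "x \<notin> J" if "r < x" "x \<le> ?g (Suc i)" for x using only[of x] that \<open>c \<le> r\<close> c by auto
            then show "{r<..?g (Suc i)} \<inter> J = {}" by auto
          qed
        qed (use c in auto)
      qed
    next
      fix r assume r: "?g n \<le> r" "r < T"
      show "p r = p (?g n)"
      proof (rule jumps_withinD[OF J g0 r(1)])
        have "x \<notin> J" if "?g n < x" "x \<le> r" for x
        proof
          assume "x \<in> J"
          then have "\<delta> \<le> T - x" using \<delta>(2)[of x T] that r by auto
          then show False using that gd[of n] gn elim by linarith
        qed
        then show "{?g n<..r} \<inter> J = {}" by auto
      qed (use r in simp)
    qed
  qed
qed

section \<open>Lipschitz envelopes and jumps on a grid\<close>

text \<open>
  The largest minorant of \<open>g\<close> that is Lipschitz with constant \<open>k\<close>. It turns continuous test functions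
  into Lipschitz ones, for which discretisation errors are uniform.
\<close>

definition lipschitz_envelope :: "'a set \<Rightarrow> ('a \<Rightarrow> 'a \<Rightarrow> real) \<Rightarrow> ('a \<Rightarrow> real) \<Rightarrow> real \<Rightarrow> 'a \<Rightarrow> real" where
  "lipschitz_envelope S d g k x = (INF y\<in>S. g y + k * d x y)"

context Metric_space
begin

lemma continuous_nearby:
  assumes f: "continuous_map mtopology euclideanreal f" and x: "x \<in> M" and e: "0 < e"
  obtains r where "r > 0" "\<And>y. y \<in> M \<Longrightarrow> d x y < r \<Longrightarrow> \<bar>f y - f x\<bar> < e"
proof -
  have "openin mtopology {y \<in> topspace mtopology. f y \<in> ball (f x) e}"
    by (rule openin_continuous_map_preimage[OF f]) simp
  then have "openin mtopology {y \<in> M. f y \<in> ball (f x) e}" by simp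
  moreover have "x \<in> {y \<in> M. f y \<in> ball (f x) e}" using x e by simp
  ultimately obtain r where r: "r > 0" "mball x r \<subseteq> {y \<in> M. f y \<in> ball (f x) e}"
    unfolding openin_mtopology by blast
  show ?thesis
  proof (rule that[OF r(1)])
    fix y assume "y \<in> M" "d x y < r"
    then have "y \<in> mball x r" using x by simp
    then have "f y \<in> ball (f x) e" using r(2) by blast
    then show "\<bar>f y - f x\<bar> < e" by (simp add: dist_real_def abs_minus_commute)
  qed
qed

lemma lipschitz_continuous:
  assumes f: "\<And>x y. x \<in> M \<Longrightarrow> y \<in> M \<Longrightarrow> f x \<le> f y + k * d x y"
  shows "continuous_map mtopology euclideanreal f"
proof -
  have "openin mtopology {x \<in> M. f x \<in> U}" if "open U" for U
    unfolding openin_mtopology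
  proof (intro conjI allI impI)
    fix x assume x: "x \<in> {x \<in> M. f x \<in> U}"
    then obtain e where e: "e > 0" "ball (f x) e \<subseteq> U" using \<open>open U\<close> openE by blast
    define r where "r = e / (\<bar>k\<bar> + 1)"
    have r: "r > 0" using e(1) by (simp add: r_def)
    have "f y \<in> U" if y: "y \<in> mball x r" for y
    proof -
      have my: "y \<in> M" "d x y < r" "x \<in> M" using y by auto
      have "k * d x y \<le> \<bar>k\<bar> * d x y" by (intro mult_right_mono) auto
      also have "\<dots> \<le> (\<bar>k\<bar> + 1) * d x y" by (intro mult_right_mono) auto
      also have "\<dots> < (\<bar>k\<bar> + 1) * r" using my by (intro mult_strict_left_mono) auto
      also have "\<dots> = e" by (simp add: r_def)
      finally have "k * d x y < e" .
      then have "\<bar>f x - f y\<bar> < e" using f[of x y] f[of y x] my by (simp add: commute)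
      then show ?thesis using e(2) by (auto simp: dist_real_def)
    qed
    then show "\<exists>r>0. mball x r \<subseteq> {x \<in> M. f x \<in> U}" using r by (intro exI[of _ r]) auto
  qed auto
  then show ?thesis by (auto simp: continuous_map_def)
qed

lemma envelope_bdd:
  assumes "\<And>y. y \<in> M \<Longrightarrow> 0 \<le> g y" "0 \<le> k"
  shows "bdd_below ((\<lambda>y. g y + k * d x y) ` M)"
  by (rule bdd_belowI[of _ 0]) (use assms in auto)

lemma envelope_nonneg:
  assumes "\<And>y. y \<in> M \<Longrightarrow> 0 \<le> g y" "0 \<le> k" "x \<in> M"
  shows "0 \<le> lipschitz_envelope M d g k x"
  unfolding lipschitz_envelope_def by (rule cINF_greatest) (use assms in auto)

lemma envelope_le:
  assumes "\<And>y. y \<in> M \<Longrightarrow> 0 \<le> g y" "0 \<le> k" "x \<in> M"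
  shows "lipschitz_envelope M d g k x \<le> g x"
  unfolding lipschitz_envelope_def
  using cINF_lower[OF envelope_bdd[OF assms(1,2), where x = x] assms(3)] assms(3) by simp

lemma envelope_lipschitz:
  assumes g: "\<And>y. y \<in> M \<Longrightarrow> 0 \<le> g y" "0 \<le> k" and xy: "x \<in> M" "y \<in> M"
  shows "lipschitz_envelope M d g k x \<le> lipschitz_envelope M d g k y + k * d x y"
proof -
  have "lipschitz_envelope M d g k x - k * d x y \<le> g z + k * d y z" if z: "z \<in> M" for z
  proof -
    have "lipschitz_envelope M d g k x \<le> g z + k * d x z"
      unfolding lipschitz_envelope_def by (rule cINF_lower[OF envelope_bdd[OF g] z])
    moreover have "k * d x z \<le> k * (d x y + d y z)"
      using triangle xy z g(2) by (intro mult_left_mono) auto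
    ultimately show ?thesis by (simp add: algebra_simps)
  qed
  then have "lipschitz_envelope M d g k x - k * d x y \<le> lipschitz_envelope M d g k y"
    unfolding lipschitz_envelope_def[of M d g k y] using xy by (intro cINF_greatest) auto
  then show ?thesis by simp
qed

lemma envelope_continuous:
  assumes "\<And>y. y \<in> M \<Longrightarrow> 0 \<le> g y" "0 \<le> k"
  shows "continuous_map mtopology euclideanreal (lipschitz_envelope M d g k)"
  by (rule lipschitz_continuous[of _ k]) (rule envelope_lipschitz[OF assms])

text \<open>For large \<open>k\<close> the infimum is nearly attained close to \<open>x\<close>, where \<open>g\<close> is close to \<open>g x\<close>.\<close>

lemma envelope_tendsto:
  assumes g: "\<And>y. y \<in> M \<Longrightarrow> 0 \<le> g y" "continuous_map mtopology euclideanreal g" and x: "x \<in> M"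
  shows "(\<lambda>k. lipschitz_envelope M d g (real k) x) \<longlonglongrightarrow> g x"
proof (rule LIMSEQ_I)
  fix e :: real assume e: "0 < e"
  obtain r where r: "r > 0" "\<And>y. y \<in> M \<Longrightarrow> d x y < r \<Longrightarrow> \<bar>g y - g x\<bar> < e / 2"
    using continuous_nearby[OF g(2) x, of "e / 2"] e by auto
  obtain k0 :: nat where k0: "g x / r \<le> real k0" using real_arch_simple by blast
  have "norm (lipschitz_envelope M d g (real k) x - g x) < e" if k: "k0 \<le> k" for k
  proof -
    have kr: "g x \<le> real k * r"
    proof -
      have "g x / r \<le> real k" using k0 k by linarith
      then show ?thesis using r(1) by (simp add: pos_divide_le_eq)
    qed
    have "g x - e / 2 \<le> lipschitz_envelope M d g (real k) x"
      unfolding lipschitz_envelope_def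
    proof (rule cINF_greatest)
      fix y assume y: "y \<in> M"
      show "g x - e / 2 \<le> g y + real k * d x y"
      proof (cases "d x y < r")
        case True
        have "0 \<le> real k * d x y" by simp
        then show ?thesis using r(2)[OF y True] by linarith
      next
        case False
        then have "real k * r \<le> real k * d x y" by (intro mult_left_mono) auto
        then show ?thesis using kr g(1)[OF y] e by linarith
      qed
    qed (use x in auto)
    moreover have "lipschitz_envelope M d g (real k) x \<le> g x"
      by (rule envelope_le[OF g(1) _ x]) simp_all
    ultimately show ?thesis using e by simp
  qed
  then show "\<exists>k0. \<forall>k\<ge>k0. norm (lipschitz_envelope M d g (real k) x - g x) < e" by blast
qed

lemma continuous_along:
  assumes f: "continuous_map mtopology euclideanreal f" and x: "x \<in> M" "\<And>n. y n \<in> M"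
    and lim: "(\<lambda>n. d x (y n)) \<longlonglongrightarrow> 0"
  shows "(\<lambda>n. f (y n)) \<longlonglongrightarrow> f x"
proof (rule LIMSEQ_I)
  fix e :: real assume "0 < e"
  then obtain r where r: "r > 0" "\<And>y. y \<in> M \<Longrightarrow> d x y < r \<Longrightarrow> \<bar>f y - f x\<bar> < e"
    using continuous_nearby[OF f x(1), of e] by auto
  have "\<forall>\<^sub>F n in sequentially. d x (y n) < r" by (rule order_tendstoD(2)[OF lim r(1)])
  then show "\<exists>n0. \<forall>n\<ge>n0. norm (f (y n) - f x) < e"
    unfolding eventually_sequentially using r(2) x(2) by (metis real_norm_def)
qed

end

definition subgrid :: "real \<Rightarrow> real \<Rightarrow> nat \<Rightarrow> nat \<Rightarrow> real" where
  "subgrid u v m k = u + (v - u) * real k / real (Suc m)"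

lemma subgrid_ends: "subgrid u v m 0 = u" "subgrid u v m (Suc m) = v"
  by (simp_all add: subgrid_def del: of_nat_Suc)

lemma subgrid_step: "subgrid u v m (Suc k) - subgrid u v m k = (v - u) / real (Suc m)"
  by (simp add: subgrid_def diff_divide_distrib[symmetric] algebra_simps del: of_nat_Suc) (simp add: algebra_simps add_divide_distrib)

lemma subgrid_mono: "u \<le> v \<Longrightarrow> k \<le> l \<Longrightarrow> subgrid u v m k \<le> subgrid u v m l"
  unfolding subgrid_def by (intro add_left_mono divide_right_mono mult_left_mono) auto

lemma subgrid_near:
  assumes "u < r" "r \<le> v"
  obtains k where "0 < k" "k \<le> Suc m" "r \<le> subgrid u v m k" "subgrid u v m k < r + (v - u) / real (Suc m)"
proof -
  define k where "k = nat \<lceil>(r - u) * real (Suc m) / (v - u)\<rceil>"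
  let ?x = "(r - u) * real (Suc m) / (v - u)"
  have uv: "0 < v - u" using assms by simp
  have x: "0 < ?x" using assms uv by (intro divide_pos_pos mult_pos_pos) simp_all
  have xm: "?x \<le> real (Suc m)"
  proof -
    have "(r - u) * real (Suc m) \<le> (v - u) * real (Suc m)" using assms by (intro mult_right_mono) auto
    then show ?thesis using uv by (simp add: pos_divide_le_eq mult.commute del: of_nat_Suc)
  qed
  have k: "?x \<le> real k" "real k < ?x + 1" using x unfolding k_def by linarith+
  have "0 < k" using k(1) x by (cases k) (simp_all del: of_nat_Suc)
  moreover have "k \<le> Suc m" unfolding k_def using xm by (simp add: nat_le_iff ceiling_le_iff del: of_nat_Suc)
  moreover have rx: "r = u + (v - u) * ?x / real (Suc m)" using uv by (simp del: of_nat_Suc)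
  have "(v - u) * ?x / real (Suc m) \<le> (v - u) * real k / real (Suc m)"
    using k uv by (intro divide_right_mono mult_left_mono) auto
  then have "r \<le> subgrid u v m k" using rx unfolding subgrid_def by linarith
  moreover have "(v - u) * real k / real (Suc m) < (v - u) * (?x + 1) / real (Suc m)"
    using k uv by (intro divide_strict_right_mono mult_strict_left_mono) auto
  then have "subgrid u v m k < r + (v - u) / real (Suc m)"
    using rx unfolding subgrid_def by (simp only: distrib_left add_divide_distrib mult_1_right)
  ultimately show ?thesis using that by blast
qed

lemma change_index:
  assumes "z i \<noteq> z i'" "i \<le> i'"
  shows "\<exists>k. i \<le> k \<and> k < i' \<and> z k \<noteq> z (Suc k)"
  using assms(2,1)
proof (induction i' rule: dec_induct)
  case (step n)
  then show ?case by (cases "z i = z n") (auto intro: less_SucI)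
qed simp

lemma one_jump_on_grid:
  assumes p: "step_path {0..} p" and u: "0 \<le> u" "u < r" "r \<le> v" "p r \<noteq> p u"
  shows "\<forall>\<^sub>F m in sequentially. \<exists>k<Suc m. p (subgrid u v m k) \<noteq> p (subgrid u v m (Suc k))"
proof (cases "r = v")
  case True
  have "\<exists>k<Suc m. p (subgrid u v m k) \<noteq> p (subgrid u v m (Suc k))" for m
    using change_index[of "\<lambda>k. p (subgrid u v m k)" 0 "Suc m"] u True by (auto simp: subgrid_ends)
  then show ?thesis by simp
next
  case False
  have "r \<in> {0..}" using u by simp
  then obtain d where d: "d > 0" "\<And>s. s \<in> {0..} \<Longrightarrow> r \<le> s \<Longrightarrow> s < r + d \<Longrightarrow> p s = p r"
    by (rule step_path_right[OF p]) blast
  have "(\<lambda>m. (v - u) / real (Suc m)) \<longlonglongrightarrow> 0"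
    using LIMSEQ_Suc[OF lim_const_over_n[of "v - u"]] by simp
  then have "\<forall>\<^sub>F m in sequentially. (v - u) / real (Suc m) < d" using d(1) by (rule order_tendstoD(2))
  then show ?thesis
  proof eventually_elim
    case (elim m)
    obtain i where i: "0 < i" "i \<le> Suc m" "r \<le> subgrid u v m i" "subgrid u v m i < r + (v - u) / real (Suc m)"
      by (rule subgrid_near[OF u(2,3)])
    have "p (subgrid u v m i) = p r" by (rule d(2)) (use i elim u in simp_all)
    then have "p (subgrid u v m 0) \<noteq> p (subgrid u v m i)" using u(4) by (simp add: subgrid_ends)
    then obtain k where "k < i" "p (subgrid u v m k) \<noteq> p (subgrid u v m (Suc k))"
      using change_index[of "\<lambda>k. p (subgrid u v m k)" 0 i] by blast
    then show ?case using i(2) by (intro exI[of _ k]) simp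
  qed
qed

text \<open>
  Up to the first jump time \<open>s\<close> the path is constant. A path that is not constant after \<open>s\<close> changes
  again at a later point, and a fine subgrid separates the two changes.
\<close>

lemma two_jumps_on_grid:
  assumes p: "step_path {0..} p" and u: "0 \<le> u" "u < v" and bad: "\<not> single_jump p u v"
  shows "\<forall>\<^sub>F m in sequentially. \<exists>k l. k < l \<and> l < Suc m \<and>
     p (subgrid u v m k) \<noteq> p (subgrid u v m (Suc k)) \<and> p (subgrid u v m l) \<noteq> p (subgrid u v m (Suc l))"
proof -
  define C where "C = {r. u \<le> r \<and> r \<le> v \<and> p r \<noteq> p u}"
  have "C \<noteq> {}"
  proof
    assume C: "C = {}"
    have const: "p r = p u" if "u \<le> r" "r \<le> v" for r using C that unfolding C_def by blast
    have "single_jump p u v"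
      unfolding single_jump_def
    proof (intro exI[of _ v] conjI allI impI)
      show "p r = p u" if "u \<le> r" "r < v" for r by (rule const[OF that(1) less_imp_le[OF that(2)]])
      show "p r = p v" if "v \<le> r" "r \<le> v" for r
        by (rule arg_cong[where f = p], rule order_antisym[OF that(2,1)])
    qed (use u in auto)
    then show False using bad by blast
  qed
  have bdd: "bdd_below C" by (rule bdd_belowI[of _ u]) (auto simp: C_def)
  define s where "s = Inf C"
  have s: "u \<le> s" "s \<le> v"
    unfolding s_def using \<open>C \<noteq> {}\<close> bdd by (auto simp: C_def intro: cInf_greatest cInf_lower2)
  have before: "p r = p u" if r: "u \<le> r" "r < s" for r
  proof (rule ccontr)
    assume "p r \<noteq> p u"
    then have "r \<in> C" using r s by (simp add: C_def)
    then show False using cInf_lower[OF _ bdd] r unfolding s_def by force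
  qed
  have "s \<in> {0..}" using s u by simp
  then obtain d where d: "d > 0" "\<And>r. r \<in> {0..} \<Longrightarrow> s \<le> r \<Longrightarrow> r < s + d \<Longrightarrow> p r = p s"
    by (rule step_path_right[OF p]) blast
  have ps: "p s \<noteq> p u"
  proof
    assume eq: "p s = p u"
    obtain r where r: "r \<in> C" "r < s + d"
      using cInf_lessD[OF \<open>C \<noteq> {}\<close>, of "s + d"] d(1) unfolding s_def by auto
    have "s \<le> r" unfolding s_def by (rule cInf_lower[OF r(1) bdd])
    then have "p r = p s" using r(2) s u by (intro d(2)) auto
    then show False using r(1) eq by (simp add: C_def)
  qed
  then have us: "u < s" using s by (cases "u = s") auto
  have "\<exists>r. s < r \<and> r \<le> v \<and> p r \<noteq> p s"
  proof (rule ccontr)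
    assume none: "\<not> ?thesis"
    have const: "p r = p s" if "s \<le> r" "r \<le> v" for r
    proof (cases "r = s")
      case False
      then have "s < r" using that(1) by simp
      then show ?thesis using none that(2) by blast
    qed simp
    have "single_jump p u v"
      unfolding single_jump_def
    proof (intro exI[of _ s] conjI allI impI us s before)
      show "p r = p v" if "s \<le> r" "r \<le> v" for r
        using const[OF that] const[of v] s by simp
    qed
    then show False using bad by blast
  qed
  then obtain r where r: "s < r" "r \<le> v" "p r \<noteq> p s" by blast
  have r0: "r \<in> {0..}" using r s u by simp
  obtain d' where "d' > 0" "\<And>x. x \<in> {0..} \<Longrightarrow> r \<le> x \<Longrightarrow> x < r + d' \<Longrightarrow> p x = p r"
    by (rule step_path_right[OF p r0]) blast
  moreover have "x \<in> {0..}" if "r \<le> x" for x using that r0 by simp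
  ultimately obtain d' where d': "d' > 0" "\<And>x. r \<le> x \<Longrightarrow> x < r + d' \<Longrightarrow> p x = p r" by blast
  have "(\<lambda>m. (v - u) / real (Suc m)) \<longlonglongrightarrow> 0"
    using LIMSEQ_Suc[OF lim_const_over_n[of "v - u"]] by simp
  then have "\<forall>\<^sub>F m in sequentially. (v - u) / real (Suc m) < min (min d d') (r - s)"
    using d(1) d'(1) r(1) by (intro order_tendstoD(2)) auto
  then show ?thesis
  proof eventually_elim
    case (elim m)
    obtain i where i: "0 < i" "i \<le> Suc m" "s \<le> subgrid u v m i" "subgrid u v m i < s + (v - u) / real (Suc m)"
      by (rule subgrid_near[OF us s(2)])
    have ur: "u < r" using us r by simp
    obtain i' where i': "0 < i'" "i' \<le> Suc m" "r \<le> subgrid u v m i'" "subgrid u v m i' < r + (v - u) / real (Suc m)"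
      by (rule subgrid_near[OF ur r(2)])
    have pi: "p (subgrid u v m i) = p s" by (rule d(2)) (use i elim us u in simp_all)
    have pi': "p (subgrid u v m i') = p r" by (rule d'(2)) (use i' elim in simp_all)
    have "subgrid u v m i < subgrid u v m i'" using i i' elim by simp
    then have ii': "i \<le> i'" using subgrid_mono[of u v i' i m] u by (cases "i \<le> i'") auto
    obtain k where k: "k < i" "p (subgrid u v m k) \<noteq> p (subgrid u v m (Suc k))"
      using change_index[of "\<lambda>k. p (subgrid u v m k)" 0 i] pi ps by (auto simp: subgrid_ends)
    obtain l where l: "i \<le> l" "l < i'" "p (subgrid u v m l) \<noteq> p (subgrid u v m (Suc l))"
      using change_index[of "\<lambda>k. p (subgrid u v m k)" i i'] pi pi' r(3) ii' by auto
    show ?case using k l i'(2) by (intro exI[of _ k] exI[of _ l]) auto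
  qed
qed

section \<open>The error of discretisation\<close>

lemma step_path_cong:
  assumes p: "step_path I p" and eq: "\<And>t. t \<in> I \<Longrightarrow> p' t = p t"
  shows "step_path I p'"
  unfolding step_path_def
proof (intro ballI conjI)
  fix t assume t: "t \<in> I"
  obtain d where d: "d > 0" "\<And>s. s \<in> I \<Longrightarrow> t \<le> s \<Longrightarrow> s < t + d \<Longrightarrow> p s = p t"
    by (rule step_path_right[OF p t]) blast
  show "\<exists>d>0. \<forall>s\<in>I. t < s \<and> s < t + d \<longrightarrow> p' s = p' t"
  proof (intro exI[of _ d] conjI d(1) ballI impI)
    fix s assume s: "s \<in> I" "t < s \<and> s < t + d"
    have "p s = p t" by (rule d(2)) (use s in simp_all)
    then show "p' s = p' t" by (simp only: eq[OF s(1)] eq[OF t])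
  qed
  obtain a d where d: "d > 0" "\<And>s. s \<in> I \<Longrightarrow> t - d < s \<Longrightarrow> s < t \<Longrightarrow> p s = a"
    by (rule step_path_left[OF p t]) blast
  show "\<exists>a. \<exists>d>0. \<forall>s\<in>I. t - d < s \<and> s < t \<longrightarrow> p' s = a"
  proof (intro exI[of _ a] exI[of _ d] conjI d(1) ballI impI)
    fix s assume s: "s \<in> I" "t - d < s \<and> s < t"
    have "p s = a" by (rule d(2)) (use s in simp_all)
    then show "p' s = a" by (simp only: eq[OF s(1)])
  qed
qed

lemma step_function_cong:
  assumes "0 < T" "\<And>i. i \<le> n \<Longrightarrow> z i = z' i"
  shows "step_function T n z = step_function T n z'"
  unfolding step_function_def
proof (rule restrict_ext)
  fix t assume t: "t \<in> {0..T}"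
  have "t * real n / T \<le> real n"
    using t assms(1) mult_right_mono[of t T "real n"] by (simp add: pos_divide_le_eq mult.commute)
  then have "nat \<lfloor>t * real n / T\<rfloor> \<le> n" by linarith
  then show "z (nat \<lfloor>t * real n / T\<rfloor>) = z' (nat \<lfloor>t * real n / T\<rfloor>)" by (rule assms(2))
qed

lemma grid_in:
  assumes "0 < T" "0 < n" "i \<le> n"
  shows "real i * (T / real n) \<in> {0..T}"
proof -
  have "real i * (T / real n) \<le> real n * (T / real n)" using assms by (intro mult_right_mono) auto
  then show ?thesis using assms by simp
qed

lemma discretize_restrict:
  assumes "0 < T" "0 < n"
  shows "discretize T n (restrict p {0..T}) = discretize T n p"
  unfolding discretize_def
  by (rule step_function_cong[OF assms(1)]) (use grid_in[OF assms] in \<open>simp only: restrict_apply'\<close>)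

lemma single_jump_cong:
  assumes sj: "single_jump p u v" and eq: "\<And>r. u \<le> r \<Longrightarrow> r \<le> v \<Longrightarrow> p' r = p r"
  shows "single_jump p' u v"
proof -
  obtain s where s: "u < s" "s \<le> v" "\<And>r. u \<le> r \<Longrightarrow> r < s \<Longrightarrow> p r = p u" "\<And>r. s \<le> r \<Longrightarrow> r \<le> v \<Longrightarrow> p r = p v"
    using sj unfolding single_jump_def by blast
  show ?thesis
    unfolding single_jump_def
  proof (intro exI[of _ s] conjI allI impI s(1,2))
    show "p' r = p' u" if "u \<le> r" "r < s" for r
    proof -
      have "p' r = p r" "p' u = p u" by (rule eq, use that s(1,2) in simp_all)+
      then show ?thesis using s(3)[OF that] by simp
    qed
    show "p' r = p' v" if "s \<le> r" "r \<le> v" for r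
    proof -
      have "p' r = p r" "p' v = p v" by (rule eq, use that s(1,2) in simp_all)+
      then show ?thesis using s(4)[OF that] by simp
    qed
  qed
qed

lemma resolved_restrict:
  assumes T: "0 < T" and res: "resolved T n p"
  shows "resolved T n (restrict p {0..T})"
proof -
  let ?g = "\<lambda>i. real i * (T / real (Suc n))"
  have g: "?g i \<in> {0..T}" if "i \<le> Suc n" for i by (rule grid_in[OF T]) (use that in simp_all)
  show ?thesis
    unfolding resolved_def
  proof (intro conjI allI impI)
    fix i assume i: "i < n"
    have "single_jump p (?g i) (?g (Suc i))" using res i unfolding resolved_def by blast
    then show "single_jump (restrict p {0..T}) (?g i) (?g (Suc i))"
    proof (rule single_jump_cong)
      fix r assume r: "?g i \<le> r" "r \<le> ?g (Suc i)"
      have "0 \<le> ?g i" "?g (Suc i) \<le> T" using g[of i] g[of "Suc i"] i by (simp_all del: of_nat_Suc)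
      then have "0 \<le> r" "r \<le> T" using r by linarith+
      then have "r \<in> {0..T}" by simp
      then show "restrict p {0..T} r = p r" by (rule restrict_apply')
    qed
  next
    fix r assume r: "?g n \<le> r" "r < T"
    have gn: "?g n \<in> {0..T}" by (rule g) simp
    have "p r = p (?g n)" using res r unfolding resolved_def by blast
    moreover have "0 \<le> r" using r gn unfolding atLeastAtMost_iff by linarith
    then have "r \<in> {0..T}" using r by simp
    ultimately show "restrict p {0..T} r = restrict p {0..T} (?g n)" using gn by (simp only: restrict_apply')
  qed
qed

text \<open>A chain observed on the time interval \<open>[0,T]\<close>, whose restricted paths lie in Skorohod space.\<close>

locale step_chain = finite_chain E q L P X x
  for E :: "'a::discrete_topology set" and q L and P :: "'w measure" and X x +
  fixes T :: real
  assumes T: "0 < T"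
begin

abbreviation space_D where "space_D \<equiv> skorohod_space T E"
abbreviation dist_D where "dist_D \<equiv> skorohod_dist T E"
abbreviation topology_D where "topology_D \<equiv> skorohod_topology T E"

sublocale D: Metric_space space_D dist_D
  by (rule Metric_space_skorohod[OF T])

definition path :: "'w \<Rightarrow> real \<Rightarrow> 'a" where
  "path \<omega> = restrict (\<lambda>t. X t \<omega>) {0..T}"

lemma step_X: "\<omega> \<in> space P \<Longrightarrow> step_path {0..} (\<lambda>t. X t \<omega>)"
  using paths by (simp only: cadlag_on_iff_step_path)

lemma step_path_path: "\<omega> \<in> space P \<Longrightarrow> step_path {0..T} (path \<omega>)"
  unfolding path_def
  by (rule step_path_cong[OF step_path_subset[OF step_X]]) (auto simp: restrict_apply')

lemma path_in: "\<omega> \<in> space P \<Longrightarrow> path \<omega> \<in> space_D"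
  using step_path_path[of \<omega>] state_in
  by (auto simp: skorohod_space_def cadlag_on_iff_step_path path_def)

definition sample :: "nat \<Rightarrow> 'w \<Rightarrow> nat \<Rightarrow> 'a" where
  "sample n \<omega> = (\<lambda>i. X (real i * (T / real (Suc n))) \<omega>)"

lemma sample_times: "0 \<le> real i * (T / real (Suc n))" "real 0 * (T / real (Suc n)) = 0" "mono (\<lambda>i. real i * (T / real (Suc n)))"
  using T by (auto simp: mono_def intro!: mult_right_mono divide_right_mono)

lemma sample_step: "real (Suc i) * (T / real (Suc n)) - real i * (T / real (Suc n)) = T / real (Suc n)"
  using real_Suc_mult[of i "T / real (Suc n)"] by linarith

lemma discretize_path: "discretize T (Suc n) (path \<omega>) = step_function T (Suc n) (sample n \<omega>)"
  unfolding path_def discretize_restrict[OF T zero_less_Suc] by (simp only: discretize_def sample_def)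

lemma discretize_in: "\<omega> \<in> space P \<Longrightarrow> discretize T (Suc n) (path \<omega>) \<in> space_D"
  unfolding discretize_path
  by (rule step_function_in_space[OF T]) (use state_in sample_times(1) in \<open>simp_all only: sample_def zero_less_Suc\<close>)

lemma functional_adapted: "adapted (Suc n) (\<lambda>z. F (step_function T (Suc n) z))"
  by (rule adaptedI, rule arg_cong[where f = F], rule step_function_cong[OF T])

lemma functional_integrable: "integrable P (\<lambda>\<omega>. F (discretize T (Suc n) (path \<omega>)) :: real)"
  unfolding discretize_path sample_def
  by (rule history_integrable[OF sample_times(1) functional_adapted])

text \<open>
  The discretised path is a function of finitely many states, so its law is an explicit polynomial
  in transition probabilities.
\<close>

lemma functional_expectation:
  "expectation (\<lambda>\<omega>. F (discretize T (Suc n) (path \<omega>)))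
    = (\<Sum>z\<in>PiE {..Suc n} (\<lambda>_. E). F (step_function T (Suc n) z) * ((if z 0 = x then 1 else 0) *
        (\<Prod>i<Suc n. generator_semigroup L (T / real (Suc n)) (indicator {z (Suc i)}) (z i))))"
proof -
  let ?t = "\<lambda>i. real i * (T / real (Suc n))"
  have "expectation (\<lambda>\<omega>. F (discretize T (Suc n) (path \<omega>)))
     = (\<Sum>z\<in>PiE {..Suc n} (\<lambda>_. E). F (step_function T (Suc n) z) * prob {\<omega> \<in> space P. \<forall>i\<le>Suc n. X (?t i) \<omega> = z i})"
    unfolding discretize_path sample_def
    by (rule history_expectation[where t = ?t, OF sample_times(1) functional_adapted])
  also have "\<dots> = (\<Sum>z\<in>PiE {..Suc n} (\<lambda>_. E). F (step_function T (Suc n) z) * ((if z 0 = x then 1 else 0) *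
        (\<Prod>i<Suc n. generator_semigroup L (T / real (Suc n)) (indicator {z (Suc i)}) (z i))))"
  proof (intro sum.cong refl arg_cong[where f = "(*) _"])
    fix z assume "z \<in> PiE {..Suc n} (\<lambda>_. E)"
    then have z: "z i \<in> E" if "i \<le> Suc n" for i using that by auto
    have "prob {\<omega> \<in> space P. \<forall>i\<le>Suc n. X (?t i) \<omega> = z i} = (if z 0 = x then 1 else 0) *
        (\<Prod>i<Suc n. generator_semigroup L (?t (Suc i) - ?t i) (indicator {z (Suc i)}) (z i))"
      by (rule history_prob[where t = ?t, OF sample_times(2,3) z])
    then show "prob {\<omega> \<in> space P. \<forall>i\<le>Suc n. X (?t i) \<omega> = z i} = (if z 0 = x then 1 else 0) *
        (\<Prod>i<Suc n. generator_semigroup L (T / real (Suc n)) (indicator {z (Suc i)}) (z i))"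
      by (simp only: sample_step)
  qed
  finally show ?thesis .
qed

lemma discretize_tendsto:
  assumes \<omega>: "\<omega> \<in> space P" and F: "continuous_map topology_D euclideanreal F"
  shows "(\<lambda>n. F (discretize T (Suc n) (path \<omega>))) \<longlonglongrightarrow> F (path \<omega>)"
proof (rule D.continuous_along)
  show "continuous_map D.mtopology euclideanreal F" using F by (simp add: skorohod_topology_def)
  have "(\<lambda>n. T / real (Suc n)) \<longlonglongrightarrow> 0"
    using LIMSEQ_Suc[OF lim_const_over_n[of T]] by simp
  moreover have "\<forall>\<^sub>F n in sequentially. norm (dist_D (path \<omega>) (discretize T (Suc n) (path \<omega>))) \<le> T / real (Suc n)"
    using eventually_resolved[OF T step_path_path[OF \<omega>]]
  proof eventually_elim
    case (elim n)
    have "dist_D (path \<omega>) (discretize T (Suc n) (path \<omega>)) \<le> T / real (Suc n)"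
      by (rule resolved_dist[OF T path_in[OF \<omega>] elim])
    then show ?case by (simp only: real_norm_def abs_of_nonneg[OF D.nonneg])
  qed
  ultimately show "(\<lambda>n. dist_D (path \<omega>) (discretize T (Suc n) (path \<omega>))) \<longlonglongrightarrow> 0"
    by (rule Lim_null_comparison[rotated])
qed (use path_in[OF \<omega>] discretize_in[OF \<omega>] in auto)

lemma functional_measurable:
  assumes "continuous_map topology_D euclideanreal F"
  shows "(\<lambda>\<omega>. F (path \<omega>)) \<in> borel_measurable P"
  by (rule borel_measurable_LIMSEQ_real[OF discretize_tendsto[OF _ assms]])
     (auto intro: borel_measurable_integrable functional_integrable)

lemma topspace_D: "topspace topology_D = space_D"
  by (simp add: skorohod_topology_def)

text \<open>
  An open set \<open>U\<close> is the set where the Lipschitz envelope of its indicator is positive. This replaces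
  separability of Skorohod space in proving that the path is a Borel random element: the envelope is
  continuous, hence a limit of functions of discretised paths.
\<close>

lemma open_preimage:
  assumes U: "openin topology_D U"
  shows "path -` U \<inter> space P \<in> sets P"
proof -
  define \<phi> where "\<phi> = lipschitz_envelope space_D dist_D (indicator U) 1"
  have \<phi>: "continuous_map topology_D euclideanreal \<phi>"
    unfolding \<phi>_def skorohod_topology_def by (rule D.envelope_continuous) auto
  have "p \<in> U \<longleftrightarrow> 0 < \<phi> p" if p: "p \<in> space_D" for p
  proof
    assume "p \<in> U"
    then obtain r where r: "r > 0" "D.mball p r \<subseteq> U"
      using U unfolding skorohod_topology_def D.openin_mtopology by blast
    have "min 1 r \<le> \<phi> p"
      unfolding \<phi>_def lipschitz_envelope_def
    proof (rule cINF_greatest)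
      fix y assume y: "y \<in> space_D"
      show "min 1 r \<le> indicator U y + 1 * dist_D p y"
      proof (cases "dist_D p y < r")
        case True
        then have "y \<in> U" using r(2) y p by auto
        then show ?thesis by (simp add: min_le_iff_disj)
      next
        case False
        then show ?thesis by (simp add: min_le_iff_disj indicator_def)
      qed
    qed (use p in auto)
    then show "0 < \<phi> p" using r(1) by linarith
  next
    assume "0 < \<phi> p"
    moreover have "\<phi> p \<le> indicator U p"
      unfolding \<phi>_def by (rule D.envelope_le) (use p in auto)
    ultimately show "p \<in> U" by (cases "p \<in> U") simp_all
  qed
  then have "path -` U \<inter> space P = {\<omega> \<in> space P. 0 < \<phi> (path \<omega>)}"
    using path_in by auto
  then show ?thesis using functional_measurable[OF \<phi>] by simp
qed

lemma path_measurable: "path \<in> P \<rightarrow>\<^sub>M borel_sets_of topology_D"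
  unfolding borel_sets_of_def
proof (rule measurable_measure_of)
  show "{U. openin topology_D U} \<subseteq> Pow (topspace topology_D)"
    using openin_subset by blast
  show "path \<in> space P \<rightarrow> topspace topology_D" using path_in by (simp add: topspace_D)
qed (use open_preimage in auto)

lemma law_integral:
  assumes F: "continuous_map topology_D euclideanreal F"
  shows "(\<integral>p. F p \<partial>(skorohod_law T E P (\<lambda>\<omega> t. X t \<omega>))) = expectation (\<lambda>\<omega>. F (path \<omega>))"
proof -
  have "F \<in> borel_measurable (borel_sets_of topology_D)"
  proof (rule borel_measurableI)
    fix S :: "real set" assume "open S"
    have "space (borel_sets_of topology_D) = topspace topology_D"
      by (simp add: borel_sets_of_def space_measure_of_conv)
    moreover have "openin topology_D {p \<in> topspace topology_D. F p \<in> S}"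
      by (rule openin_continuous_map_preimage[OF F]) (use \<open>open S\<close> in simp)
    then have "{p \<in> topspace topology_D. F p \<in> S} \<in> sets (borel_sets_of topology_D)"
      unfolding borel_sets_of_def by (subst sets_measure_of) (auto dest: openin_subset)
    moreover have "F -` S \<inter> topspace topology_D = {p \<in> topspace topology_D. F p \<in> S}" by auto
    ultimately show "F -` S \<inter> space (borel_sets_of topology_D) \<in> sets (borel_sets_of topology_D)" by simp
  qed
  then have "(\<integral>p. F p \<partial>(distr P (borel_sets_of topology_D) path)) = expectation (\<lambda>\<omega>. F (path \<omega>))"
    by (rule integral_distr[OF path_measurable])
  then show ?thesis by (simp add: skorohod_law_def path_def[abs_def])
qed

lemma change_event:
  assumes "0 \<le> a" "0 \<le> b"
  shows "{\<omega> \<in> space P. X a \<omega> \<noteq> X b \<omega>} \<in> sets P"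
proof -
  define t where "t = (\<lambda>i::nat. if i = 0 then a else b)"
  have "0 \<le> t i" for i using assms by (simp add: t_def)
  moreover have "adapted 1 (\<lambda>z. z 0 \<noteq> z 1)" by (simp add: adapted_def)
  ultimately have "{\<omega> \<in> space P. X (t 0) \<omega> \<noteq> X (t 1) \<omega>} \<in> sets P"
    by (rule history_pred)
  then show ?thesis by (simp add: t_def)
qed

lemma eventually_event:
  assumes A: "\<And>m. A m \<in> sets P" and c: "\<And>m. prob (A m) \<le> c"
  obtains B where "B \<in> sets P" "\<And>\<omega>. \<forall>\<^sub>F m in sequentially. \<omega> \<in> A m \<Longrightarrow> \<omega> \<in> B" "prob B \<le> c"
proof
  let ?I = "\<lambda>k. \<Inter>m\<in>{k..}. A m"
  have I: "?I k \<in> sets P" for k using A by (intro sets.countable_INT) auto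
  show "(\<Union>k. ?I k) \<in> sets P" using I by auto
  show "\<omega> \<in> (\<Union>k. ?I k)" if "\<forall>\<^sub>F m in sequentially. \<omega> \<in> A m" for \<omega>
    using that by (auto simp: eventually_sequentially)
  have "(\<lambda>k. prob (?I k)) \<longlonglongrightarrow> prob (\<Union>k. ?I k)"
    using I by (intro finite_Lim_measure_incseq) (auto simp: incseq_def)
  moreover have "prob (?I k) \<le> c" for k
    using finite_measure_mono[of "?I k" "A k"] A c[of k] by fastforce
  ultimately show "prob (\<Union>k. ?I k) \<le> c"
    by (intro LIMSEQ_le_const2) auto
qed

text \<open>
  A path with several jumps shows two changes on every sufficiently fine subgrid, which by the
  estimate for two jumps has a probability of the order of the square of the length of the interval.
  The set of such paths need not be measurable, hence the measurable superset \<open>B\<close>.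
\<close>

lemma several_jumps_event:
  assumes uv: "0 \<le> u" "u < v" "v - u \<le> 1"
  obtains B where "B \<in> sets P" "\<And>\<omega>. \<omega> \<in> space P \<Longrightarrow> \<not> single_jump (\<lambda>t. X t \<omega>) u v \<Longrightarrow> \<omega> \<in> B"
    "prob B \<le> jump_rate\<^sup>2 * (v - u)\<^sup>2"
proof -
  let ?g = "subgrid u v"
  define J where "J m k = {\<omega> \<in> space P. X (?g m k) \<omega> \<noteq> X (?g m (Suc k)) \<omega>}" for m k
  define I where "I m = {(k, l). k < l \<and> l < Suc m}" for m :: nat
  define A where "A m = (\<Union>(k, l)\<in>I m. J m k \<inter> J m l)" for m
  have I_sub: "I m \<subseteq> {..<Suc m} \<times> {..<Suc m}" for m by (auto simp: I_def)
  have I_fin: "finite (I m)" for m by (rule finite_subset[OF I_sub]) simp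
  have I_card: "real (card (I m)) \<le> (real (Suc m))\<^sup>2" for m
  proof -
    have "card (I m) \<le> card ({..<Suc m} \<times> {..<Suc m})" by (rule card_mono[OF _ I_sub]) simp
    then have "real (card (I m)) \<le> real (Suc m * Suc m)"
      by (simp only: card_cartesian_product card_lessThan of_nat_le_iff)
    then show ?thesis by (simp only: power2_eq_square of_nat_mult)
  qed
  have g0: "0 \<le> ?g m k" for m k
    using uv(1) subgrid_mono[of u v 0 k m] uv by (simp add: subgrid_ends)
  have J: "J m k \<in> sets P" for m k unfolding J_def by (rule change_event[OF g0 g0])
  have A: "A m \<in> sets P" for m
    unfolding A_def using J by (intro sets.finite_UN I_fin) auto
  have h: "0 \<le> (v - u) / real (Suc m)" "(v - u) / real (Suc m) \<le> 1" for m
    using uv by (auto simp: divide_le_eq_1 intro: order_trans)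
  have pair: "prob (J m k \<inter> J m l) \<le> jump_rate\<^sup>2 * ((v - u) / real (Suc m))\<^sup>2" if "(k, l) \<in> I m" for m k l
  proof -
    have kl: "Suc k \<le> l" using that by (simp add: I_def)
    have "prob {\<omega> \<in> space P. X (?g m k) \<omega> \<noteq> X (?g m (Suc k)) \<omega> \<and> X (?g m l) \<omega> \<noteq> X (?g m (Suc l)) \<omega>}
        \<le> jump_rate\<^sup>2 * (?g m (Suc k) - ?g m k) * (?g m (Suc l) - ?g m l)"
    proof (rule two_jumps[OF g0])
      show "?g m k \<le> ?g m (Suc k)" "?g m l \<le> ?g m (Suc l)" "?g m (Suc k) \<le> ?g m l"
        using uv kl by (simp_all add: subgrid_mono)
      show "?g m (Suc k) - ?g m k \<le> 1" "?g m (Suc l) - ?g m l \<le> 1"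
        unfolding subgrid_step by (rule h(2))+
    qed
    moreover have "J m k \<inter> J m l = {\<omega> \<in> space P. X (?g m k) \<omega> \<noteq> X (?g m (Suc k)) \<omega> \<and> X (?g m l) \<omega> \<noteq> X (?g m (Suc l)) \<omega>}"
      by (auto simp: J_def)
    ultimately show ?thesis by (simp only: subgrid_step power2_eq_square mult.assoc)
  qed
  have "prob (A m) \<le> jump_rate\<^sup>2 * (v - u)\<^sup>2" for m
  proof -
    have "prob (A m) \<le> (\<Sum>(k, l)\<in>I m. prob (J m k \<inter> J m l))"
      unfolding A_def case_prod_unfold using J
      by (intro finite_measure_subadditive_finite I_fin) auto
    also have "\<dots> \<le> (\<Sum>(k, l)\<in>I m. jump_rate\<^sup>2 * ((v - u) / real (Suc m))\<^sup>2)"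
      by (intro sum_mono) (use pair in auto)
    also have "\<dots> = real (card (I m)) * (jump_rate\<^sup>2 * ((v - u) / real (Suc m))\<^sup>2)"
      by (simp add: case_prod_unfold)
    also have "\<dots> \<le> (real (Suc m))\<^sup>2 * (jump_rate\<^sup>2 * ((v - u) / real (Suc m))\<^sup>2)"
      by (intro mult_right_mono I_card) simp
    also have "\<dots> = jump_rate\<^sup>2 * (v - u)\<^sup>2"
      by (simp add: power_divide del: of_nat_Suc)
    finally show ?thesis .
  qed
  from eventually_event[of A, OF A this] obtain B where B: "B \<in> sets P"
    "\<And>\<omega>. \<forall>\<^sub>F m in sequentially. \<omega> \<in> A m \<Longrightarrow> \<omega> \<in> B" "prob B \<le> jump_rate\<^sup>2 * (v - u)\<^sup>2" by blast
  show ?thesis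
  proof (rule that[OF B(1) _ B(3)])
    fix \<omega> assume \<omega>: "\<omega> \<in> space P" "\<not> single_jump (\<lambda>t. X t \<omega>) u v"
    show "\<omega> \<in> B"
    proof (rule B(2))
      show "\<forall>\<^sub>F m in sequentially. \<omega> \<in> A m"
        using two_jumps_on_grid[OF step_X[OF \<omega>(1)] uv(1,2) \<omega>(2)]
        by eventually_elim (use \<omega>(1) in \<open>auto simp: A_def I_def J_def\<close>)
    qed
  qed
qed

lemma any_jump_event:
  assumes uv: "0 \<le> u" "u < v" "v - u \<le> 1"
  obtains B where "B \<in> sets P" "\<And>\<omega> r. \<omega> \<in> space P \<Longrightarrow> u \<le> r \<Longrightarrow> r < v \<Longrightarrow> X r \<omega> \<noteq> X u \<omega> \<Longrightarrow> \<omega> \<in> B"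
    "prob B \<le> jump_rate * (v - u)"
proof -
  let ?g = "subgrid u v"
  define J where "J m k = {\<omega> \<in> space P. X (?g m k) \<omega> \<noteq> X (?g m (Suc k)) \<omega>}" for m k
  define A where "A m = (\<Union>k\<in>{..<Suc m}. J m k)" for m
  have g0: "0 \<le> ?g m k" for m k
    using uv(1) subgrid_mono[of u v 0 k m] uv by (simp add: subgrid_ends)
  have J: "J m k \<in> sets P" for m k unfolding J_def by (rule change_event[OF g0 g0])
  have A: "A m \<in> sets P" for m
    unfolding A_def using J by (intro sets.finite_UN) auto
  have h: "(v - u) / real (Suc m) \<le> 1" for m
    using uv by (auto simp: divide_le_eq_1 intro: order_trans)
  have "prob (A m) \<le> jump_rate * (v - u)" for m
  proof -
    have "prob (A m) \<le> (\<Sum>k\<in>{..<Suc m}. prob (J m k))"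
      unfolding A_def using J by (intro finite_measure_subadditive_finite) auto
    also have "\<dots> \<le> (\<Sum>k\<in>{..<Suc m}. jump_rate * ((v - u) / real (Suc m)))"
    proof (rule sum_mono)
      fix k
      have "prob (J m k) \<le> jump_rate * (?g m (Suc k) - ?g m k)"
        unfolding J_def
      proof (rule one_jump[OF g0])
        show "?g m k \<le> ?g m (Suc k)" using uv by (simp add: subgrid_mono)
        show "?g m (Suc k) - ?g m k \<le> 1" unfolding subgrid_step by (rule h)
      qed
      then show "prob (J m k) \<le> jump_rate * ((v - u) / real (Suc m))" by (simp only: subgrid_step)
    qed
    also have "\<dots> = jump_rate * (v - u)" by (simp del: of_nat_Suc)
    finally show ?thesis .
  qed
  from eventually_event[of A, OF A this] obtain B where B: "B \<in> sets P"
    "\<And>\<omega>. \<forall>\<^sub>F m in sequentially. \<omega> \<in> A m \<Longrightarrow> \<omega> \<in> B" "prob B \<le> jump_rate * (v - u)" by blast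
  show ?thesis
  proof (rule that[OF B(1) _ B(3)])
    fix \<omega> r assume \<omega>: "\<omega> \<in> space P" and r: "u \<le> r" "r < v" "X r \<omega> \<noteq> X u \<omega>"
    have ur: "u < r" using r by (cases "u = r") auto
    show "\<omega> \<in> B"
    proof (rule B(2))
      show "\<forall>\<^sub>F m in sequentially. \<omega> \<in> A m"
        using one_jump_on_grid[OF step_X[OF \<omega>] uv(1) ur less_imp_le[OF r(2)] r(3)]
        by eventually_elim (use \<omega> in \<open>auto simp: A_def J_def\<close>)
    qed
  qed
qed

text \<open>
  There are \<open>n\<close> cells, each with several jumps with probability \<open>O(n\<^sup>-\<^sup>2)\<close>, and the last cell has a jump
  with probability \<open>O(n\<^sup>-\<^sup>1)\<close>.
\<close>

lemma unresolved_event: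
  assumes n: "T \<le> real (Suc n)"
  obtains B where "B \<in> sets P" "\<And>\<omega>. \<omega> \<in> space P \<Longrightarrow> \<not> resolved T n (path \<omega>) \<Longrightarrow> \<omega> \<in> B"
    "prob B \<le> (jump_rate\<^sup>2 * T\<^sup>2 + jump_rate * T) / real (Suc n)"
proof -
  let ?h = "T / real (Suc n)" and ?g = "\<lambda>i. real i * (T / real (Suc n))"
  have h: "0 < ?h" "?h \<le> 1" using T n by (auto simp: divide_le_eq_1)
  have g0: "0 \<le> ?g i" for i using T by simp
  have gd: "?g (Suc i) = ?g i + ?h" for i by (rule real_Suc_mult)
  have gn: "?g (Suc n) = T" by simp
  have "\<exists>B. B \<in> sets P \<and> (\<forall>\<omega>\<in>space P. \<not> single_jump (\<lambda>t. X t \<omega>) (?g i) (?g (Suc i)) \<longrightarrow> \<omega> \<in> B)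
     \<and> prob B \<le> jump_rate\<^sup>2 * ?h\<^sup>2" for i
  proof -
    have *: "?g i < ?g (Suc i)" "?g (Suc i) - ?g i = ?h" using gd[of i] h by linarith+
    then have "?g (Suc i) - ?g i \<le> 1" using h by linarith
    from several_jumps_event[OF g0 *(1) this] show ?thesis unfolding *(2) by metis
  qed
  then obtain B where B: "\<And>i. B i \<in> sets P"
    "\<And>i \<omega>. \<omega> \<in> space P \<Longrightarrow> \<not> single_jump (\<lambda>t. X t \<omega>) (?g i) (?g (Suc i)) \<Longrightarrow> \<omega> \<in> B i"
    "\<And>i. prob (B i) \<le> jump_rate\<^sup>2 * ?h\<^sup>2" by metis
  have last: "?g n < T" "T - ?g n = ?h" using gd[of n] gn h by linarith+
  then have "T - ?g n \<le> 1" using h by linarith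
  from any_jump_event[OF g0 last(1) this] obtain C where C: "C \<in> sets P"
    "\<And>\<omega> r. \<omega> \<in> space P \<Longrightarrow> ?g n \<le> r \<Longrightarrow> r < T \<Longrightarrow> X r \<omega> \<noteq> X (?g n) \<omega> \<Longrightarrow> \<omega> \<in> C"
    "prob C \<le> jump_rate * ?h" unfolding last(2) by metis
  define U where "U = (\<Union>i\<in>{..<n}. B i)"
  have U: "U \<in> sets P" unfolding U_def using B(1) by (intro sets.finite_UN) auto
  show ?thesis
  proof (rule that[of "U \<union> C"])
    show "U \<union> C \<in> sets P" using U C(1) by blast
    fix \<omega> assume \<omega>: "\<omega> \<in> space P" "\<not> resolved T n (path \<omega>)"
    then have "\<not> resolved T n (\<lambda>t. X t \<omega>)"
      using resolved_restrict[OF T] unfolding path_def by blast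
    then consider i where "i < n" "\<not> single_jump (\<lambda>t. X t \<omega>) (?g i) (?g (Suc i))"
      | r where "?g n \<le> r" "r < T" "X r \<omega> \<noteq> X (?g n) \<omega>"
      unfolding resolved_def by blast
    then show "\<omega> \<in> U \<union> C"
    proof cases
      case 1 then show ?thesis using B(2)[OF \<omega>(1)] unfolding U_def by blast
    next
      case 2 then show ?thesis using C(2)[OF \<omega>(1)] by blast
    qed
  next
    have "prob U \<le> (\<Sum>i\<in>{..<n}. prob (B i))"
      unfolding U_def using B(1) by (intro finite_measure_subadditive_finite) auto
    also have "\<dots> \<le> real n * (jump_rate\<^sup>2 * ?h\<^sup>2)"
      using sum_bounded_above[of "{..<n}" "\<lambda>i. prob (B i)" "jump_rate\<^sup>2 * ?h\<^sup>2"] B(3) by simp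
    also have "\<dots> \<le> real (Suc n) * (jump_rate\<^sup>2 * ?h\<^sup>2)"
      by (intro mult_right_mono) auto
    also have "\<dots> = jump_rate\<^sup>2 * T\<^sup>2 / real (Suc n)"
      by (simp add: power2_eq_square field_simps del: of_nat_Suc)
    finally have "prob U \<le> jump_rate\<^sup>2 * T\<^sup>2 / real (Suc n)" .
    moreover have "prob (U \<union> C) \<le> prob U + prob C"
      by (rule measure_Un_le[OF U C(1)])
    ultimately show "prob (U \<union> C) \<le> (jump_rate\<^sup>2 * T\<^sup>2 + jump_rate * T) / real (Suc n)"
      using C(3) unfolding add_divide_distrib times_divide_eq_right by linarith
  qed
qed

text \<open>
  On resolved paths the Lipschitz property gives an error \<open>k T / (n+1)\<close>; the others have small
  probability. The bound depends on the chain only through its jump rate.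
\<close>

lemma discretization_error:
  assumes F: "\<And>p. p \<in> space_D \<Longrightarrow> 0 \<le> F p" "\<And>p. p \<in> space_D \<Longrightarrow> F p \<le> c"
    "\<And>p p'. p \<in> space_D \<Longrightarrow> p' \<in> space_D \<Longrightarrow> F p \<le> F p' + k * dist_D p p'" "0 \<le> k"
    and n: "T \<le> real (Suc n)"
  shows "\<bar>expectation (\<lambda>\<omega>. F (path \<omega>)) - expectation (\<lambda>\<omega>. F (discretize T (Suc n) (path \<omega>)))\<bar>
     \<le> (k * T + c * (jump_rate\<^sup>2 * T\<^sup>2 + jump_rate * T)) / real (Suc n)"
proof -
  let ?b = "(jump_rate\<^sup>2 * T\<^sup>2 + jump_rate * T) / real (Suc n)"
  obtain B where B: "B \<in> sets P" "\<And>\<omega>. \<omega> \<in> space P \<Longrightarrow> \<not> resolved T n (path \<omega>) \<Longrightarrow> \<omega> \<in> B" "prob B \<le> ?b"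
    by (rule unresolved_event[OF n]) blast
  have cont: "continuous_map topology_D euclideanreal F"
    unfolding skorohod_topology_def by (rule D.lipschitz_continuous[OF F(3)])
  have int1: "integrable P (\<lambda>\<omega>. F (path \<omega>))"
    by (rule integrable_const_bound[where B = c])
       (use F(1,2) path_in functional_measurable[OF cont] in \<open>auto intro!: AE_I2\<close>)
  have int2: "integrable P (\<lambda>\<omega>. F (discretize T (Suc n) (path \<omega>)))" by (rule functional_integrable)
  have "\<bar>expectation (\<lambda>\<omega>. F (path \<omega>)) - expectation (\<lambda>\<omega>. F (discretize T (Suc n) (path \<omega>)))\<bar>
     = \<bar>expectation (\<lambda>\<omega>. F (path \<omega>) - F (discretize T (Suc n) (path \<omega>)))\<bar>"
    using int1 int2 by simp
  also have "\<dots> \<le> expectation (\<lambda>\<omega>. \<bar>F (path \<omega>) - F (discretize T (Suc n) (path \<omega>))\<bar>)"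
    by (rule integral_abs_bound)
  also have "\<dots> \<le> expectation (\<lambda>\<omega>. k * (T / real (Suc n)) + c * indicator B \<omega>)"
  proof (rule integral_mono)
    show "integrable P (\<lambda>\<omega>. \<bar>F (path \<omega>) - F (discretize T (Suc n) (path \<omega>))\<bar>)"
      by (intro integrable_abs Bochner_Integration.integrable_diff int1 int2)
    show "integrable P (\<lambda>\<omega>. k * (T / real (Suc n)) + c * indicator B \<omega>)"
      by (intro Bochner_Integration.integrable_add integrable_const event_integrable B(1))
    fix \<omega> assume \<omega>: "\<omega> \<in> space P"
    let ?p = "path \<omega>" and ?p' = "discretize T (Suc n) (path \<omega>)"
    have p: "?p \<in> space_D" "?p' \<in> space_D" using path_in[OF \<omega>] discretize_in[OF \<omega>] by auto
    have kT: "0 \<le> k * (T / real (Suc n))" using F(4) T by simp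
    show "\<bar>F ?p - F ?p'\<bar> \<le> k * (T / real (Suc n)) + c * indicator B \<omega>"
    proof (cases "\<omega> \<in> B")
      case True
      then show ?thesis using F(1)[OF p(1)] F(1)[OF p(2)] F(2)[OF p(1)] F(2)[OF p(2)] kT by auto
    next
      case False
      then have "resolved T n ?p" using B(2)[OF \<omega>] by blast
      then have "dist_D ?p ?p' \<le> T / real (Suc n)" by (rule resolved_dist[OF T p(1)])
      then have "k * dist_D ?p ?p' \<le> k * (T / real (Suc n))" using F(4) by (rule mult_left_mono)
      then show ?thesis using F(3)[OF p] F(3)[OF p(2,1)] False by (simp add: D.commute)
    qed
  qed
  also have "\<dots> = k * (T / real (Suc n)) + c * prob B"
    by (subst Bochner_Integration.integral_add[OF integrable_const event_integrable[OF B(1)]])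
       (simp only: event_expectation[OF B(1)] lebesgue_integral_const prob_space scaleR_one)
  also have "\<dots> \<le> k * (T / real (Suc n)) + c * ?b"
  proof -
    obtain \<omega> where "\<omega> \<in> space P" using not_empty by blast
    then have "0 \<le> c" using F(1,2)[OF path_in] by (meson order_trans)
    then show ?thesis using B(3) by (intro add_left_mono mult_left_mono)
  qed
  also have "\<dots> = (k * T + c * (jump_rate\<^sup>2 * T\<^sup>2 + jump_rate * T)) / real (Suc n)"
    by (simp only: add_divide_distrib[of "k * T"] times_divide_eq_right)
  finally show ?thesis .
qed

end

section \<open>Convergence of generators and weak convergence\<close>

lemma (in step_chain) path_integrable:
  assumes "continuous_map topology_D euclideanreal F" "\<And>p. p \<in> space_D \<Longrightarrow> \<bar>F p\<bar> \<le> c"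
  shows "integrable P (\<lambda>\<omega>. F (path \<omega>))"
proof (rule integrable_const_bound[where B = c])
  show "AE \<omega> in P. norm (F (path \<omega>)) \<le> c"
    using assms(2)[OF path_in] by (intro AE_I2) (simp only: real_norm_def)
qed (rule functional_measurable[OF assms(1)])

text \<open>
  For a Lipschitz function of the path, the error of discretisation is uniform in the chain, and the
  law of the discretised path converges with the generators. A continuous bounded function \<open>G\<close> is
  approximated from below by its Lipschitz envelopes, which gives the lower bound for the limit of
  its expectations; applied to \<open>G\<close> and to \<open>-G\<close>, both shifted to be nonnegative, this is convergence.
\<close>

theorem chain_weak_convergence:
  fixes E :: "'a::discrete_topology set" and P :: "nat \<Rightarrow> 'w measure" and Q :: "'v measure"
  assumes chains: "\<And>N. step_chain E (q N) (L N) (P N) (X N) x T"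
    and limit: "step_chain E q' L' Q Y x T"
    and conv: "\<And>y z. y \<in> E \<Longrightarrow> z \<in> E \<Longrightarrow> (\<lambda>N. q N y z) \<longlonglongrightarrow> q' y z"
  shows "weakly_converges (skorohod_topology T E)
    (\<lambda>N. skorohod_law T E (P N) (\<lambda>\<omega> t. X N t \<omega>)) (skorohod_law T E Q (\<lambda>\<omega> t. Y t \<omega>))"
proof -
  interpret c: step_chain E "q N" "L N" "P N" "X N" x T for N by (rule chains)
  interpret l: step_chain E q' L' Q Y x T by (rule limit)
  have ops: "finite_operator E (q N) (L N)" "finite_operator E q' L'" for N by unfold_locales
  obtain J where J: "\<And>N. c.jump_rate N \<le> J" "l.jump_rate \<le> J"
  proof -
    have "(\<lambda>N. c.jump_rate N) \<longlonglongrightarrow> l.jump_rate"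
      unfolding c.jump_rate_def l.jump_rate_def c.bound_def l.bound_def
      by (intro tendsto_intros conv)
    then have "Bseq (\<lambda>N. c.jump_rate N)" by (rule convergent_imp_Bseq[OF convergentI])
    then obtain J where "\<And>N. norm (c.jump_rate N) \<le> J" unfolding Bseq_def by blast
    then have "c.jump_rate N \<le> max J l.jump_rate" for N by (simp add: le_max_iff_disj abs_le_iff)
    then show ?thesis by (rule that) simp
  qed
  have J0: "0 \<le> J" using J(2) l.jump_rate_nonneg by linarith
  have T: "0 < T" by (rule l.T)
  \<comment> \<open>Up to the factor \<open>1/(n+1)\<close>, the probability that a path is not resolved, for all the chains at once.\<close>
  define K where "K = J\<^sup>2 * T\<^sup>2 + J * T"
  have K: "(c.jump_rate N)\<^sup>2 * T\<^sup>2 + c.jump_rate N * T \<le> K" "l.jump_rate\<^sup>2 * T\<^sup>2 + l.jump_rate * T \<le> K" for N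
    unfolding K_def using J c.jump_rate_nonneg l.jump_rate_nonneg T
    by (intro add_mono mult_right_mono power_mono; simp)+
  have lipschitz_case: "(\<lambda>N. c.expectation N (\<lambda>\<omega>. F (c.path N \<omega>))) \<longlonglongrightarrow> l.expectation (\<lambda>\<omega>. F (l.path \<omega>))"
    if F: "\<And>p. p \<in> skorohod_space T E \<Longrightarrow> 0 \<le> F p" "\<And>p. p \<in> skorohod_space T E \<Longrightarrow> F p \<le> b"
      "\<And>p p'. p \<in> skorohod_space T E \<Longrightarrow> p' \<in> skorohod_space T E \<Longrightarrow> F p \<le> F p' + k * skorohod_dist T E p p'" "0 \<le> k"
    for F b k
  proof (rule LIMSEQ_I)
    fix e :: real assume e: "0 < e"
    have b: "0 \<le> b"
    proof -
      obtain \<omega> where "\<omega> \<in> space Q" using l.not_empty by blast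
      then show ?thesis using F(1,2)[OF l.path_in] by (meson order_trans)
    qed
    have "(\<lambda>n. (k * T + b * K) / real (Suc n)) \<longlonglongrightarrow> 0"
      using LIMSEQ_Suc[OF lim_const_over_n[of "k * T + b * K"]] by simp
    then have "\<forall>\<^sub>F n in sequentially. (k * T + b * K) / real (Suc n) < e / 3"
      by (rule order_tendstoD(2)) (use e in simp)
    moreover have "\<forall>\<^sub>F n in sequentially. T \<le> real (Suc n)"
    proof -
      obtain n0 :: nat where "T \<le> real n0" using real_arch_simple by blast
      then show ?thesis unfolding eventually_sequentially by (intro exI[of _ n0]) auto
    qed
    ultimately have "\<forall>\<^sub>F n in sequentially. (k * T + b * K) / real (Suc n) < e / 3 \<and> T \<le> real (Suc n)"
      by (rule eventually_conj)
    then obtain n where n: "(k * T + b * K) / real (Suc n) < e / 3" "T \<le> real (Suc n)"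
      using eventually_happens'[OF sequentially_bot] by blast
    let ?d = "discretize T (Suc n)"
    have "(\<lambda>N. c.expectation N (\<lambda>\<omega>. F (?d (c.path N \<omega>)))) \<longlonglongrightarrow> l.expectation (\<lambda>\<omega>. F (?d (l.path \<omega>)))"
      unfolding c.functional_expectation l.functional_expectation
    proof (intro tendsto_sum tendsto_mult tendsto_const tendsto_prod)
      fix z i assume "z \<in> PiE {..Suc n} (\<lambda>_. E)" "i \<in> {..<Suc n}"
      then have "z i \<in> E" by auto
      then show "(\<lambda>N. generator_semigroup (L N) (T / real (Suc n)) (indicator {z (Suc i)}) (z i))
          \<longlonglongrightarrow> generator_semigroup L' (T / real (Suc n)) (indicator {z (Suc i)}) (z i)"
        by (intro generator_semigroup_tendsto[OF ops conv])
    qed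
    from LIMSEQ_D[OF this, of "e / 3"] obtain N0 where N0:
      "\<And>N. N0 \<le> N \<Longrightarrow> \<bar>c.expectation N (\<lambda>\<omega>. F (?d (c.path N \<omega>))) - l.expectation (\<lambda>\<omega>. F (?d (l.path \<omega>)))\<bar> < e / 3"
      using e by auto
    have mono: "(k * T + b * a) / real (Suc n) < e / 3" if "a \<le> K" for a
    proof -
      have "(k * T + b * a) / real (Suc n) \<le> (k * T + b * K) / real (Suc n)"
        using that b by (intro divide_right_mono add_left_mono mult_left_mono) auto
      then show ?thesis using n(1) by linarith
    qed
    have "\<bar>c.expectation N (\<lambda>\<omega>. F (c.path N \<omega>)) - l.expectation (\<lambda>\<omega>. F (l.path \<omega>))\<bar> < e" if "N0 \<le> N" for N
      using c.discretization_error[of F b k n N, OF F n(2)] l.discretization_error[of F b k n, OF F n(2)]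
        mono[OF K(1)[of N]] mono[OF K(2)] N0[OF that] by linarith
    then show "\<exists>N0. \<forall>N\<ge>N0. norm (c.expectation N (\<lambda>\<omega>. F (c.path N \<omega>)) - l.expectation (\<lambda>\<omega>. F (l.path \<omega>))) < e"
      by auto
  qed
  have lower: "\<forall>\<^sub>F N in sequentially. l.expectation (\<lambda>\<omega>. G (l.path \<omega>)) - e < c.expectation N (\<lambda>\<omega>. G (c.path N \<omega>))"
    if G: "\<And>p. p \<in> skorohod_space T E \<Longrightarrow> 0 \<le> G p" "\<And>p. p \<in> skorohod_space T E \<Longrightarrow> G p \<le> b"
      "continuous_map (skorohod_topology T E) euclideanreal G" and e: "0 < e"
    for G b e
  proof -
    define env where "env k = lipschitz_envelope (skorohod_space T E) (skorohod_dist T E) G (real k)" for k :: nat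
    have env: "0 \<le> env k p" "env k p \<le> G p" "env k p \<le> b" if "p \<in> skorohod_space T E" for k p
    proof -
      show "0 \<le> env k p" unfolding env_def by (rule c.D.envelope_nonneg[OF G(1) _ that]) simp_all
      show "env k p \<le> G p" unfolding env_def by (rule c.D.envelope_le[OF G(1) _ that]) simp_all
      then show "env k p \<le> b" using G(2)[OF that] by linarith
    qed
    have env_cont: "continuous_map (skorohod_topology T E) euclideanreal (env k)" for k
      unfolding env_def skorohod_topology_def by (rule c.D.envelope_continuous[OF G(1)]) simp_all
    have "(\<lambda>k. l.expectation (\<lambda>\<omega>. env k (l.path \<omega>))) \<longlonglongrightarrow> l.expectation (\<lambda>\<omega>. G (l.path \<omega>))"
    proof (rule integral_dominated_convergence[where w = "\<lambda>_. b"])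
      show "(\<lambda>\<omega>. G (l.path \<omega>)) \<in> borel_measurable Q" by (rule l.functional_measurable[OF G(3)])
      show "(\<lambda>\<omega>. env k (l.path \<omega>)) \<in> borel_measurable Q" for k by (rule l.functional_measurable[OF env_cont])
      show "AE \<omega> in Q. (\<lambda>k. env k (l.path \<omega>)) \<longlonglongrightarrow> G (l.path \<omega>)"
        unfolding env_def
        by (intro AE_I2 c.D.envelope_tendsto G(1) l.path_in) (use G(3) in \<open>simp_all only: skorohod_topology_def\<close>)
      show "AE \<omega> in Q. norm (env k (l.path \<omega>)) \<le> b" for k
        using env[OF l.path_in] by (intro AE_I2) simp
    qed simp
    then have "\<forall>\<^sub>F k in sequentially. l.expectation (\<lambda>\<omega>. G (l.path \<omega>)) - e / 2 < l.expectation (\<lambda>\<omega>. env k (l.path \<omega>))"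
      by (rule order_tendstoD(1)) (use e in simp)
    then obtain k where k: "l.expectation (\<lambda>\<omega>. G (l.path \<omega>)) - e / 2 < l.expectation (\<lambda>\<omega>. env k (l.path \<omega>))"
      using eventually_happens'[OF sequentially_bot] by blast
    have "(\<lambda>N. c.expectation N (\<lambda>\<omega>. env k (c.path N \<omega>))) \<longlonglongrightarrow> l.expectation (\<lambda>\<omega>. env k (l.path \<omega>))"
    proof (rule lipschitz_case)
      show "env k p \<le> env k p' + real k * skorohod_dist T E p p'"
        if "p \<in> skorohod_space T E" "p' \<in> skorohod_space T E" for p p'
        unfolding env_def by (rule c.D.envelope_lipschitz[OF G(1) _ that]) simp_all
    qed (use env in auto)
    then have "\<forall>\<^sub>F N in sequentially. l.expectation (\<lambda>\<omega>. env k (l.path \<omega>)) - e / 2 < c.expectation N (\<lambda>\<omega>. env k (c.path N \<omega>))"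
      by (rule order_tendstoD(1)) (use e in simp)
    then show ?thesis
    proof eventually_elim
      case (elim N)
      have "c.expectation N (\<lambda>\<omega>. env k (c.path N \<omega>)) \<le> c.expectation N (\<lambda>\<omega>. G (c.path N \<omega>))"
      proof (rule integral_mono)
        show "integrable (P N) (\<lambda>\<omega>. env k (c.path N \<omega>))"
          by (rule c.path_integrable[OF env_cont, where c = b]) (use env in auto)
        show "integrable (P N) (\<lambda>\<omega>. G (c.path N \<omega>))"
          by (rule c.path_integrable[OF G(3), where c = b]) (use G(1,2) in auto)
      qed (use env(2)[OF c.path_in] in simp)
      then show ?case using elim k by linarith
    qed
  qed
  show ?thesis
    unfolding weakly_converges_def
  proof (intro allI impI)
    fix F assume "continuous_map (skorohod_topology T E) euclideanreal F \<and> bounded (F ` topspace (skorohod_topology T E))"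
    then have F: "continuous_map (skorohod_topology T E) euclideanreal F" "bounded (F ` skorohod_space T E)"
      by (auto simp: l.topspace_D)
    obtain b where b: "\<And>p. p \<in> skorohod_space T E \<Longrightarrow> \<bar>F p\<bar> \<le> b"
      using F(2) unfolding bounded_iff by auto
    have cont: "continuous_map (skorohod_topology T E) euclideanreal (\<lambda>p. F p + b)"
      "continuous_map (skorohod_topology T E) euclideanreal (\<lambda>p. b - F p)"
      by (intro continuous_intros F(1))+
    have bd: "0 \<le> F p + b" "F p + b \<le> 2 * b" "0 \<le> b - F p" "b - F p \<le> 2 * b" if "p \<in> skorohod_space T E" for p
      using b[OF that] by auto
    have intc: "integrable (P N) (\<lambda>\<omega>. F (c.path N \<omega>))" for N by (rule c.path_integrable[OF F(1) b])
    have intl: "integrable Q (\<lambda>\<omega>. F (l.path \<omega>))" by (rule l.path_integrable[OF F(1) b])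
    have "(\<lambda>N. c.expectation N (\<lambda>\<omega>. F (c.path N \<omega>))) \<longlonglongrightarrow> l.expectation (\<lambda>\<omega>. F (l.path \<omega>))"
    proof (rule order_tendstoI)
      fix a assume a: "a < l.expectation (\<lambda>\<omega>. F (l.path \<omega>))"
      have "\<forall>\<^sub>F N in sequentially. l.expectation (\<lambda>\<omega>. F (l.path \<omega>) + b) - (l.expectation (\<lambda>\<omega>. F (l.path \<omega>)) - a)
          < c.expectation N (\<lambda>\<omega>. F (c.path N \<omega>) + b)"
        by (rule lower[OF bd(1,2) cont(1)]) (use a in simp_all)
      then show "\<forall>\<^sub>F N in sequentially. a < c.expectation N (\<lambda>\<omega>. F (c.path N \<omega>))"
        by eventually_elim (simp add: intc intl c.prob_space l.prob_space)
    next
      fix a assume a: "l.expectation (\<lambda>\<omega>. F (l.path \<omega>)) < a"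
      have "\<forall>\<^sub>F N in sequentially. l.expectation (\<lambda>\<omega>. b - F (l.path \<omega>)) - (a - l.expectation (\<lambda>\<omega>. F (l.path \<omega>)))
          < c.expectation N (\<lambda>\<omega>. b - F (c.path N \<omega>))"
        by (rule lower[OF bd(3,4) cont(2)]) (use a in simp_all)
      then show "\<forall>\<^sub>F N in sequentially. c.expectation N (\<lambda>\<omega>. F (c.path N \<omega>)) < a"
        by eventually_elim (simp add: intc intl c.prob_space l.prob_space)
    qed
    then show "(\<lambda>N. \<integral>p. F p \<partial>skorohod_law T E (P N) (\<lambda>\<omega> t. X N t \<omega>)) \<longlonglongrightarrow> (\<integral>p. F p \<partial>skorohod_law T E Q (\<lambda>\<omega> t. Y t \<omega>))"
      by (simp only: c.law_integral[OF F(1)] l.law_integral[OF F(1)])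
  qed
qed

section \<open>The Green function of the discrete torus\<close>

definition freq :: "nat \<Rightarrow> nat \<Rightarrow> real" where
  "freq N k = sin (pi * real k / real N)"

text \<open>
  The exponential rate at which the Fourier mode \<open>k\<close> in the first coordinate decays in the second one:
  \<open>cosh\<close> of it is \<open>2 - cos (2\<pi>k/N)\<close>.
\<close>

definition decay :: "nat \<Rightarrow> nat \<Rightarrow> real" where
  "decay N k = 2 * arsinh (freq N k)"

text \<open>
  The solution, symmetric under \<open>r \<mapsto> N - r\<close>, of \<open>g(r+1) + g(r-1) - 2 cosh (decay N k) g(r) = 0\<close> on
  \<open>0 < r < N\<close>, normalised to have the source \<open>-4\<close> at \<open>r = 0\<close> on the circle of length \<open>N\<close>.
\<close>

definition mode :: "nat \<Rightarrow> nat \<Rightarrow> real \<Rightarrow> real" where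
  "mode N k r = 2 * cosh (decay N k * (real N / 2 - r)) / (sinh (decay N k) * sinh (decay N k * real N / 2))"

text \<open>
  The solution of \<open>\<Delta> g = 4/N\<^sup>2 - 4 \<delta>\<^sub>0\<close> on the discrete torus, written as a Fourier sum in the first
  coordinate. The quadratic polynomial is the mode \<open>k = 0\<close>, for which there is no exponential decay;
  it solves \<open>g(r+1) + g(r-1) - 2 g(r) = 4/N\<^sup>2\<close> on \<open>0 < r < N\<close>.
\<close>

definition green :: "nat \<Rightarrow> int \<Rightarrow> int \<Rightarrow> real" where
  "green N a b = (\<Sum>k\<in>{1..<N}. cos (2 * pi * real k * real_of_int a / real N) * mode N k (real_of_int (b mod int N))) / real N
     + 2 * real_of_int (b mod int N) * (real_of_int (b mod int N) - real N) / (real N)\<^sup>2"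

lemma freq_pos: "k \<in> {1..<N} \<Longrightarrow> 0 < freq N k"
  unfolding freq_def by (rule sin_gt_zero) (auto simp: field_simps)

lemma freq_le_1: "freq N k \<le> 1"
  by (simp add: freq_def)

lemma decay_pos: "k \<in> {1..<N} \<Longrightarrow> 0 < decay N k"
  using freq_pos by (simp add: decay_def)

lemma cosh_decay: "cosh (decay N k) = 2 - cos (2 * pi * real k / real N)"
proof -
  have "cosh (decay N k) = 1 + 2 * (sinh (arsinh (freq N k)))\<^sup>2"
    unfolding decay_def cosh_double cosh_square_eq by simp
  also have "\<dots> = 1 + 2 * (sin (pi * real k / real N))\<^sup>2"
    by (simp add: freq_def)
  also have "\<dots> = 2 - cos (2 * (pi * real k / real N))"
    using cos_double_sin[of "pi * real k / real N"] by simp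
  finally show ?thesis by (simp add: mult.assoc)
qed

lemma sinh_decay: "sinh (decay N k) = 2 * freq N k * sqrt (1 + (freq N k)\<^sup>2)"
proof -
  have "sinh (decay N k) = 2 * sinh (arsinh (freq N k)) * cosh (arsinh (freq N k))"
    unfolding decay_def by (rule sinh_double)
  then show ?thesis by (simp add: cosh_arsinh_real add.commute)
qed

lemma mode_recurrence: "mode N k (r + 1) + mode N k (r - 1) = 2 * cosh (decay N k) * mode N k r"
proof -
  let ?x = "decay N k * (real N / 2 - r)"
  have "cosh (decay N k * (real N / 2 - (r + 1))) = cosh ?x * cosh (decay N k) - sinh ?x * sinh (decay N k)"
    using cosh_diff[of ?x "decay N k"] by (simp add: algebra_simps)
  moreover have "cosh (decay N k * (real N / 2 - (r - 1))) = cosh ?x * cosh (decay N k) + sinh ?x * sinh (decay N k)"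
    using cosh_add[of ?x "decay N k"] by (simp add: algebra_simps)
  ultimately show ?thesis
    by (simp add: mode_def add_divide_distrib[symmetric])
qed

lemma mode_reflect: "mode N k (real N - r) = mode N k r"
proof -
  have "decay N k * (real N / 2 - (real N - r)) = - (decay N k * (real N / 2 - r))" by (simp add: algebra_simps)
  then show ?thesis by (simp only: mode_def cosh_minus)
qed

lemma mode_source:
  assumes "k \<in> {1..<N}"
  shows "2 * mode N k 1 - 2 * cosh (decay N k) * mode N k 0 = - 4"
proof -
  let ?x = "decay N k * real N / 2"
  have "cosh (decay N k * (real N / 2 - 1)) = cosh ?x * cosh (decay N k) - sinh ?x * sinh (decay N k)"
    using cosh_diff[of ?x "decay N k"] by (simp add: algebra_simps)
  moreover have "decay N k * (real N / 2 - 0) = ?x" by simp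
  moreover have "sinh (decay N k) * sinh ?x \<noteq> 0" using decay_pos[OF assms] assms by simp
  ultimately show ?thesis
    unfolding mode_def by (simp only:) (simp add: field_simps)
qed

lemma sum_cos_multiples:
  assumes N: "0 < N"
  shows "(\<Sum>k<N. cos (2 * pi * real k * real_of_int a / real N)) = (if int N dvd a then real N else 0)"
proof (cases "int N dvd a")
  case True
  then obtain c where c: "a = int N * c" by auto
  have "cos (2 * pi * real k * real_of_int a / real N) = 1" for k
  proof -
    have "2 * pi * real k * real_of_int a / real N = 2 * pi * real_of_int (int k * c)"
      using N by (simp add: c field_simps)
    then show ?thesis by (simp only: cos_int_2pin)
  qed
  then show ?thesis using True by simp
next
  case False
  define x where "x = 2 * pi * real_of_int a / real N"
  have "sin (x / 2) \<noteq> 0"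
  proof
    assume "sin (x / 2) = 0"
    then obtain i :: int where i: "x / 2 = of_int i * pi" by (auto simp: sin_zero_iff_int2)
    then have "real_of_int a = real_of_int (int N * i)" using N by (simp add: x_def field_simps)
    then have "a = int N * i" by (simp only: of_int_eq_iff)
    then show False using False by simp
  qed
  have tel: "2 * sin (x / 2) * cos (real k * x) = sin (real (Suc k) * x - x / 2) - sin (real k * x - x / 2)" for k
  proof -
    have eq: "real (Suc k) * x - x / 2 = real k * x + x / 2" by (simp add: algebra_simps)
    show ?thesis unfolding eq sin_add sin_diff by simp
  qed
  have "2 * sin (x / 2) * (\<Sum>k<N. cos (real k * x)) = (\<Sum>k<N. sin (real (Suc k) * x - x / 2) - sin (real k * x - x / 2))"
    by (simp add: sum_distrib_left tel del: of_nat_Suc)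
  also have "\<dots> = sin (real N * x - x / 2) - sin (real 0 * x - x / 2)"
    by (rule sum_lessThan_telescope)
  also have "real N * x = 2 * pi * real_of_int a" using N by (simp add: x_def)
  also have "sin (2 * pi * real_of_int a - x / 2) = - sin (x / 2)"
    by (simp add: sin_diff)
  finally have "2 * sin (x / 2) * (\<Sum>k<N. cos (real k * x)) = 0" by simp
  then have "(\<Sum>k<N. cos (real k * x)) = 0" using \<open>sin (x / 2) \<noteq> 0\<close> by simp
  moreover have "cos (2 * pi * real k * real_of_int a / real N) = cos (real k * x)" for k
    by (simp add: x_def mult_ac)
  ultimately show ?thesis using False by simp
qed

lemma green_periodic: "0 < N \<Longrightarrow> green N (a mod int N) (b mod int N) = green N a b"
proof -
  assume N: "0 < N"
  have "cos (2 * pi * real k * real_of_int (a mod int N) / real N) = cos (2 * pi * real k * real_of_int a / real N)" for k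
  proof -
    have "real_of_int a = real_of_int (a mod int N) + real N * real_of_int (a div int N)"
      by (metis mod_mult_div_eq of_int_add of_int_mult of_int_of_nat_eq)
    then have "2 * pi * real k * real_of_int a / real N
        = 2 * pi * real k * real_of_int (a mod int N) / real N + 2 * pi * real_of_int (int k * (a div int N))"
      using N by (simp add: field_simps)
    then show ?thesis by (simp only: cos_add cos_int_2pin sin_int_2pin)
  qed
  then show ?thesis by (simp add: green_def)
qed

text \<open>
  Away from the line \<open>b = 0\<close> every mode solves the homogeneous recurrence. On this line each mode has
  the source \<open>-4\<close>, and the Fourier sum of equal sources is concentrated at \<open>a = 0\<close>.
\<close>

lemma green_laplacian:
  assumes N: "2 \<le> N"
  shows "green N (a + 1) b + green N (a - 1) b + green N a (b + 1) + green N a (b - 1) - 4 * green N a b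
     = 4 / (real N)\<^sup>2 - (if int N dvd a \<and> int N dvd b then 4 else 0)"
proof -
  define r where "r = b mod int N"
  have r: "0 \<le> r" "r < int N" using N by (auto simp: r_def)
  have N0: "0 < real N" using N by simp
  have mod_up: "(b + 1) mod int N = (r + 1) mod int N" and mod_down: "(b - 1) mod int N = (r - 1) mod int N"
    unfolding r_def by (rule mod_add_left_eq[symmetric], rule mod_diff_left_eq[symmetric])
  define q where "q y = 2 * y * (y - real N) / (real N)\<^sup>2" for y :: real
  define h where "h y = (\<Sum>k\<in>{1..<N}. cos (2 * pi * real k * real_of_int a / real N) * mode N k y)" for y
  have reduce: "green N a c = h (real_of_int (c mod int N)) / real N + q (real_of_int (c mod int N))" for c
    by (simp add: green_def h_def q_def)
  have up: "h (real_of_int ((b + 1) mod int N)) = h (real_of_int r + 1)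
      \<and> q (real_of_int ((b + 1) mod int N)) = q (real_of_int r + 1)"
  proof (cases "r = int N - 1")
    case True
    then have "(b + 1) mod int N = 0" by (simp add: mod_up)
    moreover have "real_of_int r + 1 = real N" using True by simp
    moreover have "h (real N) = h 0" using mode_reflect[of N _ 0] by (simp add: h_def)
    ultimately show ?thesis by (simp add: q_def)
  next
    case False
    then have "(b + 1) mod int N = r + 1"
      unfolding mod_up using r by (intro mod_pos_pos_trivial) auto
    then show ?thesis by simp
  qed
  have horizontal: "green N (a + 1) b + green N (a - 1) b
      = (\<Sum>k\<in>{1..<N}. 2 * cos (2 * pi * real k / real N) * (cos (2 * pi * real k * real_of_int a / real N) * mode N k (real_of_int r))) / real N
        + 2 * q (real_of_int r)"
  proof -
    have "cos (2 * pi * real k * real_of_int (a + 1) / real N) + cos (2 * pi * real k * real_of_int (a - 1) / real N)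
        = 2 * cos (2 * pi * real k / real N) * cos (2 * pi * real k * real_of_int a / real N)" for k
    proof -
      let ?y = "2 * pi * real k * real_of_int a / real N" and ?z = "2 * pi * real k / real N"
      have "2 * pi * real k * real_of_int (a + 1) / real N = ?y + ?z" by (simp add: field_simps add_divide_distrib)
      moreover have "2 * pi * real k * real_of_int (a - 1) / real N = ?y - ?z" by (simp add: field_simps diff_divide_distrib)
      ultimately show ?thesis by (simp add: cos_add cos_diff)
    qed
    then have c: "cos (2 * pi * real k * (real_of_int a + 1) / real N) * m + cos (2 * pi * real k * (real_of_int a - 1) / real N) * m
        = 2 * cos (2 * pi * real k / real N) * (cos (2 * pi * real k * real_of_int a / real N) * m)" for k m
      by (simp add: distrib_right[symmetric] mult.assoc)
    show ?thesis
      unfolding green_def r_def[symmetric] q_def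
      by (simp add: add_divide_distrib[symmetric] sum.distrib[symmetric] c)
  qed
  have vertical_split: "green N (a + 1) b + green N (a - 1) b + green N a (b + 1) + green N a (b - 1) - 4 * green N a b
     = (\<Sum>k\<in>{1..<N}. cos (2 * pi * real k * real_of_int a / real N) *
          (mode N k (real_of_int r + 1) + m k - 2 * cosh (decay N k) * mode N k (real_of_int r))) / real N
       + (q (real_of_int r + 1) + q' - 2 * q (real_of_int r))"
    if down: "green N a (b - 1) = (\<Sum>k\<in>{1..<N}. cos (2 * pi * real k * real_of_int a / real N) * m k) / real N + q'" for m q'
  proof -
    have "green N a b = h (real_of_int r) / real N + q (real_of_int r)"
      using reduce[of b] by (simp add: r_def)
    moreover have "green N a (b + 1) = h (real_of_int r + 1) / real N + q (real_of_int r + 1)"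
      using reduce[of "b + 1"] up by simp
    moreover have "(\<Sum>k\<in>{1..<N}. cos (2 * pi * real k * real_of_int a / real N) *
          (mode N k (real_of_int r + 1) + m k - 2 * cosh (decay N k) * mode N k (real_of_int r)))
       = h (real_of_int r + 1) + (\<Sum>k\<in>{1..<N}. cos (2 * pi * real k * real_of_int a / real N) * m k)
        + (\<Sum>k\<in>{1..<N}. 2 * cos (2 * pi * real k / real N) * (cos (2 * pi * real k * real_of_int a / real N) * mode N k (real_of_int r)))
        - 4 * h (real_of_int r)"
      unfolding h_def cosh_decay
      by (simp add: sum.distrib[symmetric] sum_subtractf[symmetric] sum_distrib_left algebra_simps)
    ultimately show ?thesis
      using horizontal down by (simp add: add_divide_distrib diff_divide_distrib)
  qed
  show ?thesis
  proof (cases "r = 0")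
    case False
    then have "(b - 1) mod int N = r - 1"
      unfolding mod_down using r by (intro mod_pos_pos_trivial) auto
    then have "green N a (b - 1) = (\<Sum>k\<in>{1..<N}. cos (2 * pi * real k * real_of_int a / real N) * mode N k (real_of_int r - 1)) / real N
        + q (real_of_int r - 1)"
      using reduce[of "b - 1"] by (simp add: h_def)
    note split = vertical_split[OF this]
    have zero: "(\<Sum>k\<in>{1..<N}. cos (2 * pi * real k * real_of_int a / real N) *
          (mode N k (real_of_int r + 1) + mode N k (real_of_int r - 1) - 2 * cosh (decay N k) * mode N k (real_of_int r))) = 0"
      by (intro sum.neutral ballI) (simp only: mode_recurrence diff_self mult_zero_right)
    have "q (real_of_int r + 1) + q (real_of_int r - 1) - 2 * q (real_of_int r) = 4 / (real N)\<^sup>2"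
      using N0 by (simp add: q_def field_simps power2_eq_square)
    then show ?thesis
      using False unfolding split zero by (simp add: r_def dvd_eq_mod_eq_0)
  next
    case True
    then have "(b - 1) mod int N = int N - 1"
      unfolding mod_down using N by (simp add: zmod_minus1)
    moreover have "h (real N - 1) = h 1" using mode_reflect[of N _ 1] by (simp add: h_def)
    ultimately have "green N a (b - 1) = (\<Sum>k\<in>{1..<N}. cos (2 * pi * real k * real_of_int a / real N) * mode N k 1) / real N
        + q (real N - 1)"
      using reduce[of "b - 1"] by (simp add: h_def)
    from vertical_split[OF this]
    have "green N (a + 1) b + green N (a - 1) b + green N a (b + 1) + green N a (b - 1) - 4 * green N a b
      = (\<Sum>k\<in>{1..<N}. cos (2 * pi * real k * real_of_int a / real N) *
          (2 * mode N k 1 - 2 * cosh (decay N k) * mode N k 0)) / real N + (q 1 + q (real N - 1) - 2 * q 0)"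
      using True by simp
    also have "(\<Sum>k\<in>{1..<N}. cos (2 * pi * real k * real_of_int a / real N) *
          (2 * mode N k 1 - 2 * cosh (decay N k) * mode N k 0))
        = (\<Sum>k\<in>{1..<N}. cos (2 * pi * real k * real_of_int a / real N) * (- 4))"
      by (intro sum.cong refl) (simp only: mode_source)
    also have "\<dots> = - 4 * (\<Sum>k\<in>{1..<N}. cos (2 * pi * real k * real_of_int a / real N))"
      by (simp add: sum_distrib_left mult.commute sum_negf)
    also have "(\<Sum>k\<in>{1..<N}. cos (2 * pi * real k * real_of_int a / real N)) = (if int N dvd a then real N else 0) - 1"
    proof -
      have "{..<N} = insert 0 {1..<N}" using N by auto
      then have "(\<Sum>k<N. cos (2 * pi * real k * real_of_int a / real N)) = 1 + (\<Sum>k\<in>{1..<N}. cos (2 * pi * real k * real_of_int a / real N))"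
        by simp
      then show ?thesis using sum_cos_multiples[of N a] N by simp
    qed
    also have "q 1 + q (real N - 1) - 2 * q 0 = 4 / (real N)\<^sup>2 - 4 / real N"
      using N0 by (simp add: q_def field_simps power2_eq_square)
    finally have "green N (a + 1) b + green N (a - 1) b + green N a (b + 1) + green N a (b - 1) - 4 * green N a b
      = - 4 * ((if int N dvd a then real N else 0) - 1) / real N + (4 / (real N)\<^sup>2 - 4 / real N)" .
    moreover have "int N dvd b" using True by (simp add: r_def dvd_eq_mod_eq_0)
    moreover have "- 4 * (real N - 1) / real N = - 4 + 4 / real N" using N0 by (simp add: field_simps)
    ultimately show ?thesis by (cases "int N dvd a") simp_all
  qed
qed

lemma sin_ge_half:
  assumes "0 \<le> y" "y \<le> pi / 2"
  shows "y / 2 \<le> sin y" "y - y ^ 3 / 6 \<le> sin y"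
proof -
  have "\<bar>sin y - (\<Sum>m<3. sin_coeff m * y ^ m)\<bar> \<le> inverse (fact 3) * \<bar>y\<bar> ^ 3"
    by (rule Maclaurin_sin_bound)
  moreover have "(\<Sum>m<3. sin_coeff m * y ^ m) = y"
    by (simp add: sin_coeff_def numeral_3_eq_3)
  moreover have "inverse (fact 3) * \<bar>y\<bar> ^ 3 = y ^ 3 / 6"
    using assms(1) by (simp add: fact_numeral)
  ultimately have "\<bar>sin y - y\<bar> \<le> y ^ 3 / 6" by simp
  then show *: "y - y ^ 3 / 6 \<le> sin y" by linarith
  have "y \<le> 17/10" using assms(2) pi_less_4 pi_approx by simp
  then have "y * y \<le> 17/10 * (17/10)" using assms(1) by (intro mult_mono) auto
  then have "y * (y * y) \<le> y * 3" using assms(1) by (intro mult_left_mono) auto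
  then show "y / 2 \<le> sin y" using * by (simp add: power3_eq_cube)
qed

text \<open>
  Both singularities of the cosecant on \<open>[0,\<pi>]\<close> are simple poles of residue one up to sign; by
  symmetry it suffices to compare \<open>sin y\<close> with \<open>y\<close> on the left half.
\<close>

lemma cosecant_bound:
  assumes "0 < y" "y < pi"
  shows "\<bar>1 / sin y - 1 / y - 1 / (pi - y)\<bar> \<le> 1"
proof -
  have half: "\<bar>1 / sin y - 1 / y - 1 / (pi - y)\<bar> \<le> 1" if y: "0 < y" "y \<le> pi / 2" for y
  proof -
    have s: "y / 2 \<le> sin y" "y - y ^ 3 / 6 \<le> sin y" using sin_ge_half[of y] y by auto
    have sp: "0 < sin y" using s(1) y by linarith
    have "sin y \<le> y" using sin_x_le_x y by simp
    then have "0 \<le> 1 / sin y - 1 / y" using sp y by (simp add: frac_le)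
    moreover have "1 / sin y - 1 / y \<le> 1"
    proof -
      have "y \<le> 2" using y pi_less_4 by linarith
      have "1 / sin y - 1 / y = (y - sin y) / (y * sin y)" using sp y by (simp add: field_simps)
      also have "\<dots> \<le> (y ^ 3 / 6) / (y * sin y)" using s(2) sp y by (intro divide_right_mono) auto
      also have "\<dots> \<le> (y ^ 3 / 6) / (y * (y / 2))" using s(1) sp y by (intro divide_left_mono mult_left_mono) auto
      also have "\<dots> = y / 3" using y by (simp add: field_simps power3_eq_cube)
      finally show ?thesis using \<open>y \<le> 2\<close> by linarith
    qed
    moreover have "0 \<le> 1 / (pi - y)" using y pi_gt3 by simp
    moreover have "1 / (pi - y) \<le> 1" using y pi_gt3 by simp
    ultimately show ?thesis by linarith
  qed
  show ?thesis
  proof (cases "y \<le> pi / 2")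
    case True then show ?thesis using half assms by simp
  next
    case False
    then have "\<bar>1 / sin (pi - y) - 1 / (pi - y) - 1 / (pi - (pi - y))\<bar> \<le> 1"
      using assms by (intro half) auto
    then show ?thesis by (simp add: abs_minus_commute algebra_simps)
  qed
qed

lemma freq_lower:
  assumes k: "k \<in> {1..<N}"
  shows "min (real k) (real N - real k) / real N \<le> freq N k"
proof -
  let ?y = "pi * real k / real N"
  have N: "0 < real N" using k by simp
  have main: "real m / real N \<le> sin (pi * real m / real N)" if "2 * m \<le> N" for m :: nat
  proof -
    have "real m * 2 \<le> real N" using that by linarith
    then have "pi * real m / real N \<le> pi / 2" using N by (simp add: field_simps)
    moreover have "0 \<le> pi * real m / real N" using N by simp
    ultimately have "pi * real m / real N / 2 \<le> sin (pi * real m / real N)" by (intro sin_ge_half)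
    moreover have "real m * 2 \<le> real m * pi" using pi_gt3 by (intro mult_left_mono) auto
    then have "real m / real N \<le> pi * real m / real N / 2"
      using N by (simp add: field_simps)
    ultimately show ?thesis by linarith
  qed
  show ?thesis
  proof (cases "2 * k \<le> N")
    case True
    have "min (real k) (real N - real k) / real N \<le> real k / real N" using N by (intro divide_right_mono) auto
    then show ?thesis using main[OF True] by (simp add: freq_def)
  next
    case False
    have "real (N - k) / real N \<le> sin (pi * real (N - k) / real N)" using False by (intro main) simp
    also have "pi * real (N - k) / real N = pi - ?y" using k N by (simp add: of_nat_diff field_simps)
    finally have "(real N - real k) / real N \<le> freq N k" using k by (simp add: freq_def of_nat_diff)
    moreover have "min (real k) (real N - real k) / real N \<le> (real N - real k) / real N" using N by (intro divide_right_mono) auto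
    ultimately show ?thesis by linarith
  qed
qed

lemma arsinh_ge_half:
  assumes "0 \<le> s" "s \<le> 1"
  shows "s / 2 \<le> arsinh (s :: real)"
proof (rule ccontr)
  define y where "y = arsinh s"
  assume "\<not> ?thesis"
  then have y: "y < s / 2" by (simp add: y_def)
  have "0 \<le> sinh y" using assms(1) by (simp add: y_def)
  then have y0: "0 \<le> y" by (simp only: sinh_real_nonneg_iff)
  have "exp y \<le> 1 + y + y\<^sup>2" using y y0 assms by (intro exp_bound) auto
  moreover have "1 - y \<le> exp (- y)" using exp_ge_add_one_self[of "- y"] by simp
  moreover have "sinh y = (exp y - exp (- y)) / 2" by (simp add: sinh_field_def)
  moreover have "sinh y = s" by (simp add: y_def)
  moreover have "y\<^sup>2 \<le> y" using y y0 assms mult_left_mono[of y 1 y] by (simp add: power2_eq_square)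
  ultimately show False using y y0 by simp
qed

lemma decay_lower:
  assumes k: "k \<in> {1..<N}"
  shows "min (real k) (real N - real k) / 2 \<le> decay N k * real N / 2"
proof -
  have N: "0 < real N" using k by simp
  have "min (real k) (real N - real k) \<le> freq N k * real N"
    using freq_lower[OF k] N by (simp add: field_simps)
  also have "\<dots> \<le> (2 * arsinh (freq N k)) * real N"
    using arsinh_ge_half[OF less_imp_le[OF freq_pos[OF k]] freq_le_1] N by (intro mult_right_mono) auto
  finally show ?thesis by (simp add: decay_def)
qed

lemma inverse_square_min:
  assumes "k \<in> {1..<N}"
  shows "1 / (min (real k) (real N - real k))\<^sup>2 \<le> 1 / (real k)\<^sup>2 + 1 / (real N - real k)\<^sup>2"
  by (auto simp: min_def)

lemma sum_inverse_squares: "(\<Sum>k\<in>{1..<N}. 1 / (real k)\<^sup>2) \<le> 2"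
proof -
  have "(\<Sum>k\<in>{1..<Suc n}. 1 / (real k)\<^sup>2) \<le> 2 - 1 / real n" if "1 \<le> n" for n
    using that
  proof (induction n rule: dec_induct)
    case (step n)
    have "1 / (real (Suc n))\<^sup>2 \<le> 1 / (real n * real (Suc n))"
      using step by (intro divide_left_mono) (auto simp: power2_eq_square intro!: mult_right_mono)
    also have "\<dots> = 1 / real n - 1 / real (Suc n)" using step by (simp add: field_simps)
    finally show ?case using step by simp
  qed simp
  then show ?thesis
  proof (cases "N \<le> 1")
    case False
    then obtain n where n: "N = Suc n" "1 \<le> n" by (cases N) auto
    have "(\<Sum>k\<in>{1..<Suc n}. 1 / (real k)\<^sup>2) \<le> 2 - 1 / real n"
      using \<open>\<And>n. 1 \<le> n \<Longrightarrow> _\<close>[OF n(2)] .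
    moreover have "0 \<le> 1 / real n" by simp
    ultimately show ?thesis unfolding n(1) by linarith
  qed auto
qed

lemma sum_reflect: "(\<Sum>k\<in>{1..<N}. f (real N - real k)) = (\<Sum>k\<in>{1..<N}. f (real k) :: real)"
  by (rule sum.reindex_bij_witness[of _ "\<lambda>k. N - k" "\<lambda>k. N - k"]) (auto simp: of_nat_diff)

lemma sum_inverse_square_min: "(\<Sum>k\<in>{1..<N}. 1 / (min (real k) (real N - real k))\<^sup>2) \<le> 4"
proof -
  have "(\<Sum>k\<in>{1..<N}. 1 / (min (real k) (real N - real k))\<^sup>2)
      \<le> (\<Sum>k\<in>{1..<N}. 1 / (real k)\<^sup>2 + 1 / (real N - real k)\<^sup>2)"
    by (intro sum_mono inverse_square_min)
  also have "\<dots> = (\<Sum>k\<in>{1..<N}. 1 / (real k)\<^sup>2) + (\<Sum>k\<in>{1..<N}. 1 / (real k)\<^sup>2)"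
    using sum_reflect[of "\<lambda>y. 1 / y\<^sup>2" N] by (simp add: sum.distrib)
  finally show ?thesis using sum_inverse_squares[of N] by linarith
qed

lemma mode_nonneg: "k \<in> {1..<N} \<Longrightarrow> 0 \<le> mode N k r"
  using decay_pos[of k N] unfolding mode_def by (intro divide_nonneg_nonneg mult_nonneg_nonneg) auto

lemma mode_le_0:
  assumes k: "k \<in> {1..<N}" and r: "0 \<le> r" "r \<le> real N"
  shows "mode N k r \<le> mode N k 0"
proof -
  have d: "0 < decay N k" by (rule decay_pos[OF k])
  have "decay N k * \<bar>real N / 2 - r\<bar> \<le> decay N k * (real N / 2)"
  proof (rule mult_left_mono)
    show "\<bar>real N / 2 - r\<bar> \<le> real N / 2" using r by linarith
  qed (use d in simp)
  then have "\<bar>decay N k * (real N / 2 - r)\<bar> \<le> decay N k * (real N / 2 - 0)"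
    using d by (simp add: abs_mult)
  then have "cosh \<bar>decay N k * (real N / 2 - r)\<bar> \<le> cosh (decay N k * (real N / 2 - 0))"
    using d by (subst cosh_real_nonneg_le_iff) auto
  then have "cosh (decay N k * (real N / 2 - r)) \<le> cosh (decay N k * (real N / 2 - 0))" by simp
  then show ?thesis
    unfolding mode_def using d by (intro divide_right_mono mult_left_mono mult_nonneg_nonneg) auto
qed

lemma green_quadratic:
  assumes "0 < N"
  shows "\<bar>2 * real_of_int (b mod int N) * (real_of_int (b mod int N) - real N) / (real N)\<^sup>2\<bar> \<le> 1"
proof -
  define r where "r = real_of_int (b mod int N)"
  have r: "0 \<le> r" "r \<le> real N" using assms unfolding r_def
    by (simp_all, metis of_int_le_iff of_int_of_nat_eq pos_mod_bound less_imp_le of_nat_0_less_iff)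
  have "4 * (r * (real N - r)) \<le> (real N)\<^sup>2"
    using zero_le_power2[of "real N - 2 * r"] by (simp add: power2_eq_square algebra_simps)
  then have "2 * (r * (real N - r)) \<le> (real N)\<^sup>2" using r mult_nonneg_nonneg[of r "real N - r"] by linarith
  moreover have "\<bar>2 * r * (r - real N)\<bar> = 2 * (r * (real N - r))" using r by (simp add: abs_mult)
  ultimately have "\<bar>2 * r * (r - real N)\<bar> / (real N)\<^sup>2 \<le> 1"
    using assms by (simp add: divide_le_eq_1)
  then show ?thesis by (simp add: r_def abs_mult)
qed

lemma green_mode_bound:
  assumes N: "0 < N"
  shows "\<bar>green N a b\<bar> \<le> (\<Sum>k\<in>{1..<N}. mode N k (real_of_int (b mod int N))) / real N + 1"
proof -
  let ?S = "\<Sum>k\<in>{1..<N}. cos (2 * pi * real k * real_of_int a / real N) * mode N k (real_of_int (b mod int N))"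
  have "\<bar>?S\<bar> \<le> (\<Sum>k\<in>{1..<N}. \<bar>cos (2 * pi * real k * real_of_int a / real N) * mode N k (real_of_int (b mod int N))\<bar>)"
    by (rule sum_abs)
  also have "\<dots> \<le> (\<Sum>k\<in>{1..<N}. mode N k (real_of_int (b mod int N)))"
  proof (rule sum_mono)
    fix k assume "k \<in> {1..<N}"
    then have "0 \<le> mode N k (real_of_int (b mod int N))" by (rule mode_nonneg)
    then show "\<bar>cos (2 * pi * real k * real_of_int a / real N) * mode N k (real_of_int (b mod int N))\<bar> \<le> mode N k (real_of_int (b mod int N))"
      using mult_right_mono[OF abs_cos_le_one[of "2 * pi * real k * real_of_int a / real N"], of "mode N k (real_of_int (b mod int N))"]
      by (simp add: abs_mult)
  qed
  finally have "\<bar>?S / real N\<bar> \<le> (\<Sum>k\<in>{1..<N}. mode N k (real_of_int (b mod int N))) / real N"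
    using N by (simp add: divide_right_mono)
  then show ?thesis
    unfolding green_def using green_quadratic[OF N, of b] by linarith
qed

lemma green_0: "green N 0 0 = (\<Sum>k\<in>{1..<N}. mode N k 0) / real N"
  by (simp add: green_def)

text \<open>Each mode is positive and largest at \<open>r = 0\<close>, and cosines are at most one.\<close>

lemma green_le_green_0:
  assumes N: "0 < N"
  shows "\<bar>green N a b\<bar> \<le> green N 0 0 + 1"
proof -
  have r: "0 \<le> real_of_int (b mod int N)" "real_of_int (b mod int N) \<le> real N"
    using N by (simp_all, metis of_int_le_iff of_int_of_nat_eq pos_mod_bound less_imp_le of_nat_0_less_iff)
  have "(\<Sum>k\<in>{1..<N}. mode N k (real_of_int (b mod int N))) / real N \<le> (\<Sum>k\<in>{1..<N}. mode N k 0) / real N"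
    using mode_le_0[OF _ r] by (intro divide_right_mono sum_mono) auto
  then show ?thesis using green_mode_bound[OF N, of a b] by (simp add: green_0)
qed

text \<open>
  At distance \<open>c N\<close> from the line \<open>b = 0\<close> the mode is of order \<open>exp (-c N decay)/decay\<close>, where \<open>N decay\<close> is
  at least a multiple of \<open>min k (N - k)\<close>. Bounding the exponential by an inverse makes the estimate
  summable over \<open>k\<close>, uniformly in \<open>N\<close>.
\<close>

lemma mode_far:
  assumes k: "k \<in> {1..<N}" and c: "0 < c" and r: "c * real N \<le> r" "r \<le> real N - c * real N"
  shows "mode N k r / real N \<le> 8 / c * (1 / (min (real k) (real N - real k))\<^sup>2)"
proof -
  define m where "m = min (real k) (real N - real k)"
  define x where "x = decay N k * real N / 2"
  have N: "0 < real N" using k by simp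
  have m: "1 \<le> m" using k by (auto simp: m_def min_def)
  have x: "m / 2 \<le> x" using decay_lower[OF k] by (simp add: m_def x_def)
  have x0: "0 < x" using x m by linarith
  define \<beta> where "\<beta> = decay N k"
  have \<beta>: "0 < \<beta>" unfolding \<beta>_def by (rule decay_pos[OF k])
  have f: "0 < freq N k" by (rule freq_pos[OF k])
  have "c * real N \<le> real N / 2" using r by linarith
  then have c2: "2 * c \<le> 1" using N by (simp add: field_simps)
  have "\<beta> * \<bar>real N / 2 - r\<bar> \<le> \<beta> * (real N / 2 - c * real N)"
  proof (rule mult_left_mono)
    show "\<bar>real N / 2 - r\<bar> \<le> real N / 2 - c * real N" using r by linarith
  qed (use \<beta> in simp)
  also have "\<dots> = x * (1 - 2 * c)" by (simp add: x_def \<beta>_def algebra_simps)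
  finally have arg: "\<bar>\<beta> * (real N / 2 - r)\<bar> \<le> x * (1 - 2 * c)" using \<beta> by (simp add: abs_mult)
  have "cosh (\<beta> * (real N / 2 - r)) = cosh \<bar>\<beta> * (real N / 2 - r)\<bar>" by simp
  also have "\<dots> \<le> cosh (x * (1 - 2 * c))"
    using arg x0 c2 by (subst cosh_real_nonneg_le_iff) auto
  also have "\<dots> \<le> exp (x * (1 - 2 * c))"
    using x0 c2 by (simp add: cosh_field_def)
  finally have num: "cosh (\<beta> * (real N / 2 - r)) \<le> exp (x * (1 - 2 * c))" .
  have den: "exp x / 4 \<le> sinh x"
  proof -
    have "2 \<le> exp (2 * x)" using exp_ge_add_one_self[of "2 * x"] x m by linarith
    then have "exp (- x) * 2 \<le> exp (- x) * exp (2 * x)" by (intro mult_left_mono) auto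
    also have "\<dots> = exp x" by (simp add: exp_add[symmetric])
    finally show ?thesis by (simp add: sinh_field_def)
  qed
  have "cosh (\<beta> * (real N / 2 - r)) / sinh x \<le> exp (x * (1 - 2 * c)) / (exp x / 4)"
    by (rule frac_le[OF _ num _ den]) auto
  also have "\<dots> = 4 * exp (- (2 * c * x))"
  proof -
    have "exp (x * (1 - 2 * c)) = exp x * exp (- (2 * c * x))"
      by (simp add: exp_add[symmetric] algebra_simps)
    then show ?thesis by simp
  qed
  also have "\<dots> \<le> 4 / (2 * c * x)"
  proof -
    have "2 * c * x \<le> exp (2 * c * x)" using exp_ge_add_one_self[of "2 * c * x"] by linarith
    then show ?thesis using c x0 by (simp add: exp_minus field_simps)
  qed
  also have "\<dots> \<le> 4 / (c * m)"
    using x m c x0 by (intro divide_left_mono mult_pos_pos) auto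
  finally have ratio: "cosh (\<beta> * (real N / 2 - r)) / sinh x \<le> 4 / (c * m)" .
  have sb: "2 * freq N k \<le> sinh \<beta>"
    unfolding \<beta>_def sinh_decay using f by (simp add: mult_le_cancel_left1)
  have fm: "m / real N \<le> freq N k" using freq_lower[OF k] by (simp add: m_def)
  have "mode N k r / real N = (2 / (sinh \<beta> * real N)) * (cosh (\<beta> * (real N / 2 - r)) / sinh x)"
    by (simp add: mode_def \<beta>_def x_def)
  also have "\<dots> \<le> (2 / (2 * (m / real N) * real N)) * (4 / (c * m))"
  proof (rule mult_mono[OF _ ratio])
    have "2 * (m / real N) * real N \<le> sinh \<beta> * real N"
      using sb fm N by (intro mult_right_mono) auto
    then show "2 / (sinh \<beta> * real N) \<le> 2 / (2 * (m / real N) * real N)"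
      using m N by (intro divide_left_mono mult_pos_pos) (auto simp: \<beta>)
    show "0 \<le> cosh (\<beta> * (real N / 2 - r)) / sinh x" using x0 by simp
  qed (use m N in auto)
  also have "\<dots> = 4 / c * (1 / m\<^sup>2)" using m N c by (simp add: power2_eq_square field_simps)
  also have "\<dots> \<le> 8 / c * (1 / m\<^sup>2)" using c by (intro mult_right_mono divide_right_mono) auto
  finally show ?thesis by (simp add: m_def)
qed

lemma green_far:
  assumes N: "0 < N" and c: "0 < c"
    and r: "c * real N \<le> real_of_int (b mod int N)" "real_of_int (b mod int N) \<le> real N - c * real N"
  shows "\<bar>green N a b\<bar> \<le> 32 / c + 1"
proof -
  have "(\<Sum>k\<in>{1..<N}. mode N k (real_of_int (b mod int N))) / real N
      \<le> (\<Sum>k\<in>{1..<N}. 8 / c * (1 / (min (real k) (real N - real k))\<^sup>2))"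
    unfolding sum_divide_distrib by (intro sum_mono mode_far[OF _ c r])
  also have "\<dots> \<le> 8 / c * 4"
    unfolding sum_distrib_left[symmetric] using c by (intro mult_left_mono sum_inverse_square_min) auto
  finally show ?thesis using green_mode_bound[OF N, of a b] by simp
qed

text \<open>
  At the origin the mode is \<open>2 coth (N decay / 2) / sinh decay\<close>. The hyperbolic cotangent is one up to
  a summable error, and \<open>sinh decay\<close> is \<open>2 sin (\<pi>k/N)\<close> up to a factor \<open>1 + O(sin\<^sup>2)\<close>, so that the poles of
  the cosecant give the main term.
\<close>

lemma mode_0_estimate:
  assumes k: "k \<in> {1..<N}"
  shows "\<bar>mode N k 0 / real N - (1 / real k + 1 / (real N - real k)) / pi\<bar>
     \<le> 4 * (1 / (min (real k) (real N - real k))\<^sup>2) + 2 / real N"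
proof -
  define m where "m = min (real k) (real N - real k)"
  define x where "x = decay N k * real N / 2"
  define s where "s = freq N k"
  define w where "w = sqrt (1 + s\<^sup>2)"
  have N: "0 < real N" using k by simp
  have m: "1 \<le> m" using k by (auto simp: m_def min_def)
  have x: "m / 2 \<le> x" using decay_lower[OF k] by (simp add: m_def x_def)
  have x0: "0 < x" using x m by linarith
  have s: "0 < s" "s \<le> 1" using freq_pos[OF k] freq_le_1 by (auto simp: s_def)
  have sm: "m / real N \<le> s" using freq_lower[OF k] by (simp add: m_def s_def)
  have w1: "1 \<le> w" by (simp add: w_def)
  have w2: "w \<le> 1 + s\<^sup>2"
    unfolding w_def
  proof (rule real_le_lsqrt)
    show "1 + s\<^sup>2 \<le> (1 + s\<^sup>2)\<^sup>2"
      using mult_right_mono[of 1 "1 + s\<^sup>2" "1 + s\<^sup>2"] by (simp add: power2_eq_square[of "1 + s\<^sup>2"])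
  qed simp
  have form: "mode N k 0 / real N = (1 / real N) * ((cosh x / sinh x) * (1 / (s * w)))"
    by (simp add: mode_def x_def sinh_decay s_def w_def)
  have coth: "1 \<le> cosh x / sinh x" "cosh x / sinh x \<le> 1 + 4 / m"
  proof -
    have sh: "0 < sinh x" using x0 by simp
    have "sinh x \<le> cosh x" by (simp add: sinh_field_def cosh_field_def)
    then show "1 \<le> cosh x / sinh x" using sh by simp
    have ex: "exp (- x) \<le> 1" "1 + x \<le> exp x" using x0 exp_ge_add_one_self[of x] by auto
    have "sinh x = (exp x - exp (- x)) / 2" by (simp add: sinh_field_def)
    moreover have "1 + x - 1 \<le> exp x - exp (- x)" by (rule diff_mono[OF ex(2,1)])
    then have "x / 2 \<le> (exp x - exp (- x)) / 2"
      by (intro divide_right_mono) (simp_all only: add_diff_cancel_left' zero_le_numeral)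
    ultimately have half: "x / 2 \<le> sinh x" by (simp only:)
    have "cosh x / sinh x - 1 = exp (- x) / sinh x"
      using sh by (simp add: sinh_field_def cosh_field_def field_simps)
    also have "\<dots> \<le> 1 / (x / 2)" using ex(1) half x0 by (intro frac_le) auto
    also have "\<dots> \<le> 4 / m" using x m x0 by (simp add: field_simps)
    finally show "cosh x / sinh x \<le> 1 + 4 / m" by linarith
  qed
  have e1: "\<bar>(cosh x / sinh x) * (1 / (s * w)) - 1 / (s * w)\<bar> \<le> 4 * real N / m\<^sup>2"
  proof -
    have "s * 1 \<le> s * w" using s w1 by (intro mult_left_mono) auto
    then have sw: "m / real N \<le> s * w" using sm by linarith
    have "\<bar>(cosh x / sinh x) * (1 / (s * w)) - 1 / (s * w)\<bar> = (cosh x / sinh x - 1) * (1 / (s * w))"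
    proof -
      have gen: "\<bar>c * r - r\<bar> = (c - 1) * r" if "1 \<le> c" "0 \<le> r" for c r :: real
      proof -
        have "c * r - r = (c - 1) * r" by (simp add: algebra_simps)
        then show ?thesis using that by simp
      qed
      show ?thesis by (rule gen[OF coth(1)]) (use s w1 in simp)
    qed
    also have "\<dots> \<le> (4 / m) * (1 / (m / real N))"
    proof (rule mult_mono)
      have "0 < s * w" using s w1 by simp
      then show "0 \<le> 1 / (s * w)" by simp
      show "1 / (s * w) \<le> 1 / (m / real N)" by (rule frac_le[OF _ _ _ sw]) (use m N in auto)
    qed (use coth m in auto)
    also have "\<dots> = 4 * real N / m\<^sup>2" using m N by (simp add: power2_eq_square field_simps)
    finally show ?thesis .
  qed
  have e2: "\<bar>1 / (s * w) - 1 / s\<bar> \<le> 1"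
  proof -
    have "\<bar>1 / (s * w) - 1 / s\<bar> = (w - 1) / (s * w)" using s w1 by (simp add: field_simps abs_if)
    also have "\<dots> \<le> s\<^sup>2 / (s * 1)" using w1 w2 s by (intro frac_le mult_left_mono) auto
    also have "\<dots> \<le> 1" using s by (simp add: power2_eq_square)
    finally show ?thesis .
  qed
  define y where "y = pi * real k / real N"
  have y: "0 < y" "y < pi" using k N by (auto simp: y_def field_simps)
  have e3: "\<bar>1 / s - (1 / y + 1 / (pi - y))\<bar> \<le> 1"
    using cosecant_bound[OF y] by (simp add: s_def freq_def y_def algebra_simps)
  have target: "(1 / real k + 1 / (real N - real k)) / pi = (1 / real N) * (1 / y + 1 / (pi - y))"
  proof -
    have "pi - y = pi * (real N - real k) / real N" using N by (simp add: y_def field_simps)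
    then show ?thesis using N k by (simp add: y_def field_simps)
  qed
  have "\<bar>(cosh x / sinh x) * (1 / (s * w)) - (1 / y + 1 / (pi - y))\<bar> \<le> 4 * real N / m\<^sup>2 + 2"
    using e1 e2 e3 by linarith
  then have "(1 / real N) * \<bar>(cosh x / sinh x) * (1 / (s * w)) - (1 / y + 1 / (pi - y))\<bar> \<le> (1 / real N) * (4 * real N / m\<^sup>2 + 2)"
    using N by (intro mult_left_mono) auto
  moreover have "\<bar>mode N k 0 / real N - (1 / real k + 1 / (real N - real k)) / pi\<bar>
      = (1 / real N) * \<bar>(cosh x / sinh x) * (1 / (s * w)) - (1 / y + 1 / (pi - y))\<bar>"
    unfolding form target right_diff_distrib[symmetric] abs_mult using N by simp
  moreover have "(1 / real N) * (4 * real N / m\<^sup>2 + 2) = 4 * (1 / m\<^sup>2) + 2 / real N"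
    using N by (simp add: field_simps)
  ultimately show ?thesis by (simp add: m_def)
qed

text \<open>
  The main terms of the modes sum to \<open>2/\<pi>\<close> times the harmonic number, since \<open>1/k\<close> and \<open>1/(N-k)\<close> have equal
  sums; the errors sum to a constant.
\<close>

lemma green_0_harmonic: "\<bar>green N 0 0 - 2 / pi * harm (N - 1)\<bar> \<le> 18"
proof -
  have h: "harm (N - 1) = (\<Sum>k\<in>{1..<N}. 1 / real k)"
  proof -
    have "{1..N - 1} = {1..<N}" by auto
    then show ?thesis by (simp add: harm_def inverse_eq_divide)
  qed
  have "(\<Sum>k\<in>{1..<N}. (1 / real k + 1 / (real N - real k)) / pi)
      = ((\<Sum>k\<in>{1..<N}. 1 / real k) + (\<Sum>k\<in>{1..<N}. 1 / (real N - real k))) / pi"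
    by (simp only: sum_divide_distrib[symmetric] sum.distrib)
  also have "(\<Sum>k\<in>{1..<N}. 1 / (real N - real k)) = (\<Sum>k\<in>{1..<N}. 1 / real k)"
    by (rule sum_reflect)
  finally have "2 / pi * harm (N - 1) = (\<Sum>k\<in>{1..<N}. (1 / real k + 1 / (real N - real k)) / pi)"
    unfolding h by simp
  then have "green N 0 0 - 2 / pi * harm (N - 1)
      = (\<Sum>k\<in>{1..<N}. mode N k 0 / real N - (1 / real k + 1 / (real N - real k)) / pi)"
    by (simp add: green_0 sum_divide_distrib sum_subtractf)
  also have "\<bar>\<dots>\<bar> \<le> (\<Sum>k\<in>{1..<N}. \<bar>mode N k 0 / real N - (1 / real k + 1 / (real N - real k)) / pi\<bar>)"
    by (rule sum_abs)
  also have "\<dots> \<le> (\<Sum>k\<in>{1..<N}. 4 * (1 / (min (real k) (real N - real k))\<^sup>2) + 2 / real N)"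
    by (intro sum_mono mode_0_estimate)
  also have "\<dots> = 4 * (\<Sum>k\<in>{1..<N}. 1 / (min (real k) (real N - real k))\<^sup>2) + real (N - 1) * (2 / real N)"
    by (simp add: sum.distrib sum_distrib_left)
  also have "\<dots> \<le> 4 * 4 + 2"
  proof (intro add_mono mult_left_mono sum_inverse_square_min)
    show "real (N - 1) * (2 / real N) \<le> 2" by (cases N) (auto simp: field_simps)
  qed simp
  finally show ?thesis by simp
qed

lemma green_0_asymptotics: "(\<lambda>N. green N 0 0 / ln (real N)) \<longlonglongrightarrow> 2 / pi"
proof -
  have ln: "filterlim (\<lambda>N. ln (real N)) at_top sequentially"
    by (rule filterlim_compose[OF ln_at_top filterlim_real_sequentially])
  have inv: "(\<lambda>N. C / ln (real N)) \<longlonglongrightarrow> 0" for C :: real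
    by (rule tendsto_divide_0[OF tendsto_const filterlim_at_top_imp_at_infinity[OF ln]])
  have "(\<lambda>N. harm N - ln (real N)) \<longlonglongrightarrow> (euler_mascheroni :: real)" by (rule euler_mascheroni_LIMSEQ)
  then have "Bseq (\<lambda>N. harm N - ln (real N) :: real)" by (intro convergent_imp_Bseq convergentI)
  then obtain C where C: "\<And>N. norm (harm N - ln (real N) :: real) \<le> C" unfolding Bseq_def by blast
  have "\<forall>\<^sub>F N in sequentially. norm (green N 0 0 / ln (real N) - 2 / pi) \<le> (18 + 2 / pi * (C + 1)) / ln (real N)"
    using eventually_ge_at_top[of 2]
  proof eventually_elim
    case (elim N)
    have l: "0 < ln (real N)" using elim by simp
    have hN: "harm N = harm (N - 1) + 1 / real N" using elim harm_Suc[of "N - 1"] by (simp add: inverse_eq_divide)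
    have "1 / real N \<le> 1" "0 \<le> 1 / real N" using elim by auto
    then have "\<bar>harm (N - 1) - ln (real N)\<bar> \<le> C + 1" using C[of N] hN unfolding real_norm_def by linarith
    then have "2 / pi * \<bar>harm (N - 1) - ln (real N)\<bar> \<le> 2 / pi * (C + 1)" by (intro mult_left_mono) auto
    then have "\<bar>2 / pi * harm (N - 1) - 2 / pi * ln (real N)\<bar> \<le> 2 / pi * (C + 1)"
      by (simp only: right_diff_distrib[symmetric] abs_mult) simp
    then have "\<bar>green N 0 0 - 2 / pi * ln (real N)\<bar> \<le> 18 + 2 / pi * (C + 1)"
      using green_0_harmonic[of N] by linarith
    then have "\<bar>green N 0 0 - 2 / pi * ln (real N)\<bar> / ln (real N) \<le> (18 + 2 / pi * (C + 1)) / ln (real N)"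
      using l by (intro divide_right_mono) auto
    moreover have "green N 0 0 / ln (real N) - 2 / pi = (green N 0 0 - 2 / pi * ln (real N)) / ln (real N)"
      using l by (simp add: field_simps)
    ultimately show ?case using l by (simp add: abs_divide)
  qed
  then have "(\<lambda>N. green N 0 0 / ln (real N) - 2 / pi) \<longlonglongrightarrow> 0"
    by (rule Lim_null_comparison[OF _ inv])
  then show ?thesis by (rule LIM_zero_cancel)
qed

section \<open>Harmonic functions on the discrete torus\<close>

definition laplacian :: "nat \<Rightarrow> (int \<times> int \<Rightarrow> real) \<Rightarrow> int \<times> int \<Rightarrow> real" where
  "laplacian N f z = (\<Sum>y\<in>neighbours N z. f y - f z)"

lemma dvd_small: "3 \<le> N \<Longrightarrow> int N dvd d \<Longrightarrow> \<bar>d\<bar> \<le> 2 \<Longrightarrow> d = 0"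
  using zdvd_imp_le[of "int N" "\<bar>d\<bar>"] by (cases "d = 0") auto

lemma sum_neighbours:
  assumes "3 \<le> N"
  shows "(\<Sum>y\<in>neighbours N (a, b). f y) =
    f ((a + 1) mod int N, b mod int N) + f ((a - 1) mod int N, b mod int N)
    + f (a mod int N, (b + 1) mod int N) + f (a mod int N, (b - 1) mod int N)"
proof -
  let ?s = "\<lambda>e. ((fst (a, b) + fst e) mod int N, (snd (a, b) + snd e) mod int N)"
  let ?D = "{(1, 0), (-1, 0), (0, 1), (0, -1)} :: (int \<times> int) set"
  have "inj_on ?s ?D"
  proof (rule inj_onI)
    fix d d' assume d: "d \<in> ?D" "d' \<in> ?D" and eq: "?s d = ?s d'"
    have "int N dvd fst d - fst d'" "int N dvd snd d - snd d'"
      using eq by (auto simp: mod_eq_dvd_iff)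
    moreover have "\<bar>fst d - fst d'\<bar> \<le> 2" "\<bar>snd d - snd d'\<bar> \<le> 2" using d by auto
    ultimately have "fst d - fst d' = 0" "snd d - snd d' = 0" using dvd_small[OF assms] by blast+
    then show "d = d'" by (simp add: prod_eq_iff)
  qed
  then show ?thesis by (simp add: neighbours_def sum.reindex algebra_simps)
qed

lemma neighbours_in_grid: "0 < N \<Longrightarrow> neighbours N z \<subseteq> grid N"
  by (auto simp: neighbours_def grid_def)

lemma finite_neighbours: "finite (neighbours N z)"
  by (simp add: neighbours_def)

lemma finite_grid: "finite (grid N)"
  by (simp add: grid_def)

lemma laplacian_eq:
  assumes "3 \<le> N"
  shows "laplacian N f (a, b) = f ((a + 1) mod int N, b mod int N) + f ((a - 1) mod int N, b mod int N)
    + f (a mod int N, (b + 1) mod int N) + f (a mod int N, (b - 1) mod int N) - 4 * f (a, b)"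
  unfolding laplacian_def sum_neighbours[OF assms] by simp

lemma card_neighbours: "3 \<le> N \<Longrightarrow> real (card (neighbours N z)) = 4"
  using sum_neighbours[of N "\<lambda>_. 1 :: real" "fst z" "snd z"] by simp

lemma laplacian_sum: "finite I \<Longrightarrow> laplacian N (\<lambda>z. \<Sum>i\<in>I. c i * f i z) z = (\<Sum>i\<in>I. c i * laplacian N (f i) z)"
  unfolding laplacian_def
  by (simp add: sum_subtractf[symmetric] right_diff_distrib[symmetric] sum.swap[of _ I] sum_distrib_left)

lemma laplacian_add: "laplacian N (\<lambda>z. f z + g z) z = laplacian N f z + laplacian N g z"
  unfolding laplacian_def by (simp add: sum.distrib[symmetric] algebra_simps)

lemma laplacian_const: "laplacian N (\<lambda>_. c) z = 0"
  by (simp add: laplacian_def)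

lemma laplacian_cong:
  assumes "0 < N" "z \<in> grid N" "\<And>y. y \<in> grid N \<Longrightarrow> f y = g y"
  shows "laplacian N f z = laplacian N g z"
  unfolding laplacian_def
  using assms neighbours_in_grid[OF assms(1), of z] by (intro sum.cong) auto

text \<open>
  At a maximal point outside \<open>B\<close> all neighbours are maximal as well, so the maximal points would fill
  the torus.
\<close>

lemma maximum_principle:
  assumes N: "3 \<le> N" and B: "B \<subseteq> grid N" "B \<noteq> {}"
    and sub: "\<And>z. z \<in> grid N - B \<Longrightarrow> 0 \<le> laplacian N f z"
    and bound: "\<And>z. z \<in> B \<Longrightarrow> f z \<le> c"
    and z: "z \<in> grid N"
  shows "f z \<le> c"
proof (rule ccontr)
  assume "\<not> f z \<le> c"
  define m where "m = Max (f ` grid N)"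
  have le: "f y \<le> m" if "y \<in> grid N" for y
    unfolding m_def using that finite_grid by (intro Max_ge) auto
  have "m \<in> f ` grid N"
    unfolding m_def using z finite_grid by (intro Max_in) auto
  then obtain y0 where y0: "y0 \<in> grid N" "f y0 = m" by auto
  have mc: "c < m" using le[OF z] \<open>\<not> f z \<le> c\<close> by linarith
  define S where "S = {y \<in> grid N. f y = m}"
  have notB: "y \<notin> B" if "y \<in> S" for y using that bound[of y] mc by (auto simp: S_def)
  have closed: "neighbours N y \<subseteq> S" if y: "y \<in> S" for y
  proof
    fix x assume x: "x \<in> neighbours N y"
    have gy: "y \<in> grid N - B" "f y = m" using y notB[OF y] by (auto simp: S_def)
    have nb: "neighbours N y \<subseteq> grid N" using N by (intro neighbours_in_grid) simp
    have neg: "f x' - f y \<le> 0" if "x' \<in> neighbours N y" for x' using le[of x'] that nb gy by auto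
    have "(\<Sum>x'\<in>neighbours N y. f x' - f y) \<le> f x - f y"
    proof -
      have "(\<Sum>x'\<in>neighbours N y. f x' - f y) = (f x - f y) + (\<Sum>x'\<in>neighbours N y - {x}. f x' - f y)"
        by (rule sum.remove[OF finite_neighbours x])
      moreover have "(\<Sum>x'\<in>neighbours N y - {x}. f x' - f y) \<le> 0" using neg by (intro sum_nonpos) auto
      ultimately show ?thesis by linarith
    qed
    then have "0 \<le> f x - f y" using sub[OF gy(1)] by (simp add: laplacian_def)
    then have "f x = m" using neg[OF x] gy by simp
    then show "x \<in> S" using x nb by (auto simp: S_def)
  qed
  obtain a b where ab: "y0 = (a, b)" by (cases y0)
  have right: "((a + int i) mod int N, b mod int N) \<in> S" for i
  proof (induction i)
    case 0 then show ?case using y0 ab by (auto simp: S_def grid_def)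
  next
    case (Suc i)
    have "((a + int i) mod int N + 1) mod int N = (a + int (Suc i)) mod int N"
      by (simp only: mod_add_left_eq of_nat_Suc add.assoc add.commute[of 1])
    then have "((a + int (Suc i)) mod int N, b mod int N) \<in> neighbours N ((a + int i) mod int N, b mod int N)"
      by (auto simp: neighbours_def intro!: image_eqI[of _ _ "(1, 0)"])
    then show ?case using closed[OF Suc] by blast
  qed
  have up: "((a + int i) mod int N, (b + int k) mod int N) \<in> S" for i k
  proof (induction k)
    case 0 then show ?case using right by simp
  next
    case (Suc k)
    have "((b + int k) mod int N + 1) mod int N = (b + int (Suc k)) mod int N"
      by (simp only: mod_add_left_eq of_nat_Suc add.assoc add.commute[of 1])
    then have "((a + int i) mod int N, (b + int (Suc k)) mod int N) \<in> neighbours N ((a + int i) mod int N, (b + int k) mod int N)"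
      by (auto simp: neighbours_def intro!: image_eqI[of _ _ "(0, 1)"])
    then show ?case using closed[OF Suc] by blast
  qed
  obtain p where p: "p \<in> B" using B by auto
  have pg: "0 \<le> fst p" "fst p < int N" "0 \<le> snd p" "snd p < int N" using p B by (auto simp: grid_def)
  define i where "i = nat ((fst p - a) mod int N)"
  define k where "k = nat ((snd p - b) mod int N)"
  have "(a + int i) mod int N = fst p" "(b + int k) mod int N = snd p"
    using N pg by (simp_all add: i_def k_def mod_add_right_eq)
  then have "p \<in> S" using up[of i k] by simp
  then show False using notB p by blast
qed

lemma harmonic_unique:
  assumes N: "3 \<le> N" and B: "B \<subseteq> grid N" "B \<noteq> {}"
    and harm: "\<And>z. z \<in> grid N - B \<Longrightarrow> laplacian N f z = 0" "\<And>z. z \<in> grid N - B \<Longrightarrow> laplacian N g z = 0"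
    and eq: "\<And>z. z \<in> B \<Longrightarrow> f z = g z" and z: "z \<in> grid N"
  shows "f z = g z"
proof -
  have d: "laplacian N (\<lambda>z. f z - g z) y = laplacian N f y - laplacian N g y" for f g y
    unfolding laplacian_def by (simp add: sum_subtractf[symmetric] algebra_simps)
  have "f z - g z \<le> 0"
    by (rule maximum_principle[OF N B _ _ z, of "\<lambda>z. f z - g z"]) (use d harm eq in simp_all)
  moreover have "g z - f z \<le> 0"
    by (rule maximum_principle[OF N B _ _ z, of "\<lambda>z. g z - f z"]) (use d harm eq in simp_all)
  ultimately show ?thesis by simp
qed

text \<open>
  Replacing a function off \<open>B\<close> by its average over the neighbours, starting from \<open>\<phi>\<close> extended by zero,
  gives an increasing bounded sequence, whose limit is harmonic off \<open>B\<close>.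
\<close>

lemma harmonic_extension_exists:
  assumes N: "3 \<le> N" and \<phi>: "\<And>z. 0 \<le> \<phi> z" "\<And>z. \<phi> z \<le> (1::real)"
  obtains h where "\<And>z. z \<in> B \<Longrightarrow> h z = \<phi> z" "\<And>z. z \<notin> B \<Longrightarrow> laplacian N h z = 0"
proof -
  define F where "F = rec_nat (\<lambda>z. if z \<in> B then \<phi> z else 0)
     (\<lambda>_ f z. if z \<in> B then \<phi> z else (\<Sum>y\<in>neighbours N z. f y) / 4)"
  have F0: "F 0 z = (if z \<in> B then \<phi> z else 0)" for z by (simp add: F_def)
  have FS: "F (Suc n) z = (if z \<in> B then \<phi> z else (\<Sum>y\<in>neighbours N z. F n y) / 4)" for n z
    by (simp add: F_def)
  have bounds: "0 \<le> F n z \<and> F n z \<le> 1" for n z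
  proof (induction n arbitrary: z)
    case 0 then show ?case using \<phi> by (simp add: F0)
  next
    case (Suc n)
    have "(\<Sum>y\<in>neighbours N z. F n y) \<le> (\<Sum>y\<in>neighbours N z. 1)" using Suc by (intro sum_mono) blast
    then have "(\<Sum>y\<in>neighbours N z. F n y) \<le> 4" using card_neighbours[OF N, of z] by simp
    moreover have "0 \<le> (\<Sum>y\<in>neighbours N z. F n y)" using Suc by (intro sum_nonneg) blast
    ultimately show ?case using \<phi> by (simp add: FS)
  qed
  have mono: "F n z \<le> F (Suc n) z" for n z
  proof (induction n arbitrary: z)
    case 0
    then show ?case using bounds by (auto simp: F0 FS[of 0] intro!: sum_nonneg \<phi>)
  next
    case (Suc n)
    have "(\<Sum>y\<in>neighbours N z. F n y) \<le> (\<Sum>y\<in>neighbours N z. F (Suc n) y)"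
      by (intro sum_mono Suc)
    then have "(if z \<in> B then \<phi> z else (\<Sum>y\<in>neighbours N z. F n y) / 4)
        \<le> (if z \<in> B then \<phi> z else (\<Sum>y\<in>neighbours N z. F (Suc n) y) / 4)"
      by (simp only: divide_right_mono split: if_split) simp
    then show ?case unfolding FS[of "Suc n"] FS[of n] .
  qed
  have "convergent (\<lambda>n. F n z)" for z
  proof (rule Bseq_monoseq_convergent)
    show "Bseq (\<lambda>n. F n z)" using bounds[of _ z] by (intro BseqI'[where K = 1]) auto
    show "monoseq (\<lambda>n. F n z)" using mono by (simp add: monoseq_Suc)
  qed
  then have lim: "(\<lambda>n. F n z) \<longlonglongrightarrow> lim (\<lambda>n. F n z)" for z by (simp add: convergent_LIMSEQ_iff)
  define h where "h z = lim (\<lambda>n. F n z)" for z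
  have h: "(\<lambda>n. F n z) \<longlonglongrightarrow> h z" for z using lim by (simp add: h_def)
  show ?thesis
  proof (rule that[of h])
    fix z assume "z \<in> B"
    then have "F n z = \<phi> z" for n by (cases n) (simp_all add: F0 FS)
    then have "(\<lambda>n. \<phi> z) \<longlonglongrightarrow> h z" using h[of z] by simp
    then show "h z = \<phi> z" by (simp add: LIMSEQ_const_iff)
  next
    fix z assume z: "z \<notin> B"
    have "(\<lambda>n. (\<Sum>y\<in>neighbours N z. F n y) / 4) \<longlonglongrightarrow> h z"
      using LIMSEQ_Suc[OF h[of z]] z by (simp add: FS)
    moreover have "(\<lambda>n. (\<Sum>y\<in>neighbours N z. F n y) / 4) \<longlonglongrightarrow> (\<Sum>y\<in>neighbours N z. h y) / 4"
      by (intro tendsto_intros h) simp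
    ultimately have "h z = (\<Sum>y\<in>neighbours N z. h y) / 4"
      by (rule LIMSEQ_unique)
    then show "laplacian N h z = 0"
      using card_neighbours[OF N, of z] by (simp add: laplacian_def sum_subtractf)
  qed
qed

text \<open>The Green function with pole \<open>p\<close>.\<close>

definition kernel :: "nat \<Rightarrow> int \<times> int \<Rightarrow> int \<times> int \<Rightarrow> real" where
  "kernel N p z = green N (fst z - fst p) (snd z - snd p)"

lemma green_cong:
  assumes "0 < N" "a mod int N = a' mod int N" "b mod int N = b' mod int N"
  shows "green N a b = green N a' b'"
  using green_periodic[OF assms(1), of a b] green_periodic[OF assms(1), of a' b'] assms by simp

lemma kernel_laplacian:
  assumes N: "3 \<le> N" and p: "p \<in> grid N" and z: "z \<in> grid N"
  shows "laplacian N (kernel N p) z = 4 / (real N)\<^sup>2 - (if z = p then 4 else 0)"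
proof -
  obtain a b where ab: "z = (a, b)" by (cases z)
  obtain c d where cd: "p = (c, d)" by (cases p)
  have N0: "0 < N" using N by simp
  have shift: "kernel N p (x mod int N, y mod int N) = green N (x - c) (y - d)" for x y
    unfolding kernel_def cd by (rule green_cong[OF N0]) (simp_all add: mod_diff_left_eq)
  have "laplacian N (kernel N p) z = green N (a - c + 1) (b - d) + green N (a - c - 1) (b - d)
     + green N (a - c) (b - d + 1) + green N (a - c) (b - d - 1) - 4 * green N (a - c) (b - d)"
    unfolding ab laplacian_eq[OF N] shift by (simp add: kernel_def cd algebra_simps)
  also have "\<dots> = 4 / (real N)\<^sup>2 - (if int N dvd a - c \<and> int N dvd b - d then 4 else 0)"
    using N by (intro green_laplacian) simp
  also have "int N dvd a - c \<and> int N dvd b - d \<longleftrightarrow> z = p"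
  proof -
    have g: "0 \<le> a" "a < int N" "0 \<le> b" "b < int N" "0 \<le> c" "c < int N" "0 \<le> d" "d < int N"
      using p z by (auto simp: ab cd grid_def)
    have "int N dvd x - y \<longleftrightarrow> x = y" if "0 \<le> x" "x < int N" "0 \<le> y" "y < int N" for x y
      using that by (simp add: mod_eq_dvd_iff[symmetric])
    then show ?thesis using g by (simp add: ab cd)
  qed
  finally show ?thesis .
qed

text \<open>
  The formula is not symmetric in the two coordinates. Both sides solve the same equation and agree
  at the origin, so they agree by the maximum principle.
\<close>

lemma green_swap:
  assumes N: "3 \<le> N"
  shows "green N a b = green N b a"
proof -
  have N0: "0 < N" using N by simp
  have o: "(0, 0) \<in> grid N" using N by (simp add: grid_def)
  let ?f = "kernel N (0, 0)" and ?g = "\<lambda>z. kernel N (0, 0) (snd z, fst z)"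
  have lapg: "laplacian N ?g z = laplacian N ?f (snd z, fst z)" for z
    by (cases z) (simp add: laplacian_eq[OF N])
  have eq: "laplacian N (\<lambda>z. ?f z - ?g z) z = 0" if z: "z \<in> grid N" for z
  proof -
    have "(snd z, fst z) \<in> grid N" using z by (auto simp: grid_def)
    then have "laplacian N ?f z = laplacian N ?g z"
      using kernel_laplacian[OF N o z] kernel_laplacian[OF N o, of "(snd z, fst z)"] lapg[of z]
      by (auto simp: prod_eq_iff)
    moreover have "laplacian N (\<lambda>z. ?f z - ?g z) z = laplacian N ?f z - laplacian N ?g z"
      unfolding laplacian_def by (simp add: sum_subtractf[symmetric] algebra_simps)
    ultimately show ?thesis by simp
  qed
  have z: "(a mod int N, b mod int N) \<in> grid N" using N0 by (simp add: grid_def)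
  have "(\<lambda>z. ?f z - ?g z) (a mod int N, b mod int N) = (\<lambda>z. 0) (a mod int N, b mod int N)"
  proof (rule harmonic_unique[OF N _ _ _ _ _ z])
    show "{(0, 0)} \<subseteq> grid N" using o by simp
  qed (use eq in \<open>simp_all add: laplacian_const\<close>)
  then show ?thesis using green_periodic[OF N0, of a b] green_periodic[OF N0, of b a] by (simp add: kernel_def)
qed

text \<open>
  Macroscopic separation on the torus in at least one of the coordinates; the upper bounds exclude
  closeness around the torus.
\<close>

definition far_apart :: "real \<Rightarrow> nat \<Rightarrow> int \<times> int \<Rightarrow> int \<times> int \<Rightarrow> bool" where
  "far_apart c N p z \<longleftrightarrow>
     (c * real N \<le> real_of_int \<bar>fst z - fst p\<bar> \<and> real_of_int \<bar>fst z - fst p\<bar> \<le> real N - c * real N) \<or>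
     (c * real N \<le> real_of_int \<bar>snd z - snd p\<bar> \<and> real_of_int \<bar>snd z - snd p\<bar> \<le> real N - c * real N)"

text \<open>
  If the separation is in the second coordinate, the decay of the modes applies; otherwise the
  coordinates are exchanged first.
\<close>

lemma kernel_far:
  assumes N: "3 \<le> N" and c: "0 < c" and far: "far_apart c N p z"
  shows "\<bar>kernel N p z\<bar> \<le> 32 / c + 1"
proof -
  have N0: "0 < N" using N by simp
  have coord: "\<bar>green N a b\<bar> \<le> 32 / c + 1"
    if b: "c * real N \<le> real_of_int \<bar>b\<bar>" "real_of_int \<bar>b\<bar> \<le> real N - c * real N" for a b
  proof -
    have "0 < c * real N" using c N0 by simp
    then have "real_of_int \<bar>b\<bar> < real N" using b by linarith
    then have bN: "\<bar>b\<bar> < int N" by linarith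
    have "c * real N \<le> real_of_int (b mod int N) \<and> real_of_int (b mod int N) \<le> real N - c * real N"
    proof (cases "0 \<le> b")
      case True
      then show ?thesis using b bN by simp
    next
      case False
      have "b mod int N = (b + int N) mod int N" by simp
      also have "\<dots> = b + int N" using False bN by (intro mod_pos_pos_trivial) auto
      finally show ?thesis using b False by simp
    qed
    then show ?thesis using green_far[OF N0 c] by blast
  qed
  show ?thesis
    using far unfolding far_apart_def kernel_def
  proof
    assume "c * real N \<le> real_of_int \<bar>fst z - fst p\<bar> \<and> real_of_int \<bar>fst z - fst p\<bar> \<le> real N - c * real N"
    then show "\<bar>green N (fst z - fst p) (snd z - snd p)\<bar> \<le> 32 / c + 1"
      unfolding green_swap[OF N, of "fst z - fst p"] by (intro coord) auto
  next
    assume "c * real N \<le> real_of_int \<bar>snd z - snd p\<bar> \<and> real_of_int \<bar>snd z - snd p\<bar> \<le> real N - c * real N"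
    then show "\<bar>green N (fst z - fst p) (snd z - snd p)\<bar> \<le> 32 / c + 1" by (intro coord) auto
  qed
qed

lemma kernel_self: "kernel N p p = green N 0 0"
  by (simp add: kernel_def)

lemma kernel_bound: "0 < N \<Longrightarrow> \<bar>kernel N p z\<bar> \<le> green N 0 0 + 1"
  unfolding kernel_def by (rule green_le_green_0)

text \<open>
  A linear system whose matrix tends to the identity: summing the absolute values shows first that
  the solutions are bounded, and then that they have the same limit as the right-hand sides.
\<close>

lemma perturbed_identity_tendsto:
  fixes a b :: "nat \<Rightarrow> 'i \<Rightarrow> real"
  assumes I: "finite I"
    and sys: "\<forall>\<^sub>F n in sequentially. \<forall>j\<in>I. b n j = a n j + (\<Sum>l\<in>I. \<epsilon> n l j * a n l)"
    and \<epsilon>: "\<And>l j. l \<in> I \<Longrightarrow> j \<in> I \<Longrightarrow> (\<lambda>n. \<epsilon> n l j) \<longlonglongrightarrow> 0"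
    and b: "\<And>j. j \<in> I \<Longrightarrow> (\<lambda>n. b n j) \<longlonglongrightarrow> b' j"
    and j: "j \<in> I"
  shows "(\<lambda>n. a n j) \<longlonglongrightarrow> b' j"
proof -
  define \<delta> where "\<delta> n = (\<Sum>l\<in>I. \<Sum>j\<in>I. \<bar>\<epsilon> n l j\<bar>)" for n
  define S where "S n = (\<Sum>j\<in>I. \<bar>a n j\<bar>)" for n
  define Q where "Q n = (\<Sum>j\<in>I. \<bar>b n j\<bar>)" for n
  have "\<delta> \<longlonglongrightarrow> (\<Sum>l\<in>I. \<Sum>j\<in>I. \<bar>0\<bar>)"
    unfolding \<delta>_def[abs_def] by (intro tendsto_sum tendsto_rabs \<epsilon>)
  then have \<delta>: "\<delta> \<longlonglongrightarrow> 0" by simp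
  have "Q \<longlonglongrightarrow> (\<Sum>j\<in>I. \<bar>b' j\<bar>)" unfolding Q_def[abs_def] by (intro tendsto_sum tendsto_rabs b)
  then have "Bseq Q" by (intro convergent_imp_Bseq convergentI)
  then obtain C where C: "\<And>n. norm (Q n) \<le> C" unfolding Bseq_def by blast
  have pert: "\<bar>\<Sum>l\<in>I. \<epsilon> n l j * a n l\<bar> \<le> (\<Sum>l\<in>I. \<bar>\<epsilon> n l j\<bar>) * S n" for n j
  proof -
    have "\<bar>\<Sum>l\<in>I. \<epsilon> n l j * a n l\<bar> \<le> (\<Sum>l\<in>I. \<bar>\<epsilon> n l j * a n l\<bar>)" by (rule sum_abs)
    also have "\<dots> \<le> (\<Sum>l\<in>I. \<bar>\<epsilon> n l j\<bar> * S n)"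
      unfolding abs_mult S_def using I
      by (intro sum_mono mult_left_mono member_le_sum[where f = "\<lambda>j. \<bar>a n j\<bar>"]) auto
    finally show ?thesis by (simp add: sum_distrib_right)
  qed
  have S0: "0 \<le> S n" for n by (simp add: S_def sum_nonneg)
  have ev: "\<forall>\<^sub>F n in sequentially. S n \<le> 2 * C"
    using sys order_tendstoD(2)[OF \<delta>, of "1/2", simplified]
  proof eventually_elim
    case (elim n)
    have "S n \<le> (\<Sum>j\<in>I. \<bar>b n j\<bar> + (\<Sum>l\<in>I. \<bar>\<epsilon> n l j\<bar>) * S n)"
      unfolding S_def
    proof (rule sum_mono)
      fix j assume "j \<in> I"
      then have "a n j = b n j - (\<Sum>l\<in>I. \<epsilon> n l j * a n l)" using elim by simp
      then show "\<bar>a n j\<bar> \<le> \<bar>b n j\<bar> + (\<Sum>l\<in>I. \<bar>\<epsilon> n l j\<bar>) * (\<Sum>j\<in>I. \<bar>a n j\<bar>)"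
        using pert[where n = n and j = j] unfolding S_def by linarith
    qed
    also have "\<dots> = Q n + \<delta> n * S n"
      unfolding Q_def \<delta>_def by (subst sum.swap[of _ I I]) (simp add: sum.distrib sum_distrib_right)
    finally have "S n \<le> Q n + \<delta> n * S n" .
    moreover have "\<delta> n * S n \<le> 1/2 * S n" using elim S0[of n] by (intro mult_right_mono) auto
    ultimately show ?case using C[of n] by (simp add: abs_le_iff)
  qed
  have "(\<lambda>n. b n j - a n j) \<longlonglongrightarrow> 0"
  proof (rule Lim_null_comparison)
    show "\<forall>\<^sub>F n in sequentially. norm (b n j - a n j) \<le> (\<Sum>l\<in>I. \<bar>\<epsilon> n l j\<bar>) * (2 * C)"
      using sys ev
    proof eventually_elim
      case (elim n)
      have "norm (b n j - a n j) \<le> (\<Sum>l\<in>I. \<bar>\<epsilon> n l j\<bar>) * S n" using elim(1) j pert[where n = n and j = j] by simp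
      also have "\<dots> \<le> (\<Sum>l\<in>I. \<bar>\<epsilon> n l j\<bar>) * (2 * C)"
        using elim(2) by (intro mult_left_mono sum_nonneg) auto
      finally show ?case .
    qed
    have "(\<lambda>n. (\<Sum>l\<in>I. \<bar>\<epsilon> n l j\<bar>) * (2 * C)) \<longlonglongrightarrow> (\<Sum>l\<in>I. \<bar>0\<bar>) * (2 * C)"
      by (intro tendsto_intros \<epsilon> j)
    then show "(\<lambda>n. (\<Sum>l\<in>I. \<bar>\<epsilon> n l j\<bar>) * (2 * C)) \<longlonglongrightarrow> 0" by simp
  qed
  from tendsto_diff[OF b[OF j] this] show ?thesis by simp
qed

section \<open>The masses of the cells\<close>

definition cell :: "nat \<Rightarrow> int \<times> int \<Rightarrow> (real \<times> real) set" where
  "cell N z = {real_of_int (fst z) / real N ..< (real_of_int (fst z) + 1) / real N} \<times>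
      {real_of_int (snd z) / real N ..< (real_of_int (snd z) + 1) / real N}"

definition cell_index :: "nat \<Rightarrow> real \<times> real \<Rightarrow> int \<times> int" where
  "cell_index N p = (\<lfloor>fst p * real N\<rfloor>, \<lfloor>snd p * real N\<rfloor>)"

lemma cell_mass_eq: "cell_mass W N z = measure W (cell N z)"
  by (simp add: cell_mass_def cell_def)

lemma in_cell_iff:
  assumes "0 < N"
  shows "p \<in> cell N z \<longleftrightarrow> cell_index N p = z"
proof -
  have "a \<in> {real_of_int k / real N ..< (real_of_int k + 1) / real N} \<longleftrightarrow> \<lfloor>a * real N\<rfloor> = k" for a k
    using assms by (auto simp: floor_eq_iff field_simps)
  then show ?thesis by (cases p, cases z) (auto simp: cell_def cell_index_def)
qed

lemma cell_index_in_grid: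
  assumes "0 < N" "p \<in> torus"
  shows "cell_index N p \<in> grid N"
proof -
  have "0 \<le> \<lfloor>a * real N\<rfloor> \<and> \<lfloor>a * real N\<rfloor> < int N" if "0 \<le> a" "a < 1" for a
  proof -
    have "a * real N < 1 * real N" using that assms(1) by (intro mult_strict_right_mono) auto
    then show ?thesis using that by (simp add: floor_less_iff)
  qed
  then show ?thesis using assms(2) by (auto simp: torus_def cell_index_def grid_def)
qed

lemma cell_borel: "cell N z \<in> sets borel"
  unfolding cell_def by (intro borel_Times) auto

lemma far_apart_mono: "far_apart c N p z \<Longrightarrow> c' \<le> c \<Longrightarrow> far_apart c' N p z"
proof -
  assume far: "far_apart c N p z" and c: "c' \<le> c"
  have "c' * real N \<le> c * real N" using c by (intro mult_right_mono) auto
  then show ?thesis using far unfolding far_apart_def by linarith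
qed

lemma far_apart_neq: "far_apart c N p z \<Longrightarrow> 0 < c \<Longrightarrow> 0 < N \<Longrightarrow> p \<noteq> z"
proof -
  assume far: "far_apart c N p z" "0 < c" "0 < N"
  then have "0 < c * real N" by simp
  then show ?thesis using far(1) unfolding far_apart_def by auto
qed

text \<open>
  The cells of two distinct points differ by about \<open>N\<close> times the difference of the coordinates, up to
  an error of one in the floor functions.
\<close>

lemma distinct_points_far_apart:
  assumes p: "p \<in> torus" "q \<in> torus" "p \<noteq> q"
  obtains c where "0 < c" "\<forall>\<^sub>F N in sequentially. far_apart c N (cell_index N p) (cell_index N q)"
proof -
  have coord: "\<exists>c>0. \<forall>\<^sub>F N in sequentially. c * real N \<le> real_of_int \<bar>\<lfloor>b * real N\<rfloor> - \<lfloor>a * real N\<rfloor>\<bar>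
      \<and> real_of_int \<bar>\<lfloor>b * real N\<rfloor> - \<lfloor>a * real N\<rfloor>\<bar> \<le> real N - c * real N"
    if ab: "0 \<le> a" "a < 1" "0 \<le> b" "b < 1" "a \<noteq> b" for a b :: real
  proof -
    define d where "d = \<bar>b - a\<bar>"
    define m where "m = min d (1 - d)"
    have m: "0 < m" "m \<le> d" "m \<le> 1 - d" using ab by (auto simp: m_def d_def min_def)
    obtain n0 :: nat where n0: "2 / m \<le> real n0" using real_arch_simple by blast
    have "m / 2 * real N \<le> real_of_int \<bar>\<lfloor>b * real N\<rfloor> - \<lfloor>a * real N\<rfloor>\<bar>
      \<and> real_of_int \<bar>\<lfloor>b * real N\<rfloor> - \<lfloor>a * real N\<rfloor>\<bar> \<le> real N - m / 2 * real N" if N: "n0 \<le> N" for N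
    proof -
      have "2 / m \<le> real N" using n0 N by (meson of_nat_mono order_trans)
      then have big: "1 \<le> m / 2 * real N" using m(1) by (simp add: field_simps)
      have close: "\<bar>real_of_int \<bar>\<lfloor>b * real N\<rfloor> - \<lfloor>a * real N\<rfloor>\<bar> - d * real N\<bar> \<le> 1"
      proof -
        have "d * real N = \<bar>b * real N - a * real N\<bar>" by (simp add: d_def left_diff_distrib[symmetric] abs_mult)
        moreover have "\<bar>real_of_int (\<lfloor>b * real N\<rfloor> - \<lfloor>a * real N\<rfloor>) - (b * real N - a * real N)\<bar> \<le> 1"
          using of_int_floor_le[of "b * real N"] of_int_floor_le[of "a * real N"]
            real_of_int_floor_add_one_gt[of "b * real N"] real_of_int_floor_add_one_gt[of "a * real N"]
          unfolding abs_le_iff of_int_diff by linarith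
        ultimately show ?thesis by (simp only: of_int_abs)
      qed
      have "m * real N \<le> d * real N" "m * real N \<le> (1 - d) * real N"
        using m by (auto intro: mult_right_mono)
      then show ?thesis using close big unfolding left_diff_distrib by linarith
    qed
    then show ?thesis using m(1) unfolding eventually_sequentially by (intro exI[of _ "m / 2"]) auto
  qed
  have b: "0 \<le> fst p" "fst p < 1" "0 \<le> fst q" "fst q < 1" "0 \<le> snd p" "snd p < 1" "0 \<le> snd q" "snd q < 1"
    using p by (simp_all add: torus_def mem_Times_iff)
  have "fst p \<noteq> fst q \<or> snd p \<noteq> snd q" using p(3) by (auto simp: prod_eq_iff)
  then show ?thesis
  proof
    assume "fst p \<noteq> fst q"
    then obtain c where c: "c > 0" "\<forall>\<^sub>F N in sequentially. c * real N \<le> real_of_int \<bar>\<lfloor>fst q * real N\<rfloor> - \<lfloor>fst p * real N\<rfloor>\<bar>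
      \<and> real_of_int \<bar>\<lfloor>fst q * real N\<rfloor> - \<lfloor>fst p * real N\<rfloor>\<bar> \<le> real N - c * real N"
      using coord[OF b(1-4) \<open>fst p \<noteq> fst q\<close>] by blast
    from c(2) have "\<forall>\<^sub>F N in sequentially. far_apart c N (cell_index N p) (cell_index N q)"
      by eventually_elim (simp add: far_apart_def cell_index_def)
    with c(1) show ?thesis by (rule that)
  next
    assume "snd p \<noteq> snd q"
    then obtain c where c: "c > 0" "\<forall>\<^sub>F N in sequentially. c * real N \<le> real_of_int \<bar>\<lfloor>snd q * real N\<rfloor> - \<lfloor>snd p * real N\<rfloor>\<bar>
      \<and> real_of_int \<bar>\<lfloor>snd q * real N\<rfloor> - \<lfloor>snd p * real N\<rfloor>\<bar> \<le> real N - c * real N"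
      using coord[OF b(5-8) \<open>snd p \<noteq> snd q\<close>] by blast
    from c(2) have "\<forall>\<^sub>F N in sequentially. far_apart c N (cell_index N p) (cell_index N q)"
      by eventually_elim (simp add: far_apart_def cell_index_def)
    with c(1) show ?thesis by (rule that)
  qed
qed

lemma finite_points_far_apart:
  assumes F: "finite F" "F \<subseteq> torus"
  obtains c where "0 < c"
    "\<forall>\<^sub>F N in sequentially. \<forall>p\<in>F. \<forall>q\<in>F. p \<noteq> q \<longrightarrow> far_apart c N (cell_index N p) (cell_index N q)"
proof -
  have "\<exists>c>0. \<forall>\<^sub>F N in sequentially. far_apart c N (cell_index N p) (cell_index N q)" if "p \<in> F" "q \<in> F" "p \<noteq> q" for p q
    using distinct_points_far_apart[of p q] that F(2) by blast
  then obtain C where C: "\<And>p q. p \<in> F \<Longrightarrow> q \<in> F \<Longrightarrow> p \<noteq> q \<Longrightarrow> C p q > 0 \<and>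
      (\<forall>\<^sub>F N in sequentially. far_apart (C p q) N (cell_index N p) (cell_index N q))"
    by metis
  define D where "D = insert 1 ((\<lambda>(p, q). C p q) ` {(p, q) \<in> F \<times> F. p \<noteq> q})"
  have fin: "finite D" using F(1) by (auto simp: D_def intro: finite_subset[of _ "F \<times> F"])
  have pos: "0 < Min D" using fin C by (subst Min_gr_iff) (auto simp: D_def)
  have "\<forall>\<^sub>F N in sequentially. \<forall>p\<in>F. \<forall>q\<in>F. p \<noteq> q \<longrightarrow> far_apart (Min D) N (cell_index N p) (cell_index N q)"
  proof (intro eventually_ball_finite ballI F(1))
    fix p q assume pq: "p \<in> F" "q \<in> F"
    show "\<forall>\<^sub>F N in sequentially. p \<noteq> q \<longrightarrow> far_apart (Min D) N (cell_index N p) (cell_index N q)"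
    proof (cases "p = q")
      case False
      have "Min D \<le> C p q" using fin pq False by (intro Min_le) (auto simp: D_def intro!: image_eqI[of _ _ "(p, q)"])
      with C[OF pq False] show ?thesis by (auto elim!: eventually_mono intro: far_apart_mono)
    qed simp
  qed
  with pos show ?thesis by (rule that)
qed

text \<open>
  The atomic measure with its rearranged weights, for which the atom of weight \<open>w_hat k\<close> is fixed
  below by a choice of the rearranging bijection.
\<close>

locale atomic_torus_measure =
  fixes w w_hat :: "nat \<Rightarrow> real" and x :: "nat \<Rightarrow> real \<times> real" and W :: "(real \<times> real) measure"
  assumes w_pos: "\<And>i. 1 \<le> i \<Longrightarrow> 0 < w i"
    and w_summable: "w summable_on {1..}"
    and x_torus: "x ` {1..} \<subseteq> torus"
    and x_distinct: "inj_on x {1..}"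
    and x_dense: "torus_topology closure_of (x ` {1..}) = torus"
    and W_def: "W = atomic_measure w x"
    and w_hat: "decreasing_rearrangement w w_hat"
begin

definition \<sigma> :: "nat \<Rightarrow> nat" where
  "\<sigma> = (SOME \<sigma>. bij_betw \<sigma> {1..} {1..} \<and> (\<forall>k\<ge>1. w_hat k = w (\<sigma> k)))"

lemma \<sigma>: "bij_betw \<sigma> {1..} {1..}" "\<And>k. 1 \<le> k \<Longrightarrow> w_hat k = w (\<sigma> k)"
proof -
  have "\<exists>\<sigma>. bij_betw \<sigma> {1..} {1..} \<and> (\<forall>k\<ge>1. w_hat k = w (\<sigma> k))"
    using w_hat unfolding decreasing_rearrangement_def by blast
  from someI_ex[OF this] show "bij_betw \<sigma> {1..} {1..}" "\<And>k. 1 \<le> k \<Longrightarrow> w_hat k = w (\<sigma> k)"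
    unfolding \<sigma>_def by blast+
qed

definition atom :: "nat \<Rightarrow> real \<times> real" where
  "atom k = x (\<sigma> k)"

lemma \<sigma>_ge: "1 \<le> k \<Longrightarrow> 1 \<le> \<sigma> k"
  using \<sigma>(1) by (auto simp: bij_betw_def)

lemma atom_torus: "1 \<le> k \<Longrightarrow> atom k \<in> torus"
  using x_torus \<sigma>_ge by (auto simp: atom_def)

lemma atom_inj: "inj_on atom {1..}"
proof (rule inj_onI)
  fix k l assume kl: "k \<in> {1..}" "l \<in> {1..}" "atom k = atom l"
  then have "\<sigma> k = \<sigma> l" using x_distinct \<sigma>_ge by (auto simp: atom_def inj_on_def)
  then show "k = l" using \<sigma>(1) kl by (auto simp: bij_betw_def inj_on_def)
qed

lemma atom_range: "atom ` {1..} = x ` {1..}"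
proof -
  have "\<sigma> ` {1..} = {1..}" using \<sigma>(1) by (simp add: bij_betw_def)
  then show ?thesis by (metis (no_types, lifting) atom_def image_cong image_image)
qed

lemma w_hat_pos: "1 \<le> k \<Longrightarrow> 0 < w_hat k"
  using \<sigma>(2) w_pos \<sigma>_ge by simp

lemma w_hat_decreasing: "1 \<le> k \<Longrightarrow> k \<le> l \<Longrightarrow> w_hat l \<le> w_hat k"
  using w_hat unfolding decreasing_rearrangement_def by blast

lemma sets_W [simp]: "sets W = sets borel" and space_W [simp]: "space W = UNIV"
  by (simp_all add: W_def atomic_measure_def)

lemma emeasure_W: "B \<in> sets borel \<Longrightarrow> emeasure W B = (\<integral>\<^sup>+i. ennreal (w i) * indicator (x -` B) i \<partial>count_space {1..})"
  by (simp add: W_def atomic_measure_def emeasure_distr emeasure_density)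
     (auto intro!: nn_integral_cong simp: indicator_def)

lemma finite_W: "emeasure W UNIV < \<infinity>"
proof -
  have "(\<lambda>i. norm (w i)) summable_on {1..}"
    using w_summable by (rule iffD1[OF summable_on_iff_abs_summable_on_real])
  then have "integrable (count_space {1..}) w"
    unfolding abs_summable_equivalent Infinite_Set_Sum.abs_summable_on_def .
  then have "(\<integral>\<^sup>+i. ennreal (norm (w i)) \<partial>count_space {1..}) < \<infinity>"
    by (simp add: integrable_iff_bounded)
  moreover have "(\<integral>\<^sup>+i. ennreal (norm (w i)) \<partial>count_space {1..}) = emeasure W UNIV"
    using w_pos by (subst emeasure_W) (auto intro!: nn_integral_cong simp: less_imp_le)
  ultimately show ?thesis by simp
qed

sublocale W: finite_measure W
  by (rule finite_measureI) (use finite_W in auto)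

lemma measure_atom: "1 \<le> k \<Longrightarrow> measure W {atom k} = w_hat k"
proof -
  assume k: "1 \<le> k"
  have "emeasure W {atom k} = (\<integral>\<^sup>+i. ennreal (w i) * indicator (x -` {atom k}) i \<partial>count_space {1..})"
    by (rule emeasure_W) simp
  also have "\<dots> = (\<integral>\<^sup>+i. ennreal (w i) * indicator {\<sigma> k} i \<partial>count_space {1..})"
    using x_distinct \<sigma>_ge[OF k] by (intro nn_integral_cong) (auto simp: indicator_def atom_def inj_on_def)
  also have "\<dots> = ennreal (w (\<sigma> k)) * emeasure (count_space {1..}) {\<sigma> k}"
    using \<sigma>_ge[OF k] by (intro nn_integral_indicator_singleton) auto
  also have "\<dots> = ennreal (w_hat k)" using \<sigma>_ge[OF k] \<sigma>(2)[OF k] by simp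
  finally show ?thesis using w_hat_pos[OF k] by (simp add: measure_def)
qed

lemma atoms_borel: "atom ` {1..K} \<in> sets borel"
  by (intro borel_closed finite_imp_closed) auto

definition tail :: "nat \<Rightarrow> real" where
  "tail K = measure W (UNIV - atom ` {1..K})"

lemma tail_nonneg: "0 \<le> tail K"
  by (simp add: tail_def)

lemma measure_atoms: "measure W (atom ` {1..K}) = (\<Sum>k\<in>{1..K}. w_hat k)"
proof -
  have "measure W (atom ` {1..K}) = (\<Sum>p\<in>atom ` {1..K}. measure W {p})"
    by (rule W.finite_measure_eq_sum_singleton) auto
  also have "\<dots> = (\<Sum>k\<in>{1..K}. measure W {atom k})"
    by (rule sum.reindex_cong[OF inj_on_subset[OF atom_inj]]) auto
  finally show ?thesis by (simp add: measure_atom)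
qed

lemma tail_eq: "tail K = measure W UNIV - (\<Sum>k\<in>{1..K}. w_hat k)"
proof -
  have "measure W (UNIV - atom ` {1..K}) = measure W UNIV - measure W (atom ` {1..K})"
    by (rule W.finite_measure_Diff) (use atoms_borel in auto)
  then show ?thesis unfolding tail_def measure_atoms .
qed

lemma tail_tendsto: "tail \<longlonglongrightarrow> 0"
proof -
  have borel: "UNIV - atom ` {1..K} \<in> sets borel" for K by (intro sets.Diff atoms_borel) auto
  have "(\<lambda>K. measure W (UNIV - atom ` {1..K})) \<longlonglongrightarrow> measure W (\<Inter>K. UNIV - atom ` {1..K})"
    using borel by (intro W.finite_Lim_measure_decseq) (auto simp: decseq_def)
  also have "(\<Inter>K. UNIV - atom ` {1..K}) = UNIV - x ` {1..}"
    unfolding atom_range[symmetric]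
  proof (intro equalityI subsetI)
    fix p assume p: "p \<in> (\<Inter>K. UNIV - atom ` {1..K})"
    have "p \<noteq> atom k" if "k \<in> {1..}" for k
    proof
      assume "p = atom k"
      moreover have "k \<in> {1..k}" using that by simp
      ultimately have "p \<in> atom ` {1..k}" by (rule image_eqI)
      then show False using p by blast
    qed
    then show "p \<in> UNIV - atom ` {1..}" by blast
  next
    fix p assume p: "p \<in> UNIV - atom ` {1..}"
    have "{1..K} \<subseteq> {1..}" for K :: nat by auto
    then show "p \<in> (\<Inter>K. UNIV - atom ` {1..K})" using p by blast
  qed
  also have "measure W (UNIV - x ` {1..}) = 0"
  proof -
    have "x ` {1..} \<in> sets borel"
    proof (rule sets.countable)
      show "countable (x ` {1..})" by (rule countable_image) simp
    qed simp
    then have b: "UNIV - x ` {1..} \<in> sets borel" by (rule borel_comp[unfolded Compl_eq_Diff_UNIV])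
    have "emeasure W (UNIV - x ` {1..}) = (\<integral>\<^sup>+(i::nat). 0 \<partial>count_space {1..})"
      unfolding emeasure_W[OF b] by (intro nn_integral_cong) (auto simp: indicator_def)
    then show ?thesis by (simp add: measure_def)
  qed
  finally show ?thesis by (simp add: tail_def[abs_def])
qed

lemma cell_mass_ge: "0 < N \<Longrightarrow> 1 \<le> k \<Longrightarrow> w_hat k \<le> cell_mass W N (cell_index N (atom k))"
  unfolding cell_mass_eq measure_atom[symmetric]
  by (rule W.finite_measure_mono) (auto simp: in_cell_iff cell_borel)

text \<open>
  When the \<open>K\<close> heaviest atoms lie in distinct cells, a cell holds at most one of them; all the other
  mass is in the tail.
\<close>

lemma cell_mass_le:
  assumes N: "0 < N" and inj: "inj_on (\<lambda>k. cell_index N (atom k)) {1..K}"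
  shows "k \<in> {1..K} \<Longrightarrow> cell_mass W N (cell_index N (atom k)) \<le> w_hat k + tail K"
    and "z \<notin> (\<lambda>k. cell_index N (atom k)) ` {1..K} \<Longrightarrow> cell_mass W N z \<le> tail K"
proof -
  have borel: "UNIV - atom ` {1..K} \<in> sets borel" by (intro sets.Diff atoms_borel) auto
  show "cell_mass W N z \<le> tail K" if z: "z \<notin> (\<lambda>k. cell_index N (atom k)) ` {1..K}"
    unfolding cell_mass_eq tail_def
  proof (rule W.finite_measure_mono)
    show "cell N z \<subseteq> UNIV - atom ` {1..K}" using z N by (auto simp: in_cell_iff)
  qed (use borel in simp)
  assume k: "k \<in> {1..K}"
  have "measure W (cell N (cell_index N (atom k))) \<le> measure W ({atom k} \<union> (UNIV - atom ` {1..K}))"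
  proof (rule W.finite_measure_mono)
    show "cell N (cell_index N (atom k)) \<subseteq> {atom k} \<union> (UNIV - atom ` {1..K})"
    proof
      fix p assume p: "p \<in> cell N (cell_index N (atom k))"
      have "p = atom k" if "p \<in> atom ` {1..K}"
      proof -
        obtain l where l: "l \<in> {1..K}" "p = atom l" using \<open>p \<in> atom ` {1..K}\<close> by (rule imageE)
        then have "cell_index N (atom l) = cell_index N (atom k)" using p N by (simp add: in_cell_iff)
        then have "l = k" by (rule inj_onD[OF inj _ l(1) k])
        then show ?thesis using l by simp
      qed
      then show "p \<in> {atom k} \<union> (UNIV - atom ` {1..K})" by blast
    qed
  qed (use borel in auto)
  also have "\<dots> \<le> measure W {atom k} + measure W (UNIV - atom ` {1..K})"
    using borel by (intro measure_Un_le) auto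
  finally show "cell_mass W N (cell_index N (atom k)) \<le> w_hat k + tail K"
    using k by (simp add: cell_mass_eq tail_def measure_atom)
qed

lemma cells_separate:
  obtains c where "0 < c" "\<forall>\<^sub>F N in sequentially. \<forall>k\<in>{1..K}. \<forall>l\<in>{1..K}. k \<noteq> l \<longrightarrow>
     far_apart c N (cell_index N (atom k)) (cell_index N (atom l))"
proof -
  obtain c where c: "0 < c" "\<forall>\<^sub>F N in sequentially. \<forall>p\<in>atom ` {1..K}. \<forall>q\<in>atom ` {1..K}. p \<noteq> q \<longrightarrow>
     far_apart c N (cell_index N p) (cell_index N q)"
  proof (rule finite_points_far_apart[of "atom ` {1..K}"])
    show "atom ` {1..K} \<subseteq> torus"
      by (intro image_subsetI atom_torus) (simp only: atLeastAtMost_iff)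
  qed auto
  from c(2) have "\<forall>\<^sub>F N in sequentially. \<forall>k\<in>{1..K}. \<forall>l\<in>{1..K}. k \<noteq> l \<longrightarrow>
     far_apart c N (cell_index N (atom k)) (cell_index N (atom l))"
  proof eventually_elim
    case (elim N)
    show ?case
    proof (intro ballI impI)
      fix k l assume kl: "k \<in> {1..K}" "l \<in> {1..K}" "k \<noteq> l"
      then have "atom k \<noteq> atom l" using inj_on_eq_iff[OF atom_inj, of k l] by simp
      then show "far_apart c N (cell_index N (atom k)) (cell_index N (atom l))" using elim kl(1,2) by blast
    qed
  qed
  with c(1) show ?thesis by (rule that)
qed

lemma cells_distinct: "\<forall>\<^sub>F N in sequentially. inj_on (\<lambda>k. cell_index N (atom k)) {1..K}"
proof -
  obtain c where c: "0 < c" "\<forall>\<^sub>F N in sequentially. \<forall>k\<in>{1..K}. \<forall>l\<in>{1..K}. k \<noteq> l \<longrightarrow>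
     far_apart c N (cell_index N (atom k)) (cell_index N (atom l))" by (rule cells_separate)
  from c(2) eventually_gt_at_top[of 0] show ?thesis
    by eventually_elim (use c(1) far_apart_neq in \<open>blast intro: inj_onI\<close>)
qed

text \<open>The interior of a cell is open in the torus, so it contains an atom by density.\<close>

lemma cell_mass_pos:
  assumes N: "0 < N" and z: "z \<in> grid N"
  shows "0 < cell_mass W N z"
proof -
  define a b where "a = real_of_int (fst z) / real N" and "b = (real_of_int (fst z) + 1) / real N"
  define c d where "c = real_of_int (snd z) / real N" and "d = (real_of_int (snd z) + 1) / real N"
  have bounds: "0 \<le> a" "a < b" "b \<le> 1" "0 \<le> c" "c < d" "d \<le> 1"
  proof -
    have "real_of_int (fst z) + 1 \<le> real N" "real_of_int (snd z) + 1 \<le> real N" "0 \<le> fst z" "0 \<le> snd z"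
      using z by (auto simp: grid_def)
    then show "0 \<le> a" "a < b" "b \<le> 1" "0 \<le> c" "c < d" "d \<le> 1"
      using N by (auto simp: a_def b_def c_def d_def divide_strict_right_mono)
  qed
  let ?U = "{a<..<b} \<times> {c<..<d}"
  have opn: "openin torus_topology ?U"
    unfolding openin_torus_topology
  proof
    show "?U \<subseteq> torus" using bounds by (auto simp: torus_def)
    have frac_open: "open (frac -` {s<..<t})" if "0 \<le> s" "t \<le> 1" for s t :: real
    proof -
      have "frac -` {s<..<t} = (\<Union>n::int. {real_of_int n + s<..<real_of_int n + t})"
      proof (intro set_eqI iffI)
        fix y assume "y \<in> frac -` {s<..<t}"
        then show "y \<in> (\<Union>n::int. {real_of_int n + s<..<real_of_int n + t})"
          by (auto simp: frac_def intro!: exI[of _ "\<lfloor>y\<rfloor>"])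
      next
        fix y assume "y \<in> (\<Union>n::int. {real_of_int n + s<..<real_of_int n + t})"
        then obtain n :: int where n: "real_of_int n + s < y" "y < real_of_int n + t" by auto
        then have "\<lfloor>y\<rfloor> = n" using that by (simp add: floor_eq_iff)
        then show "y \<in> frac -` {s<..<t}" using n by (simp add: frac_def)
      qed
      then show ?thesis by auto
    qed
    have "torus_proj -` ?U = (frac -` {a<..<b}) \<times> (frac -` {c<..<d})"
      by (auto simp: torus_proj_def)
    then show "open (torus_proj -` ?U)" using frac_open bounds by (simp add: open_Times)
  qed
  have mid: "((a + b) / 2, (c + d) / 2) \<in> ?U" using bounds by simp
  have "((a + b) / 2, (c + d) / 2) \<in> torus_topology closure_of (x ` {1..})"
    unfolding x_dense using bounds by (simp add: torus_def)
  then have "\<forall>U. ((a + b) / 2, (c + d) / 2) \<in> U \<and> openin torus_topology U \<longrightarrow> (\<exists>y. y \<in> x ` {1..} \<and> y \<in> U)"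
    unfolding in_closure_of by (rule conjunct2)
  from this[rule_format, OF conjI[OF mid opn]] obtain p where "p \<in> x ` {1..}" "p \<in> ?U" by (elim exE conjE)
  then have "p \<in> atom ` {1..}" by (simp only: atom_range)
  then obtain k where "k \<in> {1..}" "p = atom k" by (rule imageE)
  then have k: "1 \<le> k" "atom k \<in> ?U" using \<open>p \<in> ?U\<close> by (simp_all only: atLeast_iff)
  have "atom k \<in> cell N z" using k(2) by (auto simp: cell_def a_def b_def c_def d_def)
  then have "cell_index N (atom k) = z" using N by (simp add: in_cell_iff)
  then show ?thesis using cell_mass_ge[OF N k(1)] w_hat_pos[OF k(1)] by simp
qed

end

locale enumerated_cells = atomic_torus_measure +
  fixes e :: "nat \<Rightarrow> nat \<Rightarrow> int \<times> int"
  assumes enum: "\<And>N. 1 \<le> N \<Longrightarrow> decreasing_enumeration W N (e N)"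
begin

lemma e_bij: "1 \<le> N \<Longrightarrow> bij_betw (e N) {1..N\<^sup>2} (grid N)"
  using enum unfolding decreasing_enumeration_def by blast

lemma e_decreasing: "1 \<le> N \<Longrightarrow> 1 \<le> i \<Longrightarrow> i \<le> l \<Longrightarrow> l \<le> N\<^sup>2 \<Longrightarrow> cell_mass W N (e N l) \<le> cell_mass W N (e N i)"
  using enum[of N] unfolding decreasing_enumeration_def by auto

text \<open>
  Pigeonhole in both directions: \<open>i\<close> distinct cells have mass at least \<open>w_hat i\<close>, so the \<open>i\<close>-th heaviest
  cell has; and fewer than \<open>i\<close> cells have mass above \<open>w_hat i + tail K\<close>.
\<close>

lemma mass_bounds:
  assumes N: "1 \<le> N" and inj: "inj_on (\<lambda>k. cell_index N (atom k)) {1..K}" and i: "1 \<le> i" "i \<le> K" "i \<le> N\<^sup>2"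
  shows "w_hat i \<le> cell_mass W N (e N i)" "cell_mass W N (e N i) \<le> w_hat i + tail K"
proof -
  have N0: "0 < N" using N by simp
  let ?I = "\<lambda>k. cell_index N (atom k)"
  have in_grid: "?I k \<in> grid N" if "1 \<le> k" for k by (rule cell_index_in_grid[OF N0 atom_torus[OF that]])
  have e_inj: "inj_on (e N) {1..N\<^sup>2}" using e_bij[OF N] by (simp add: bij_betw_def)
  show "w_hat i \<le> cell_mass W N (e N i)"
  proof -
    have "\<not> ?I ` {1..i} \<subseteq> e N ` {1..<i}"
    proof
      assume "?I ` {1..i} \<subseteq> e N ` {1..<i}"
      then have "card (?I ` {1..i}) \<le> card (e N ` {1..<i})" by (intro card_mono) auto
      also have "\<dots> \<le> card {1..<i}" by (rule card_image_le) simp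
      also have "card (?I ` {1..i}) = card {1..i}"
        using i by (intro card_image inj_on_subset[OF inj]) auto
      finally show False using i by simp
    qed
    then obtain k where k: "k \<in> {1..i}" "?I k \<notin> e N ` {1..<i}" by blast
    have "?I k \<in> e N ` {1..N\<^sup>2}" using e_bij[OF N] in_grid[of k] k by (simp add: bij_betw_def)
    then obtain l where l: "l \<in> {1..N\<^sup>2}" "?I k = e N l" by auto
    have "i \<le> l" using k(2) l by (cases "i \<le> l") auto
    then have "cell_mass W N (?I k) \<le> cell_mass W N (e N i)"
      unfolding l(2) using l(1) i by (intro e_decreasing N) auto
    moreover have "w_hat k \<le> cell_mass W N (?I k)" using k by (intro cell_mass_ge N0) auto
    moreover have "w_hat i \<le> w_hat k" using k by (intro w_hat_decreasing) auto
    ultimately show ?thesis by linarith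
  qed
  show "cell_mass W N (e N i) \<le> w_hat i + tail K"
  proof (rule ccontr)
    assume big: "\<not> cell_mass W N (e N i) \<le> w_hat i + tail K"
    have "e N ` {1..i} \<subseteq> ?I ` {1..<i}"
    proof
      fix z assume "z \<in> e N ` {1..i}"
      then obtain l where l: "l \<in> {1..i}" "z = e N l" by auto
      have "cell_mass W N (e N i) \<le> cell_mass W N z"
        unfolding l(2) using l(1) i by (intro e_decreasing N) auto
      then have mz: "w_hat i + tail K < cell_mass W N z" using big by linarith
      then have "tail K < cell_mass W N z" using w_hat_pos[OF i(1)] by linarith
      then have "z \<in> ?I ` {1..K}" using cell_mass_le(2)[OF N0 inj, of z] by (cases "z \<in> ?I ` {1..K}") auto
      then obtain k where k: "k \<in> {1..K}" "z = ?I k" by auto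
      have "w_hat i < w_hat k" using cell_mass_le(1)[OF N0 inj k(1)] mz k(2) by simp
      then have "k < i" using w_hat_decreasing[OF i(1), of k] by (cases "k < i") auto
      then show "z \<in> ?I ` {1..<i}" using k by auto
    qed
    then have "card (e N ` {1..i}) \<le> card (?I ` {1..<i})" by (intro card_mono) auto
    also have "\<dots> \<le> card {1..<i}" by (rule card_image_le) simp
    also have "card (e N ` {1..i}) = card {1..i}"
      using i by (intro card_image inj_on_subset[OF e_inj]) auto
    finally show False using i by simp
  qed
qed

lemma eventually_index_bound: "\<forall>\<^sub>F N in sequentially. i \<le> N\<^sup>2"
proof -
  have "i \<le> N\<^sup>2" if "max i 1 \<le> N" for N :: nat
  proof -
    have "N * 1 \<le> N * N" using that by (intro mult_left_mono) auto
    then have "N \<le> N\<^sup>2" by (simp only: power2_eq_square mult_1_right)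
    then show ?thesis using that by linarith
  qed
  then show ?thesis unfolding eventually_sequentially by blast
qed

lemma mass_tendsto:
  assumes i: "1 \<le> i"
  shows "(\<lambda>N. cell_mass W N (e N i)) \<longlonglongrightarrow> w_hat i"
proof (rule LIMSEQ_I)
  fix r :: real assume r: "0 < r"
  have "\<forall>\<^sub>F K in sequentially. tail K < r" by (rule order_tendstoD(2)[OF tail_tendsto r])
  then have "\<forall>\<^sub>F K in sequentially. tail K < r \<and> i \<le> K" using eventually_ge_at_top[of i] by (rule eventually_conj)
  then obtain K where K: "tail K < r" "i \<le> K" using eventually_happens'[OF sequentially_bot] by blast
  have "\<forall>\<^sub>F N in sequentially. norm (cell_mass W N (e N i) - w_hat i) < r"
    using cells_distinct[of K] eventually_ge_at_top[of 1] eventually_index_bound[of i]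
  proof eventually_elim
    case (elim N)
    then show ?case using mass_bounds[OF elim(2,1) i K(2) elim(3)] K(1) by simp
  qed
  then show "\<exists>n0. \<forall>N\<ge>n0. norm (cell_mass W N (e N i) - w_hat i) < r"
    unfolding eventually_sequentially .
qed

text \<open>
  For \<open>K\<close> so large that the tail is lighter than \<open>w_hat M\<close>, each of the \<open>M\<close> heaviest cells contains one of
  the \<open>K\<close> heaviest atoms. With ties among the weights this atom may depend on \<open>N\<close>, but all the \<open>K\<close> atoms
  are separated.
\<close>

lemma heavy_cells_far_apart:
  obtains c where "0 < c" "\<forall>\<^sub>F N in sequentially. \<forall>i\<in>{1..M}. \<forall>l\<in>{1..M}. i \<noteq> l \<longrightarrow> far_apart c N (e N i) (e N l)"
proof (cases "M = 0")
  case True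
  then show ?thesis by (intro that[of 1]) auto
next
  case False
  then have M: "1 \<le> M" by simp
  have "\<forall>\<^sub>F K in sequentially. tail K < w_hat M" by (rule order_tendstoD(2)[OF tail_tendsto w_hat_pos[OF M]])
  then have "\<forall>\<^sub>F K in sequentially. tail K < w_hat M \<and> M \<le> K" using eventually_ge_at_top[of M] by (rule eventually_conj)
  then obtain K where K: "tail K < w_hat M" "M \<le> K" using eventually_happens'[OF sequentially_bot] by blast
  obtain c where c: "0 < c" "\<forall>\<^sub>F N in sequentially. \<forall>k\<in>{1..K}. \<forall>l\<in>{1..K}. k \<noteq> l \<longrightarrow>
     far_apart c N (cell_index N (atom k)) (cell_index N (atom l))" by (rule cells_separate)
  have "\<forall>\<^sub>F N in sequentially. \<forall>i\<in>{1..M}. \<forall>l\<in>{1..M}. i \<noteq> l \<longrightarrow> far_apart c N (e N i) (e N l)"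
    using c(2) cells_distinct[of K] eventually_ge_at_top[of 1] eventually_index_bound[of M]
  proof eventually_elim
    case (elim N)
    have N0: "0 < N" using elim(3) by simp
    have loc: "\<exists>k\<in>{1..K}. e N i = cell_index N (atom k)" if i: "i \<in> {1..M}" for i
    proof -
      have "w_hat i \<le> cell_mass W N (e N i)" using i K elim by (intro mass_bounds(1)) auto
      moreover have "w_hat M \<le> w_hat i" using i by (intro w_hat_decreasing) auto
      ultimately have "tail K < cell_mass W N (e N i)" using K by linarith
      then show ?thesis using cell_mass_le(2)[OF N0 elim(2), of "e N i"] by force
    qed
    show ?case
    proof (intro ballI impI)
      fix i l assume il: "i \<in> {1..M}" "l \<in> {1..M}" "i \<noteq> l"
      obtain k where k: "k \<in> {1..K}" "e N i = cell_index N (atom k)" using loc[OF il(1)] by blast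
      obtain k' where k': "k' \<in> {1..K}" "e N l = cell_index N (atom k')" using loc[OF il(2)] by blast
      have "e N i \<noteq> e N l"
        using e_bij[OF elim(3)] il elim(4) by (auto simp: bij_betw_def inj_on_def)
      then have "k \<noteq> k'" using k k' by auto
      then show "far_apart c N (e N i) (e N l)" using elim(1) k k' by simp
    qed
  qed
  with c(1) show ?thesis by (rule that)
qed

text \<open>The \<open>M\<close> heaviest cells have in total at least the mass of the \<open>M\<close> heaviest atoms.\<close>

lemma light_mass:
  assumes N: "1 \<le> N" and inj: "inj_on (\<lambda>k. cell_index N (atom k)) {1..M}" and M: "M \<le> N\<^sup>2"
  shows "(\<Sum>z\<in>grid N - e N ` {1..M}. cell_mass W N z) \<le> tail M"
proof -
  have N0: "0 < N" using N by simp
  have e_inj: "inj_on (e N) {1..M}" using e_bij[OF N] M by (auto simp: bij_betw_def intro: inj_on_subset)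
  have sub: "e N ` {1..M} \<subseteq> grid N" using e_bij[OF N] M by (auto simp: bij_betw_def)
  have "disjoint_family_on (cell N) (grid N)"
    using N0 by (auto simp: disjoint_family_on_def in_cell_iff)
  then have "measure W (\<Union>z\<in>grid N. cell N z) = (\<Sum>z\<in>grid N. measure W (cell N z))"
    by (intro W.finite_measure_finite_Union finite_grid) (auto simp: cell_borel)
  then have "(\<Sum>z\<in>grid N. cell_mass W N z) \<le> measure W UNIV"
    using W.bounded_measure[of "\<Union>z\<in>grid N. cell N z"] by (simp add: cell_mass_eq)
  moreover have "(\<Sum>z\<in>grid N - e N ` {1..M}. cell_mass W N z)
      = (\<Sum>z\<in>grid N. cell_mass W N z) - (\<Sum>z\<in>e N ` {1..M}. cell_mass W N z)"
    by (rule sum_diff[OF finite_grid sub])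
  moreover have "(\<Sum>z\<in>e N ` {1..M}. cell_mass W N z) = (\<Sum>i\<in>{1..M}. cell_mass W N (e N i))"
    by (rule sum.reindex_cong[OF e_inj]) auto
  moreover have "(\<Sum>i\<in>{1..M}. w_hat i) \<le> (\<Sum>i\<in>{1..M}. cell_mass W N (e N i))"
    using M by (intro sum_mono mass_bounds(1)[OF N inj]) auto
  ultimately show ?thesis by (simp add: tail_eq)
qed

end

section \<open>Trace rates and a Foster function\<close>

context enumerated_cells
begin

abbreviation walk :: "nat \<Rightarrow> (int \<times> int \<Rightarrow> real) \<Rightarrow> int \<times> int \<Rightarrow> real" where
  "walk N \<equiv> (\<lambda>f z. ln (real N) * walk_generator W N f z)"

definition walk_rate :: "nat \<Rightarrow> int \<times> int \<Rightarrow> int \<times> int \<Rightarrow> real" where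
  "walk_rate N z y = ln (real N) / (4 * cell_mass W N z) *
     (of_bool (y \<in> neighbours N z) - real (card (neighbours N z)) * of_bool (y = z))"

lemma walk_eq: "walk N f z = ln (real N) / (4 * cell_mass W N z) * laplacian N f z"
  by (simp add: walk_generator_def laplacian_def)

lemma walk_finite_operator:
  assumes N: "1 \<le> N"
  shows "finite_operator (grid N) (walk_rate N) (walk N)"
proof (rule finite_operator.intro)
  show "finite (grid N)" by (rule finite_grid)
  fix f :: "int \<times> int \<Rightarrow> real" and z assume z: "z \<in> grid N"
  have sub: "neighbours N z \<subseteq> grid N" using N by (intro neighbours_in_grid) simp
  have "(\<Sum>y\<in>grid N. of_bool (y \<in> neighbours N z) * f y) = (\<Sum>y\<in>neighbours N z. f y)"
    by (rule sum.mono_neutral_cong_right[OF finite_grid sub]) auto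
  moreover have "(\<Sum>y\<in>grid N. of_bool (y = z) * f y) = f z"
  proof -
    have "(\<Sum>y\<in>grid N. of_bool (y = z) * f y) = (\<Sum>y\<in>grid N. if y = z then f y else 0)"
      by (rule sum.cong) auto
    then show ?thesis using z finite_grid by (simp add: sum.delta')
  qed
  ultimately have "laplacian N f z = (\<Sum>y\<in>grid N. of_bool (y \<in> neighbours N z) * f y)
      - real (card (neighbours N z)) * (\<Sum>y\<in>grid N. of_bool (y = z) * f y)"
    by (simp add: laplacian_def sum_subtractf)
  also have "\<dots> = (\<Sum>y\<in>grid N. (of_bool (y \<in> neighbours N z) - real (card (neighbours N z)) * of_bool (y = z)) * f y)"
    by (simp only: sum_distrib_left left_diff_distrib sum_subtractf mult.assoc)
  finally show "walk N f z = (\<Sum>y\<in>grid N. walk_rate N z y * f y)"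
    unfolding walk_eq walk_rate_def by (simp only: sum_distrib_left mult.assoc)
qed

lemma walk_const: "walk N (\<lambda>_. c) z = 0"
  unfolding walk_eq laplacian_const by simp

lemma e_in_grid: "1 \<le> N \<Longrightarrow> i \<in> {1..N\<^sup>2} \<Longrightarrow> e N i \<in> grid N"
  using e_bij[of N] by (auto simp: bij_betw_def)

lemma e_eq_iff: "1 \<le> N \<Longrightarrow> i \<in> {1..N\<^sup>2} \<Longrightarrow> l \<in> {1..N\<^sup>2} \<Longrightarrow> e N i = e N l \<longleftrightarrow> i = l"
  using e_bij[of N] inj_on_eq_iff[of "e N" "{1..N\<^sup>2}" i l] by (simp only: bij_betw_def)

definition mass :: "nat \<Rightarrow> (int \<times> int) set \<Rightarrow> real" where
  "mass N S = (\<Sum>z\<in>S. cell_mass W N z)"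

text \<open>
  The function \<open>u\<close> is the potential of the charge \<open>W\<close> off \<open>A\<close>, balanced by a multiple of \<open>-W\<close> on
  \<open>A\<close> so that the total charge is zero: the constant part of the Laplacians of the Green functions
  then cancels, and the walk, whose rates are divided by \<open>W\<close>, drifts down at unit speed off \<open>A\<close>.
\<close>

lemma foster_function:
  assumes N: "3 \<le> N" and A: "A \<subseteq> grid N" "A \<noteq> {}"
  obtains u where "\<And>z. z \<in> grid N \<Longrightarrow> walk N u z = (if z \<in> A then mass N (grid N - A) / mass N A else - 1)"
    and "\<And>z. \<bar>u z\<bar> \<le> 2 * mass N (grid N - A) * ((green N 0 0 + 1) / ln (real N))"
proof -
  have N0: "0 < N" and ln: "0 < ln (real N)" using N by auto
  have pos: "0 < cell_mass W N z" if "z \<in> grid N" for z by (rule cell_mass_pos[OF N0 that])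
  have finA: "finite A" by (rule finite_subset[OF A(1) finite_grid])
  have mA: "0 < mass N A" unfolding mass_def by (rule sum_pos[OF finA A(2)]) (use pos A in blast)
  have mD: "0 \<le> mass N (grid N - A)" unfolding mass_def by (rule sum_nonneg) (use pos less_imp_le in blast)
  define b where "b = mass N (grid N - A) / mass N A"
  define v where "v p = (if p \<in> A then - b else 1) * cell_mass W N p" for p
  define u where "u z = 1 / ln (real N) * (\<Sum>p\<in>grid N. v p * kernel N p z)" for z
  have split: "(\<Sum>p\<in>grid N. f p) = (\<Sum>p\<in>grid N - A. f p) + (\<Sum>p\<in>A. f p)" for f :: "int \<times> int \<Rightarrow> real"
    by (rule sum.subset_diff[OF A(1) finite_grid])
  have v_sum: "(\<Sum>p\<in>grid N. v p) = 0"
  proof -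
    have "(\<Sum>p\<in>A. v p) = - b * mass N A" by (simp add: v_def mass_def sum_distrib_left)
    moreover have "(\<Sum>p\<in>grid N - A. v p) = mass N (grid N - A)" by (simp add: v_def mass_def)
    ultimately show ?thesis using mA unfolding split by (simp add: b_def)
  qed
  have v_abs: "(\<Sum>p\<in>grid N. \<bar>v p\<bar>) = 2 * mass N (grid N - A)"
  proof -
    have b0: "0 \<le> b" using mA mD by (simp add: b_def)
    have "(\<Sum>p\<in>A. \<bar>v p\<bar>) = (\<Sum>p\<in>A. b * cell_mass W N p)"
    proof (rule sum.cong[OF refl])
      fix p assume "p \<in> A"
      then show "\<bar>v p\<bar> = b * cell_mass W N p" using pos[of p] A(1) b0 by (auto simp: v_def abs_mult)
    qed
    then have "(\<Sum>p\<in>A. \<bar>v p\<bar>) = b * mass N A" by (simp only: mass_def sum_distrib_left)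
    then have "(\<Sum>p\<in>A. \<bar>v p\<bar>) = mass N (grid N - A)" using mA by (simp add: b_def)
    moreover have "(\<Sum>p\<in>grid N - A. \<bar>v p\<bar>) = mass N (grid N - A)"
      unfolding mass_def by (rule sum.cong[OF refl]) (use pos in \<open>auto simp: v_def abs_of_pos\<close>)
    ultimately show ?thesis unfolding split by simp
  qed
  show ?thesis
  proof (rule that)
    fix z
    assume z: "z \<in> grid N"
    have "laplacian N u z = 1 / ln (real N) * laplacian N (\<lambda>z. \<Sum>p\<in>grid N. v p * kernel N p z) z"
      unfolding u_def[abs_def] laplacian_def by (simp only: sum_distrib_left right_diff_distrib)
    also have "laplacian N (\<lambda>z. \<Sum>p\<in>grid N. v p * kernel N p z) z
        = (\<Sum>p\<in>grid N. v p * (4 / (real N)\<^sup>2) - (if p = z then 4 * v z else 0))"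
      unfolding laplacian_sum[OF finite_grid]
    proof (rule sum.cong[OF refl])
      fix p assume "p \<in> grid N"
      from kernel_laplacian[OF N this z]
      show "v p * laplacian N (kernel N p) z = v p * (4 / (real N)\<^sup>2) - (if p = z then 4 * v z else 0)"
        by (auto simp: right_diff_distrib)
    qed
    also have "\<dots> = - 4 * v z"
      using z finite_grid unfolding sum_subtractf sum_distrib_right[symmetric] v_sum by simp
    finally show "walk N u z = (if z \<in> A then mass N (grid N - A) / mass N A else - 1)"
      using pos[OF z] ln unfolding walk_eq by (simp add: v_def b_def)
  next
    fix z
    have "\<bar>\<Sum>p\<in>grid N. v p * kernel N p z\<bar> \<le> (\<Sum>p\<in>grid N. \<bar>v p\<bar> * (green N 0 0 + 1))"
    proof (rule order_trans[OF sum_abs sum_mono])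
      fix p show "\<bar>v p * kernel N p z\<bar> \<le> \<bar>v p\<bar> * (green N 0 0 + 1)"
        unfolding abs_mult by (rule mult_left_mono[OF kernel_bound[OF N0]]) simp
    qed
    also have "\<dots> = 2 * mass N (grid N - A) * (green N 0 0 + 1)"
      unfolding sum_distrib_right[symmetric] v_abs ..
    finally have "1 / ln (real N) * \<bar>\<Sum>p\<in>grid N. v p * kernel N p z\<bar>
        \<le> 1 / ln (real N) * (2 * mass N (grid N - A) * (green N 0 0 + 1))"
      using ln by (intro mult_left_mono) auto
    then show "\<bar>u z\<bar> \<le> 2 * mass N (grid N - A) * ((green N 0 0 + 1) / ln (real N))"
      using ln by (simp add: u_def abs_mult)
  qed
qed

text \<open>
  The probability, as a function of the starting point, that the walk enters \<open>{e 1, \<dots>, e M}\<close> at \<open>e j\<close>,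
  through its characterisation as a harmonic extension.
\<close>

definition hitting :: "nat \<Rightarrow> nat \<Rightarrow> nat \<Rightarrow> int \<times> int \<Rightarrow> real" where
  "hitting M N j = (SOME h. (\<forall>z\<in>e N ` {1..M}. h z = of_bool (z = e N j)) \<and>
     (\<forall>z. z \<notin> e N ` {1..M} \<longrightarrow> laplacian N h z = 0))"

lemma hitting:
  assumes "3 \<le> N"
  shows "z \<in> e N ` {1..M} \<Longrightarrow> hitting M N j z = of_bool (z = e N j)"
    and "z \<notin> e N ` {1..M} \<Longrightarrow> laplacian N (hitting M N j) z = 0"
proof -
  have "\<exists>h. (\<forall>z\<in>e N ` {1..M}. h z = of_bool (z = e N j)) \<and>
     (\<forall>z. z \<notin> e N ` {1..M} \<longrightarrow> laplacian N h z = (0::real))"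
  proof (rule harmonic_extension_exists[OF assms, of "\<lambda>z. of_bool (z = e N j)" "e N ` {1..M}"])
    fix h assume "\<And>z. z \<in> e N ` {1..M} \<Longrightarrow> h z = of_bool (z = e N j)"
      and "\<And>z. z \<notin> e N ` {1..M} \<Longrightarrow> laplacian N h z = (0::real)"
    then show ?thesis by blast
  qed simp_all
  from someI_ex[OF this]
  show "z \<in> e N ` {1..M} \<Longrightarrow> hitting M N j z = of_bool (z = e N j)"
    and "z \<notin> e N ` {1..M} \<Longrightarrow> laplacian N (hitting M N j) z = 0"
    unfolding hitting_def by blast+
qed

text \<open>It is asymptotic to a positive multiple of \<open>ln N\<close>.\<close>

lemma green_0_at_top: "filterlim (\<lambda>N. green N 0 0) at_top sequentially"
proof -
  have ln: "filterlim (\<lambda>N. ln (real N)) at_top sequentially"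
    by (rule filterlim_compose[OF ln_at_top filterlim_real_sequentially])
  have "filterlim (\<lambda>N. green N 0 0 / ln (real N) * ln (real N)) at_top sequentially"
    by (rule filterlim_tendsto_pos_mult_at_top[OF green_0_asymptotics _ ln]) simp
  moreover have "\<forall>\<^sub>F N in sequentially. green N 0 0 / ln (real N) * ln (real N) = green N 0 0"
    using eventually_gt_at_top[of 1] by eventually_elim auto
  note filterlim_cong[OF refl refl this, THEN iffD1]
  ultimately show ?thesis by blast
qed

text \<open>
  On \<open>{e 1, \<dots>, e M}\<close> the matrix of the Green functions is \<open>g\<close> times the identity up to a bounded error,
  where \<open>g = green N 0 0 \<rightarrow> \<infinity>\<close>. Let \<open>F\<^sub>j\<close> be the constant \<open>1/M\<close> plus the combination of the Green functions with
  the coefficients \<open>(\<delta>\<^sub>i\<^sub>j - 1/M)/g\<close>. Since these have sum zero, \<open>F\<^sub>j\<close> is harmonic off this set, on which it is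
  close to the indicator of \<open>e j\<close>. Hence \<open>F\<^sub>j\<close> is a combination of the harmonic extensions \<open>h\<^sub>l\<close> whose coefficients
  tend to the identity, and because the Laplacian of \<open>F\<^sub>j\<close> is explicit, the values \<open>L h\<^sub>l\<close> converge.
\<close>

lemma trace_rates_tendsto:
  assumes i: "i \<in> {1..M}" and l: "l \<in> {1..M}"
  shows "(\<lambda>N. walk N (hitting M N l) (e N i)) \<longlonglongrightarrow> pi / (2 * w_hat i) * (1 / real M - of_bool (i = l))"
proof -
  have M: "1 \<le> M" using i by simp
  define c where "c N i j = (of_bool (i = j) - 1 / real M) / green N 0 0" for N and i j :: nat
  define F where "F N j z = (\<Sum>i\<in>{1..M}. c N i j * kernel N (e N i) z) + 1 / real M" for N j z
  define \<epsilon> where "\<epsilon> N l j = (\<Sum>i\<in>{1..M} - {l}. c N i j * kernel N (e N i) (e N l))" for N l j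
  define a where "a N l = walk N (hitting M N l) (e N i)" for N l
  define b where "b N j = - (ln (real N) * c N i j) / cell_mass W N (e N i)" for N j
  have gtop: "filterlim (\<lambda>N. green N 0 0) at_top sequentially" by (rule green_0_at_top)
  have inv0: "(\<lambda>N. inverse (green N 0 0)) \<longlonglongrightarrow> 0" by (rule tendsto_inverse_0_at_top[OF gtop])
  obtain d where d: "0 < d" "\<forall>\<^sub>F N in sequentially. \<forall>i\<in>{1..M}. \<forall>l\<in>{1..M}. i \<noteq> l \<longrightarrow> far_apart d N (e N i) (e N l)"
    by (rule heavy_cells_far_apart)
  have \<epsilon>: "(\<lambda>N. \<epsilon> N l j) \<longlonglongrightarrow> 0" if lj: "l \<in> {1..M}" "j \<in> {1..M}" for l j
    unfolding \<epsilon>_def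
  proof (rule tendsto_null_sum)
    fix i assume i: "i \<in> {1..M} - {l}"
    have "\<forall>\<^sub>F N in sequentially. norm (inverse (green N 0 0) * kernel N (e N i) (e N l)) \<le> \<bar>inverse (green N 0 0)\<bar> * (32 / d + 1)"
      using d(2) eventually_ge_at_top[of 3]
    proof eventually_elim
      case (elim N)
      have "\<bar>kernel N (e N i) (e N l)\<bar> \<le> 32 / d + 1"
        by (rule kernel_far[OF elim(2) d(1)]) (use elim(1) i lj in blast)
      then show ?case unfolding real_norm_def abs_mult by (rule mult_left_mono) simp
    qed
    moreover have "(\<lambda>N. \<bar>inverse (green N 0 0)\<bar> * (32 / d + 1)) \<longlonglongrightarrow> 0"
      by (intro tendsto_mult_left_zero tendsto_rabs_zero inv0)
    ultimately have "(\<lambda>N. inverse (green N 0 0) * kernel N (e N i) (e N l)) \<longlonglongrightarrow> 0"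
      by (rule Lim_null_comparison)
    then have "(\<lambda>N. (of_bool (i = j) - 1 / real M) * (inverse (green N 0 0) * kernel N (e N i) (e N l))) \<longlonglongrightarrow> 0"
      by (rule tendsto_mult_right_zero)
    then show "(\<lambda>N. c N i j * kernel N (e N i) (e N l)) \<longlonglongrightarrow> 0"
      by (simp only: c_def divide_inverse mult.assoc)
  qed
  have sys: "\<forall>\<^sub>F N in sequentially. \<forall>j\<in>{1..M}. b N j = a N j + (\<Sum>l\<in>{1..M}. \<epsilon> N l j * a N l)"
    using eventually_ge_at_top[of 3] eventually_index_bound[of M] filterlim_at_top_dense[THEN iffD1, OF gtop, rule_format, of 0]
  proof eventually_elim
    case (elim N)
    note N = elim(1) and G = elim(3)
    have N1: "1 \<le> N" "0 < N" using N by auto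
    let ?A = "e N ` {1..M}"
    have idx: "k \<in> {1..N\<^sup>2}" if "k \<in> {1..M}" for k using that elim(2) by simp
    have e_inj: "e N k = e N k' \<longleftrightarrow> k = k'" if "k \<in> {1..M}" "k' \<in> {1..M}" for k k'
      by (rule e_eq_iff[OF N1(1) idx[OF that(1)] idx[OF that(2)]])
    have grid: "e N k \<in> grid N" if "k \<in> {1..M}" for k by (rule e_in_grid[OF N1(1) idx[OF that]])
    have A: "?A \<subseteq> grid N" "?A \<noteq> {}" using grid M by auto
    show ?case
    proof
      fix j assume j: "j \<in> {1..M}"
      have c0: "(\<Sum>k\<in>{1..M}. c N k j) = 0"
      proof -
        have "(\<Sum>k\<in>{1..M}. of_bool (k = j) - 1 / real M) = (\<Sum>k\<in>{1..M}. if k = j then 1 else 0) - 1"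
          using M by (simp add: sum_subtractf of_bool_def)
        also have "\<dots> = 0" using j by simp
        finally show ?thesis unfolding c_def sum_divide_distrib[symmetric] by simp
      qed
      have lapF: "laplacian N (F N j) z = - 4 * (\<Sum>k\<in>{1..M}. if z = e N k then c N k j else 0)" if z: "z \<in> grid N" for z
      proof -
        have "laplacian N (F N j) z = (\<Sum>k\<in>{1..M}. c N k j * laplacian N (kernel N (e N k)) z)"
          unfolding F_def[abs_def] laplacian_add laplacian_const laplacian_sum[OF finite_atLeastAtMost] by simp
        also have "\<dots> = (\<Sum>k\<in>{1..M}. c N k j * (4 / (real N)\<^sup>2) - 4 * (if z = e N k then c N k j else 0))"
          by (rule sum.cong[OF refl]) (simp add: kernel_laplacian[OF N grid z] right_diff_distrib)
        also have "\<dots> = - 4 * (\<Sum>k\<in>{1..M}. if z = e N k then c N k j else 0)"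
          unfolding sum_subtractf sum_distrib_right[symmetric] c0 sum_distrib_left[symmetric] by simp
        finally show ?thesis .
      qed
      have F_boundary: "F N j (e N k) = of_bool (k = j) + \<epsilon> N k j" if k: "k \<in> {1..M}" for k
      proof -
        have "(\<Sum>i\<in>{1..M}. c N i j * kernel N (e N i) (e N k)) = c N k j * kernel N (e N k) (e N k) + \<epsilon> N k j"
          unfolding \<epsilon>_def by (rule sum.remove[OF finite_atLeastAtMost k])
        moreover have "c N k j * kernel N (e N k) (e N k) = of_bool (k = j) - 1 / real M"
          using G by (simp add: c_def kernel_self)
        ultimately show ?thesis by (simp add: F_def)
      qed
      have expand: "F N j z = (\<Sum>k\<in>{1..M}. F N j (e N k) * hitting M N k z)" if z: "z \<in> grid N" for z
      proof (rule harmonic_unique[OF N A _ _ _ z])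
        fix y assume y: "y \<in> grid N - ?A"
        have "(\<Sum>k\<in>{1..M}. if y = e N k then c N k j else 0) = 0"
          using y by (intro sum.neutral) auto
        then show "laplacian N (F N j) y = 0" using y by (simp add: lapF)
        show "laplacian N (\<lambda>z. \<Sum>k\<in>{1..M}. F N j (e N k) * hitting M N k z) y = 0"
          unfolding laplacian_sum[OF finite_atLeastAtMost]
          by (rule sum.neutral) (use y hitting(2)[OF N] in auto)
      next
        fix y assume y: "y \<in> ?A"
        then obtain m where m: "m \<in> {1..M}" "y = e N m" by (rule imageE)
        have "(\<Sum>k\<in>{1..M}. F N j (e N k) * hitting M N k y) = (\<Sum>k\<in>{1..M}. if k = m then F N j (e N k) else 0)"
        proof (rule sum.cong[OF refl])
          fix k assume k: "k \<in> {1..M}"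
          show "F N j (e N k) * hitting M N k y = (if k = m then F N j (e N k) else 0)"
            using hitting(1)[OF N y, of k] unfolding m(2) e_inj[OF m(1) k] by simp
        qed
        also have "\<dots> = F N j y" using m by simp
        finally show "F N j y = (\<Sum>k\<in>{1..M}. F N j (e N k) * hitting M N k y)" ..
      qed
      have "walk N (F N j) (e N i) = (\<Sum>k\<in>{1..M}. F N j (e N k) * a N k)"
      proof -
        have "laplacian N (F N j) (e N i) = laplacian N (\<lambda>z. \<Sum>k\<in>{1..M}. F N j (e N k) * hitting M N k z) (e N i)"
          by (rule laplacian_cong[OF N1(2) grid[OF i] expand])
        then show ?thesis
          unfolding a_def walk_eq laplacian_sum[OF finite_atLeastAtMost]
          by (simp only: sum_distrib_left mult.left_commute)
      qed
      also have "\<dots> = (\<Sum>k\<in>{1..M}. (if k = j then a N k else 0) + \<epsilon> N k j * a N k)"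
        by (rule sum.cong[OF refl]) (simp add: F_boundary distrib_right)
      also have "\<dots> = a N j + (\<Sum>k\<in>{1..M}. \<epsilon> N k j * a N k)"
        using j by (simp add: sum.distrib)
      finally have "walk N (F N j) (e N i) = a N j + (\<Sum>k\<in>{1..M}. \<epsilon> N k j * a N k)" .
      moreover have "walk N (F N j) (e N i) = b N j"
      proof -
        have "(\<Sum>k\<in>{1..M}. if e N i = e N k then c N k j else 0) = (\<Sum>k\<in>{1..M}. if i = k then c N k j else 0)"
          by (rule sum.cong[OF refl]) (simp only: e_inj[OF i])
        also have "\<dots> = c N i j" using i by simp
        finally show ?thesis unfolding walk_eq lapF[OF grid[OF i]] b_def by simp
      qed
      ultimately show "b N j = a N j + (\<Sum>l\<in>{1..M}. \<epsilon> N l j * a N l)" by simp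
    qed
  qed
  have b: "(\<lambda>N. b N j) \<longlonglongrightarrow> pi / (2 * w_hat i) * (1 / real M - of_bool (i = j))" for j
  proof -
    have "(\<lambda>N. inverse (green N 0 0 / ln (real N))) \<longlonglongrightarrow> inverse (2 / pi)"
      by (rule tendsto_inverse[OF green_0_asymptotics]) simp
    moreover have "(\<lambda>N. cell_mass W N (e N i)) \<longlonglongrightarrow> w_hat i" using i by (intro mass_tendsto) simp
    ultimately have "(\<lambda>N. - (inverse (green N 0 0 / ln (real N)) * (of_bool (i = j) - 1 / real M)) / cell_mass W N (e N i))
        \<longlonglongrightarrow> - (inverse (2 / pi) * (of_bool (i = j) - 1 / real M)) / w_hat i"
    proof (intro tendsto_divide tendsto_minus tendsto_mult_right)
      show "w_hat i \<noteq> 0" using w_hat_pos[of i] i by simp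
    qed
    moreover have "- (inverse (2 / pi) * (of_bool (i = j) - 1 / real M)) / w_hat i
        = pi / (2 * w_hat i) * (1 / real M - of_bool (i = j))"
      using w_hat_pos[of i] i by (simp add: field_simps)
    ultimately show ?thesis by (simp add: b_def c_def)
  qed
  show ?thesis
    using perturbed_identity_tendsto[OF finite_atLeastAtMost sys \<epsilon> b l] unfolding a_def .
qed

lemma limit_generator_operator:
  "finite_operator {1..M} (\<lambda>i l. pi / (2 * w_hat i) * (1 / real M - of_bool (i = l))) (limit_generator w_hat M)"
proof (rule finite_operator.intro)
  fix f :: "nat \<Rightarrow> real" and i assume i: "i \<in> {1..M}"
  have "(\<Sum>l\<in>{1..M}. (1 / real M - of_bool (i = l)) * f l) = (\<Sum>l\<in>{1..M}. f l / real M - (if i = l then f l else 0))"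
    by (rule sum.cong) (auto simp: left_diff_distrib)
  also have "\<dots> = (\<Sum>l\<in>{1..M}. f l) / real M - f i"
    using i by (simp add: sum_subtractf sum_divide_distrib)
  finally have avg: "(\<Sum>l\<in>{1..M}. (1 / real M - of_bool (i = l)) * f l) = (\<Sum>l\<in>{1..M}. f l) / real M - f i" .
  have "limit_generator w_hat M f i = pi / (2 * w_hat i) * ((\<Sum>l\<in>{1..M}. f l) / real M - f i)"
    using i w_hat_pos[of i] by (simp add: limit_generator_def sum_subtractf field_simps)
  then show "limit_generator w_hat M f i = (\<Sum>l\<in>{1..M}. pi / (2 * w_hat i) * (1 / real M - of_bool (i = l)) * f l)"
    unfolding avg[symmetric] by (simp only: sum_distrib_left mult.assoc)
qed simp

lemma light_cells_negligible:
  assumes M: "1 \<le> M"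
  shows "\<forall>\<^sub>F N in sequentially. mass N (grid N - e N ` {1..M}) \<le> tail M \<and> w_hat 1 \<le> mass N (e N ` {1..M})"
  using cells_distinct[of M] eventually_ge_at_top[of 1] eventually_index_bound[of M]
proof eventually_elim
  case (elim N)
  have N0: "0 < N" using elim(2) by simp
  have "w_hat 1 \<le> cell_mass W N (e N 1)" using M elim by (intro mass_bounds(1)) auto
  also have "\<dots> \<le> mass N (e N ` {1..M})"
    unfolding mass_def
  proof (rule member_le_sum)
    show "e N 1 \<in> e N ` {1..M}" using M by simp
    fix z assume "z \<in> e N ` {1..M} - {e N 1}"
    then have "z \<in> grid N" using e_in_grid[OF elim(2)] elim(3) by auto
    then show "0 \<le> cell_mass W N z" using cell_mass_pos[OF N0] less_imp_le by blast
  qed simp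
  finally show ?case using light_mass[OF elim(2,1,3)] unfolding mass_def by simp
qed

end

section \<open>Expected occupation times\<close>

text \<open>
  Dynkin's formula gives \<open>\<E> u(X\<^sub>T) - \<E> u(X\<^sub>0) = \<E> \<integral>\<^sub>0\<^sup>T L u(X\<^sub>s) ds\<close>. A drift of at most \<open>b\<close>, and of at
  most \<open>b - 1\<close> in \<open>D\<close>, therefore bounds the time spent in \<open>D\<close>. The formula is used along the
  discrete skeleton of step \<open>T/n\<close>, whose visits to \<open>D\<close> are Riemann sums of the occupation time.
\<close>

lemma expected_occupation_le:
  fixes X :: "real \<Rightarrow> 'w \<Rightarrow> 'a::discrete_topology"
  assumes chain: "finite_chain E q L P X x"
    and drift: "\<And>z. z \<in> E \<Longrightarrow> L u z \<le> b - of_bool (z \<in> D)"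
    and u: "\<And>z. z \<in> E \<Longrightarrow> \<bar>u z\<bar> \<le> B"
    and T: "0 \<le> T"
  shows "(\<integral>\<omega>. occupation_time D (\<lambda>t. X t \<omega>) T \<partial>P) \<le> 2 * B + b * T"
proof -
  interpret finite_chain E q L P X x by (rule chain)
  define C where "C = exp bound * B * bound\<^sup>2"
  define h where "h n = T / real (Suc n)" for n
  define Z where "Z n \<omega> = (\<lambda>l. X (real l * h n) \<omega>)" for n \<omega>
  \<comment> \<open>From here on the time steps have length at most one, as the second-order estimate requires.\<close>
  define n0 where "n0 = nat \<lceil>T\<rceil>"
  have h0: "0 \<le> h n" for n using T by (simp add: h_def)
  have h1: "h n \<le> 1" if "n0 \<le> n" for n
  proof -
    have "T \<le> real n0" unfolding n0_def by (rule real_nat_ceiling_ge)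
    then show ?thesis using that by (simp add: h_def field_simps)
  qed
  have times: "0 \<le> real l * h n" "real 0 * h n = 0" "mono (\<lambda>l. real l * h n)" for l n
    using h0[of n] by (auto simp: mono_def intro: mult_right_mono)
  have Z_in: "Z n \<omega> l \<in> E" if "\<omega> \<in> space P" for n \<omega> l
    unfolding Z_def by (rule state_in[OF times(1) that])
  have int: "integrable P (\<lambda>\<omega>. f (Z n \<omega> l) :: real)" for f n l
    unfolding Z_def
    by (rule history_integrable[where t = "\<lambda>l. real l * h n" and n = l and u = "\<lambda>z. f (z l)", OF times(1)])
      (rule adaptedI, simp)
  have step: "h n * expectation (\<lambda>\<omega>. of_bool (Z n \<omega> k \<in> D))
      \<le> expectation (\<lambda>\<omega>. u (Z n \<omega> k)) - expectation (\<lambda>\<omega>. u (Z n \<omega> (Suc k))) + (h n * b + (h n)\<^sup>2 * C)"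
    if n: "n0 \<le> n" for n k
  proof -
    have "expectation (\<lambda>\<omega>. u (Z n \<omega> (Suc k))) = expectation (\<lambda>\<omega>. generator_semigroup L (h n) u (Z n \<omega> k))"
    proof -
      have "real (Suc k) * h n - real k * h n = h n" by (simp add: algebra_simps)
      then show ?thesis
        using markov_property[where t = "\<lambda>l. real l * h n" and u = "\<lambda>_. u" and n = k, OF times(2,3)]
        by (simp only: Z_def adapted_def simp_thms)
    qed
    also have "\<dots> \<le> expectation (\<lambda>\<omega>. u (Z n \<omega> k) + (h n * b + (h n)\<^sup>2 * C) - h n * of_bool (Z n \<omega> k \<in> D))"
    proof (rule integral_mono)
      fix \<omega> assume \<omega>: "\<omega> \<in> space P"
      let ?z = "Z n \<omega> k"
      have "\<bar>generator_semigroup L (h n) u ?z - (u ?z + h n * L u ?z)\<bar> \<le> (h n)\<^sup>2 * C"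
        unfolding C_def by (rule semigroup_second_order[OF Z_in[OF \<omega>] u h0 h1[OF n]])
      moreover have "h n * L u ?z \<le> h n * (b - of_bool (?z \<in> D))"
        by (rule mult_left_mono[OF drift[OF Z_in[OF \<omega>]] h0])
      ultimately show "generator_semigroup L (h n) u ?z \<le> u ?z + (h n * b + (h n)\<^sup>2 * C) - h n * of_bool (?z \<in> D)"
        unfolding right_diff_distrib by linarith
    qed (intro Bochner_Integration.integrable_diff Bochner_Integration.integrable_add integrable_mult_right int; simp)+
    also have "\<dots> = expectation (\<lambda>\<omega>. u (Z n \<omega> k)) + (h n * b + (h n)\<^sup>2 * C) - h n * expectation (\<lambda>\<omega>. of_bool (Z n \<omega> k \<in> D))"
      using int[of u n k] int[of "\<lambda>z. of_bool (z \<in> D)" n k]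
      by (simp add: prob_space)
    finally show ?thesis by linarith
  qed
  have visits_sum: "real (visits D z k) = (\<Sum>l<k. of_bool (z l \<in> D))" for z k
    by (induction k) auto
  have skeleton: "expectation (\<lambda>\<omega>. h n * real (visits D (Z n \<omega>) (Suc n))) \<le> 2 * B + b * T + T * C * h n"
    if n: "n0 \<le> n" for n
  proof -
    have "expectation (\<lambda>\<omega>. h n * real (visits D (Z n \<omega>) (Suc n)))
        = (\<Sum>l<Suc n. h n * expectation (\<lambda>\<omega>. of_bool (Z n \<omega> l \<in> D)))"
      unfolding visits_sum sum_distrib_left
      by (subst Bochner_Integration.integral_sum) (use int[of "\<lambda>z. of_bool (z \<in> D)"] in auto)
    also have "\<dots> \<le> (\<Sum>l<Suc n. expectation (\<lambda>\<omega>. u (Z n \<omega> l)) - expectation (\<lambda>\<omega>. u (Z n \<omega> (Suc l)))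
        + (h n * b + (h n)\<^sup>2 * C))"
      by (rule sum_mono) (rule step[OF n])
    also have "\<dots> = expectation (\<lambda>\<omega>. u (Z n \<omega> 0)) - expectation (\<lambda>\<omega>. u (Z n \<omega> (Suc n)))
        + real (Suc n) * (h n * b + (h n)\<^sup>2 * C)"
    proof -
      have "(\<Sum>l<Suc n. expectation (\<lambda>\<omega>. u (Z n \<omega> l)) - expectation (\<lambda>\<omega>. u (Z n \<omega> (Suc l))))
          = expectation (\<lambda>\<omega>. u (Z n \<omega> 0)) - expectation (\<lambda>\<omega>. u (Z n \<omega> (Suc n)))"
        by (rule sum_lessThan_telescope')
      then show ?thesis by (simp only: sum.distrib[where h = "\<lambda>_. h n * b + (h n)\<^sup>2 * C"] sum_constant card_lessThan)
    qed
    also have "real (Suc n) * (h n * b + (h n)\<^sup>2 * C) = b * T + T * C * h n"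
    proof -
      have "real (Suc n) * h n = T" by (simp add: h_def del: of_nat_Suc)
      then have "real (Suc n) * (h n * b + h n * h n * C) = T * b + T * h n * C"
        by (simp only: distrib_left mult.assoc[symmetric])
      then show ?thesis by (simp only: power2_eq_square mult.commute mult.left_commute)
    qed
    also have "expectation (\<lambda>\<omega>. u (Z n \<omega> 0)) - expectation (\<lambda>\<omega>. u (Z n \<omega> (Suc n))) \<le> 2 * B"
    proof -
      have "\<bar>expectation (\<lambda>\<omega>. u (Z n \<omega> l))\<bar> \<le> B" for l
      proof -
        have "expectation (\<lambda>\<omega>. u (Z n \<omega> l)) \<le> expectation (\<lambda>\<omega>. B)"
          by (rule integral_mono[OF int]) (use u[OF Z_in] in \<open>auto simp: abs_le_iff\<close>)
        moreover have "expectation (\<lambda>\<omega>. - B) \<le> expectation (\<lambda>\<omega>. u (Z n \<omega> l))"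
          by (rule integral_mono[OF _ int]) (use abs_le_D2[OF u[OF Z_in]] in \<open>simp_all add: minus_le_iff\<close>)
        ultimately show ?thesis by (simp add: prob_space)
      qed
      from this[of 0] this[of "Suc n"] show ?thesis by linarith
    qed
    finally show ?thesis by (simp only: add.assoc)
  qed
  have riemann: "(\<lambda>n. h n * real (visits D (Z n \<omega>) (Suc n))) \<longlonglongrightarrow> occupation_time D (\<lambda>t. X t \<omega>) T"
    if \<omega>: "\<omega> \<in> space P" for \<omega>
  proof -
    interpret infinite_path "\<lambda>t. X t \<omega>" D
      by unfold_locales (use paths[OF \<omega>] in \<open>simp add: cadlag_on_iff_step_path\<close>)
    obtain S where S: "jumps_within S 0 T (\<lambda>t. X t \<omega>)" by (rule obtain_jumps)
    have end_time: "real (Suc n) * h n = T" for n by (simp add: h_def del: of_nat_Suc)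
    have error: "\<bar>h n * real (visits D (Z n \<omega>) (Suc n)) - occ T\<bar> \<le> h n * real (card S)" for n
    proof -
      have "real (Suc n) * h n \<le> T" by (simp only: end_time)
      from riemann_sum_error[OF S h0 this] show ?thesis unfolding end_time Z_def .
    qed
    have "(\<lambda>n. h n * real (card S)) \<longlonglongrightarrow> 0"
    proof -
      have "(\<lambda>n. T * (1 / real (Suc n)) * real (card S)) \<longlonglongrightarrow> T * 0 * real (card S)"
        by (intro tendsto_intros LIMSEQ_Suc lim_1_over_n)
      then show ?thesis by (simp add: h_def)
    qed
    then have "(\<lambda>n. h n * real (visits D (Z n \<omega>) (Suc n)) - occ T) \<longlonglongrightarrow> 0"
      by (rule Lim_null_comparison[rotated]) (simp only: real_norm_def error eventually_True)
    then show ?thesis by (rule LIM_zero_cancel)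
  qed
  have visits_int: "integrable P (\<lambda>\<omega>. h n * real (visits D (Z n \<omega>) (Suc n)))" for n
    unfolding visits_sum by (intro integrable_mult_right Bochner_Integration.integrable_sum int)
  have visits_le: "\<bar>h n * real (visits D (Z n \<omega>) (Suc n))\<bar> \<le> T" for n \<omega>
  proof -
    have "visits D z k \<le> k" for z k by (induction k) auto
    then have "h n * real (visits D (Z n \<omega>) (Suc n)) \<le> h n * real (Suc n)"
      by (intro mult_left_mono h0 of_nat_mono)
    also have "\<dots> = T" by (simp add: h_def del: of_nat_Suc)
    finally show ?thesis using h0[of n] by (simp del: visits.simps)
  qed
  have occ_meas: "(\<lambda>\<omega>. occupation_time D (\<lambda>t. X t \<omega>) T) \<in> borel_measurable P"
    by (rule borel_measurable_LIMSEQ_real[OF riemann borel_measurable_integrable[OF visits_int]])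
  have lim: "(\<lambda>n. expectation (\<lambda>\<omega>. h n * real (visits D (Z n \<omega>) (Suc n))))
      \<longlonglongrightarrow> expectation (\<lambda>\<omega>. occupation_time D (\<lambda>t. X t \<omega>) T)"
  proof (rule integral_dominated_convergence[where w = "\<lambda>_. T"])
    show "AE \<omega> in P. (\<lambda>n. h n * real (visits D (Z n \<omega>) (Suc n))) \<longlonglongrightarrow> occupation_time D (\<lambda>t. X t \<omega>) T"
      by (rule AE_I2) (rule riemann)
    show "AE \<omega> in P. norm (h n * real (visits D (Z n \<omega>) (Suc n))) \<le> T" for n
      by (rule AE_I2) (simp only: real_norm_def visits_le)
  qed (use occ_meas borel_measurable_integrable[OF visits_int] in auto)
  have upper: "(\<lambda>n. 2 * B + b * T + T * C * h n) \<longlonglongrightarrow> 2 * B + b * T"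
  proof -
    have "(\<lambda>n. 2 * B + b * T + T * C * (T * (1 / real (Suc n)))) \<longlonglongrightarrow> 2 * B + b * T + T * C * (T * 0)"
      by (intro tendsto_intros LIMSEQ_Suc lim_1_over_n)
    then show ?thesis by (simp add: h_def)
  qed
  show ?thesis
    by (rule LIMSEQ_le[OF lim upper]) (use skeleton in blast)
qed

section \<open>The accelerated walk\<close>

locale accelerated_walk = enumerated_cells w w_hat x W e
  for w w_hat :: "nat \<Rightarrow> real" and x W and e :: "nat \<Rightarrow> nat \<Rightarrow> int \<times> int" +
  fixes P :: "nat \<Rightarrow> int \<times> int \<Rightarrow> 'w measure" and X :: "nat \<Rightarrow> real \<Rightarrow> 'w \<Rightarrow> int \<times> int"
  assumes walk: "\<And>N z. 1 \<le> N \<Longrightarrow> z \<in> grid N \<Longrightarrow> markov_chain (grid N) (walk N) (P N z) (X N) z"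
begin

lemma walk_chain:
  assumes "1 \<le> N" "z \<in> grid N"
  shows "finite_chain (grid N) (walk_rate N) (walk N) (P N z) (X N) z"
proof (rule finite_chain.intro)
  show "finite_operator (grid N) (walk_rate N) (walk N)" by (rule walk_finite_operator[OF assms(1)])
  show "finite_chain_axioms (grid N) (walk N) (P N z) (X N) z"
    by (rule finite_chain_axioms.intro[OF walk[OF assms] assms(2)])
qed

text \<open>
  The harmonic extensions are the hitting probabilities, and the charge potential is the Foster
  function.
\<close>

lemma trace_chain:
  assumes N: "3 \<le> N" and M: "M \<le> N\<^sup>2" and j: "j \<in> {1..M}"
  shows "markov_chain {1..M} (trace_generator (walk N) (hitting M N) (e N) M) (P N (e N j))
     (\<lambda>t \<omega>. labelled_trace (N\<^sup>2) (e N) M (\<lambda>s. X N s \<omega>) t) j"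
proof -
  have N1: "1 \<le> N" using N by simp
  have grid: "e N ` {1..N\<^sup>2} = grid N" and inj: "inj_on (e N) {1..N\<^sup>2}"
    using e_bij[OF N1] by (simp_all only: bij_betw_def)
  have idx: "k \<in> {1..N\<^sup>2}" if "k \<in> {1..M}" for k using that M by simp
  have A: "e N ` {1..M} \<subseteq> grid N" "e N ` {1..M} \<noteq> {}" using e_in_grid[OF N1 idx] j by auto
  obtain u where u: "\<And>z. z \<in> grid N \<Longrightarrow> walk N u z =
      (if z \<in> e N ` {1..M} then mass N (grid N - e N ` {1..M}) / mass N (e N ` {1..M}) else - 1)"
    using foster_function[OF N A] by blast
  interpret trace_setting "e N" "N\<^sup>2" "walk_rate N" "walk N" "P N (e N j)" "X N" j M "hitting M N" u
  proof (rule trace_setting.intro)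
    show "finite_chain (e N ` {1..N\<^sup>2}) (walk_rate N) (walk N) (P N (e N j)) (X N) (e N j)"
      unfolding grid by (rule walk_chain[OF N1 e_in_grid[OF N1 idx[OF j]]])
    show "trace_setting_axioms (e N) (N\<^sup>2) (walk N) j M (hitting M N) u"
    proof (rule trace_setting_axioms.intro)
      fix i l assume il: "i \<in> {1..M}" "l \<in> {1..M}"
      have "hitting M N i (e N l) = of_bool (e N l = e N i)"
        by (rule hitting(1)[OF N]) (use il in blast)
      also have "\<dots> = of_bool (i = l)"
        unfolding e_eq_iff[OF N1 idx[OF il(2)] idx[OF il(1)]] by auto
      finally show "hitting M N i (e N l) = of_bool (i = l)" .
    next
      fix i z assume "z \<in> e N ` {1..N\<^sup>2} - e N ` {1..M}"
      then have "laplacian N (hitting M N i) z = 0" by (intro hitting(2)[OF N]) blast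
      then show "walk N (hitting M N i) z = 0" unfolding walk_eq by simp
    next
      fix z assume z: "z \<in> e N ` {1..N\<^sup>2} - e N ` {1..M}"
      then have "z \<in> grid N" "z \<notin> e N ` {1..M}" unfolding grid by blast+
      then show "walk N u z \<le> - 1" using u[of z] by (simp only: if_False order_refl)
    qed (use inj j M walk_const in \<open>simp_all only:\<close>)
  qed
  show ?thesis by (rule trace_markov_chain)
qed

text \<open>
  The trace is a Markov chain only once \<open>N \<ge> 3\<close> and \<open>M \<le> N\<^sup>2\<close>, so the sequence is shifted by some \<open>N0\<close>;
  then the rates converge and the general convergence theorem applies.
\<close>

theorem trace_weak_convergence:
  fixes Q :: "'v measure" and Y :: "real \<Rightarrow> 'v \<Rightarrow> nat"
  assumes T: "0 < T" and j: "j \<in> {1..M}"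
    and Y: "markov_chain {1..M} (limit_generator w_hat M) Q Y j"
  shows "weakly_converges (skorohod_topology T {1..M} :: (real \<Rightarrow> nat) topology)
      (\<lambda>N. skorohod_law T {1..M} (P N (e N j)) (\<lambda>\<omega>. labelled_trace (N\<^sup>2) (e N) M (\<lambda>t. X N t \<omega>)))
      (skorohod_law T {1..M} Q (\<lambda>\<omega> t. Y t \<omega>))"
proof -
  have "\<forall>\<^sub>F N in sequentially. 3 \<le> N \<and> M \<le> N\<^sup>2"
    using eventually_ge_at_top eventually_index_bound by (rule eventually_conj)
  then obtain N0 where N0: "\<And>N. N0 \<le> N \<Longrightarrow> 3 \<le> N \<and> M \<le> N\<^sup>2"
    unfolding eventually_sequentially by blast
  let ?q = "\<lambda>N i l. walk N (hitting M N l) (e N i)"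
  let ?G = "\<lambda>N. trace_generator (walk N) (hitting M N) (e N) M"
  let ?Z = "\<lambda>N t \<omega>. labelled_trace (N\<^sup>2) (e N) M (\<lambda>s. X N s \<omega>) t"
  have traces: "step_chain {1..M} (?q (n + N0)) (?G (n + N0)) (P (n + N0) (e (n + N0) j)) (?Z (n + N0)) j T" for n
  proof (intro step_chain.intro step_chain_axioms.intro finite_chain.intro finite_chain_axioms.intro T j)
    show "finite_operator {1..M} (?q (n + N0)) (?G (n + N0))"
      by (rule finite_operator.intro) (simp_all only: trace_generator_def finite_atLeastAtMost)
    have "N0 \<le> n + N0" by simp
    from N0[OF this] show "markov_chain {1..M} (?G (n + N0)) (P (n + N0) (e (n + N0) j)) (?Z (n + N0)) j"
      by (elim conjE) (rule trace_chain[OF _ _ j])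
  qed
  have limit: "step_chain {1..M} (\<lambda>i l. pi / (2 * w_hat i) * (1 / real M - of_bool (i = l)))
      (limit_generator w_hat M) Q Y j T"
    by (intro step_chain.intro step_chain_axioms.intro finite_chain.intro finite_chain_axioms.intro T j Y
        limit_generator_operator)
  have "weakly_converges (skorohod_topology T {1..M})
      (\<lambda>n. skorohod_law T {1..M} (P (n + N0) (e (n + N0) j)) (\<lambda>\<omega> t. ?Z (n + N0) t \<omega>))
      (skorohod_law T {1..M} Q (\<lambda>\<omega> t. Y t \<omega>))"
  proof (rule chain_weak_convergence[OF traces limit])
    fix i l assume "i \<in> {1..M}" "l \<in> {1..M}"
    from LIMSEQ_ignore_initial_segment[OF trace_rates_tendsto[OF this], of N0]
    show "(\<lambda>n. ?q (n + N0) i l) \<longlonglongrightarrow> pi / (2 * w_hat i) * (1 / real M - of_bool (i = l))" .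
  qed
  then show ?thesis
    unfolding weakly_converges_def by (blast intro: LIMSEQ_offset)
qed

text \<open>
  The drift of the charge potential bounds the time off \<open>A\<close> by twice its supremum plus \<open>T W(A\<^sup>c)/W(A)\<close>,
  where \<open>W(A\<^sup>c) \<le> tail M\<close> and \<open>W(A) \<ge> w_hat 1\<close>.
\<close>

lemma expected_light_time:
  assumes T: "0 < T" and M: "1 \<le> M"
  shows "\<forall>\<^sub>F N in sequentially. (MAX j\<in>{1..M}.
      \<integral>\<omega>. occupation_time (grid N - e N ` {1..M}) (\<lambda>t. X N t \<omega>) T \<partial>(P N (e N j)))
    \<le> tail M * (4 * ((green N 0 0 + 1) / ln (real N)) + T / w_hat 1)"
  using eventually_ge_at_top[of 3] eventually_index_bound[of M] light_cells_negligible[OF M]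
    filterlim_at_top_dense[THEN iffD1, OF green_0_at_top, rule_format, of 0]
proof eventually_elim
  case (elim N)
  note N = elim(1)
  let ?A = "e N ` {1..M}"
  let ?D = "grid N - ?A"
  let ?g = "(green N 0 0 + 1) / ln (real N)"
  have N1: "1 \<le> N" using N by simp
  have idx: "k \<in> {1..N\<^sup>2}" if "k \<in> {1..M}" for k using that elim(2) by simp
  have A: "?A \<subseteq> grid N" "?A \<noteq> {}" using e_in_grid[OF N1 idx] M by auto
  have g: "0 \<le> ?g" using elim(4) N by simp
  have w1: "0 < w_hat 1" by (rule w_hat_pos) simp
  obtain u where u: "\<And>z. z \<in> grid N \<Longrightarrow> walk N u z = (if z \<in> ?A then mass N ?D / mass N ?A else - 1)"
    and u_bound: "\<And>z. \<bar>u z\<bar> \<le> 2 * mass N ?D * ?g"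
    using foster_function[OF N A] by blast
  have D0: "0 \<le> mass N ?D"
    unfolding mass_def
  proof (rule sum_nonneg)
    fix z assume "z \<in> ?D"
    then show "0 \<le> cell_mass W N z" using N1 by (intro less_imp_le cell_mass_pos) simp_all
  qed
  have "(\<integral>\<omega>. occupation_time ?D (\<lambda>t. X N t \<omega>) T \<partial>(P N (e N j))) \<le> tail M * (4 * ?g + T / w_hat 1)"
    if j: "j \<in> {1..M}" for j
  proof -
    have "(\<integral>\<omega>. occupation_time ?D (\<lambda>t. X N t \<omega>) T \<partial>(P N (e N j)))
        \<le> 2 * (2 * mass N ?D * ?g) + mass N ?D / mass N ?A * T"
    proof (rule expected_occupation_le[OF walk_chain[OF N1 e_in_grid[OF N1 idx[OF j]]]])
      fix z assume z: "z \<in> grid N"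
      show "walk N u z \<le> mass N ?D / mass N ?A - of_bool (z \<in> ?D)"
        unfolding u[OF z] using z D0 elim(3) w1 by auto
    qed (use u_bound T in auto)
    also have "\<dots> = mass N ?D * (4 * ?g + T / mass N ?A)" by (simp add: algebra_simps)
    also have "\<dots> \<le> tail M * (4 * ?g + T / w_hat 1)"
    proof (intro mult_mono add_left_mono divide_left_mono)
      show "0 \<le> 4 * ?g + T / mass N ?A"
        using T w1 elim(3) by (intro add_nonneg_nonneg mult_nonneg_nonneg[OF _ g]) auto
    qed (use elim(3) T w1 tail_nonneg in auto)
    finally show ?thesis .
  qed
  then show ?case
    by (intro Max.boundedI) (use M in \<open>simp_all only: finite_imageI finite_atLeastAtMost image_is_empty atLeastatMost_empty_iff not_le ball_simps image_iff\<close>, auto)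
qed

text \<open>
  Since \<open>G(0,0)/ln N\<close> tends to \<open>2/\<pi>\<close>, the limit superior in \<open>N\<close> is at most a constant, not depending on \<open>M\<close>,
  times \<open>tail M\<close>.
\<close>

theorem light_time_negligible:
  assumes T: "0 < T"
  shows "(\<lambda>M. limsup (\<lambda>N. ereal (MAX j\<in>{1..M}.
        \<integral>\<omega>. occupation_time (grid N - e N ` {1..M}) (\<lambda>t. X N t \<omega>) T \<partial>(P N (e N j))))) \<longlonglongrightarrow> 0"
    (is "(\<lambda>M. limsup (?R M)) \<longlonglongrightarrow> 0")
proof (rule tendsto_sandwich)
  have nonneg: "0 \<le> ?R M N" if "1 \<le> M" for M N
  proof -
    have "0 \<le> (MAX j\<in>{1..M}. \<integral>\<omega>. occupation_time (grid N - e N ` {1..M}) (\<lambda>t. X N t \<omega>) T \<partial>(P N (e N j)))"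
      using that
      by (subst Max_ge_iff) (auto intro!: Bochner_Integration.integral_nonneg bexI[of _ 1]
          simp: occupation_time_def set_lebesgue_integral_def)
    then show ?thesis by simp
  qed
  show "\<forall>\<^sub>F M in sequentially. 0 \<le> limsup (?R M)"
    using eventually_ge_at_top[of 1]
  proof eventually_elim
    case (elim M)
    have "limsup (\<lambda>N. 0 :: ereal) \<le> limsup (?R M)"
      by (intro Limsup_mono always_eventually allI nonneg elim)
    then show ?case by (simp add: Limsup_const)
  qed
  define B where "B = 4 * (2 / pi) + T / w_hat 1"
  show "\<forall>\<^sub>F M in sequentially. limsup (?R M) \<le> ereal (tail M * B)"
    using eventually_ge_at_top[of 1]
  proof eventually_elim
    case (elim M)
    have "(\<lambda>N. (green N 0 0 + 1) / ln (real N)) \<longlonglongrightarrow> 2 / pi"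
    proof -
      have "(\<lambda>N. inverse (ln (real N))) \<longlonglongrightarrow> 0"
        by (intro tendsto_inverse_0_at_top filterlim_compose[OF ln_at_top filterlim_real_sequentially])
      from tendsto_add[OF green_0_asymptotics this] show ?thesis
        by (simp only: add_divide_distrib inverse_eq_divide add_0_right)
    qed
    then have "(\<lambda>N. ereal (tail M * (4 * ((green N 0 0 + 1) / ln (real N)) + T / w_hat 1))) \<longlonglongrightarrow> ereal (tail M * B)"
      unfolding B_def by (intro tendsto_ereal tendsto_mult_left tendsto_add tendsto_const)
    then have "limsup (\<lambda>N. ereal (tail M * (4 * ((green N 0 0 + 1) / ln (real N)) + T / w_hat 1))) = ereal (tail M * B)"
      by (rule lim_imp_Limsup[OF sequentially_bot])
    moreover have "limsup (?R M) \<le> limsup (\<lambda>N. ereal (tail M * (4 * ((green N 0 0 + 1) / ln (real N)) + T / w_hat 1)))"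
      by (rule Limsup_mono) (use expected_light_time[OF T elim] in \<open>simp only: ereal_less_eq\<close>)
    ultimately show ?case by simp
  qed
  have "(\<lambda>M. tail M * B) \<longlonglongrightarrow> 0" by (rule tendsto_mult_left_zero[OF tail_tendsto])
  then show "(\<lambda>M. ereal (tail M * B)) \<longlonglongrightarrow> 0" by (simp add: zero_ereal_def)
qed simp

end


section \<open>Convergence of the trace and negligible time outside it\<close>

theorem theorem2p4:
  fixes w w_hat :: "nat \<Rightarrow> real"
    and x :: "nat \<Rightarrow> real \<times> real"
    and W :: "(real \<times> real) measure"
    and e :: "nat \<Rightarrow> nat \<Rightarrow> int \<times> int"
    and P :: "nat \<Rightarrow> int \<times> int \<Rightarrow> 'w measure"
    and X :: "nat \<Rightarrow> real \<Rightarrow> 'w \<Rightarrow> int \<times> int"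
    and T :: real
  assumes w_pos: "\<And>i. 1 \<le> i \<Longrightarrow> 0 < w i"
    and w_summable: "w summable_on {1..}"
    and x_torus: "x ` {1..} \<subseteq> torus"
    and x_distinct: "inj_on x {1..}"
    and x_dense: "torus_topology closure_of (x ` {1..}) = torus"
    and W_def: "W = atomic_measure w x"
    and w_hat: "decreasing_rearrangement w w_hat"
    and enum: "\<And>N. 1 \<le> N \<Longrightarrow> decreasing_enumeration W N (e N)"
    and walk: "\<And>N z. 1 \<le> N \<Longrightarrow> z \<in> grid N \<Longrightarrow>
      markov_chain (grid N) (\<lambda>f y. ln (real N) * walk_generator W N f y) (P N z) (X N) z"
    and T_pos: "0 < T"
  shows
    "(\<forall>M\<ge>1. \<forall>j\<in>{1..M}. \<forall>(Q :: 'v measure) (Y :: real \<Rightarrow> 'v \<Rightarrow> nat).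
        markov_chain {1..M} (limit_generator w_hat M) Q Y j \<longrightarrow>
        weakly_converges (skorohod_topology T {1..M} :: (real \<Rightarrow> nat) topology)
          (\<lambda>N. skorohod_law T ({1..M} :: nat set) (P N (e N j))
                 (\<lambda>\<omega>. labelled_trace (N^2) (e N) M (\<lambda>t. X N t \<omega>)))
          (skorohod_law T ({1..M} :: nat set) Q (\<lambda>\<omega> t. Y t \<omega>))) \<and>
     (\<lambda>M. limsup (\<lambda>N. ereal (MAX j\<in>{1..M}.
        \<integral>\<omega>. occupation_time (grid N - e N ` {1..M}) (\<lambda>t. X N t \<omega>) T \<partial>(P N (e N j)))))
      \<longlonglongrightarrow> 0"
proof -
  interpret accelerated_walk w w_hat x W e P X
    by unfold_locales (fact w_pos w_summable x_torus x_distinct x_dense W_def w_hat enum walk)+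
  show ?thesis
  proof (intro conjI allI impI ballI)
    fix M j :: nat and Q :: "'v measure" and Y :: "real \<Rightarrow> 'v \<Rightarrow> nat"
    assume "j \<in> {1..M}" "markov_chain {1..M} (limit_generator w_hat M) Q Y j"
    with T_pos show "weakly_converges (skorohod_topology T {1..M} :: (real \<Rightarrow> nat) topology)
          (\<lambda>N. skorohod_law T ({1..M} :: nat set) (P N (e N j))
                 (\<lambda>\<omega>. labelled_trace (N^2) (e N) M (\<lambda>t. X N t \<omega>)))
          (skorohod_law T ({1..M} :: nat set) Q (\<lambda>\<omega> t. Y t \<omega>))"
      by (rule trace_weak_convergence)
  qed (rule light_time_negligible[OF T_pos])
qed

end
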